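(* Let $F$ be a totally real field of degree $d$, let $B$ be a quaternion algebra over $F$ split at all finite places of $F$ and at $r\ge1$ infinite places, and let $\Gamma^1$ be an associated arithmetic group acting on $\mathcal H^r$ with quotient $X^1=\Gamma^1\backslash\mathcal H^r$, as in the context. For $\underline k=(k_1,\dots,k_r)\in(2\mathbb Z_{>0})^r$ let $\mathcal B_{X^1}^{\underline k}$ be the Bergman kernel of the space $\mathcal S_{\underline k}(\Gamma^1)$ of weight-$\underline k$ cusp forms. (1) If $\Gamma^1$ is of Type (1), then for all $\underline k\in(2\mathbb Z_{>0})^r$ $$\sup_{z\in X^1}\mathcal B_{X^1}^{\underline k}(z)=O_{X^1}\Big(\prod_{j=1}^r k_j\Big).$$ (2) If $\Gamma^1$ is of Type (2) (so $r=d$), then for all $\underline k\in(2\mathbb Z_{>0})^d$ $$\sup_{z\in X^1}\mathcal B_{X^1}^{\underline k}(z)=O_{X^1}\Big(\prod_{j=1}^d k_j^{3/2}\Big).$$ The implied constants depend on $X^1$ (and not on $\underline k$).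
   Context: **Setting.** $F$ is a totally real number field of degree $d$ with ring of integers $\mathcal O_F$; $B$ is a quaternion algebra over $F$ split at all finite places of $F$; $r\ge1$ is the number of infinite places of $F$ at which $B$ is split; the weight at the ramified infinite places is taken trivial (forms are scalar valued). $\mathcal H$ is the upper half-plane, with coordinates $z_j=x_j+iy_j$ on $\mathcal H^r$. Let $G$ be the algebraic group over $\mathbb Q$ with $G(A)=(B\otimes_F(F\otimes_{\mathbb Q}A))^\times$ and $G^1\subset G$ the kernel of the reduced norm. $\Gamma=G(\mathbb Q)^+\cap tUG_\infty^+t^{-1}$, with $U\subset G(\mathbb A_f)$ an open compact subgroup, $t\in G(\mathbb A_f)$, $G_\infty^+\subset G(\mathbb R)$ the elements with positive determinant at the split infinite places and $G(\mathbb Q)^+=G(\mathbb Q)\cap G_\infty^+$, is the group of a connected component of the Shimura variety of level $U$ attached to $B$, and $\Gamma^1=\Gamma\cap G^1(\mathbb Q)$, regarded as a discrete irreducible subgroup of $\mathrm{PSL}_2(\mathbb R)^r$ acting on $\mathcal H^r$. $U$ is small enough that $\Gamma^1$ has no elliptic fixed points, so $X^1=\Gamma^1\backslash\mathcal H^r$ is a complex manifold of finite hyperbolic volume. $\Gamma^1$ is assumed to be of one of the following two types: - *Type (1)*: $1\le r<d$; then $\Gamma^1$ is a discrete, irreducible, cocompact subgroup of $\mathrm{PSL}_2(\mathbb R)^r$ and $X^1$ is a compact complex manifold of dimension $r$. - *Type (2)*: $B=M_2(F)$ (so $r=d$), and $\Gamma^1$ is a finite index subgroup of $\mathrm{PSL}_2(\mathcal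 O_F)$ (embedded in $\mathrm{PSL}_2(\mathbb R)^d$ through the $d$ real embeddings of $F$) without elliptic fixed points; $X^1$ is a noncompact complex manifold of dimension $d$ with cusps. In both cases $\Gamma^1$ is assumed to contain no hyperbolic-elliptic elements (elements some of whose components in $\mathrm{PSL}_2(\mathbb R)$ are hyperbolic and the others elliptic). **Cusp forms and Bergman kernel.** $\mathcal S_{\underline k}(\Gamma^1)$ is the finite-dimensional space of holomorphic $f:\mathcal H^r\to\mathbb C$ with $f(\gamma z)=\prod_{j=1}^r(c_jz_j+d_j)^{k_j}f(z)$ for all $\gamma=(\gamma_1,\dots,\gamma_r)\in\Gamma^1$, $\gamma_j=\begin{pmatrix}a_j&b_j\\c_j&d_j\end{pmatrix}$, which vanish at the cusps if $\Gamma^1$ is of Type (2) (with the usual boundedness condition at the cusps if $F=\mathbb Q$). The Petersson inner product is $\langle f,g\rangle=\int_{X^1}\prod_j y_j^{k_j}f(z)\overline{g(z)}\prod_j\frac{dx_j\,dy_j}{y_j^2}$. With $\{f_1,\dots,f_{\delta_{\underline k}}\}$ an orthonormal basis of $\mathcal S_{\underline k}(\Gamma^1)$, $$\mathcal B_{X^1}^{\underline k}(z)=\sum_{i=1}^{\delta_{\underline k}}\Big(\prod_{j=1}^r y_j^{k_j}\Big)|f_i(z)|^2 .$$ *)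

theory Defs
  imports
    "HOL-Analysis.Analysis"
    "HOL-Algebra.QuotRing"
    "HOL-Algebra.Algebraic_Closure_Type"
begin

section \<open>Totally real number fields\<close>

text \<open>
  The number field \<open>F\<close> is a type of class \<^class>\<open>field_char_0\<close>; it is viewed as a ring
  structure through \<^const>\<open>ring_of_type_algebra\<close>, as are \<open>\<real>\<close> and \<open>\<complex>\<close>.
\<close>

definition number_field :: "'f::field_char_0 itself \<Rightarrow> bool" where
  "number_field _ \<longleftrightarrow>
     (\<exists>S::'f set. finite S \<and> module.span (\<lambda>(q::rat) x. of_rat q * x) S = UNIV)"

definition field_degree :: "'f::field_char_0 itself \<Rightarrow> nat" where
  "field_degree _ = vector_space.dim (\<lambda>(q::rat) (x::'f). of_rat q * x) UNIV"

definition totally_real :: "'f::field_char_0 itself \<Rightarrow> bool" where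
  "totally_real _ \<longleftrightarrow>
     (\<forall>\<tau> \<in> ring_hom (ring_of_type_algebra :: 'f ring) (ring_of_type_algebra :: complex ring).
        range \<tau> \<subseteq> \<real>)"

definition real_embeddings :: "('f::field_char_0 \<Rightarrow> real) set" where
  "real_embeddings = ring_hom ring_of_type_algebra ring_of_type_algebra"

text \<open>
  A finite place of a number field is represented by its normalized discrete valuation
  \<open>v : F\<^sup>\<times> \<rightarrow> \<int>\<close> (surjective, so that it is determined by the place);
  the value at \<open>0\<close>, which should be \<open>\<infinity>\<close>, is the dummy \<open>0\<close>, and \<open>val_ge v N x\<close> takes care of it.
\<close>

definition finite_places :: "('f::field_char_0 \<Rightarrow> int) set" where
  "finite_places = {v. v 0 = 0 \<and> (\<exists>x. x \<noteq> 0 \<and> v x = 1)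
     \<and> (\<forall>x y. x \<noteq> 0 \<longrightarrow> y \<noteq> 0 \<longrightarrow> v (x * y) = v x + v y)
     \<and> (\<forall>x y. x \<noteq> 0 \<longrightarrow> y \<noteq> 0 \<longrightarrow> x + y \<noteq> 0 \<longrightarrow> min (v x) (v y) \<le> v (x + y))}"

definition val_ge :: "('f::field_char_0 \<Rightarrow> int) \<Rightarrow> int \<Rightarrow> 'f \<Rightarrow> bool" where
  "val_ge v N x \<longleftrightarrow> x = 0 \<or> N \<le> v x"


section \<open>Completions and finite adeles\<close>

definition cauchy_ring :: "('f::field_char_0 \<Rightarrow> int) \<Rightarrow> (nat \<Rightarrow> 'f) ring" where
  "cauchy_ring v =
     \<lparr>carrier = {s. \<forall>N. \<exists>M. \<forall>m\<ge>M. \<forall>n\<ge>M. val_ge v N (s m - s n)},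
      monoid.mult = (\<lambda>s s' n. s n * s' n), one = (\<lambda>_. 1),
      zero = (\<lambda>_. 0), add = (\<lambda>s s' n. s n + s' n)\<rparr>"

definition null_seqs :: "('f::field_char_0 \<Rightarrow> int) \<Rightarrow> (nat \<Rightarrow> 'f) set" where
  "null_seqs v = {s. \<forall>N. \<exists>M. \<forall>n\<ge>M. val_ge v N (s n)}"

definition place_completion :: "('f::field_char_0 \<Rightarrow> int) \<Rightarrow> (nat \<Rightarrow> 'f) set ring" where
  "place_completion v = cauchy_ring v Quot null_seqs v"

definition to_completion :: "('f::field_char_0 \<Rightarrow> int) \<Rightarrow> 'f \<Rightarrow> (nat \<Rightarrow> 'f) set" where
  "to_completion v x = null_seqs v +>\<^bsub>cauchy_ring v\<^esub> (\<lambda>_. x)"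

text \<open>\<open>completion_ball v N\<close> is the \<open>N\<close>-th power of the maximal ideal of the valuation ring
  of the completion; in particular \<open>completion_ball v 0\<close> is the valuation ring.\<close>

definition completion_ball :: "('f::field_char_0 \<Rightarrow> int) \<Rightarrow> int \<Rightarrow> (nat \<Rightarrow> 'f) set set" where
  "completion_ball v N = {null_seqs v +>\<^bsub>cauchy_ring v\<^esub> s | s.
     s \<in> carrier (cauchy_ring v) \<and> (\<exists>M. \<forall>n\<ge>M. val_ge v N (s n))}"

definition completion_top :: "('f::field_char_0 \<Rightarrow> int) \<Rightarrow> (nat \<Rightarrow> 'f) set topology" where
  "completion_top v = topology (\<lambda>W. W \<subseteq> carrier (place_completion v) \<and>
     (\<forall>x\<in>W. \<exists>N. \<forall>y\<in>completion_ball v N. x \<oplus>\<^bsub>place_completion v\<^esub> y \<in> W))"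

text \<open>The ring \<open>F \<otimes> A\<^sub>f\<close>, where \<open>A\<^sub>f\<close> are the finite adeles of \<open>\<rat>\<close>, realized as the
  restricted product of the completions of \<open>F\<close> at its finite places.\<close>

definition finite_adeles ::
  "(('f::field_char_0 \<Rightarrow> int) \<Rightarrow> (nat \<Rightarrow> 'f) set) ring" where
  "finite_adeles =
     \<lparr>carrier = {x \<in> \<Pi>\<^sub>E v\<in>finite_places. carrier (place_completion v).
                   finite {v \<in> finite_places. x v \<notin> completion_ball v 0}},
      monoid.mult = (\<lambda>x y. \<lambda>v\<in>finite_places. x v \<otimes>\<^bsub>place_completion v\<^esub> y v),
      one = (\<lambda>v\<in>finite_places. \<one>\<^bsub>place_completion v\<^esub>),
      zero = (\<lambda>v\<in>finite_places. \<zero>\<^bsub>place_completion v\<^esub>),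
      add = (\<lambda>x y. \<lambda>v\<in>finite_places. x v \<oplus>\<^bsub>place_completion v\<^esub> y v)\<rparr>"

definition finite_adeles_top ::
  "(('f::field_char_0 \<Rightarrow> int) \<Rightarrow> (nat \<Rightarrow> 'f) set) topology" where
  "finite_adeles_top = topology_generated_by
     {\<Pi>\<^sub>E v\<in>finite_places. W v | W.
        (\<forall>v\<in>finite_places. openin (completion_top v) (W v)) \<and>
        finite {v \<in> finite_places. W v \<noteq> completion_ball v 0}}"

definition to_finite_adeles ::
  "'f::field_char_0 \<Rightarrow> ('f \<Rightarrow> int) \<Rightarrow> (nat \<Rightarrow> 'f) set" where
  "to_finite_adeles x = (\<lambda>v\<in>finite_places. to_completion v x)"


section \<open>Quaternion algebras\<close>

type_synonym 'a quad = "'a \<times> 'a \<times> 'a \<times> 'a"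

fun map_quad :: "('a \<Rightarrow> 'b) \<Rightarrow> 'a quad \<Rightarrow> 'b quad" where
  "map_quad h (x0, x1, x2, x3) = (h x0, h x1, h x2, h x3)"

fun add_quad :: "('a, 'm) ring_scheme \<Rightarrow> 'a quad \<Rightarrow> 'a quad \<Rightarrow> 'a quad" where
  "add_quad R (x0, x1, x2, x3) (y0, y1, y2, y3) =
     (x0 \<oplus>\<^bsub>R\<^esub> y0, x1 \<oplus>\<^bsub>R\<^esub> y1, x2 \<oplus>\<^bsub>R\<^esub> y2, x3 \<oplus>\<^bsub>R\<^esub> y3)"

text \<open>\<open>quat_alg R a b\<close> is the quaternion algebra \<open>(a, b | R)\<close>: the free \<open>R\<close>-module on
  \<open>1, i, j, k\<close> with \<open>i\<^sup>2 = a\<close>, \<open>j\<^sup>2 = b\<close>, \<open>k = i j = - j i\<close>.  Over a field of characteristic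
  \<open>\<noteq> 2\<close> every quaternion algebra is of this form with \<open>a, b \<noteq> 0\<close>.  For a ring homomorphism
  \<open>h : F \<rightarrow> R\<close>, the base change of \<open>(a, b | F)\<close> to \<open>R\<close> is \<open>(h a, h b | R)\<close>, with the map
  \<^term>\<open>map_quad h\<close>.\<close>

fun mult_quat :: "('a, 'm) ring_scheme \<Rightarrow> 'a \<Rightarrow> 'a \<Rightarrow> 'a quad \<Rightarrow> 'a quad \<Rightarrow> 'a quad" where
  "mult_quat R a b (x0, x1, x2, x3) (y0, y1, y2, y3) =
    (x0 \<otimes>\<^bsub>R\<^esub> y0 \<oplus>\<^bsub>R\<^esub> a \<otimes>\<^bsub>R\<^esub> (x1 \<otimes>\<^bsub>R\<^esub> y1) \<oplus>\<^bsub>R\<^esub> b \<otimes>\<^bsub>R\<^esub> (x2 \<otimes>\<^bsub>R\<^esub> y2) \<ominus>\<^bsub>R\<^esub> a \<otimes>\<^bsub>R\<^esub> b \<otimes>\<^bsub>R\<^esub> (x3 \<otimes>\<^bsub>R\<^esub> y3),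
     x0 \<otimes>\<^bsub>R\<^esub> y1 \<oplus>\<^bsub>R\<^esub> x1 \<otimes>\<^bsub>R\<^esub> y0 \<oplus>\<^bsub>R\<^esub> b \<otimes>\<^bsub>R\<^esub> (x3 \<otimes>\<^bsub>R\<^esub> y2) \<ominus>\<^bsub>R\<^esub> b \<otimes>\<^bsub>R\<^esub> (x2 \<otimes>\<^bsub>R\<^esub> y3),
     x0 \<otimes>\<^bsub>R\<^esub> y2 \<oplus>\<^bsub>R\<^esub> x2 \<otimes>\<^bsub>R\<^esub> y0 \<oplus>\<^bsub>R\<^esub> a \<otimes>\<^bsub>R\<^esub> (x1 \<otimes>\<^bsub>R\<^esub> y3) \<ominus>\<^bsub>R\<^esub> a \<otimes>\<^bsub>R\<^esub> (x3 \<otimes>\<^bsub>R\<^esub> y1),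
     x0 \<otimes>\<^bsub>R\<^esub> y3 \<oplus>\<^bsub>R\<^esub> x3 \<otimes>\<^bsub>R\<^esub> y0 \<oplus>\<^bsub>R\<^esub> x1 \<otimes>\<^bsub>R\<^esub> y2 \<ominus>\<^bsub>R\<^esub> x2 \<otimes>\<^bsub>R\<^esub> y1)"

definition quat_alg :: "('a, 'm) ring_scheme \<Rightarrow> 'a \<Rightarrow> 'a \<Rightarrow> 'a quad ring" where
  "quat_alg R a b =
     \<lparr>carrier = carrier R \<times> carrier R \<times> carrier R \<times> carrier R,
      monoid.mult = mult_quat R a b, one = (\<one>\<^bsub>R\<^esub>, \<zero>\<^bsub>R\<^esub>, \<zero>\<^bsub>R\<^esub>, \<zero>\<^bsub>R\<^esub>),
      zero = (\<zero>\<^bsub>R\<^esub>, \<zero>\<^bsub>R\<^esub>, \<zero>\<^bsub>R\<^esub>, \<zero>\<^bsub>R\<^esub>), add = add_quad R\<rparr>"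

fun nrd :: "'a::comm_ring_1 \<Rightarrow> 'a \<Rightarrow> 'a quad \<Rightarrow> 'a" where
  "nrd a b (x0, x1, x2, x3) = x0^2 - a * x1^2 - b * x2^2 + a * b * x3^2"

text \<open>A 2 by 2 matrix is the quadruple of its entries, row by row.\<close>

fun mult_mat2 :: "('a, 'm) ring_scheme \<Rightarrow> 'a quad \<Rightarrow> 'a quad \<Rightarrow> 'a quad" where
  "mult_mat2 R (p, q, r, s) (p', q', r', s') =
     (p \<otimes>\<^bsub>R\<^esub> p' \<oplus>\<^bsub>R\<^esub> q \<otimes>\<^bsub>R\<^esub> r', p \<otimes>\<^bsub>R\<^esub> q' \<oplus>\<^bsub>R\<^esub> q \<otimes>\<^bsub>R\<^esub> s',
      r \<otimes>\<^bsub>R\<^esub> p' \<oplus>\<^bsub>R\<^esub> s \<otimes>\<^bsub>R\<^esub> r', r \<otimes>\<^bsub>R\<^esub> q' \<oplus>\<^bsub>R\<^esub> s \<otimes>\<^bsub>R\<^esub> s')"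

definition mat2_ring :: "('a, 'm) ring_scheme \<Rightarrow> 'a quad ring" where
  "mat2_ring R =
     \<lparr>carrier = carrier R \<times> carrier R \<times> carrier R \<times> carrier R,
      monoid.mult = mult_mat2 R, one = (\<one>\<^bsub>R\<^esub>, \<zero>\<^bsub>R\<^esub>, \<zero>\<^bsub>R\<^esub>, \<one>\<^bsub>R\<^esub>),
      zero = (\<zero>\<^bsub>R\<^esub>, \<zero>\<^bsub>R\<^esub>, \<zero>\<^bsub>R\<^esub>, \<zero>\<^bsub>R\<^esub>), add = add_quad R\<rparr>"

definition splittings :: "('a, 'm) ring_scheme \<Rightarrow> 'a \<Rightarrow> 'a \<Rightarrow> ('a quad \<Rightarrow> 'a quad) set" where
  "splittings R a b = {\<theta> \<in> ring_iso (quat_alg R a b) (mat2_ring R).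
     \<forall>c\<in>carrier R. \<forall>x\<in>carrier (quat_alg R a b).
       \<theta> (map_quad (\<lambda>u. c \<otimes>\<^bsub>R\<^esub> u) x) = map_quad (\<lambda>u. c \<otimes>\<^bsub>R\<^esub> u) (\<theta> x)}"

definition split_at_finite_places :: "'f::field_char_0 \<Rightarrow> 'f \<Rightarrow> bool" where
  "split_at_finite_places a b \<longleftrightarrow>
     (\<forall>v\<in>finite_places. splittings (place_completion v) (to_completion v a) (to_completion v b) \<noteq> {})"

definition split_real_places :: "'f::field_char_0 \<Rightarrow> 'f \<Rightarrow> ('f \<Rightarrow> real) set" where
  "split_real_places a b =
     {\<tau> \<in> real_embeddings. splittings ring_of_type_algebra (\<tau> a) (\<tau> b) \<noteq> {}}"


section \<open>The arithmetic groups\<close>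

definition G_rat :: "'f::field_char_0 \<Rightarrow> 'f \<Rightarrow> 'f quad monoid" where
  "G_rat a b = units_of (quat_alg ring_of_type_algebra a b)"

definition G_fin ::
  "'f::field_char_0 \<Rightarrow> 'f \<Rightarrow> (('f \<Rightarrow> int) \<Rightarrow> (nat \<Rightarrow> 'f) set) quad monoid" where
  "G_fin a b = units_of (quat_alg finite_adeles (to_finite_adeles a) (to_finite_adeles b))"

text \<open>As usual for unit groups of topological rings, the topology is induced by \<open>x \<mapsto> (x, x\<^sup>-\<^sup>1)\<close>.\<close>

definition G_fin_top ::
  "'f::field_char_0 \<Rightarrow> 'f \<Rightarrow> (('f \<Rightarrow> int) \<Rightarrow> (nat \<Rightarrow> 'f) set) quad topology" where
  "G_fin_top a b =
     (let T = prod_topology finite_adeles_top (prod_topology finite_adeles_top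
                (prod_topology finite_adeles_top finite_adeles_top))
      in pullback_topology (carrier (G_fin a b)) (\<lambda>x. (x, inv\<^bsub>G_fin a b\<^esub> x)) (prod_topology T T))"

text \<open>As \<open>F\<close> is totally real, \<open>G(\<real>)\<close> is the product over the real embeddings \<open>\<tau>\<close> of the unit
  groups of \<open>(\<tau> a, \<tau> b | \<real>)\<close>; at a split place the reduced norm is the determinant.\<close>

definition G_inf_plus :: "'f::field_char_0 \<Rightarrow> 'f \<Rightarrow> (('f \<Rightarrow> real) \<Rightarrow> real quad) set" where
  "G_inf_plus a b =
     {g \<in> \<Pi>\<^sub>E \<tau>\<in>real_embeddings. Units (quat_alg ring_of_type_algebra (\<tau> a) (\<tau> b)).
        \<forall>\<tau>\<in>split_real_places a b. 0 < nrd (\<tau> a) (\<tau> b) (g \<tau>)}"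

definition to_G_inf :: "'f::field_char_0 quad \<Rightarrow> ('f \<Rightarrow> real) \<Rightarrow> real quad" where
  "to_G_inf x = (\<lambda>\<tau>\<in>real_embeddings. map_quad \<tau> x)"

definition G_rat_plus :: "'f::field_char_0 \<Rightarrow> 'f \<Rightarrow> 'f quad set" where
  "G_rat_plus a b = {x \<in> carrier (G_rat a b). to_G_inf x \<in> G_inf_plus a b}"

text \<open>\<open>G(A) = G(A\<^sub>f) \<times> G(\<real>)\<close>, in which \<open>t U G\<^sub>\<infinity>\<^sup>+ t\<^sup>-\<^sup>1\<close> is \<open>(t U t\<^sup>-\<^sup>1) \<times> G\<^sub>\<infinity>\<^sup>+\<close>.\<close>

definition Gamma_quat :: "'f::field_char_0 \<Rightarrow> 'f
     \<Rightarrow> (('f \<Rightarrow> int) \<Rightarrow> (nat \<Rightarrow> 'f) set) quad set \<Rightarrow> (('f \<Rightarrow> int) \<Rightarrow> (nat \<Rightarrow> 'f) set) quad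
     \<Rightarrow> 'f quad set" where
  "Gamma_quat a b U t = {x \<in> G_rat_plus a b.
     (map_quad to_finite_adeles x, to_G_inf x)
       \<in> ((t <#\<^bsub>G_fin a b\<^esub> U) #>\<^bsub>G_fin a b\<^esub> (inv\<^bsub>G_fin a b\<^esub> t)) \<times> G_inf_plus a b}"

definition Gamma1_quat :: "'f::field_char_0 \<Rightarrow> 'f
     \<Rightarrow> (('f \<Rightarrow> int) \<Rightarrow> (nat \<Rightarrow> 'f) set) quad set \<Rightarrow> (('f \<Rightarrow> int) \<Rightarrow> (nat \<Rightarrow> 'f) set) quad
     \<Rightarrow> 'f quad set" where
  "Gamma1_quat a b U t = {x \<in> Gamma_quat a b U t. nrd a b x = 1}"

text \<open>The split infinite places are enumerated as \<open>\<sigma> j\<close>, with chosen splittings \<open>\<theta> j\<close>.  An element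
  of \<open>PSL\<^sub>2(\<real>)\<^sup>r\<close> is represented by a family of matrices, each determined up to sign;
  nothing below depends on the signs, the weights being even.\<close>

definition Gamma1 :: "'f::field_char_0 \<Rightarrow> 'f \<Rightarrow> ('r \<Rightarrow> 'f \<Rightarrow> real) \<Rightarrow> ('r \<Rightarrow> real quad \<Rightarrow> real quad)
     \<Rightarrow> (('f \<Rightarrow> int) \<Rightarrow> (nat \<Rightarrow> 'f) set) quad set \<Rightarrow> (('f \<Rightarrow> int) \<Rightarrow> (nat \<Rightarrow> 'f) set) quad
     \<Rightarrow> ('r \<Rightarrow> real quad) set" where
  "Gamma1 a b \<sigma> \<theta> U t = (\<lambda>x j. \<theta> j (map_quad (\<sigma> j) x)) ` Gamma1_quat a b U t"

definition SL2 :: "'f::field_char_0 set \<Rightarrow> 'f quad monoid" where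
  "SL2 S = \<lparr>carrier = {(p, q, r, s). {p, q, r, s} \<subseteq> S \<and> p * s - q * r = 1},
            monoid.mult = mult_mat2 ring_of_type_algebra, one = (1, 0, 0, 1)\<rparr>"

abbreviation ring_of_integers :: "'f::field_char_0 set" where
  "ring_of_integers \<equiv> {x. algebraic_int x}"

abbreviation plus_minus_one :: "'f::field_char_0 quad set" where
  "plus_minus_one \<equiv> {(1, 0, 0, 1), (-1, 0, 0, -1)}"

definition PSL2_int :: "'f::field_char_0 quad set monoid" where
  "PSL2_int = SL2 ring_of_integers Mod plus_minus_one"

definition type1 :: "('r::finite \<Rightarrow> 'f::field_char_0 \<Rightarrow> real) \<Rightarrow> bool" where
  "type1 \<sigma> \<longleftrightarrow> 1 \<le> CARD('r) \<and> CARD('r) < field_degree TYPE('f)"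

text \<open>\<open>B = M\<^sub>2(F)\<close> through \<open>\<phi>\<close>; the second conjunct says that after this identification the group
  is embedded through the real embeddings of \<open>F\<close> themselves.\<close>

definition type2 :: "'f::field_char_0 \<Rightarrow> 'f \<Rightarrow> ('r \<Rightarrow> 'f \<Rightarrow> real) \<Rightarrow> ('r \<Rightarrow> real quad \<Rightarrow> real quad)
     \<Rightarrow> (('f \<Rightarrow> int) \<Rightarrow> (nat \<Rightarrow> 'f) set) quad set \<Rightarrow> (('f \<Rightarrow> int) \<Rightarrow> (nat \<Rightarrow> 'f) set) quad
     \<Rightarrow> bool" where
  "type2 a b \<sigma> \<theta> U t \<longleftrightarrow>
     (\<exists>\<phi> \<in> splittings ring_of_type_algebra a b.
        (\<forall>x j. \<theta> j (map_quad (\<sigma> j) x) = map_quad (\<sigma> j) (\<phi> x)) \<and>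
        (let H = (\<lambda>x. plus_minus_one #>\<^bsub>SL2 ring_of_integers\<^esub> \<phi> x) ` Gamma1_quat a b U t
         in subgroup H PSL2_int \<and> finite (rcosets\<^bsub>PSL2_int\<^esub> H)))"


section \<open>Action on the product of upper half-planes\<close>

definition upper_half :: "(complex ^ 'r) set" where
  "upper_half = {z. \<forall>j. 0 < Im (z $ j)}"

fun moebius :: "real quad \<Rightarrow> complex \<Rightarrow> complex" where
  "moebius (p, q, r, s) z = (of_real p * z + of_real q) / (of_real r * z + of_real s)"

fun autfac :: "real quad \<Rightarrow> complex \<Rightarrow> complex" where
  "autfac (p, q, r, s) z = of_real r * z + of_real s"

fun trace2 :: "real quad \<Rightarrow> real" where
  "trace2 (p, q, r, s) = p + s"

definition act :: "('r::finite \<Rightarrow> real quad) \<Rightarrow> complex ^ 'r \<Rightarrow> complex ^ 'r" where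
  "act \<gamma> z = (\<chi> j. moebius (\<gamma> j) (z $ j))"

text \<open>Stabilizers in \<open>PSL\<^sub>2(\<real>)\<^sup>r\<close> of points are trivial.\<close>

definition no_elliptic_fixed_points :: "('r::finite \<Rightarrow> real quad) set \<Rightarrow> bool" where
  "no_elliptic_fixed_points \<Gamma> \<longleftrightarrow>
     (\<forall>\<gamma>\<in>\<Gamma>. \<forall>z\<in>upper_half. act \<gamma> z = z \<longrightarrow> (\<forall>j. \<gamma> j \<in> plus_minus_one))"

definition hyperbolic_elliptic :: "('r::finite \<Rightarrow> real quad) \<Rightarrow> bool" where
  "hyperbolic_elliptic \<gamma> \<longleftrightarrow>
     (\<forall>j. \<bar>trace2 (\<gamma> j)\<bar> > 2 \<or> \<bar>trace2 (\<gamma> j)\<bar> < 2) \<and>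
     (\<exists>j. \<bar>trace2 (\<gamma> j)\<bar> > 2) \<and> (\<exists>j. \<bar>trace2 (\<gamma> j)\<bar> < 2)"

definition fundamental_domain ::
  "('r::finite \<Rightarrow> real quad) set \<Rightarrow> (complex ^ 'r) set \<Rightarrow> bool" where
  "fundamental_domain \<Gamma> D \<longleftrightarrow> D \<in> sets borel \<and> D \<subseteq> upper_half \<and>
     (\<forall>z\<in>upper_half. \<exists>!w. w \<in> D \<and> (\<exists>\<gamma>\<in>\<Gamma>. w = act \<gamma> z))"

text \<open>The integral over \<open>\<Gamma> \ H\<^sup>r\<close> of a \<open>\<Gamma>\<close>-invariant function against the hyperbolic volume,
  computed on a Borel set of representatives of the orbits; its value does not depend on the
  chosen set.  Lebesgue measure on \<open>complex ^ 'r\<close> is the product of the \<open>dx\<^sub>j dy\<^sub>j\<close>.\<close>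

definition quotient_integral ::
  "('r::finite \<Rightarrow> real quad) set \<Rightarrow> (complex ^ 'r \<Rightarrow> complex) \<Rightarrow> complex" where
  "quotient_integral \<Gamma> h =
     (LINT z:(SOME D. fundamental_domain \<Gamma> D)|lborel. h z / of_real (\<Prod>j\<in>UNIV. (Im (z $ j))^2))"


section \<open>Cusp forms and the Bergman kernel\<close>

definition holomorphic_vec :: "(complex ^ 'r \<Rightarrow> complex) \<Rightarrow> (complex ^ 'r) set \<Rightarrow> bool" where
  "holomorphic_vec f S \<longleftrightarrow>
     (\<forall>z\<in>S. \<exists>D. (f has_derivative D) (at z) \<and> (\<forall>c v. D (c *s v) = c * D v))"

definition slash ::
  "('r::finite \<Rightarrow> nat) \<Rightarrow> (complex ^ 'r \<Rightarrow> complex) \<Rightarrow> ('r \<Rightarrow> real quad) \<Rightarrow> complex ^ 'r \<Rightarrow> complex" where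
  "slash k f \<gamma> z = f (act \<gamma> z) / (\<Prod>j\<in>UNIV. autfac (\<gamma> j) (z $ j) ^ k j)"

text \<open>The value at the cusp \<open>\<infinity>\<close> is zero.  The limit being required in full (uniformly in the real
  parts), this contains the boundedness condition needed over \<open>\<rat>\<close>; over larger fields it says
  that the constant term of the Fourier expansion vanishes.\<close>

definition vanishes_at_infinity :: "(complex ^ 'r::finite \<Rightarrow> complex) \<Rightarrow> bool" where
  "vanishes_at_infinity g \<longleftrightarrow>
     (\<forall>e>0. \<exists>Y. \<forall>z\<in>upper_half. (\<forall>j. Y < Im (z $ j)) \<longrightarrow> norm (g z) < e)"

text \<open>\<open>C\<close> is a set of \<open>\<delta>\<close> such that the \<open>\<delta> \<infinity>\<close> are the cusps; it is empty when the quotient is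
  compact.  Forms are normalized to be zero outside the domain, since functions are total.\<close>

definition cusp_forms :: "('r::finite \<Rightarrow> real quad) set \<Rightarrow> ('r \<Rightarrow> real quad) set \<Rightarrow> ('r \<Rightarrow> nat)
     \<Rightarrow> (complex ^ 'r \<Rightarrow> complex) set" where
  "cusp_forms \<Gamma> C k = {f. (\<forall>z. z \<notin> upper_half \<longrightarrow> f z = 0)
     \<and> holomorphic_vec f upper_half
     \<and> (\<forall>\<gamma>\<in>\<Gamma>. \<forall>z\<in>upper_half. f (act \<gamma> z) = (\<Prod>j\<in>UNIV. autfac (\<gamma> j) (z $ j) ^ k j) * f z)
     \<and> (\<forall>\<delta>\<in>C. vanishes_at_infinity (slash k f \<delta>))}"

text \<open>The cusps of a group commensurable with \<open>PSL\<^sub>2(O\<^sub>F)\<close> are the points of \<open>P\<^sup>1(F)\<close>, on which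
  \<open>SL\<^sub>2(F)\<close> acts transitively.\<close>

definition hilbert_cusps :: "('r \<Rightarrow> 'f::field_char_0 \<Rightarrow> real) \<Rightarrow> ('r \<Rightarrow> real quad) set" where
  "hilbert_cusps \<sigma> = (\<lambda>A j. map_quad (\<sigma> j) A) ` carrier (SL2 UNIV)"

definition petersson :: "('r::finite \<Rightarrow> real quad) set \<Rightarrow> ('r \<Rightarrow> nat)
     \<Rightarrow> (complex ^ 'r \<Rightarrow> complex) \<Rightarrow> (complex ^ 'r \<Rightarrow> complex) \<Rightarrow> complex" where
  "petersson \<Gamma> k f g =
     quotient_integral \<Gamma> (\<lambda>z. of_real (\<Prod>j\<in>UNIV. Im (z $ j) ^ k j) * f z * cnj (g z))"

definition orthonormal_basis :: "('r::finite \<Rightarrow> real quad) set \<Rightarrow> ('r \<Rightarrow> nat)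
     \<Rightarrow> (complex ^ 'r \<Rightarrow> complex) set \<Rightarrow> (complex ^ 'r \<Rightarrow> complex) set \<Rightarrow> bool" where
  "orthonormal_basis \<Gamma> k S bs \<longleftrightarrow> finite bs \<and> bs \<subseteq> S
     \<and> (\<forall>f\<in>bs. \<forall>g\<in>bs. petersson \<Gamma> k f g = (if f = g then 1 else 0))
     \<and> (\<forall>f\<in>S. \<exists>c. f = (\<lambda>z. \<Sum>g\<in>bs. c g * g z))"

definition bergman_kernel ::
  "('r::finite \<Rightarrow> nat) \<Rightarrow> (complex ^ 'r \<Rightarrow> complex) set \<Rightarrow> complex ^ 'r \<Rightarrow> real" where
  "bergman_kernel k bs z = (\<Sum>f\<in>bs. (\<Prod>j\<in>UNIV. Im (z $ j) ^ k j) * (cmod (f z))^2)"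

end

theory Submission
  imports
    Defs
    "HOL-Complex_Analysis.Complex_Analysis"
    "HOL-Library.Function_Algebras"
    "HOL-Computational_Algebra.Computational_Algebra"
begin

text \<open>
  For a cusp form \<open>f\<close> put \<open>P(z) = \<bar>f(z)\<bar>\<^sup>2 \<Prod> y\<^sub>j\<^bsup>k\<^sub>j\<^esup>\<close>.  On the polydisc of hyperbolic radii about \<open>k\<^sub>j\<^bsup>-1/2\<^esup>\<close> the weight is
  comparable to the square of a holomorphic function, so the mean value property and unfolding bound \<open>P(z)\<close> by
  \<open>\<Prod> k\<^sub>j\<close> times the squared Petersson norm times the number of group elements that move a point near \<open>z\<close> very little.
  Applied to \<open>f = \<Sum> cnj (f\<^sub>i z) f\<^sub>i\<close> this bounds the Bergman kernel.

  Traces \<open>t\<close> of group elements are algebraic integers (compactness of the level), and a small displacement makes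
  \<open>t\<^sup>2 - 4\<close> small at every split place.  As mixed elements are excluded and the ramified places bound \<open>t\<close>,
  the norm forces \<open>t\<^sup>2 = 4\<close>.  If there is a ramified place, only \<open>1\<close> and \<open>-1\<close> remain.

  For Hilbert modular groups the remaining elements are unipotent and fix a common cusp; there are at most
  \<open>O (1 + h \<Prod> k\<^sub>j\<^bsup>-1/2\<^esup>)\<close> of them, where \<open>h\<close> is the height of \<open>z\<close> at that cusp.  This is enough if
  \<open>h = O (\<Prod> k\<^sub>j)\<close>.  Higher up, some translation by \<open>n u\<^sup>2\<close> with a small integer \<open>u\<close> makes \<open>f\<close> periodic along a line, and
  the Schwarz lemma on the punctured disc shows that \<open>P\<close> decays exponentially towards the cusp.
\<close>

text \<open>Finite places are discrete valuations, so integrality enters place by place: compactness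
  of \<open>U\<close> bounds the scalar parts of the whole group at each v, iterated squares of one
  element turn this into a nonnegative valuation of its trace, and
  \<open>algebraic_int_iff_val_ge\<close> converts nonnegative valuations into an integral equation.
  The norm argument needs as many embeddings as the degree; they are counted as a basis of the dual
  space.

  The obstacle in Type (2) is uniformity over infinitely many cusps. Instead of representatives of
  cusps and of units, each cusp gets a pair (c, s) that is coprime up to a fixed integer M, by
  Hurwitz's lemma, and short translations come from the pigeonhole principle.

  The threshold for the height is where a descent begins to pay. Moving down by about Y_j / k_j at
  each place, with Y_j the local height, changes the weight factor only by a constant; a translation
  v of the group with v_j of that size exists once the product of the Y_j exceeds a constant times
  the product of the k_j.\<close>

no_notation fps_nth (infixl "$" 75)

abbreviation (input) "RT \<equiv> ring_of_type_algebra"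
abbreviation (input) "mmul \<equiv> mult_mat2 RT"
abbreviation (input) "mq \<equiv> mult_quat RT"
abbreviation (input) "Vball \<equiv> completion_ball"
abbreviation (input) "Kv \<equiv> place_completion"
abbreviation (input) "CR \<equiv> cauchy_ring"
abbreviation (input) "aint \<equiv> algebraic_int"

abbreviation (input) "kprod k \<equiv> \<Prod>j\<in>UNIV. real (k j)"

lemmas sq_simps = power2_eq_square algebra_simps

section \<open>Field homomorphisms and rational functionals on a number field\<close>

interpretation QV: vector_space "%(q::rat) (x::'f::field_char_0). of_rat q * x" by unfold_locales (simp_all add: algebra_simps of_rat_add of_rat_mult)

interpretation CV: vector_space "%(c::complex) (f::'f::field_char_0 => complex) x. c * f x" by unfold_locales (simp_all add: fun_eq_iff algebra_simps)

definition field_hom :: "('f::field_char_0 => 'g::field_char_0) => bool" where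
 "field_hom ta \<longleftrightarrow> ta 1 = 1 & (ALL x y. ta (x + y) = ta x + ta y) & (ALL x y. ta (x * y) = ta x * ta y)"

lemma ring_hom_iff_field_hom:
 "ta : ring_hom RT RT \<longleftrightarrow> field_hom ta" by (auto simp: ring_hom_def ring_of_type_algebra_def field_hom_def)

context
 fixes ta :: "'f::field_char_0 => 'g::field_char_0"
 assumes hom: "field_hom ta"
begin

lemma hom_1: "ta 1 = 1" and hom_add: "ta (x + y) = ta x + ta y" and hom_mult: "ta (x * y) = ta x * ta y" using hom by (auto simp: field_hom_def)

lemma hom_0: "ta 0 = 0" using hom_add[of 0 0] by simp

lemma hom_minus: "ta (- x) = - ta x" using hom_add[of x "- x"] hom_0 by (simp add: add_eq_0_iff)

lemma hom_diff: "ta (x - y) = ta x - ta y" using hom_add[of x "- y"] hom_minus by simp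

lemma hom_eq_0: "ta x = 0 \<longleftrightarrow> x = 0"
proof
 show "x = 0" if "ta x = 0" using hom_mult[of x "inverse x"] that hom_1 by (cases "x = 0") auto
qed (simp add: hom_0)

lemma hom_inj: "ta x = ta y \<longleftrightarrow> x = y" using hom_eq_0[of "x - y"] by (simp add: hom_diff)

lemma hom_power: "ta (x ^ n) = ta x ^ n" by (induction n) (simp_all add: hom_1 hom_mult)

lemma hom_sum: "ta (sum f A) = (\<Sum>i\<in>A. ta (f i))" by (induction A rule: infinite_finite_induct) (simp_all add: hom_0 hom_add)

lemma hom_of_nat: "ta (of_nat n) = of_nat n" by (induction n) (simp_all add: hom_0 hom_1 hom_add)

lemma hom_of_int: "ta (of_int n) = of_int n" by (cases n rule: int_cases2) (simp_all add: hom_of_nat hom_minus)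

lemma hom_of_rat: "ta (of_rat q) = of_rat q"
proof (cases q)
 case (Fract a b)
 hence "of_rat q * of_int b = (of_int a :: 'f)" "of_rat q * of_int b = (of_int a :: 'g)" by (simp_all add: of_rat_rat)
 hence "ta (of_rat q) * of_int b = of_rat q * of_int b" by (metis hom_mult hom_of_int)
 with Fract show ?thesis by simp
qed

lemma hom_poly_int: "ta (poly (map_poly of_int p) x) = poly (map_poly of_int p) (ta x)"
 by (induction p) (simp_all add: map_poly_pCons hom_0 hom_add hom_mult hom_of_int)

end

lemma sum_fun_apply: "(\<Sum>i\<in>A. f i) x = (\<Sum>i\<in>A. f i x :: 'b::comm_monoid_add)"
 by (induction A rule: infinite_finite_induct) (auto simp: zero_fun_def plus_fun_def)

text \<open>The dual of the field over Q, with complex values. The embeddings turn out to be a basis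
  of this complex vector space, which is how they are counted.\<close>

definition qlin :: "('f::field_char_0 => complex) => bool" where
 "qlin ph \<longleftrightarrow> (ALL x y. ph (x + y) = ph x + ph y) & (ALL q x. ph (of_rat q * x) = of_rat q * ph x)"

lemma qlin_0: "qlin ph ==> ph 0 = 0" unfolding qlin_def by (metis mult_zero_left of_rat_0)

lemma qlin_sum: "qlin ph ==> ph (sum f A) = (\<Sum>i\<in>A. ph (f i))" by (induction A rule: infinite_finite_induct) (auto simp: qlin_0 qlin_def)

lemma field_hom_qlin: "field_hom ta ==> qlin ta" by (simp add: qlin_def hom_add hom_mult hom_of_rat)

lemma qlin_representation:
 fixes S :: "'f::field_char_0 set"
 assumes "QV.independent S" "QV.span S = UNIV"
 shows "qlin (%z. of_rat (QV.representation S z b))"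
 using assms by (simp add: qlin_def QV.representation_add QV.representation_scale of_rat_add of_rat_mult)

text \<open>Partial fractions: an operator killed by a polynomial with simple roots is diagonalizable.
 Here the operator is the multiplication by \<open>s\<close>, acting on functions by translation of the
 argument.\<close>

lemma eigen_decomposition:
 fixes V :: "('f::field_char_0 => complex) set"
 assumes V: "!!f g a b. f : V ==> g : V ==> (%z. a * f z + b * g z) : V"
  and Vs: "!!f. f : V ==> (%z. f (s * z)) : V"
  and "distinct rs" "ph : V"
  and "fold (%be f z. f (s * z) - be * f z) rs ph = (%_. 0)"
 shows "EX psi. (ALL z. ph z = (\<Sum>be\<in>set rs. psi be z)) \<and>
  (ALL be:set rs. psi be : V & (ALL z. psi be (s * z) = be * psi be z))" using assms(3-)
proof (induction rs arbitrary: ph)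
 case (Cons be rs)
 let ?ph1 = "%z. ph (s * z) - be * ph z"
 have "?ph1 : V" using V[OF Vs[OF Cons.prems(2)] Cons.prems(2), of 1 "- be"] by simp
 with Cons.IH[of ?ph1] Cons.prems obtain psi where
  psi: "!!z. ?ph1 z = (\<Sum>ga\<in>set rs. psi ga z)"
   "!!ga. ga : set rs ==> psi ga : V" "!!ga z. ga : set rs ==> psi ga (s * z) = ga * psi ga z" by auto
 have be: "be ~: set rs" using Cons.prems by auto
 \<comment> \<open>On the component with eigenvalue ga the operator minus \<open>be\<close> is
   multiplication by ga - be. So \<open>ka\<close> is a preimage of \<open>?ph1\<close> under it,
   and ph - \<open>ka\<close> is the missing eigenfunction for \<open>be\<close>.\<close>
 define ka where "ka z = (\<Sum>ga\<in>set rs. 1 / (ga - be) * psi ga z)" for z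
 have Vsum: "(%z. f z + (\<Sum>ga\<in>A. c ga * psi ga z)) : V" if "finite A" "A <= set rs" "f : V" for A f and c :: "complex => complex" using that
 proof (induction A)
  case (insert ga A)
  have "(%z. 1 * (f z + (\<Sum>ga\<in>A. c ga * psi ga z)) + c ga * psi ga z) : V" using insert psi(2) by (intro V) auto
  thus ?case using insert by (simp add: algebra_simps)
 qed simp
 have kas: "ka (s * z) - be * ka z = ?ph1 z" for z
 proof -
  have "ka (s * z) - be * ka z = (\<Sum>ga\<in>set rs. 1 / (ga - be) * (ga - be) * psi ga z)"
   unfolding ka_def sum_distrib_left sum_subtractf[symmetric] by (intro sum.cong) (auto simp: psi(3) algebra_simps)
  also have "... = (\<Sum>ga\<in>set rs. psi ga z)" using be by (intro sum.cong) auto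
  finally show ?thesis using psi(1) by simp
 qed
 define psi' where "psi' = (%ga. if ga = be then (%z. ph z - ka z) else (%z. 1 / (ga - be) * psi ga z))"
 have "psi' be : V" using Vsum[of "set rs" ph "%ga. - (1 / (ga - be))"] Cons.prems by (simp add: psi'_def ka_def sum_negf)
 moreover have "psi' ga : V" if "ga : set rs" for ga
  using V[OF psi(2)[OF that] psi(2)[OF that], of "1 / (ga - be)" 0] that be by (auto simp: psi'_def)
 moreover have "psi' be (s * z) = be * psi' be z" for z using kas[of z] by (simp add: psi'_def algebra_simps)
 moreover have "psi' ga (s * z) = ga * psi' ga z" if "ga : set rs" for ga z using that be psi(3) by (auto simp: psi'_def)
 moreover have "ph z = (\<Sum>ga\<in>set (be # rs). psi' ga z)" for z
 proof -
  have "(\<Sum>ga\<in>set rs. psi' ga z) = ka z" unfolding ka_def using be by (intro sum.cong) (auto simp: psi'_def)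
  thus ?thesis using be by (simp add: psi'_def)
 qed
 ultimately show ?case by (intro exI[of _ psi']) auto
qed (auto simp: fun_eq_iff)

text \<open>The fold composes the operators S - be with S f z = f (s * z), that is, it evaluates the
  product polynomial at S. The free bound N allows a comparison with polynomials of another
  degree.\<close>

lemma fold_roots_operator:
 fixes ph :: "'f::field_char_0 => complex"
 assumes "Polynomial.degree (\<Prod>be\<leftarrow>rs. [:-be, 1:]) <= N"
 shows "fold (%be f z. f (s * z) - be * f z) rs ph z
  = (\<Sum>i\<le>N. poly.coeff (\<Prod>be\<leftarrow>rs. [:-be, 1:]) i * ph (s ^ i * z))" using assms
proof (induction rs arbitrary: ph N)
 case Nil
 have "(\<Sum>i\<le>N. poly.coeff 1 i * ph (s ^ i * z)) = (\<Sum>i\<in>{0}. poly.coeff 1 i * ph (s ^ i * z))" by (intro sum.mono_neutral_right) auto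
 thus ?case by simp
next
 case (Cons be rs)
 let ?P = "\<Prod>be\<leftarrow>rs. [:-be, 1:]"
 have "?P ~= 0" by (auto simp: prod_list_zero_iff)
 hence "Polynomial.degree ([:-be, 1:] * ?P) = Suc (Polynomial.degree ?P)" by (subst Polynomial.degree_mult_eq) auto
 then obtain M where M: "N = Suc M" "Polynomial.degree ?P <= M" using Cons.prems by (cases N) auto
 have c: "poly.coeff ([:-be, 1:] * ?P) i = (case i of 0 => 0 | Suc j => poly.coeff ?P j) - be * poly.coeff ?P i" for i
  by (simp add: coeff_pCons split: nat.split)
 have "fold (%be f z. f (s * z) - be * f z) (be # rs) ph z
  = (\<Sum>i\<le>M. poly.coeff ?P i * (ph (s * (s ^ i * z)) - be * ph (s ^ i * z)))" using Cons.IH[OF M(2)] by simp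
 also have "... = (\<Sum>i\<le>M. poly.coeff ?P i * ph (s ^ Suc i * z)) - (\<Sum>i\<le>M. be * poly.coeff ?P i * ph (s ^ i * z))"
  by (simp add: algebra_simps sum_subtractf)
 also have "(\<Sum>i\<le>M. be * poly.coeff ?P i * ph (s ^ i * z)) = (\<Sum>i\<le>N. be * poly.coeff ?P i * ph (s ^ i * z))"
  using M by (simp add: coeff_eq_0)
 also have "(\<Sum>i\<le>M. poly.coeff ?P i * ph (s ^ Suc i * z))
  = (\<Sum>i\<le>N. (case i of 0 => 0 | Suc j => poly.coeff ?P j) * ph (s ^ i * z))" unfolding M(1) by (subst sum.atMost_Suc_shift) simp
 finally show ?case unfolding list.map prod_list.Cons c by (simp add: sum_subtractf[symmetric] algebra_simps)
qed

text \<open>By linearity the functional moves out of the sum, whose argument becomes p(s) z =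
  0.\<close>

lemma rat_poly_annihilates:
 fixes ph :: "'f::field_char_0 => complex" and p :: "rat poly"
 assumes "qlin ph" "poly (map_poly of_rat p) s = 0" "Polynomial.degree p <= N"
 shows "(\<Sum>i\<le>N. poly.coeff (map_poly of_rat p) i * ph (s ^ i * z)) = 0"
proof -
 have "(\<Sum>i\<le>N. poly.coeff (map_poly of_rat p) i * ph (s ^ i * z))
  = ph (\<Sum>i\<le>N. of_rat (poly.coeff p i) * (s ^ i * z))" using assms(1) by (simp add: qlin_sum coeff_map_poly qlin_def)
 also have "(\<Sum>i\<le>N. of_rat (poly.coeff p i) * (s ^ i * z)) = poly (map_poly of_rat p) s * z"
 proof -
  have "poly (map_poly of_rat p) s = (\<Sum>i\<le>Polynomial.degree p. of_rat (poly.coeff p i) * s ^ i)"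
   by (simp add: poly_altdef coeff_map_poly degree_map_poly)
  also have "... = (\<Sum>i\<le>N. of_rat (poly.coeff p i) * s ^ i)" using assms(3) by (intro sum.mono_neutral_left) (auto simp: coeff_eq_0)
  finally show ?thesis by (simp add: sum_distrib_right mult.assoc)
 qed
 finally show ?thesis using assms qlin_0 by simp
qed


lemma number_field_basis:
 assumes "number_field TYPE('f::field_char_0)"
 obtains B :: "'f::field_char_0 set" where "finite B" "QV.independent B" "QV.span B = UNIV" "card B = field_degree TYPE('f)"
proof -
 obtain S :: "'f set" where S: "finite S" "QV.span S = UNIV" using assms by (auto simp: number_field_def)
 obtain B where B: "B <= S" "QV.independent B" "QV.span B = QV.span S"
  using QV.maximal_independent_subset[of S] by (metis QV.span_mono QV.span_span subset_antisym)
 hence "finite B" using S finite_subset by blast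
 moreover have "card B = field_degree TYPE('f)" unfolding field_degree_def using QV.dim_eq_card[of B UNIV] B S by simp
 ultimately show thesis using that B S by simp
qed

lemma ex_rat_poly:
 fixes s :: "'f::field_char_0"
 assumes "number_field TYPE('f)"
 shows "\<exists>p::rat poly. p ~= 0 & poly (map_poly of_rat p) s = 0"
proof -
 obtain B :: "'f set" where B: "finite B" "QV.independent B" "QV.span B = UNIV" "card B = field_degree TYPE('f)" using number_field_basis[OF assms] .
 let ?n = "card B"
 have *: "poly (map_poly of_rat p) s = (\<Sum>i\<le>N. of_rat (poly.coeff p i) * s ^ i)" if "Polynomial.degree p <= N" for p N
 proof -
  have "poly (map_poly of_rat p) s = (\<Sum>i\<le>Polynomial.degree p. of_rat (poly.coeff p i) * s ^ i)"
   by (simp add: poly_altdef coeff_map_poly degree_map_poly)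
  also have "... = (\<Sum>i\<le>N. of_rat (poly.coeff p i) * s ^ i)" using that by (intro sum.mono_neutral_left) (auto simp: coeff_eq_0)
  finally show ?thesis .
 qed
 show ?thesis
 proof (cases "inj_on (%i. s ^ i) {..?n}")
  \<comment> \<open>Linear dependence is about the set of powers, so coinciding powers are a case of
    their own.\<close>
  case False
  then obtain i j where ij: "i ~= j" "s ^ i = s ^ j" by (auto simp: inj_on_def)
  let ?p = "Polynomial.monom 1 i - Polynomial.monom (1::rat) j"
  have "poly.coeff ?p i = 1" using ij(1) by simp
  hence "?p ~= 0" by (metis coeff_0 zero_neq_one)
  moreover have "map_poly of_rat ?p = (Polynomial.monom 1 i - Polynomial.monom 1 j :: 'f poly)"
   by (intro poly_eqI) (simp add: coeff_map_poly of_rat_diff)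
  hence "poly (map_poly of_rat ?p) s = 0" using ij by (simp add: poly_monom)
  ultimately show ?thesis by blast
 next
  case True
  let ?S = "(%i. s ^ i) ` {..?n}"
  have "card ?S = Suc ?n" using True by (simp add: card_image)
  hence "QV.dependent ?S" using QV.independent_span_bound[of B ?S] B by auto
  then obtain u v where u: "(\<Sum>v\<in>?S. of_rat (u v) * v) = 0" "v : ?S" "u v ~= (0::rat)"
   unfolding QV.dependent_finite[OF finite_imageI[OF finite_atMost]] by blast
  define p where "p = (\<Sum>i\<le>?n. Polynomial.monom (u (s ^ i)) i)"
  have c: "poly.coeff p i = (if i <= ?n then u (s ^ i) else 0)" for i unfolding p_def by (simp add: coeff_sum)
  hence "Polynomial.degree p <= ?n" by (intro degree_le) auto
  hence "poly (map_poly of_rat p) s = (\<Sum>i\<le>?n. of_rat (u (s ^ i)) * s ^ i)" by (subst *) (auto simp: c)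
  also have "... = 0" using u(1) True by (simp add: sum.reindex)
  finally have "poly (map_poly of_rat p) s = 0" .
  moreover have "p ~= 0"
  proof
   assume "p = 0"
   moreover obtain i where "v = s ^ i" "i <= ?n" using u by auto
   ultimately show False using c[of i] u(3) by simp
  qed
  ultimately show ?thesis by blast
 qed
qed

lemma map_poly_of_rat_mult:
 "map_poly of_rat (p * q) = map_poly of_rat p * (map_poly of_rat q :: 'f::field_char_0 poly)"
 by (intro poly_eqI) (simp add: coeff_map_poly coeff_mult of_rat_sum of_rat_mult)

lemma map_poly_of_rat_add:
 "map_poly of_rat (p + q) = map_poly of_rat p + (map_poly of_rat q :: 'f::field_char_0 poly)"
 by (intro poly_eqI) (simp add: coeff_map_poly of_rat_add)

lemma map_poly_of_rat_pderiv:
 "map_poly of_rat (pderiv p) = pderiv (map_poly of_rat p :: 'f::field_char_0 poly)"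
 by (intro poly_eqI) (simp add: coeff_map_poly coeff_pderiv of_rat_mult of_rat_add)

lemma map_poly_of_rat_1: "map_poly of_rat 1 = (1 :: 'f::field_char_0 poly)" by (intro poly_eqI) (simp add: coeff_map_poly)

text \<open>A polynomial of least degree that kills s is coprime to its derivative: otherwise the
  cofactor of their gcd would kill s in lower degree. The Bezout identity carries this over to the
  complex numbers.\<close>

lemma ex_separable_rat_poly:
 fixes s :: "'f::field_char_0"
 assumes "number_field TYPE('f)"
 obtains p :: "rat poly" where "p ~= 0" "poly (map_poly of_rat p) s = 0"
  "rsquarefree (map_poly of_rat p :: complex poly)"
proof -
 define P where "P p \<longleftrightarrow> p ~= 0 & poly (map_poly of_rat p) s = 0" for p
 obtain p0 where "P p0" using ex_rat_poly[OF assms, of s] by (auto simp: P_def)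
 then obtain p where p: "P p" and min: "!!q. P q ==> Polynomial.degree p <= Polynomial.degree q"
  using ex_has_least_nat[of P p0 Polynomial.degree] by blast
 have "Polynomial.degree p > 0"
 proof (rule ccontr)
  assume "~ Polynomial.degree p > 0"
  then obtain c where "p = [:c:]" by (metis not_gr0 degree_eq_zeroE)
  with p show False by (auto simp: P_def map_poly_pCons)
 qed
 let ?g = "gcd p (pderiv p)"
 have "pderiv p ~= 0" using \<open>Polynomial.degree p > 0\<close> by (simp add: pderiv_eq_0_iff)
 have "Polynomial.degree ?g <= Polynomial.degree (pderiv p)" using \<open>pderiv p ~= 0\<close> by (intro dvd_imp_degree_le) auto
 hence dg: "Polynomial.degree ?g < Polynomial.degree p" using \<open>Polynomial.degree p > 0\<close> by (simp add: degree_pderiv)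
 obtain e where e: "p = ?g * e" using gcd_dvd1[of p "pderiv p"] by (elim dvdE)
 have "e ~= 0" "?g ~= 0" using e p by (auto simp: P_def)
 have "poly (map_poly of_rat ?g) s ~= 0" using min[of ?g] dg \<open>?g ~= 0\<close> by (auto simp: P_def)
 moreover have "poly (map_poly of_rat ?g) s * poly (map_poly of_rat e) s = 0"
  using p unfolding P_def poly_mult[symmetric] map_poly_of_rat_mult[symmetric] e[symmetric] by blast
 ultimately have "P e" using \<open>e ~= 0\<close> by (simp add: P_def)
 hence "Polynomial.degree ?g = 0" using min[of e] Polynomial.degree_mult_eq[OF \<open>?g ~= 0\<close> \<open>e ~= 0\<close>] e by simp
 hence "is_unit ?g" using \<open>?g ~= 0\<close> is_unit_iff_degree[of ?g] by blast
 hence "?g = 1" using is_unit_gcd_iff by blast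
 define u v where "u = fst (bezout_coefficients p (pderiv p))" and "v = snd (bezout_coefficients p (pderiv p))"
 have "u * p + v * pderiv p = 1" unfolding u_def v_def using bezout_coefficients_fst_snd[of p "pderiv p"] \<open>?g = 1\<close> by simp
 hence "map_poly of_rat (u * p + v * pderiv p) = (1::complex poly)" by (simp only: map_poly_of_rat_1)
 hence uv: "map_poly of_rat u * map_poly of_rat p + map_poly of_rat v * pderiv (map_poly of_rat p) = (1::complex poly)"
  by (simp only: map_poly_of_rat_add map_poly_of_rat_mult map_poly_of_rat_pderiv)
 have "rsquarefree (map_poly of_rat p :: complex poly)" unfolding rsquarefree_roots
 proof (intro allI notI)
  fix a assume a: "poly (map_poly of_rat p) a = 0 & poly (pderiv (map_poly of_rat p)) a = (0::complex)"
  show False using arg_cong[OF uv, of "%p. poly p a"] a by simp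
 qed
 with p show thesis using that by (auto simp: P_def)
qed

text \<open>Simultaneous diagonalization of the commuting multiplications by elements of S. The
  space to which \<open>eigen_decomposition\<close> is applied consists of the functionals with the
  eigenvalues found so far, so these survive the splitting by the next element.\<close>

lemma qlin_eigen_list:
 fixes S :: "'f::field_char_0 set"
 assumes nf: "number_field TYPE('f)" and "finite S" and "qlin ph"
 shows "EX L. ph = (%z. \<Sum>psi\<leftarrow>L. psi z) & (ALL psi:set L. qlin psi & (ALL s:S. EX be. ALL z. psi (s * z) = be * psi z))"
 using assms(2,3)
proof (induction S arbitrary: ph)
 case empty
 thus ?case by (intro exI[of _ "[ph]"]) auto
next
 case (insert s S)
 define E where "E = (%psi. qlin psi & (ALL s:S. EX be. ALL z. psi (s * z) = be * psi z))"
 define E' where "E' = (%psi. qlin psi & (ALL s:insert s S. EX be. ALL z. psi (s * z) = be * psi z))"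
 have step: "EX L. psi = (%z. \<Sum>psi\<leftarrow>L. psi z) & (ALL psi:set L. E' psi)" if E: "E psi" for psi
 proof -
  obtain B where B: "!!s z. s : S ==> psi (s * z) = B s * psi z"
  proof -
   have "ALL s. EX be. s : S --> (ALL z. psi (s * z) = be * psi z)" using E unfolding E_def by blast
   thus thesis using that by metis
  qed
  define V where "V = {f. qlin f & (ALL s:S. ALL z. f (s * z) = B s * f z)}"
  obtain p :: "rat poly" where p: "p ~= 0" "poly (map_poly of_rat p) s = 0"
   "rsquarefree (map_poly of_rat p :: complex poly)" using ex_separable_rat_poly[OF nf] .
  let ?p = "map_poly of_rat p :: complex poly"
  have "?p ~= 0" using p(1) by (metis leading_coeff_0_iff coeff_map_poly of_rat_eq_0_iff of_rat_0 coeff_0)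
  hence "finite {z. poly ?p z = 0}" by (rule poly_roots_finite)
  then obtain rs where rs: "set rs = {z. poly ?p z = 0}" "distinct rs" using finite_distinct_list by blast
  let ?P = "\<Prod>be\<leftarrow>rs. [:-be, 1:]"
  have "?P = (\<Prod>z | poly ?p z = 0. [:-z, 1:])" using rs by (simp add: prod.distinct_set_conv_list[symmetric])
  hence Pp: "Polynomial.smult (Polynomial.lead_coeff ?p) ?P = ?p" using complex_poly_decompose_rsquarefree[OF p(3)] by simp
  have fold0: "fold (%be f z. f (s * z) - be * f z) rs psi = (%_. 0)"
  proof
   fix z
   let ?N = "max (Polynomial.degree ?P) (Polynomial.degree p)"
   have "Polynomial.lead_coeff ?p * fold (%be f z. f (s * z) - be * f z) rs psi z
    = (\<Sum>i\<le>?N. poly.coeff (Polynomial.smult (Polynomial.lead_coeff ?p) ?P) i * psi (s ^ i * z))"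
    by (subst fold_roots_operator[of _ ?N]) (auto simp: sum_distrib_left mult_ac)
   also have "... = 0" unfolding Pp using E by (intro rat_poly_annihilates p) (auto simp: E_def)
   finally show "fold (%be f z. f (s * z) - be * f z) rs psi z = 0" using \<open>?p ~= 0\<close> by simp
  qed
  have "EX psi'. (ALL z. psi z = (\<Sum>be\<in>set rs. psi' be z)) \<and>
   (ALL be:set rs. psi' be : V & (ALL z. psi' be (s * z) = be * psi' be z))"
  proof (rule eigen_decomposition[OF _ _ rs(2) _ fold0])
   show "(%z. a * f z + b * g z) : V" if "f : V" "g : V" for f g a b using that unfolding V_def by (auto simp: qlin_def algebra_simps)
   show "(%z. f (s * z)) : V" if "f : V" for f using that unfolding V_def qlin_def by (auto simp: distrib_left mult.left_commute[of s])
   show "psi : V" using E B by (auto simp: V_def E_def)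
  qed
  then obtain psi' where psi': "!!z. psi z = (\<Sum>be\<in>set rs. psi' be z)"
   "!!be. be : set rs ==> psi' be : V & (ALL z. psi' be (s * z) = be * psi' be z)" by blast
  show ?thesis
  proof (intro exI[of _ "map psi' rs"] conjI ballI)
   show "psi = (%z. \<Sum>psi\<leftarrow>map psi' rs. psi z)" using psi'(1) rs(2) by (simp add: fun_eq_iff o_def sum.distinct_set_conv_list)
   show "E' psi" if "psi : set (map psi' rs)" for psi using that psi'(2) unfolding E'_def V_def by auto
  qed
 qed
 obtain L where L: "ph = (%z. \<Sum>psi\<leftarrow>L. psi z)" "!!psi. psi : set L ==> E psi" using insert.IH[OF insert.prems] unfolding E_def by blast
 obtain M where M: "!!psi. psi : set L ==> psi = (%z. \<Sum>psi\<leftarrow>M psi. psi z) & (\<forall>psi'\<in>set (M psi). E' psi')"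
  using step[OF L(2)] by metis
 show ?case
 proof (intro exI[of _ "concat (map M L)"] conjI)
  have "(\<Sum>psi\<leftarrow>L'. psi z) = (\<Sum>psi\<leftarrow>concat (map M L'). psi z)" if "set L' <= set L" for z L' using that
  proof (induction L')
   case (Cons a L')
   hence "a z = (\<Sum>psi\<leftarrow>M a. psi z)" using M[of a] by (auto dest!: fun_cong[of _ _ z])
   with Cons show ?case by simp
  qed simp
  thus "ph = (%z. \<Sum>psi\<leftarrow>concat (map M L). psi z)" using L(1) by auto
 qed (use M in \<open>auto simp: E'_def\<close>)
qed

text \<open>A functional that is an eigenvector for a spanning set is one for every multiplication,
  and the eigenvalue, as a function of the multiplier, is additive and multiplicative.\<close>

lemma eigen_field_hom:
 fixes psi :: "'f::field_char_0 => complex"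
 assumes "qlin psi" "QV.span S = UNIV" "ALL s:S. EX be. ALL z. psi (s * z) = be * psi z" "psi x ~= 0"
 shows "EX ta. field_hom ta & psi = (%z. psi 1 * ta z)"
proof -
 have "EX be. ALL z. psi (y * z) = be * psi z" for y
 proof -
  have "y : QV.span S" using assms by simp
  thus ?thesis
  proof (induction rule: QV.span_induct_alt)
   case base
   thus ?case using assms(1) by (intro exI[of _ 0]) (simp add: qlin_0)
  next
   case (step c s y)
   obtain be where "ALL z. psi (s * z) = be * psi z" using assms(3) step by blast
   moreover obtain ga where "ALL z. psi (y * z) = ga * psi z" using step by blast
   ultimately show ?case using assms(1) by (intro exI[of _ "of_rat c * be + ga"]) (simp add: qlin_def distrib_right mult.assoc)
  qed
 qed
 then obtain ta where ta: "!!y z. psi (y * z) = ta y * psi z" by metis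
 have "psi 1 ~= 0" using ta[of x 1] assms(4) by auto
 have eq: "psi z = psi 1 * ta z" for z using ta[of z 1] by simp
 have "ta 1 = 1" using ta[of 1 1] \<open>psi 1 ~= 0\<close> by simp
 moreover have "ta (x + y) = ta x + ta y" for x y
 proof -
  have "psi (x + y) = psi x + psi y" using assms(1) by (simp add: qlin_def)
  hence "psi 1 * ta (x + y) = psi 1 * (ta x + ta y)" unfolding eq[of "x + y"] eq[of x] eq[of y] by (simp add: distrib_left)
  thus ?thesis using \<open>psi 1 ~= 0\<close> by simp
 qed
 moreover have "ta (x * y) = ta x * ta y" for x y
 proof -
  have "psi 1 * ta (x * y) = ta x * (psi 1 * ta y)" using ta[of x y] unfolding eq[of "x * y"] eq[of y] .
  thus ?thesis using \<open>psi 1 ~= 0\<close> by simp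
 qed
 ultimately have "field_hom ta" by (simp add: field_hom_def)
 moreover have "psi = (%z. psi 1 * ta z)" using eq by (rule ext)
 ultimately show ?thesis by blast
qed

abbreviation complex_embeddings :: "('f::field_char_0 => complex) set" where
 "complex_embeddings \<equiv> {ta. field_hom ta}"

text \<open>Artin's argument: subtracting si(y) times a relation from the same relation at y x
  removes the term of si, and some y keeps a given other coefficient alive.\<close>

lemma independent_embeddings:
 "CV.independent (complex_embeddings :: ('f::field_char_0 => complex) set)"
proof -
 have indep: "ALL ta:T. c ta = 0"
  if "finite T" "T <= complex_embeddings" "!!x. (\<Sum>ta\<in>T. c ta * ta x) = 0"
  for T and c :: "('f => complex) => complex" using that
 proof (induction T arbitrary: c)
  case (insert si T)
  have si: "field_hom si" using insert.prems by simp
  have *: "ALL ta:T. c ta * (ta y - si y) = 0" for y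
  proof (rule insert.IH)
   fix x
   have e: "(\<Sum>ta\<in>T. c ta * ta x) = - c si * si x" for x
    using insert.prems(2)[of x] insert.hyps by (simp add: eq_neg_iff_add_eq_0 add.commute)
   have "(\<Sum>ta\<in>T. c ta * (ta y - si y) * ta x) = (\<Sum>ta\<in>T. c ta * ta (y * x)) - si y * (\<Sum>ta\<in>T. c ta * ta x)"
    unfolding sum_distrib_left sum_subtractf[symmetric] using insert.prems(1) by (intro sum.cong) (auto simp: hom_mult algebra_simps)
   also have "... = 0" unfolding e using si by (simp add: hom_mult)
   finally show "(\<Sum>ta\<in>T. c ta * (ta y - si y) * ta x) = 0" .
  qed (use insert.prems in auto)
  have T0: "c ta = 0" if "ta : T" for ta
  proof -
   have "ta ~= si" using that insert.hyps by auto
   then obtain y where "ta y ~= si y" by (auto simp: fun_eq_iff)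
   thus ?thesis using * that by auto
  qed
  hence "c si * si 1 = 0" using insert.prems(2)[of 1] insert.hyps by simp
  thus ?case using T0 hom_1[OF si] by auto
 qed simp
 show ?thesis
 proof
  assume "CV.dependent (complex_embeddings :: ('f => complex) set)"
  then obtain T u si where T: "finite T" "T <= complex_embeddings" "si : T" "u si ~= 0"
   and *: "(\<Sum>v\<in>T. (%x::'f. u v * v x)) = 0" unfolding CV.dependent_explicit by blast
  have "(\<Sum>v\<in>T. u v * v x) = 0" for x using fun_cong[OF *, of x] by (simp add: sum_fun_apply)
  hence "ALL v:T. u v = 0" by (intro indep T) blast
  with T show False by blast
 qed
qed

section \<open>Integer relations between powers\<close>

lemma common_denominator:
 fixes q :: "'a => rat"
 assumes "finite A"
 shows "\<exists>D::int. D > 0 & (ALL i:A. EX m. of_int D * q i = of_int m)" using assms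
proof (induction A)
 case (insert n A)
 then obtain D where D: "D > 0" "!!i. i : A ==> EX m. of_int D * q i = of_int m" by blast
 obtain a b where ab: "q n = Rat.Fract a b" "b > 0" by (cases "q n") auto
 have "EX m. of_int (b * D) * q i = of_int m" if i: "i : insert n A" for i
 proof (cases "i = n")
  case True
  hence "of_int (b * D) * q i = of_int (D * a)" using ab by (simp add: Fract_of_int_quotient)
  thus ?thesis by blast
 next
  case False
  then obtain m where "of_int D * q i = of_int m" using D(2)[of i] i by auto
  hence "of_int (b * D) * q i = of_int (b * m)" by simp
  thus ?thesis by blast
 qed
 thus ?case using D(1) ab(2) by (intro exI[of _ "b * D"]) auto
qed (auto intro: exI[of _ 1])

lemma common_denominator_relation:
 fixes q :: "'a => rat" and x :: "'a => 'f::field_char_0"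
 assumes "finite A" "(\<Sum>i\<in>A. of_rat (q i) * x i) = 0" "j : A" "q j ~= 0"
 shows "\<exists>m::'a => int. (\<Sum>i\<in>A. of_int (m i) * x i) = 0 & m j ~= 0"
proof -
 obtain D m where D: "D > 0" "!!i. i : A ==> of_int D * q i = of_int (m i)" using common_denominator[OF assms(1), of q] by metis
 have e: "of_int (m i) = of_int D * (of_rat (q i) :: 'f)" if "i : A" for i
 proof -
  have "of_rat (of_int (m i)) = (of_rat (of_int D * q i) :: 'f)" using D(2)[OF that] by simp
  thus ?thesis by (simp add: of_rat_mult)
 qed
 hence "(\<Sum>i\<in>A. of_int (m i) * x i) = of_int D * (\<Sum>i\<in>A. of_rat (q i) * x i)" by (simp add: sum_distrib_left mult.assoc)
 moreover have "m j ~= 0" using D(1) D(2)[OF assms(3)] assms(4) by auto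
 ultimately show ?thesis using assms(2) by (intro exI[of _ m]) simp
qed

lemma ex_int_relation:
 fixes s :: "'f::field_char_0"
 assumes "number_field TYPE('f)"
 shows "\<exists>m::nat => int. (\<Sum>i\<le>field_degree TYPE('f). of_int (m i) * s ^ i) = 0 & (\<exists>i\<le>field_degree TYPE('f). m i ~= 0)"
proof -
 obtain B :: "'f set" where B: "finite B" "QV.independent B" "QV.span B = UNIV" "card B = field_degree TYPE('f)" using number_field_basis[OF assms] .
 let ?n = "field_degree TYPE('f)"
 show ?thesis
 proof (cases "inj_on (%i. s ^ i) {..?n}")
  case False
  then obtain i j where ij: "i ~= j" "s ^ i = s ^ j" "i <= ?n" "j <= ?n" by (auto simp: inj_on_def)
  let ?m = "%k. if k = i then 1 else if k = j then - 1 else (0::int)"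
  have "(\<Sum>k\<le>?n. of_int (?m k) * s ^ k) = (\<Sum>k\<in>{i, j}. of_int (?m k) * s ^ k)" using ij by (intro sum.mono_neutral_right) auto
  also have "... = 0" using ij by simp
  finally have "(\<Sum>k\<le>?n. of_int (?m k) * s ^ k) = 0" .
  moreover have "?m i ~= 0" by simp
  ultimately show ?thesis using ij(3) by (intro exI[of _ ?m]) blast
 next
  case True
  let ?S = "(%i. s ^ i) ` {..?n}"
  have "card ?S = Suc ?n" using True by (simp add: card_image)
  hence "QV.dependent ?S" using QV.independent_span_bound[of B ?S] B by auto
  then obtain u v where u: "(\<Sum>v\<in>?S. of_rat (u v) * v) = 0" "v : ?S" "u v ~= (0::rat)"
   unfolding QV.dependent_finite[OF finite_imageI[OF finite_atMost]] by blast
  obtain j where j: "j <= ?n" "v = s ^ j" using u(2) by auto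
  have "(\<Sum>i\<le>?n. of_rat (u (s ^ i)) * s ^ i) = 0" using u(1) True by (simp add: sum.reindex)
  from common_denominator_relation[OF finite_atMost this, of j] j u(3) show ?thesis by auto
 qed
qed

text \<open>Cut off at its last nonzero coefficient, a relation controls denominators: by
  \<open>val_lead_coeff\<close> every pole of s is a zero of that coefficient.\<close>

lemma ex_lead_relation:
 fixes s :: "'f::field_char_0"
 assumes "number_field TYPE('f)"
 obtains m :: "nat => int" and n where "n > 0" "m n ~= 0" "(\<Sum>i\<le>n. of_int (m i) * s ^ i) = 0"
proof -
 obtain m :: "nat => int" where m: "(\<Sum>i\<le>field_degree TYPE('f). of_int (m i) * s ^ i) = 0"
  "\<exists>i\<le>field_degree TYPE('f). m i ~= 0" using ex_int_relation[OF assms] by blast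
 define n where "n = (GREATEST i. i <= field_degree TYPE('f) & m i ~= 0)"
 have n: "n <= field_degree TYPE('f)" "m n ~= 0" using GreatestI_ex_nat[OF m(2)[unfolded Bex_def], of "field_degree TYPE('f)"] by (auto simp: n_def)
 have gt: "m i = 0" if "i > n" "i <= field_degree TYPE('f)" for i
 proof (rule ccontr)
  assume "m i ~= 0"
  hence "i <= n" unfolding n_def using that by (intro Greatest_le_nat[of _ _ "field_degree TYPE('f)"]) auto
  with that show False by simp
 qed
 have "(\<Sum>i\<le>n. of_int (m i) * s ^ i) = (\<Sum>i\<le>field_degree TYPE('f). of_int (m i) * s ^ i)"
  using n(1) gt by (intro sum.mono_neutral_left) auto
 hence rel: "(\<Sum>i\<le>n. of_int (m i) * s ^ i) = 0" using m(1) by simp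
 have "n > 0"
 proof (rule ccontr)
  assume "~ n > 0"
  thus False using rel n(2) by simp
 qed
 with that n(2) rel show thesis by blast
qed

section \<open>Finite places as discrete valuations\<close>

context
 fixes v :: "'f::field_char_0 => int"
 assumes v: "v : finite_places"
begin

lemma val_0: "v 0 = 0" and val_mult: "x ~= 0 ==> y ~= 0 ==> v (x * y) = v x + v y"
 and val_add: "x ~= 0 ==> y ~= 0 ==> x + y ~= 0 ==> min (v x) (v y) <= v (x + y)"
 and val_surj: "EX x. x ~= 0 & v x = 1" using v by (auto simp: finite_places_def)

lemma val_1: "v 1 = 0" using val_mult[of 1 1] by simp

lemma val_uminus: "v (- x) = v x"
proof (cases "x = 0")
 case False
 have "v (-1) + v (-1) = 0" using val_mult[of "-1" "-1"] val_1 by simp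
 thus ?thesis using val_mult[of "-1" x] False by simp
qed simp

lemma val_inverse: "v (inverse x) = - v x" using val_mult[of x "inverse x"] val_1 val_0 by (cases "x = 0") auto

lemma val_divide: "x ~= 0 ==> y ~= 0 ==> v (x / y) = v x - v y" by (simp add: divide_inverse val_mult val_inverse)

lemma val_power: "x ~= 0 ==> v (x ^ n) = int n * v x" by (induction n) (simp_all add: val_1 val_mult algebra_simps)

lemma val_ge_0 [simp]: "val_ge v N 0" by (simp add: val_ge_def)

lemma val_ge_add: "val_ge v N x ==> val_ge v N y ==> val_ge v N (x + y)"
 unfolding val_ge_def using val_add[of x y] by (metis add.left_neutral add.right_neutral min.boundedI order_trans)

lemma val_ge_uminus: "val_ge v N x ==> val_ge v N (- x)" by (auto simp: val_ge_def val_uminus)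

lemma val_ge_diff: "val_ge v N x ==> val_ge v N y ==> val_ge v N (x - y)" using val_ge_add[of N x "- y"] val_ge_uminus by simp

lemma val_ge_mult: "val_ge v N x ==> val_ge v M y ==> val_ge v (N + M) (x * y)" by (cases "x = 0 | y = 0") (auto simp: val_ge_def val_mult)

lemma val_ge_mono: "val_ge v N x ==> M <= N ==> val_ge v M x" by (auto simp: val_ge_def)

lemma val_ge_sum: "(!!i. i : A ==> val_ge v N (f i)) ==> val_ge v N (sum f A)" by (induction A rule: infinite_finite_induct) (auto intro: val_ge_add)

lemma val_ge_of_int: "val_ge v 0 (of_int m)"
proof -
 have *: "val_ge v 0 (of_nat n)" for n
 proof (induction n)
  case (Suc n)
  thus ?case using val_ge_add[of 0 1 "of_nat n"] by (simp add: val_ge_def val_1 add.commute)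
 qed simp
 show ?thesis by (cases m rule: int_cases2) (use * val_ge_uminus in auto)
qed

lemma val_add_eq: "x ~= 0 ==> y ~= 0 ==> v x < v y ==> x + y ~= 0 & v (x + y) = v x"
proof -
 assume xy: "x ~= 0" "y ~= 0" "v x < v y"
 have ne: "x + y ~= 0" using xy val_uminus[of x] by (metis add_eq_0_iff order_less_irrefl)
 have "min (v (x + y)) (v (- y)) <= v (x + y + - y)" using xy ne by (intro val_add) auto
 hence "v (x + y) <= v x" using xy(3) by (simp add: val_uminus)
 moreover have "v x <= v (x + y)" using val_add[OF xy(1,2) ne] xy by simp
 ultimately show ?thesis using ne by simp
qed

text \<open>If the leading coefficient had valuation 0, then, x having a pole, the top term alone
  would have the smallest valuation, and the sum could not vanish.\<close>

lemma val_lead_coeff: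
 fixes c :: "nat => int"
 assumes x: "x ~= 0" "v x < 0" and n: "n > 0" and rel: "(\<Sum>i\<le>n. of_int (c i) * x ^ i) = 0" and "c n ~= 0"
 shows "v (of_int (c n)) > 0"
proof (rule ccontr)
 assume "~ v (of_int (c n)) > 0"
 hence c: "v (of_int (c n)) = 0" using val_ge_of_int[of "c n"] \<open>c n ~= 0\<close> by (auto simp: val_ge_def)
 have "val_ge v (int (n - 1) * v x) (\<Sum>i<n. of_int (c i) * x ^ i)"
 proof (rule val_ge_sum)
  fix i assume "i : {..<n}"
  hence "int (n - 1) * v x <= int i * v x" using x(2) by (intro mult_right_mono_neg) auto
  hence "val_ge v (int (n - 1) * v x) (x ^ i)" using x by (simp add: val_ge_def val_power)
  thus "val_ge v (int (n - 1) * v x) (of_int (c i) * x ^ i)" using val_ge_mult[OF val_ge_of_int] by fastforce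
 qed
 moreover have "(\<Sum>i<n. of_int (c i) * x ^ i) = - (of_int (c n) * x ^ n)"
  using rel by (simp add: lessThan_Suc_atMost[symmetric] eq_neg_iff_add_eq_0)
 ultimately have "val_ge v (int (n - 1) * v x) (of_int (c n) * x ^ n)" using val_ge_uminus by fastforce
 moreover have "of_int (c n) * x ^ n ~= 0" "v (of_int (c n) * x ^ n) = int n * v x"
  using x c \<open>c n ~= 0\<close> by (simp_all add: val_mult val_power)
 ultimately have "int (n - 1) * v x <= int n * v x" unfolding val_ge_def by presburger
 moreover have "int (n - 1) * v x = int n * v x - v x" using n by (simp add: of_nat_diff algebra_simps)
 ultimately show False using x(2) by simp
qed

lemma algebraic_int_imp_val_ge: "aint x ==> val_ge v 0 x"
proof (rule ccontr)
 assume "aint x" and n: "~ val_ge v 0 x"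
 then obtain P :: "int poly" where P: "poly (map_poly of_int P) x = 0" "Polynomial.lead_coeff P = 1" unfolding algebraic_int_altdef_ipoly by blast
 have "Polynomial.degree P > 0"
 proof (rule ccontr)
  assume "~ Polynomial.degree P > 0"
  then obtain c where "P = [:c:]" by (metis not_gr0 degree_eq_zeroE)
  with P show False by (simp add: map_poly_pCons)
 qed
 moreover have "(\<Sum>i\<le>Polynomial.degree P. of_int (poly.coeff P i) * x ^ i) = 0"
  using P(1) by (simp add: poly_altdef coeff_map_poly degree_map_poly)
 ultimately have "v (of_int (Polynomial.lead_coeff P)) > 0" using n P(2) by (intro val_lead_coeff[of x "Polynomial.degree P"]) (auto simp: val_ge_def)
 thus False using P(2) val_1 by simp
qed

end

text \<open>The least positive integer of positive valuation divides all others of that kind, by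
  division with remainder. Its bound in terms of c leaves finitely many candidates.\<close>

lemma ex_residue_char:
 fixes c :: int
 assumes v: "v : finite_places" and c: "v (of_int c) > 0" "c ~= 0"
 shows "EX p:{1<..nat \<bar>c\<bar>}. v (of_nat p) > 0 & (\<forall>m::int. m ~= 0 --> v (of_int m) > 0 --> int p dvd m)"
proof -
 define P where "P p \<longleftrightarrow> p > 0 & v (of_nat p) > 0" for p :: nat
 have abs: "P (nat \<bar>m\<bar>)" if "m ~= 0" "v (of_int m) > 0" for m
 proof -
  have "of_nat (nat \<bar>m\<bar>) = (of_int m :: 'a) | of_nat (nat \<bar>m\<bar>) = - (of_int m :: 'a)" by (cases "m >= 0") auto
  thus ?thesis using that val_uminus[OF v] by (auto simp: P_def)
 qed
 define p where "p = (LEAST p. P p)"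
 have Pp: "P p" unfolding p_def using abs[OF c(2,1)] by (rule LeastI)
 have le: "p <= q" if "P q" for q unfolding p_def using that by (rule Least_le)
 have dvd: "int p dvd m" if m: "m ~= 0" "v (of_int m) > 0" for m
 proof (rule ccontr)
  assume nd: "~ int p dvd m"
  define r where "r = m mod int p"
  have r: "r > 0" "r < int p" using nd Pp by (auto simp: r_def P_def dvd_eq_mod_eq_0 le_neq_trans)
  have e: "of_int r = of_int m - of_nat p * (of_int (m div int p) :: 'a)"
  proof -
   have "r = m - int p * (m div int p)" by (simp add: r_def minus_mult_div_eq_mod)
   thus ?thesis by (metis of_int_diff of_int_mult of_int_of_nat_eq)
  qed
  have "val_ge v (1 + 0) (of_nat p * (of_int (m div int p)))" using Pp by (intro val_ge_mult[OF v] val_ge_of_int[OF v]) (auto simp: val_ge_def P_def)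
  hence "val_ge v 1 (of_int r)" unfolding e using m by (intro val_ge_diff[OF v]) (auto simp: val_ge_def)
  hence "P (nat \<bar>r\<bar>)" using r by (intro abs) (auto simp: val_ge_def)
  thus False using le[of "nat \<bar>r\<bar>"] r by simp
 qed
 have "p ~= 1" using Pp val_1[OF v] by (auto simp: P_def)
 moreover have "p <= nat \<bar>c\<bar>" using le[OF abs[OF c(2,1)]] .
 ultimately show ?thesis using Pp dvd by (intro bexI[of _ p]) (auto simp: P_def)
qed

text \<open>If the valuation ring of v were contained in that of w, units at v would be units at w
  and w would be a multiple of v; both are surjective onto the integers, so they would
  coincide.\<close>

lemma finite_places_incomparable:
 assumes v: "v : finite_places" and w: "w : finite_places" and "v ~= w"
 shows "EX x. x ~= 0 & 0 <= v x & w x < 0"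
proof (rule ccontr)
 assume "~ ?thesis"
 hence *: "w x >= 0" if "x ~= 0" "v x >= 0" for x using that by force
 have 0: "w x = 0" if "x ~= 0" "v x = 0" for x using *[of x] *[of "inverse x"] that by (simp add: val_inverse[OF v] val_inverse[OF w])
 obtain \<pi> where \<pi>: "\<pi> ~= 0" "v \<pi> = 1" using val_surj[OF v] by blast
 have eq: "w x = v x * w \<pi>" if x: "x ~= 0" for x
 proof (cases "v x >= 0")
  case True
  have "w (x / \<pi> ^ nat (v x)) = 0" using True x \<pi> by (intro 0) (auto simp: val_divide[OF v] val_power[OF v])
  thus ?thesis using True x \<pi> by (simp add: val_divide[OF w] val_power[OF w])
 next
  case False
  have "w (x * \<pi> ^ nat (- v x)) = 0" using False x \<pi> by (intro 0) (auto simp: val_mult[OF v] val_power[OF v])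
  thus ?thesis using False x \<pi> by (simp add: val_mult[OF w] val_power[OF w])
 qed
 obtain y where "y ~= 0" "w y = 1" using val_surj[OF w] by blast
 hence "v y * w \<pi> = 1" using eq by simp
 moreover have "w \<pi> >= 0" using * \<pi> by simp
 ultimately have "w \<pi> = 1" by (auto simp: zmult_eq_1_iff)
 hence "w x = v x" for x using eq[of x] val_0[OF v] val_0[OF w] by (cases "x = 0") auto
 thus False using \<open>v ~= w\<close> by auto
qed

lemma finite_places_separate:
 assumes v: "v : finite_places" and w: "w : finite_places" and "v ~= w"
 shows "EX x. x ~= 0 & v x < 0 & 0 < w x"
proof -
 obtain x where x: "x ~= 0" "0 <= v x" "w x < 0" using finite_places_incomparable[OF assms] by blast
 obtain y where y: "y ~= 0" "0 <= w y" "v y < 0" using finite_places_incomparable[OF w v] assms(3) by blast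
 show ?thesis using x y by (intro exI[of _ "y / x"]) (auto simp: val_divide[OF v] val_divide[OF w])
qed

text \<open>Weak approximation. The element y separates v from the new place and is multiplied by a
  power of the old solution x, which must first be made harmless at the new place; hence the three
  cases for the value of x there.\<close>

lemma finite_places_approximation:
 assumes v: "v : finite_places" and "finite T" "T <= finite_places" "v ~: T"
 shows "EX x. x ~= 0 & v x < 0 & (ALL w:T. 0 < w x)" using assms(2-)
proof (induction T)
 case empty
 obtain \<pi> where "\<pi> ~= 0" "v \<pi> = 1" using val_surj[OF v] by blast
 thus ?case by (intro exI[of _ "inverse \<pi>"]) (simp add: val_inverse[OF v])
next
 case (insert w' T)
 then obtain x where x: "x ~= 0" "v x < 0" "!!w. w : T ==> 0 < w x" by auto
 have w': "w' : finite_places" using insert by simp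
 have FP: "w : finite_places" if "w : T" for w using insert that by auto
 obtain y where y: "y ~= 0" "v y < 0" "0 < w' y" using finite_places_separate[OF v w'] insert by auto
 \<comment> \<open>Large enough for the zeros of x^n to outweigh possible poles of y at the places
   of T.\<close>
 define n where "n = Suc (nat (\<Sum>w\<in>T. \<bar>w y\<bar>))"
 have big: "int n * w x + w y > 0" if w: "w : T" for w
 proof -
  have "\<bar>w y\<bar> <= (\<Sum>w\<in>T. \<bar>w y\<bar>)" using insert(1) w by (intro member_le_sum) auto
  hence "int n > \<bar>w y\<bar>" by (simp add: n_def)
  moreover have "int n * w x >= int n * 1" using x(3)[OF w] by (intro mult_left_mono) auto
  ultimately show ?thesis by linarith
 qed
 consider "w' x > 0" | "w' x = 0" | "w' x < 0" by linarith
 thus ?case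
 proof cases
  case 1
  with x show ?thesis by auto
 next
  case 2
  have "int n * v x <= 0" using x(2) by (simp add: mult_nonneg_nonpos)
  with 2 x y big show ?thesis by (intro exI[of _ "x ^ n * y"])
    (auto simp: val_mult[OF v] val_power[OF v] val_mult[OF w'] val_power[OF w'] val_mult[OF FP] val_power[OF FP])
 next
  case 3
  \<comment> \<open>Its valuation is 0 wherever x has a pole, hence at v and at \<open>w'\<close>,
    and it is that of x^n at the places of T.\<close>
  define z where "z = x ^ n / (1 + x ^ n)"
  have n: "n > 0" by (simp add: n_def)
  have neg: "1 + x ^ n ~= 0 & u (1 + x ^ n) = int n * u x" if u: "u : finite_places" "u x < 0" for u using val_add_eq[OF u(1), of "x ^ n" 1] x(1) u n
   by (simp add: val_power[OF u(1)] val_1[OF u(1)] mult_pos_neg add.commute)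
  have pos: "w (1 + x ^ n) = 0" if w: "w : T" for w using val_add_eq[OF FP[OF w], of 1 "x ^ n"] x(1) x(3)[OF w] n
   by (simp add: val_power[OF FP[OF w]] val_1[OF FP[OF w]])
  have ne: "1 + x ^ n ~= 0" using neg[OF v x(2)] by simp
  have "u z = 0" if u: "u : finite_places" "u x < 0" for u using neg[OF u] x(1) by (simp add: z_def val_divide[OF u(1)] val_power[OF u(1)])
  moreover have "w z = int n * w x" if w: "w : T" for w using pos[OF w] x(1) ne by (simp add: z_def val_divide[OF FP[OF w]] val_power[OF FP[OF w]])
  moreover have "z ~= 0" using x(1) ne by (simp add: z_def)
  ultimately have zz: "v z = 0" "w' z = 0" "!!w. w : T ==> w z = int n * w x" "z ~= 0" using v w' 3 x(2) by blast+
  have "v (z * y) < 0" "0 < w' (z * y)" using zz y by (simp_all add: val_mult[OF v] val_mult[OF w'])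
  moreover have "0 < w (z * y)" if "w : T" for w using big[OF that] zz y that by (simp add: val_mult[OF FP])
  ultimately show ?thesis using zz(4) y(1) by (intro exI[of _ "z * y"]) auto
 qed
qed

text \<open>Each place of T gets an element with a pole there and zeros at the rest of T; these are
  independent over Q. A coefficient of a relation that p does not divide belongs to a place where
  its term alone has a pole.\<close>

lemma finite_places_above:
 fixes T :: "('f::field_char_0 => int) set"
 assumes nf: "number_field TYPE('f)" and p: "p > 1"
  and T: "finite T" "T <= {v : finite_places. \<forall>m::int. m ~= 0 --> v (of_int m) > 0 --> int p dvd m}"
 shows "card T <= field_degree TYPE('f)"
proof -
 have FP: "v : finite_places" if "v : T" for v using T that by auto
 have "ALL v:T. EX x. x ~= 0 & v x < 0 & (ALL w:T - {v}. 0 < w x)" using T FP by (intro ballI finite_places_approximation) auto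
 then obtain x where x: "!!v. v : T ==> x v ~= 0" "!!v. v : T ==> v (x v) < 0"
  "!!v w. v : T ==> w : T ==> v ~= w ==> 0 < w (x v)" by (metis Diff_iff singletonD)
 have inj: "inj_on x T"
 proof (rule inj_onI, rule ccontr)
  fix v w assume "v : T" "w : T" "x v = x w" "v ~= w"
  thus False using x(2)[of v] x(3)[of w v] by simp
 qed
 have "QV.independent (x ` T)"
 proof
  assume "QV.dependent (x ` T)"
  then obtain u v0 where u: "(\<Sum>v\<in>x ` T. of_rat (u v) * v) = 0" "v0 : T" "u (x v0) ~= (0::rat)"
   unfolding QV.dependent_finite[OF finite_imageI[OF T(1)]] by blast
  have "(\<Sum>v\<in>T. of_rat (u (x v)) * x v) = 0" using u(1) inj by (simp add: sum.reindex)
  from common_denominator_relation[OF T(1) this u(2)] u(3)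
  obtain m0 where m0: "(\<Sum>v\<in>T. of_int (m0 v) * x v) = 0" "m0 v0 ~= 0" by auto
  define P where "P m \<longleftrightarrow> (\<Sum>v\<in>T. of_int (m v) * x v) = 0 & (EX v:T. m v ~= 0)" for m :: "('f => int) => int"
  have "P m0" using m0 u(2) by (auto simp: P_def)
  \<comment> \<open>A relation of least total size: if p divided all its coefficients, the quotient
    would be smaller.\<close>
  then obtain m where m: "P m" and min: "!!m'. P m' ==> (\<Sum>v\<in>T. nat \<bar>m v\<bar>) <= (\<Sum>v\<in>T. nat \<bar>m' v\<bar>)"
   using ex_has_least_nat[of P m0 "%m. \<Sum>v\<in>T. nat \<bar>m v\<bar>"] by blast
  have "EX v:T. ~ int p dvd m v"
  proof (rule ccontr)
   assume "~ ?thesis"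
   hence "ALL v:T. EX k. m v = int p * k" by (auto simp: dvd_def)
   then obtain m' where m': "!!v. v : T ==> m v = int p * m' v" by metis
   have "of_nat p * (\<Sum>v\<in>T. of_int (m' v) * x v) = (\<Sum>v\<in>T. of_int (m v) * x v)" by (simp add: sum_distrib_left m' mult.assoc)
   hence "P m'" using m m' p by (auto simp: P_def)
   moreover have "(\<Sum>v\<in>T. nat \<bar>m' v\<bar>) < (\<Sum>v\<in>T. nat \<bar>m v\<bar>)"
   proof (rule sum_strict_mono_ex1[OF T(1)])
    have lt: "nat \<bar>m' v\<bar> < nat \<bar>m v\<bar>" if "v : T" "m v ~= 0" for v
    proof -
     have "\<bar>m' v\<bar> * 1 < \<bar>m' v\<bar> * int p" using m'[OF that(1)] that(2) p by (intro mult_strict_left_mono) auto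
     thus ?thesis using m'[OF that(1)] by (simp add: abs_mult mult.commute)
    qed
    show "ALL v:T. nat \<bar>m' v\<bar> <= nat \<bar>m v\<bar>"
    proof
     fix v assume "v : T"
     thus "nat \<bar>m' v\<bar> <= nat \<bar>m v\<bar>" using lt[of v] m'[of v] p by (cases "m v = 0") auto
    qed
    show "EX v:T. nat \<bar>m' v\<bar> < nat \<bar>m v\<bar>" using lt m by (auto simp: P_def)
   qed
   ultimately show False using min by fastforce
  qed
  then obtain v where v: "v : T" "~ int p dvd m v" by blast
  hence mv: "m v ~= 0" by auto
  hence "v (of_int (m v)) = 0" using v T val_ge_of_int[OF FP[OF v(1)], of "m v"] by (force simp: val_ge_def)
  have "val_ge v 0 (\<Sum>w\<in>T - {v}. of_int (m w) * x w)"
  proof (rule val_ge_sum[OF FP[OF v(1)]])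
   fix w assume w: "w : T - {v}"
   hence "val_ge v 0 (x w)" using x(3)[of w v] v(1) by (auto simp: val_ge_def)
   thus "val_ge v 0 (of_int (m w) * x w)" using val_ge_mult[OF FP[OF v(1)] val_ge_of_int[OF FP[OF v(1)]]] by fastforce
  qed
  moreover have "(\<Sum>w\<in>T - {v}. of_int (m w) * x w) = - (of_int (m v) * x v)"
   using m T(1) v(1) by (simp add: P_def sum.remove[of T v] eq_neg_iff_add_eq_0 add.commute)
  ultimately have "val_ge v 0 (of_int (m v) * x v)" using val_ge_uminus[OF FP[OF v(1)]] by fastforce
  thus False using x(1,2)[OF v(1)] mv \<open>v (of_int (m v)) = 0\<close> by (simp add: val_ge_def val_mult[OF FP[OF v(1)]])
 qed
 moreover obtain B :: "'f set" where "finite B" "QV.independent B" "QV.span B = UNIV" "card B = field_degree TYPE('f)"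
  using number_field_basis[OF nf] .
 ultimately have "card (x ` T) <= field_degree TYPE('f)" using QV.independent_span_bound[of B "x ` T"] by auto
 thus ?thesis using card_image[OF inj] by simp
qed

text \<open>A pole of a lies over some p bounded by the leading coefficient of an integer relation
  for a, and over each p there are at most as many places as the degree. This is what makes the
  diagonal map into the finite adeles well defined.\<close>

lemma finite_negative_places:
 fixes a :: "'f::field_char_0"
 assumes nf: "number_field TYPE('f)"
 shows "finite {v : finite_places. v a < 0}"
proof (cases "a = 0")
 case True
 thus ?thesis by (simp add: val_0 cong: conj_cong)
next
 case False
 obtain m :: "nat => int" and n where "n > 0" and n: "m n ~= 0"
  and rel: "(\<Sum>i\<le>n. of_int (m i) * a ^ i) = 0" using ex_lead_relation[OF nf] by blast
 define S where "S p = {v : finite_places. \<forall>m::int. m ~= 0 --> v (of_int m :: 'f) > 0 --> int p dvd m}" for p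
 have "finite (S p)" if "p > 1" for p
 proof (rule ccontr)
  assume "infinite (S p)"
  then obtain T where "finite T" "T <= S p" "card T = Suc (field_degree TYPE('f))" using infinite_arbitrarily_large by blast
  thus False using finite_places_above[OF nf that, of T] by (auto simp: S_def)
 qed
 hence "finite (\<Union>p\<in>{1<..nat \<bar>m n\<bar>}. S p)" by auto
 moreover have "{v : finite_places. v a < 0} <= (\<Union>p\<in>{1<..nat \<bar>m n\<bar>}. S p)"
 proof clarify
  fix v assume v: "v : finite_places" "v a < 0"
  have "v (of_int (m n)) > 0" using val_lead_coeff[OF v(1) False v(2) \<open>n > 0\<close> rel n] .
  from ex_residue_char[OF v(1) this n] obtain p where "p : {1<..nat \<bar>m n\<bar>}"
   "\<forall>m::int. m ~= 0 --> v (of_int m) > 0 --> int p dvd m" by blast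
  with v(1) have "v : S p" by (simp add: S_def)
  with \<open>p : _\<close> show "v : (\<Union>p\<in>{1<..nat \<bar>m n\<bar>}. S p)" by blast
 qed
 ultimately show ?thesis by (rule finite_subset[rotated])
qed

section \<open>Maximal subrings, valuation rings and integrality\<close>

definition subring_set :: "'f::field_char_0 set => bool" where
 "subring_set V \<longleftrightarrow> 1 : V & (ALL x:V. ALL y:V. x - y : V & x * y : V)"

context
 fixes V :: "'f::field_char_0 set"
 assumes V: "subring_set V"
begin

lemma subring_1: "1 : V" and subring_diff: "x : V ==> y : V ==> x - y : V"
 and subring_mult: "x : V ==> y : V ==> x * y : V" using V by (auto simp: subring_set_def)

lemma subring_0: "0 : V" using subring_diff[OF subring_1 subring_1] by simp

lemma subring_uminus: "x : V ==> - x : V" using subring_diff[OF subring_0] by fastforce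

lemma subring_add: "x : V ==> y : V ==> x + y : V" using subring_diff[of x "- y"] subring_uminus by fastforce

lemma subring_sum: "(!!i. i : A ==> f i : V) ==> sum f A : V" by (induction A rule: infinite_finite_induct) (auto intro: subring_0 subring_add)

lemma subring_power: "x : V ==> x ^ n : V" by (induction n) (auto intro: subring_1 subring_mult)

lemma subring_of_nat: "of_nat n : V" by (induction n) (auto intro: subring_0 subring_1 subring_add)

lemma subring_of_int: "of_int m : V" by (cases m rule: int_cases2) (auto intro: subring_of_nat subring_uminus)

lemma subring_adjoin:
 "subring_set {x. EX p. (ALL i. poly.coeff p i : V) & x = poly p u}" unfolding subring_set_def
proof (intro conjI ballI)
 show "1 : {x. EX p. (ALL i. poly.coeff p i : V) & x = poly p u}" by (auto intro!: exI[of _ 1] subring_0 subring_1)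
next
 fix x y assume "x : {x. EX p. (ALL i. poly.coeff p i : V) & x = poly p u}"
  "y : {x. EX p. (ALL i. poly.coeff p i : V) & x = poly p u}"
 then obtain p q where pq: "!!i. poly.coeff p i : V" "x = poly p u" "!!i. poly.coeff q i : V" "y = poly q u" by blast
 show "x - y : {x. EX p. (ALL i. poly.coeff p i : V) & x = poly p u}" using pq by (auto intro!: exI[of _ "p - q"] subring_diff)
 show "x * y : {x. EX p. (ALL i. poly.coeff p i : V) & x = poly p u}"
  using pq by (auto intro!: exI[of _ "p * q"] subring_sum subring_mult simp: coeff_mult)
qed

end

text \<open>A subring that is maximal among those that contain \<open>be\<close> but not its inverse is a
 valuation ring, and it has rank one.\<close>

locale maximal_subring =
 fixes V :: "'f::field_char_0 set" and be :: 'f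
 assumes V: "subring_set V" and be: "be : V" "be ~= 0" "inverse be ~: V"
  and max: "!!W. subring_set W ==> V <= W ==> inverse be ~: W ==> W = V"
begin

lemmas subring_rules = subring_0[OF V] subring_1[OF V] subring_diff[OF V] subring_mult[OF V]
 subring_uminus[OF V] subring_add[OF V] subring_power[OF V] subring_of_int[OF V] subring_of_nat[OF V]

text \<open>The nonunits of V. Their closure under addition is \<open>M_add\<close>, which rests on
  the maximality of V.\<close>

definition M where "M = {u : V. u = 0 | inverse u ~: V}"

text \<open>The ring V[u] is larger than V, so by maximality it contains the inverse of
  \<open>be\<close>. All later relations start from this one.\<close>

lemma adjoin:
 assumes "u ~: V"
 obtains n a where "!!i. i <= n ==> a i : V" "inverse be = (\<Sum>i\<le>n. a i * u ^ i)"
proof -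
 let ?W = "{x. EX p. (ALL i. poly.coeff p i : V) & x = poly p u}"
 have "x : ?W" if "x : V" for x using that by (auto intro!: exI[of _ "[:x:]"] simp: coeff_pCons subring_rules split: nat.split)
 moreover have "u : ?W" by (auto intro!: exI[of _ "[:0, 1:]"] simp: coeff_pCons subring_rules split: nat.split)
 ultimately have "inverse be : ?W" using max[OF subring_adjoin[OF V], of u] assms by blast
 then obtain p where "!!i. poly.coeff p i : V" "inverse be = poly p u" by blast
 thus thesis using that[of "Polynomial.degree p" "poly.coeff p"] by (simp add: poly_altdef)
qed

lemma beM: "be : M" using be by (simp add: M_def)

lemma one_notin_M: "1 ~: M" by (simp add: M_def subring_rules)

lemma M_mult: "u : M ==> a : V ==> u * a : M"
proof -
 assume u: "u : M" "a : V"
 have "inverse (u * a) ~: V" if "u * a ~= 0"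
 proof
  assume "inverse (u * a) : V"
  hence "a * inverse (u * a) : V" using u by (intro subring_rules)
  also have "a * inverse (u * a) = inverse u" using that by (simp add: field_simps)
  finally show False using u that by (auto simp: M_def)
 qed
 thus ?thesis using u by (auto simp: M_def subring_rules)
qed

lemma M_power: "u : M ==> n > 0 ==> u ^ n : M" using M_mult[of u "u ^ (n - 1)"] by (cases n) (auto simp: M_def subring_rules)

lemma beV_M: "a : V ==> be * a : M" using M_mult beM by blast

text \<open>The inverse of u is outside V, so \<open>be\<close> becomes invertible in V[1 / u];
  clearing denominators puts a power of u into \<open>be\<close> V. Thus M is the radical of an
  ideal.\<close>

lemma M_rad: "u : M ==> EX n. EX a:V. u ^ n = be * a"
proof (cases "u = 0")
 case True
 thus ?thesis by (intro exI[of _ 1] bexI[of _ 0]) (auto simp: subring_rules)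
next
 case False
 assume "u : M"
 hence "inverse u ~: V" using False by (simp add: M_def)
 then obtain n a where a: "!!i. i <= n ==> a i : V" "inverse be = (\<Sum>i\<le>n. a i * inverse u ^ i)" using adjoin by blast
 have "u ^ n = be * (u ^ n * inverse be)" using be by simp
 also have "u ^ n * inverse be = (\<Sum>i\<le>n. a i * u ^ (n - i))" unfolding a(2) sum_distrib_left
  using False by (intro sum.cong) (auto simp: power_diff power_inverse field_simps)
 finally have "u ^ n = be * (\<Sum>i\<le>n. a i * u ^ (n - i))" .
 moreover have "(\<Sum>i\<le>n. a i * u ^ (n - i)) : V" using a \<open>u : M\<close> by (intro subring_sum[OF V] subring_rules) (auto simp: M_def)
 ultimately show ?thesis by blast
qed

text \<open>Every term of the binomial expansion of (u + w)^(n + m) contains u^n or w^m and hence a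
  factor \<open>be\<close>. If u + w were a unit, \<open>be\<close> would be one.\<close>

lemma M_add: "u : M ==> w : M ==> u + w : M"
proof (rule ccontr)
 assume u: "u : M" and w: "w : M" and nM: "u + w ~: M"
 have uV: "u : V" "w : V" "u + w : V" using u w by (auto simp: M_def subring_rules)
 hence inv: "u + w ~= 0" "inverse (u + w) : V" using nM by (auto simp: M_def)
 obtain n a where a: "a : V" "u ^ n = be * a" using M_rad[OF u] by blast
 obtain m b where b: "b : V" "w ^ m = be * b" using M_rad[OF w] by blast
 have "EX c:V. of_nat ((n + m) choose k) * u ^ k * w ^ (n + m - k) = be * c" if "k <= n + m" for k
 proof (cases "n <= k")
  case True
  hence "u ^ k = be * (a * u ^ (k - n))" using a(2) by (metis le_add_diff_inverse mult.assoc power_add)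
  thus ?thesis using a(1) uV by (intro bexI[of _ "of_nat ((n + m) choose k) * (a * u ^ (k - n)) * w ^ (n + m - k)"])
    (auto simp: subring_rules)
 next
  case False
  hence "n + m - k = m + (n - k)" by simp
  hence "w ^ (n + m - k) = be * (b * w ^ (n - k))" using b(2) by (metis mult.assoc power_add)
  thus ?thesis using b(1) uV by (intro bexI[of _ "of_nat ((n + m) choose k) * u ^ k * (b * w ^ (n - k))"])
    (auto simp: subring_rules)
 qed
 then obtain c where c: "!!k. k <= n + m ==> c k : V"
  "!!k. k <= n + m ==> of_nat ((n + m) choose k) * u ^ k * w ^ (n + m - k) = be * c k" by metis
 have "(u + w) ^ (n + m) = be * (\<Sum>k\<le>n + m. c k)" unfolding binomial_ring sum_distrib_left by (intro sum.cong c(2)) auto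
 moreover have "(\<Sum>k\<le>n + m. c k) : V" using c(1) by (intro subring_sum[OF V]) auto
 ultimately have "(u + w) ^ (n + m) * inverse (u + w) ^ (n + m) = be * ((\<Sum>k\<le>n + m. c k) * inverse (u + w) ^ (n + m))" by simp
 hence "inverse be = (\<Sum>k\<le>n + m. c k) * inverse (u + w) ^ (n + m)" using inv(1) be by (simp add: field_simps)
 thus False using \<open>(\<Sum>k\<le>n + m. c k) : V\<close> inv(2) be(3) by (metis subring_rules(4,7))
qed

lemma M_uminus: "u : M ==> - u : M" using M_mult[of u "- 1"] subring_rules(2,5) by fastforce

lemma M_sum: "finite A ==> (!!i. i : A ==> f i : M) ==> sum f A : M"
proof (induction A rule: finite_induct)
 case empty
 thus ?case using subring_rules(1) by (simp add: M_def)
next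
 case (insert i A)
 thus ?case using M_add by simp
qed

lemma unit_one_minus: "u : M ==> 1 - u ~= 0 & inverse (1 - u) : V"
proof -
 assume u: "u : M"
 hence "1 - u : V" by (auto simp: M_def subring_rules)
 moreover have "1 - u ~: M" using M_add[OF u, of "1 - u"] one_notin_M by auto
 ultimately show ?thesis by (auto simp: M_def)
qed

text \<open>Says that 1 lies in the extension of M to V[y], with a bound for the degree in y. For y
  outside of V there are always such relations (\<open>Rel_ex\<close>).\<close>

definition Rel where "Rel y n \<longleftrightarrow> (EX m. (\<forall>i\<le>n. m i : M) & 1 = (\<Sum>i\<le>n. m i * y ^ i))"

lemma Rel_ex: "y ~: V ==> EX n. Rel y n"
proof -
 assume "y ~: V"
 then obtain n a where a: "!!i. i <= n ==> a i : V" "inverse be = (\<Sum>i\<le>n. a i * y ^ i)" using adjoin by blast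
 have "1 = be * inverse be" using be by simp
 also have "... = (\<Sum>i\<le>n. (be * a i) * y ^ i)" by (simp add: a(2) sum_distrib_left mult.assoc)
 finally show ?thesis using a(1) beV_M by (auto simp: Rel_def intro!: exI[of _ n] exI[of _ "%i. be * a i"])
qed

lemma not_Rel_0: "~ Rel y 0" using one_notin_M by (auto simp: Rel_def)

text \<open>Multiplied by y^(n + 1), the relation for the inverse of y expresses that power by lower
  ones with coefficients in M, since 1 - \<open>l 0\<close> is a unit. Substitution removes the top
  term from the relation for y.\<close>

lemma Rel_reduce:
 assumes "Rel y (Suc n)" "Rel (inverse y) k" "k <= Suc n" "y ~= 0"
 shows "Rel y n"
proof -
 obtain m where m: "!!i. i <= Suc n ==> m i : M" "1 = (\<Sum>i\<le>Suc n. m i * y ^ i)" using assms(1) by (auto simp: Rel_def)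
 obtain l where l: "!!i. i <= k ==> l i : M" "1 = (\<Sum>i\<le>k. l i * inverse y ^ i)" using assms(2) by (auto simp: Rel_def)
 have u: "1 - l 0 ~= 0" "inverse (1 - l 0) : V" using unit_one_minus l(1) by auto
 define c where "c j = (if Suc n - j <= k then l (Suc n - j) * inverse (1 - l 0) else 0)" for j
 have cM: "c j : M" for j unfolding c_def using l(1) u(2) M_mult beV_M[of 0] subring_rules(1) by auto
 have "1 - l 0 = (\<Sum>i\<in>{1..k}. l i * inverse y ^ i)"
  using l(2) by (simp add: atLeast0AtMost[symmetric] sum.atLeast_Suc_atMost) (metis add_diff_cancel_left')
 hence "y ^ Suc n * (1 - l 0) = (\<Sum>i\<in>{1..k}. l i * (y ^ Suc n * inverse y ^ i))" by (simp add: sum_distrib_left mult_ac)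
 also have "... = (\<Sum>i\<in>{1..k}. l i * y ^ (Suc n - i))" using assms(3,4) by (intro sum.cong refl arg_cong2[of _ _ _ _ "(*)"])
   (metis atLeastAtMost_iff order_trans power_diff power_inverse divide_inverse)
 finally have "y ^ Suc n * (1 - l 0) * inverse (1 - l 0) = (\<Sum>i\<in>{1..k}. l i * y ^ (Suc n - i)) * inverse (1 - l 0)" by simp
 hence "y ^ Suc n = (\<Sum>i\<in>{1..k}. l i * inverse (1 - l 0) * y ^ (Suc n - i))"
  using u(1) unfolding sum_distrib_right mult.assoc by (simp add: mult_ac)
 also have "... = (\<Sum>j\<in>(%i. Suc n - i) ` {1..k}. l (Suc n - j) * inverse (1 - l 0) * y ^ j)"
  using assms(3) by (subst sum.reindex) (auto simp: inj_on_def)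
 also have "... = (\<Sum>j\<le>n. c j * y ^ j)"
 proof (rule sum.mono_neutral_cong_left)
  show "ALL j:{..n} - (%i. Suc n - i) ` {1..k}. c j * y ^ j = 0"
  proof
   fix j assume j: "j : {..n} - (%i. Suc n - i) ` {1..k}"
   hence "~ Suc n - j <= k" by (auto simp: image_iff dest: bspec[of _ _ "Suc n - j"])
   thus "c j * y ^ j = 0" by (simp add: c_def)
  qed
 qed (use assms(3) in \<open>auto simp: c_def\<close>)
 finally have yn: "y ^ Suc n = (\<Sum>j\<le>n. c j * y ^ j)" .
 have "1 = (\<Sum>i\<le>n. m i * y ^ i) + m (Suc n) * (\<Sum>j\<le>n. c j * y ^ j)" using m(2) unfolding yn[symmetric] by simp
 also have "... = (\<Sum>i\<le>n. (m i + m (Suc n) * c i) * y ^ i)" by (simp add: sum_distrib_left sum.distrib algebra_simps)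
 finally have "1 = (\<Sum>i\<le>n. (m i + m (Suc n) * c i) * y ^ i)" .
 moreover have "m i + m (Suc n) * c i : M" if "i <= n" for i using that m(1) cM[of i] by (intro M_add M_mult) (auto simp: M_def)
 ultimately show ?thesis unfolding Rel_def by (intro exI[of _ "%i. m i + m (Suc n) * c i"]) blast
qed

text \<open>Chevalley's argument: of the least degrees of relations for y and for its inverse, the
  larger could be lowered by \<open>Rel_reduce\<close>.\<close>

lemma valuation_ring: "y ~= 0 ==> y : V | inverse y : V"
proof (rule ccontr)
 assume y: "y ~= 0" and n: "~ (y : V | inverse y : V)"
 define n where "n = (LEAST n. Rel y n)"
 define k where "k = (LEAST k. Rel (inverse y) k)"
 have R: "Rel y n" "Rel (inverse y) k" unfolding n_def k_def using Rel_ex n by (auto intro: LeastI_ex)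
 have min: "n <= i" if "Rel y i" for i unfolding n_def using that by (rule Least_le)
 have min': "k <= i" if "Rel (inverse y) i" for i unfolding k_def using that by (rule Least_le)
 obtain n' where n': "n = Suc n'" using R(1) not_Rel_0 by (cases n) auto
 obtain k' where k': "k = Suc k'" using R(2) not_Rel_0 by (cases k) auto
 show False
 proof (cases "k <= n")
  case True
  thus False using Rel_reduce[of y n' k] R y n' min[of n'] by auto
 next
  case False
  thus False using Rel_reduce[of "inverse y" k' n] R y k' min'[of k'] by auto
 qed
qed

lemma notin_V_iff: "y ~: V \<longleftrightarrow> y ~= 0 & inverse y : M" using valuation_ring[of y] subring_rules(1) by (auto simp: M_def)


text \<open>Divided by the lowest power of \<open>be\<close> that occurs, an integer relation for
  \<open>be\<close> shows that its lowest nonzero coefficient is in M. The least positive integer in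
  M then divides all integers in M.\<close>

lemma ex_prime_int:
 assumes nf: "number_field TYPE('f)"
 obtains p :: nat where "p > 1" "of_nat p : M" "!!m::int. of_int m : M ==> int p dvd m"
proof -
 obtain m :: "nat => int" where m: "(\<Sum>i\<le>field_degree TYPE('f). of_int (m i) * be ^ i) = 0"
  "\<exists>i\<le>field_degree TYPE('f). m i ~= 0" using ex_int_relation[OF nf] by blast
 let ?d = "field_degree TYPE('f)"
 define n where "n = (LEAST i. i <= ?d & m i ~= 0)"
 have n: "n <= ?d & m n ~= 0" unfolding n_def using m(2) by (rule LeastI_ex)
 have lt: "m i = 0" if "i < n" for i using not_less_Least[of i "%i. i <= ?d & m i ~= 0"] that n by (auto simp: n_def)
 have "(\<Sum>i\<le>?d. of_int (m i) * be ^ i) = (\<Sum>i\<in>{n..?d}. of_int (m i) * be ^ i)" using lt by (intro sum.mono_neutral_right) auto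
 also have "... = be ^ n * (\<Sum>i\<in>{n..?d}. of_int (m i) * be ^ (i - n))" unfolding sum_distrib_left
  by (intro sum.cong refl) (auto simp: power_add[symmetric] mult.left_commute)
 finally have "(\<Sum>i\<in>{n..?d}. of_int (m i) * be ^ (i - n)) = 0" using m(1) be by simp
 moreover have "(\<Sum>i\<in>{n..?d}. of_int (m i) * be ^ (i - n))
   = of_int (m n) + (\<Sum>i\<in>{Suc n..?d}. of_int (m i) * be ^ (i - n))" using n by (simp add: sum.atLeast_Suc_atMost)
 moreover have "(\<Sum>i\<in>{Suc n..?d}. of_int (m i) * be ^ (i - n)) : M"
 proof (intro M_sum)
  fix i assume "i : {Suc n..?d}"
  hence "be ^ (i - n) * of_int (m i) : M" using beM by (intro M_mult M_power subring_rules) auto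
  thus "of_int (m i) * be ^ (i - n) : M" by (simp add: mult.commute)
 qed simp
 ultimately have "- of_int (m n) : M" by (simp add: add_eq_0_iff)
 hence mn: "of_int (m n) : M" using M_uminus by fastforce
 define P where "P p \<longleftrightarrow> p > 0 & of_nat p : M" for p :: nat
 have abs: "P (nat \<bar>m\<bar>)" if "m ~= 0" "of_int m : M" for m
 proof -
  have "of_nat (nat \<bar>m\<bar>) = (of_int m :: 'f) | of_nat (nat \<bar>m\<bar>) = - (of_int m :: 'f)" by (cases "m >= 0") auto
  thus ?thesis using that M_uminus by (auto simp: P_def)
 qed
 define p where "p = (LEAST p. P p)"
 have "P (nat \<bar>m n\<bar>)" using abs mn n by simp
 hence Pp: "P p" unfolding p_def by (rule LeastI)
 have le: "p <= q" if "P q" for q unfolding p_def using that by (rule Least_le)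
 have dvd: "int p dvd m" if m: "of_int m : M" for m
 proof (rule ccontr)
  assume nd: "~ int p dvd m"
  define r where "r = m mod int p"
  have r: "r > 0" "r < int p" using nd Pp by (auto simp: r_def P_def dvd_eq_mod_eq_0 le_neq_trans)
  have e: "of_int r = of_int m + - (of_nat p * (of_int (m div int p) :: 'f))"
  proof -
   have "r = m - int p * (m div int p)" by (simp add: r_def minus_mult_div_eq_mod)
   thus ?thesis by (metis of_int_diff of_int_mult of_int_of_nat_eq diff_conv_add_uminus)
  qed
  have "of_int r : M" unfolding e using m Pp by (intro M_add M_uminus M_mult subring_rules) (auto simp: P_def)
  hence "P (nat \<bar>r\<bar>)" using r by (intro abs) auto
  thus False using le[of "nat \<bar>r\<bar>"] r by simp
 qed
 have "p ~= 1" using Pp one_notin_M by (auto simp: P_def)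
 thus thesis using that[of p] Pp dvd by (auto simp: P_def)
qed

definition U where "U = {u. u ~= 0 & u : V & inverse u : V}"

lemma U_mult: "u : U ==> w : U ==> u * w : U" by (auto simp: U_def subring_rules)

lemma U_inverse: "u : U ==> inverse u : U" by (auto simp: U_def)

lemma U_power: "u : U ==> u ^ n : U" using subring_rules(2) by (induction n) (auto simp: U_mult, simp add: U_def)

lemma one_U: "1 : U" by (simp add: U_def subring_rules)

lemma divide_notin_U: "x ~= 0 ==> y ~= 0 ==> x / y : V ==> x / y ~: U ==> x / y : M" by (auto simp: U_def M_def)

lemma int_unit_part:
 assumes p: "p > 1" "!!m::int. of_int m : M ==> int p dvd m" and "m ~= (0::int)"
 shows "EX n. EX u:U. of_int m = of_nat p ^ n * u"
proof -
 define k where "k = multiplicity (int p) m"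
 have "int p ^ k dvd m" by (simp add: k_def multiplicity_dvd)
 then obtain m' where m': "m = int p ^ k * m'" by blast
 have "~ int p dvd m'"
 proof
  assume "int p dvd m'"
  hence "int p ^ Suc k dvd m" using m' by auto
  moreover have "~ is_unit (int p)" using assms(1) by auto
  ultimately have "Suc k <= k" using assms(3) power_dvd_iff_le_multiplicity[of m "int p" "Suc k"] by (simp add: k_def)
  thus False by simp
 qed
 hence "of_int m' : U" using p(2)[of m'] subring_rules(8)[of m'] by (auto simp: U_def M_def)
 thus ?thesis using m' by (intro exI[of _ k] bexI[of _ "of_int m'"]) auto
qed

text \<open>Among the terms of an integer relation one divides none of the others out of V: all
  quotients by it are in V. If none of these quotients were a unit, their sum would lie in M and
  could not be -1. Two terms that agree up to a unit yield the power of y. This bounds the index of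
  the value of p in the value group and so makes the valuation discrete.\<close>

lemma bounded_index:
 assumes nf: "number_field TYPE('f)" and p: "p > 1" "!!m::int. of_int m : M ==> int p dvd m"
  and y: "y ~= 0"
 shows "EX i n. 0 < i & i <= field_degree TYPE('f) & (EX u:U. y ^ i = of_nat p powi n * u)"
proof -
 let ?d = "field_degree TYPE('f)"
 obtain m :: "nat => int" where m: "(\<Sum>i\<le>?d. of_int (m i) * y ^ i) = 0" "\<exists>i\<le>?d. m i ~= 0" using ex_int_relation[OF nf] by blast
 define J where "J = {i. i <= ?d & m i ~= 0}"
 define t where "t i = of_int (m i) * y ^ i" for i
 have J: "finite J" "J ~= {}" using m(2) by (auto simp: J_def)
 have t0: "t i ~= 0" if "i : J" for i using that y by (auto simp: t_def J_def)
 have sumJ: "sum t J = 0" using m(1) unfolding t_def J_def by (subst (asm) sum.mono_neutral_right[of "{..?d}" J]) (auto simp: J_def)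
 have max_div: "EX i:A. ALL j:A. t j / t i : V" if "finite A" "A ~= {}" "A <= J" for A using that
 proof (induction A rule: finite_ne_induct)
  case (singleton i)
  thus ?case using t0 subring_rules(2) by auto
 next
  case (insert k A)
  then obtain i where i: "i : A" "!!j. j : A ==> t j / t i : V" by auto
  have nz: "t k ~= 0" "t i ~= 0" using t0 insert i by auto
  show ?case
  proof (cases "t k / t i : V")
   case True
   thus ?thesis using i by auto
  next
   case False
   hence "t i / t k : V" using valuation_ring[of "t k / t i"] nz by auto
   moreover have "t j / t k : V" if "j : A" for j
   proof -
    have "t j / t k = (t j / t i) * (t i / t k)" using nz by simp
    thus ?thesis using \<open>t i / t k : V\<close> i(2)[OF that] subring_rules(4) by metis
   qed
   ultimately show ?thesis using nz subring_rules(2) by auto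
  qed
 qed
 obtain i where i: "i : J" and "ALL j:J. t j / t i : V" using max_div[OF J subset_refl] by blast
 hence i: "i : J" "!!j. j : J ==> t j / t i : V" by simp_all
 have "EX j:J - {i}. t j / t i : U"
 proof (rule ccontr)
  assume "~ ?thesis"
  hence XM: "(\<Sum>j\<in>J - {i}. t j / t i) : M" (is "?X : M") using i t0 J(1) by (intro M_sum divide_notin_U) auto
  have "1 + ?X = (\<Sum>j\<in>J. t j / t i)" using J(1) i(1) t0 by (simp add: sum.remove[of J i])
  also have "... = 0" using sumJ by (simp add: sum_divide_distrib[symmetric])
  finally have "?X = - 1" by (rule minus_unique[symmetric])
  hence "- 1 : M" using XM by simp
  thus False using one_notin_M M_uminus by fastforce
 qed
 then obtain j where j: "j : J" "j ~= i" "t j / t i : U" by blast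
 obtain a u where a: "u : U" "of_int (m i) = of_nat p ^ a * u" using int_unit_part[OF p, of "m i"] i(1) by (auto simp: J_def)
 obtain b w where b: "w : U" "of_int (m j) = of_nat p ^ b * w" using int_unit_part[OF p, of "m j"] j(1) by (auto simp: J_def)
 have nz: "(of_nat p :: 'f) ~= 0" "u ~= 0" "w ~= 0" using p a b by (auto simp: U_def)
 have main: "EX n. EX z:U. y ^ (k - l) = of_nat p powi n * z"
  if "l < k" "s : U" "r : U" "of_nat p ^ e * s * y ^ k = of_nat p ^ f * r * y ^ l * g" "g : U" for k l s r e f g
 proof -
  have s0: "s ~= 0" using that by (auto simp: U_def)
  have "y ^ k = y ^ l * y ^ (k - l)" using that by (simp add: power_add[symmetric])
  hence "of_nat p ^ e * s * y ^ (k - l) = of_nat p ^ f * (r * g)" using that(4) y by (simp add: mult_ac)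
  hence "y ^ (k - l) = of_nat p ^ f / of_nat p ^ e * (r * g * inverse s)" using s0 nz by (simp add: field_simps)
  also have "of_nat p ^ f / of_nat p ^ e = (of_nat p :: 'f) powi (int f - int e)" using nz by (simp add: power_int_diff)
  finally show ?thesis using that by (meson U_mult U_inverse)
 qed
 define g where "g = t j / t i"
 have g: "t j = t i * g" using t0[OF i(1)] by (simp add: g_def)
 have gU: "g : U" "inverse g : U" "g ~= 0" using j(3) U_inverse by (auto simp: g_def U_def)
 show ?thesis
 proof (cases "i < j")
  case True
  have "of_nat p ^ b * w * y ^ j = of_nat p ^ a * u * y ^ i * g" using g a b by (simp add: t_def)
  from main[OF True b(1) a(1) this gU(1)] True j(1)
  show ?thesis by (auto simp: J_def intro!: exI[of _ "j - i"])
 next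
  case False
  hence lt: "j < i" using j by simp
  have "of_nat p ^ a * u * y ^ i = of_nat p ^ b * w * y ^ j * inverse g" using g a b gU(3) by (simp add: t_def)
  from main[OF lt a(1) b(1) this gU(2)] lt i(1)
  show ?thesis by (auto simp: J_def intro!: exI[of _ "i - j"])
 qed
qed

lemma ex_finite_place:
 assumes nf: "number_field TYPE('f)"
 shows "EX v:finite_places. v be > 0"
proof -
 obtain p :: nat where p: "p > 1" "of_nat p : M" "!!m::int. of_int m : M ==> int p dvd m" using ex_prime_int[OF nf] by blast
 let ?p = "of_nat p :: 'f"
 have p0: "?p ~= 0" using p by simp
 \<comment> \<open>A common multiple of all exponents that \<open>bounded_index\<close> can give. So
   the power of p contained in y^N defines an integer w y for every nonzero y, with w p = N.\<close>
 define N :: nat where "N = fact (field_degree TYPE('f))"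
 have N: "N > 0" by (simp add: N_def)
 have ex: "EX n. EX u:U. y ^ N = ?p powi n * u" if y: "y ~= 0" for y
 proof -
  obtain i n u where i: "0 < i" "i <= field_degree TYPE('f)" "u : U" "y ^ i = ?p powi n * u" using bounded_index[OF nf p(1,3) y] by blast
  have "i dvd N" using i by (simp add: N_def dvd_fact)
  then obtain k where k: "N = i * k" by blast
  have "y ^ N = ?p powi (n * int k) * u ^ k" by (simp add: k power_mult i(4) power_mult_distrib power_int_mult)
  thus ?thesis using i(3) U_power by blast
 qed
 have powi_M: "?p powi n : M" if "n > 0" for n using M_power[OF p(2), of "nat n"] that by (simp add: power_int_def)
 have powi_U: "n = 0" if "?p powi n : U" for n
 proof (rule ccontr)
  assume "n ~= 0"
  then consider "n > 0" | "- n > 0" by linarith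
  thus False
  proof cases
   case 1
   thus False using powi_M[OF 1] that by (auto simp: U_def M_def)
  next
   case 2
   thus False using powi_M[OF 2] U_inverse[OF that] by (auto simp: U_def M_def power_int_minus)
  qed
 qed
 have uniq: "n = n'" if "?p powi n * u = ?p powi n' * u'" "u : U" "u' : U" for n n' u u'
 proof -
  have "u ~= 0" using that by (simp add: U_def)
  hence "?p powi (n - n') = u' * inverse u" using that(1) p0 by (simp add: power_int_diff field_simps)
  hence "?p powi (n - n') : U" using that by (simp add: U_mult U_inverse)
  thus ?thesis using powi_U by fastforce
 qed
 obtain w u where w: "!!y. y ~= 0 ==> y ^ N = ?p powi (w y) * u y" "!!y. y ~= 0 ==> u y : U" using ex by metis
 have w_eq: "w y = n" if "y ~= 0" "y ^ N = ?p powi n * z" "z : U" for y n z using uniq[of "w y" "u y" n z] w[OF that(1)] that by simp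
 have w_mult: "w (x * y) = w x + w y" if "x ~= 0" "y ~= 0" for x y
 proof (rule w_eq)
  show "(x * y) ^ N = ?p powi (w x + w y) * (u x * u y)" using p0 w that by (simp add: power_mult_distrib power_int_add mult_ac)
 qed (use that w(2) U_mult in auto)
 have w_inv: "w (inverse x) = - w x" if "x ~= 0" for x
 proof (rule w_eq)
  show "inverse x ^ N = ?p powi (- w x) * inverse (u x)" using w(1)[OF that] by (simp add: power_inverse power_int_minus)
 qed (use that w(2) U_inverse in auto)
 have w_nonneg: "w x >= 0 \<longleftrightarrow> x : V" if x: "x ~= 0" for x
 proof
  assume "w x >= 0"
  hence "x ^ N : V" using w[OF x] by (auto simp: power_int_def U_def subring_rules)
  show "x : V"
  proof (rule ccontr)
   assume "x ~: V"
   hence "inverse x ^ N : M" using M_power N notin_V_iff by blast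
   thus False using \<open>x ^ N : V\<close> x by (simp add: M_def power_inverse)
  qed
 next
  assume "x : V"
  show "w x >= 0"
  proof (rule ccontr)
   assume "~ w x >= 0"
   hence "?p powi (- w x) : M" by (intro powi_M) simp
   hence "?p powi (- w x) * (inverse (u x) * x ^ N) : M"
    using U_inverse[OF w(2)[OF x]] \<open>x : V\<close> by (intro M_mult subring_rules) (auto simp: U_def)
   moreover have "?p powi (- w x) * (inverse (u x) * x ^ N) = 1" using w[OF x] p0 by (simp add: power_int_minus U_def field_simps)
   ultimately show False using one_notin_M by simp
  qed
 qed
 have w_add: "min (w x) (w y) <= w (x + y)" if "x ~= 0" "y ~= 0" "x + y ~= 0" for x y
 proof -
  have *: "w x <= w (x + y)" if "x ~= 0" "y ~= 0" "x + y ~= 0" "w x <= w y" for x y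
  proof -
   have "w (y * inverse x) >= 0" using that by (simp add: w_mult w_inv)
   hence "1 + y * inverse x : V" using w_nonneg[of "y * inverse x"] that by (simp add: subring_rules)
   moreover have e: "1 + y * inverse x = (x + y) * inverse x" using that by (simp add: field_simps)
   ultimately have "w ((x + y) * inverse x) >= 0" using w_nonneg[of "(x + y) * inverse x"] that by simp
   thus ?thesis using that by (simp add: w_mult w_inv)
  qed
  show ?thesis using *[of x y] *[of y x] that by (cases "w x <= w y") (auto simp: add.commute)
 qed
 have wp: "w ?p = int N"
 proof (rule w_eq[OF p0])
  show "?p ^ N = ?p powi int N * 1" by simp
 qed (simp add: one_U)
 \<comment> \<open>The least positive value of w generates all its values; dividing by it makes the
   valuation surjective, as \<open>finite_places\<close> demands.\<close>
 define P where "P n \<longleftrightarrow> n > 0 & (EX x. x ~= 0 & w x = int n)" for n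
 define e where "e = (LEAST n. P n)"
 have "P N" unfolding P_def using N wp p0 by blast
 hence "P e" unfolding e_def by (rule LeastI)
 then obtain \<pi> where \<pi>: "e > 0" "\<pi> ~= 0" "w \<pi> = int e" by (auto simp: P_def)
 have w_power: "w (x ^ n) = int n * w x" if "x ~= 0" for x n
 proof (induction n)
  case 0
  thus ?case using w_mult[of 1 1] by simp
 next
  case (Suc n)
  thus ?case using w_mult[of x "x ^ n"] that by (simp add: algebra_simps)
 qed
 have w_powi: "w (x powi n) = n * w x" if "x ~= 0" for x n using that by (cases "n >= 0") (simp_all add: power_int_def w_power w_inv)
 have e_dvd: "int e dvd w x" if "x ~= 0" for x
 proof (rule ccontr)
  assume nd: "~ int e dvd w x"
  define r where "r = w x mod int e"
  have r: "r > 0" "r < int e" using nd \<pi>(1) by (auto simp: r_def dvd_eq_mod_eq_0 le_neq_trans)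
  have "w (x * inverse (\<pi> powi (w x div int e))) = r" using that \<pi> by (simp add: w_mult w_inv w_powi r_def minus_div_mult_eq_mod)
  hence "P (nat r)" using r that \<pi> by (auto simp: P_def intro!: exI[of _ "x * inverse (\<pi> powi (w x div int e))"])
  hence "e <= nat r" unfolding e_def by (rule Least_le)
  thus False using r by simp
 qed
 define v where "v x = (if x = 0 then 0 else w x div int e)" for x
 have we: "w x = v x * int e" if "x ~= 0" for x using e_dvd[OF that] that by (simp add: v_def)
 have "v : finite_places" unfolding finite_places_def
 proof (intro CollectI conjI allI impI)
  show "v 0 = 0" by (simp add: v_def)
  show "EX x. x ~= 0 & v x = 1" using \<pi> by (auto simp: v_def intro!: exI[of _ \<pi>])
  fix x y :: 'f assume xy: "x ~= 0" "y ~= 0"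
  have "v (x * y) * int e = (v x + v y) * int e" using we[of "x * y"] we[of x] we[of y] w_mult[of x y] xy by (simp add: algebra_simps)
  thus "v (x * y) = v x + v y" using \<pi>(1) by simp
  assume "x + y ~= 0"
  with xy w_add[of x y] we[of x] we[of y] we[of "x + y"] have "min (v x * int e) (v y * int e) <= v (x + y) * int e" by simp
  thus "min (v x) (v y) <= v (x + y)" using \<pi>(1) by (auto simp: min_def split: if_splits)
 qed
 moreover have "v be > 0"
 proof -
  have "w (inverse be) < 0" using w_nonneg[of "inverse be"] be by auto
  thus ?thesis using w_inv[OF be(2)] we[OF be(2)] \<pi>(1) by (simp add: zero_less_mult_iff)
 qed
 ultimately show ?thesis by blast
qed

end

text \<open>An element that is not integral can be kept out of a maximal subring containing its
  inverse; the valuation of that subring has a pole at it.\<close>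

theorem algebraic_int_iff_val_ge:
 fixes al :: "'f::field_char_0"
 assumes nf: "number_field TYPE('f)"
 shows "aint al \<longleftrightarrow> (ALL v:finite_places. val_ge v 0 al)"
proof (intro iffI ballI)
 assume val: "ALL v:finite_places. val_ge v 0 al"
 show "aint al"
 proof (rule ccontr)
  assume nint: "~ aint al"
  hence a0: "al ~= 0" by auto
  define be where "be = inverse al"
  have b: "be ~= 0" "inverse be = al" using a0 by (auto simp: be_def)
  \<comment> \<open>The ring Z[1 / al]. If it contained \<open>al\<close>, multiplication by a power
    of \<open>al\<close> would give a monic equation.\<close>
  define W0 where "W0 = {x. EX p. (ALL i. poly.coeff p i : (\<int>::'f set)) & x = poly p be}"
  have "subring_set (\<int> :: 'f set)" by (auto simp: subring_set_def)
  hence W0: "subring_set W0" unfolding W0_def by (rule subring_adjoin)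
  have bW0: "be : W0" unfolding W0_def by (auto intro!: exI[of _ "[:0, 1:]"] simp: coeff_pCons split: nat.split)
  have aW0: "al ~: W0"
  proof
   assume "al : W0"
   then obtain p where p: "!!i. poly.coeff p i : \<int>" "al = poly p be" by (auto simp: W0_def)
   define n where "n = Polynomial.degree p"
   define q where "q = Polynomial.monom 1 (Suc n) - (\<Sum>i\<le>n. Polynomial.monom (poly.coeff p i) (n - i))"
   have "al ^ Suc n = al ^ n * poly p be" using p(2) by simp
   also have "... = (\<Sum>i\<le>n. poly.coeff p i * al ^ (n - i))" unfolding poly_altdef n_def sum_distrib_left
    using a0 by (intro sum.cong refl) (auto simp: be_def power_diff power_inverse field_simps)
   finally have "poly q al = 0" by (simp add: q_def poly_monom poly_sum)
   moreover have "poly.coeff q (Suc n) = 1" by (auto simp: q_def coeff_sum intro!: sum.neutral)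
   moreover have "Polynomial.degree q <= Suc n" unfolding q_def
    by (intro degree_diff_le Polynomial.degree_monom_le degree_sum_le order.trans[OF Polynomial.degree_monom_le]) auto
   hence "Polynomial.degree q = Suc n" using calculation(2) by (metis le_antisym le_degree zero_neq_one)
   moreover have "poly.coeff q i : \<int>" for i using p(1) by (auto simp: q_def coeff_sum intro!: Ints_sum Ints_diff)
   ultimately have "aint al" by (intro algebraic_int.intros[of q]) auto
   with nint show False by simp
  qed
  define \<A> where "\<A> = {W. subring_set W & W0 <= W & al ~: W}"
  have "EX V:\<A>. ALL W:\<A>. V <= W --> W = V"
  proof (rule subset_Zorn_nonempty)
   show "\<A> ~= {}" using W0 aW0 by (auto simp: \<A>_def)
   fix \<C> assume C: "\<C> ~= {}" "subset.chain \<A> \<C>"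
   have sub: "W : \<A>" if "W : \<C>" for W using C(2) that by (auto simp: subset.chain_def)
   have "subring_set (\<Union>\<C>)" unfolding subring_set_def
   proof (intro conjI ballI)
    show "1 : \<Union>\<C>" using C(1) sub by (auto simp: \<A>_def subring_set_def)
    fix x y assume "x : \<Union>\<C>" "y : \<Union>\<C>"
    then obtain A B where XY: "A : \<C>" "x : A" "B : \<C>" "y : B" by blast
    hence "A <= B | B <= A" using C(2) by (auto simp: subset.chain_def)
    then obtain Z where Z: "Z : \<C>" "x : Z" "y : Z" using XY by blast
    hence "x - y : Z" "x * y : Z" using sub[OF Z(1)] by (auto simp: \<A>_def subring_set_def)
    thus "x - y : \<Union>\<C>" "x * y : \<Union>\<C>" using Z(1) by auto
   qed
   thus "\<Union>\<C> : \<A>" using C(1) sub by (auto simp: \<A>_def)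
  qed
  then obtain V where V: "V : \<A>" "!!W. W : \<A> ==> V <= W ==> W = V" by blast
  interpret maximal_subring V be
  proof
   show "W = V" if "subring_set W" "V <= W" "inverse be ~: W" for W using that V(1) by (intro V(2)) (auto simp: \<A>_def b)
  qed (use V(1) b bW0 in \<open>auto simp: \<A>_def\<close>)
  obtain v where v: "v : finite_places" "v be > 0" using ex_finite_place[OF nf] by blast
  hence "v al < 0" using val_inverse[OF v(1), of be] b by simp
  thus False using val v(1) a0 by (auto simp: val_ge_def)
 qed
qed (rule algebraic_int_imp_val_ge)

section \<open>Embeddings and norms of algebraic integers\<close>

lemma qlin_in_span_embeddings:
 fixes ph :: "'f::field_char_0 => complex"
 assumes "number_field TYPE('f)" "qlin ph"
 shows "ph : CV.span complex_embeddings"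
proof -
 obtain B :: "'f set" where B: "finite B" "QV.span B = UNIV" using number_field_basis[OF assms(1)] by metis
 obtain L where L: "ph = (%z. \<Sum>psi\<leftarrow>L. psi z)"
  "ALL psi:set L. qlin psi & (ALL s:B. EX be. ALL z. psi (s * z) = be * psi z)" using qlin_eigen_list[OF assms(1) B(1) assms(2)] by blast
 have "(%z. \<Sum>psi\<leftarrow>L'. psi z) : CV.span complex_embeddings" if "set L' <= set L" for L' using that
 proof (induction L')
  case Nil
  thus ?case using CV.span_zero[of complex_embeddings] by (simp add: zero_fun_def)
 next
  case (Cons psi L')
  have "psi : CV.span complex_embeddings"
  proof (cases "EX x. psi x ~= 0")
   case True
   then obtain x where "psi x ~= 0" by blast
   then obtain ta where "field_hom ta" "psi = (%z. psi 1 * ta z)" using eigen_field_hom[of psi B x] B(2) L(2) Cons.prems by auto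
   thus ?thesis using CV.span_scale[OF CV.span_base[of ta complex_embeddings], of "psi 1"] by simp
  next
   case False
   hence "psi = 0" by auto
   thus ?thesis using CV.span_zero by simp
  qed
  hence "psi + (%z. \<Sum>psi\<leftarrow>L'. psi z) : CV.span complex_embeddings" using Cons by (intro CV.span_add) auto
  thus ?case by (simp add: plus_fun_def)
 qed
 thus ?thesis using L(1) by blast
qed

text \<open>The embeddings and the coordinate functionals of a Q-basis are two bases of the same
  complex vector space.\<close>

lemma card_complex_embeddings:
 assumes nf: "number_field TYPE('f::field_char_0)"
 shows "finite (complex_embeddings :: ('f => complex) set)"
  "card (complex_embeddings :: ('f => complex) set) = field_degree TYPE('f)"
proof -
 obtain B :: "'f set" where B: "finite B" "QV.independent B" "QV.span B = UNIV" "card B = field_degree TYPE('f)" using number_field_basis[OF nf] .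
 define e where "e b = (%z. complex_of_rat (QV.representation B z b))" for b
 have e_qlin: "qlin (e b)" for b unfolding e_def using B by (intro qlin_representation)
 have e_basis: "e b b' = (if b = b' then 1 else 0)" if "b' : B" for b b' using that B by (auto simp: e_def QV.representation_basis)
 have decomp: "ph = (\<Sum>b\<in>B. (%z. ph b * e b z))" if "qlin ph" for ph
 proof
  fix z
  have "z = (\<Sum>b\<in>B. of_rat (QV.representation B z b) * b)" using QV.sum_representation_eq[of B z B] B by simp
  hence "ph z = ph (\<Sum>b\<in>B. of_rat (QV.representation B z b) * b)" by simp
  also have "... = (\<Sum>b\<in>B. ph (of_rat (QV.representation B z b) * b))" using that by (rule qlin_sum)
  also have "... = (\<Sum>b\<in>B. ph b * e b z)" using that unfolding qlin_def e_def by (intro sum.cong refl) (metis mult.commute)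
  finally show "ph z = (\<Sum>b\<in>B. (%z. ph b * e b z)) z" by (simp add: sum_fun_apply)
 qed
 have inj: "inj_on e B"
 proof (rule inj_onI)
  fix b b' assume "b : B" "b' : B" "e b = e b'"
  thus "b = b'" using e_basis[of b b] e_basis[of b b'] by (metis zero_neq_one)
 qed
 have "complex_embeddings <= CV.span (e ` B)"
 proof
  fix ta :: "'f => complex" assume "ta : complex_embeddings"
  hence "ta = (\<Sum>b\<in>B. (%z. ta b * e b z))" by (intro decomp field_hom_qlin) simp
  also have "... : CV.span (e ` B)" by (rule CV.span_sum, rule CV.span_scale, rule CV.span_base) auto
  finally show "ta : CV.span (e ` B)" .
 qed
 hence 1: "finite (complex_embeddings :: ('f => complex) set) & card (complex_embeddings :: ('f => complex) set) <= card (e ` B)"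
  using B(1) by (intro CV.independent_span_bound independent_embeddings) auto
 have "CV.independent (e ` B)"
 proof
  assume "CV.dependent (e ` B)"
  then obtain u b where u: "(\<Sum>v\<in>e ` B. (%x. u v * v x)) = 0" "b : B" "u (e b) ~= 0" using B(1) by (auto simp: CV.dependent_finite)
  have "0 = (\<Sum>v\<in>e ` B. (%x. u v * v x)) b" using u(1) by simp
  also have "... = (\<Sum>b'\<in>B. u (e b') * e b' b)" unfolding sum_fun_apply using inj by (simp add: sum.reindex)
  also have "... = (\<Sum>b'\<in>B. if b' = b then u (e b') else 0)" using u(2) by (intro sum.cong) (auto simp: e_basis)
  also have "... = u (e b)" using B(1) u(2) by simp
  finally show False using u(3) by simp
 qed
 hence "card (e ` B) <= card (complex_embeddings :: ('f => complex) set)" using 1 e_qlin qlin_in_span_embeddings[OF nf]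
  by (intro CV.independent_span_bound[THEN conjunct2]) blast+
 with 1 show "finite (complex_embeddings :: ('f => complex) set)"
  "card (complex_embeddings :: ('f => complex) set) = field_degree TYPE('f)" using B(4) card_image[OF inj] by auto
qed

lemma bij_real_complex_embeddings:
 assumes tr: "totally_real TYPE('f::field_char_0)"
 shows "bij_betw (%si x. complex_of_real (si x)) (real_embeddings :: ('f => real) set) complex_embeddings"
proof (rule bij_betw_byWitness[where f' = "%ta x. Re (ta x)"])
 have real: "complex_of_real (Re (ta x)) = ta x" if "field_hom ta" for ta :: "'f => complex" and x
 proof -
  have "ta x : \<real>" using tr that unfolding totally_real_def ring_hom_iff_field_hom Ball_def by blast
  thus ?thesis by (rule of_real_Re)
 qed
 show "\<forall>a'\<in>(complex_embeddings :: ('f => complex) set). (%x. complex_of_real (Re (a' x))) = a'"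
 proof (intro ballI ext)
  fix ta :: "'f => complex" and x assume "ta : complex_embeddings"
  hence "field_hom ta" by simp
  thus "complex_of_real (Re (ta x)) = ta x" by (rule real)
 qed
 show "(%ta x. Re (ta x)) ` complex_embeddings <= (real_embeddings :: ('f => real) set)"
 proof clarify
  fix ta :: "'f => complex" assume "field_hom ta"
  have "complex_of_real (Re (ta (x * y))) = complex_of_real (Re (ta x) * Re (ta y))" for x y
   unfolding of_real_mult real[OF \<open>field_hom ta\<close>] by (rule hom_mult[OF \<open>field_hom ta\<close>])
  hence "Re (ta (x * y)) = Re (ta x) * Re (ta y)" for x y unfolding of_real_eq_iff .
  with \<open>field_hom ta\<close> show "(%x. Re (ta x)) : real_embeddings"
   unfolding real_embeddings_def ring_hom_iff_field_hom by (simp add: field_hom_def)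
 qed
qed (auto simp: real_embeddings_def ring_hom_iff_field_hom field_hom_def)

lemma card_real_embeddings:
 assumes "number_field TYPE('f::field_char_0)" "totally_real TYPE('f)"
 shows "finite (real_embeddings :: ('f => real) set)"
  "card (real_embeddings :: ('f => real) set) = field_degree TYPE('f)" using bij_betw_finite[OF bij_real_complex_embeddings[OF assms(2)]]
  bij_betw_same_card[OF bij_real_complex_embeddings[OF assms(2)]]
  card_complex_embeddings[OF assms(1)] by auto

lemma map_poly_of_int_mult:
 "map_poly of_int (p * q) = map_poly of_int p * (map_poly of_int q :: 'f::field_char_0 poly)"
 by (intro poly_eqI) (simp add: coeff_map_poly coeff_mult)

lemma map_poly_of_int_add:
 "map_poly of_int (p + q) = map_poly of_int p + (map_poly of_int q :: 'f::field_char_0 poly)" by (intro poly_eqI) (simp add: coeff_map_poly)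

lemma map_poly_of_int_smult:
 "map_poly of_int (Polynomial.smult c p) = Polynomial.smult (of_int c) (map_poly of_int p :: 'f::field_char_0 poly)"
 by (intro poly_eqI) (simp add: coeff_map_poly)

text \<open>A minimal integer polynomial of an algebraic integer is monic by Gauss, and its degree
 is the number of conjugates, because the embeddings span the dual space of the field.\<close>

lemma prod_conjugates_ge_1:
 fixes x :: "'f::field_char_0"
 assumes nf: "number_field TYPE('f)" and x: "aint x" "x ~= 0"
 shows "1 <= (\<Prod>be\<in>(%ta. ta x) ` (complex_embeddings :: ('f => complex) set). cmod be)"
proof -
 define R where "R p \<longleftrightarrow> p ~= 0 & poly (map_poly of_int p) x = 0" for p :: "int poly"
 obtain P :: "int poly" where P: "poly (map_poly of_int P) x = 0" "Polynomial.lead_coeff P = 1"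
  using x(1) unfolding algebraic_int_altdef_ipoly by blast
 hence "R P" by (auto simp: R_def)
 then obtain p1 where p1: "R p1" and min1: "!!q. R q ==> Polynomial.degree p1 <= Polynomial.degree q"
  using ex_has_least_nat[of R P Polynomial.degree] by blast
 define p where "p = primitive_part p1"
 have p0: "p ~= 0" and cp: "content p = 1" and dp: "Polynomial.degree p = Polynomial.degree p1"
  using p1 by (auto simp: p_def R_def content_primitive_part)
 have "p1 = Polynomial.smult (content p1) p" by (simp add: p_def)
 hence "of_int (content p1) * poly (map_poly of_int p) x = 0" using p1 unfolding R_def by (metis map_poly_of_int_smult poly_smult)
 hence px: "poly (map_poly of_int p) x = 0" using p1 by (simp add: R_def)
 have min: "Polynomial.degree p <= Polynomial.degree q" if "R q" for q using min1[OF that] dp by simp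
 define n where "n = Polynomial.degree p"
 have "n > 0"
 proof (rule ccontr)
  assume "~ n > 0"
  then obtain c where "p = [:c:]" by (metis n_def not_gr0 degree_eq_zeroE)
  with px p0 show False by (auto simp: map_poly_pCons)
 qed
 \<comment> \<open>Pseudo-division by p leaves no remainder, as p has least degree, so a multiple of
   the monic \<open>P\<close> is p times q. Comparing contents, with p primitive, makes the leading
   coefficient of p a unit.\<close>
 have monic: "Polynomial.lead_coeff p = 1 | Polynomial.lead_coeff p = -1"
 proof -
  obtain q r where qr: "pseudo_divmod P p = (q, r)" by (cases "pseudo_divmod P p")
  define c where "c = Polynomial.lead_coeff p ^ (Suc (Polynomial.degree P) - Polynomial.degree p)"
  have c0: "c ~= 0" using p0 by (simp add: c_def)
  have e: "Polynomial.smult c P = p * q + r" and r: "r = 0 | Polynomial.degree r < Polynomial.degree p"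
   using pseudo_divmod[OF p0 qr] by (auto simp: c_def)
  have "poly (map_poly of_int (Polynomial.smult c P)) x = poly (map_poly of_int (p * q + r)) x" by (simp add: e)
  hence "poly (map_poly of_int r) x = 0" using px P(1) by (simp add: map_poly_of_int_smult map_poly_of_int_add map_poly_of_int_mult)
  hence "r = 0" using min[of r] r unfolding R_def by linarith
  hence e': "Polynomial.smult c P = p * q" using e by simp
  have "content P = 1" using content_dvd_coeff[of P "Polynomial.degree P"] P(2) normalize_content[of P] by simp
  hence "\<bar>c\<bar> = content q" using arg_cong[OF e', of content] cp by (simp add: content_mult)
  hence "Polynomial.smult c P = Polynomial.smult \<bar>c\<bar> (p * primitive_part q)"
   using e' by (metis content_times_primitive_part mult_smult_right)
  hence "c * 1 = \<bar>c\<bar> * (Polynomial.lead_coeff p * Polynomial.lead_coeff (primitive_part q))"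
   using P(2) by (metis lead_coeff_smult lead_coeff_mult)
  hence "c = c * (sgn c * (Polynomial.lead_coeff p * Polynomial.lead_coeff (primitive_part q)))" by (simp add: abs_sgn mult_ac)
  hence "sgn c * (Polynomial.lead_coeff p * Polynomial.lead_coeff (primitive_part q)) = 1" using c0 by simp
  hence "Polynomial.lead_coeff p dvd 1" by (metis dvd_triv_left mult.left_commute)
  thus ?thesis by (auto simp: zdvd1_eq abs_if split: if_splits)
 qed
 have indep: "q i = 0" if "i < n" "(\<Sum>i<n. of_rat (q i) * x ^ i) = 0" for q i
 proof -
  obtain D m where D: "D > 0" "!!i. i < n ==> of_int D * q i = of_int (m i)"
   using common_denominator[of "{..<n}" q] by (metis finite_lessThan lessThan_iff)
  define r where "r = (\<Sum>i<n. Polynomial.monom (m i) i)"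
  have c: "poly.coeff r i = (if i < n then m i else 0)" for i unfolding r_def by (simp add: coeff_sum)
  have dr: "Polynomial.degree r < n" using \<open>n > 0\<close> by (intro degree_lessI) (auto simp: c)
  have "poly (map_poly of_int r) x = (\<Sum>i<n. of_int (m i) * x ^ i)"
  proof -
   have "map_poly of_int r = (\<Sum>i<n. Polynomial.monom (of_int (m i)) i :: 'f poly)" by (intro poly_eqI) (simp add: coeff_map_poly c coeff_sum)
   thus ?thesis by (simp add: poly_sum poly_monom)
  qed
  also have "... = (\<Sum>i<n. of_int D * (of_rat (q i) * x ^ i))"
  proof (intro sum.cong refl)
   fix i assume "i : {..<n}"
   hence "of_rat (of_int (m i)) = (of_rat (of_int D * q i) :: 'f)" using D(2) by simp
   thus "of_int (m i) * x ^ i = of_int D * (of_rat (q i) * x ^ i)" by (simp add: of_rat_mult)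
  qed
  also have "... = 0" using that by (simp add: sum_distrib_left[symmetric])
  finally have "r = 0" using min[of r] dr by (auto simp: R_def n_def)
  hence "m i = 0" using c[of i] that by simp
  thus "q i = 0" using D(1) D(2)[OF that(1)] by simp
 qed
 have inj: "inj_on (%i. x ^ i) {..<n}"
 proof (rule inj_onI, rule ccontr)
  fix i j assume ij: "i : {..<n}" "j : {..<n}" "x ^ i = x ^ j" "i ~= j"
  let ?q = "%k. if k = i then 1 else if k = j then - 1 else (0::rat)"
  have "(\<Sum>k<n. of_rat (?q k) * x ^ k) = (\<Sum>k\<in>{i, j}. of_rat (?q k) * x ^ k)" using ij by (intro sum.mono_neutral_right) auto
  also have "... = 0" using ij by simp
  finally show False using indep[of i ?q] ij by simp
 qed
 let ?S = "(%i. x ^ i) ` {..<n}"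
 have indS: "QV.independent ?S"
 proof
  assume "QV.dependent ?S"
  then obtain u v where u: "(\<Sum>v\<in>?S. of_rat (u v) * v) = 0" "v : ?S" "u v ~= (0::rat)"
   unfolding QV.dependent_finite[OF finite_imageI[OF finite_lessThan]] by blast
  hence "(\<Sum>i<n. of_rat (u (x ^ i)) * x ^ i) = 0" using inj by (simp add: sum.reindex)
  thus False using indep[of _ "%i. u (x ^ i)"] u by auto
 qed
 let ?V = "(%ta. ta x) ` (complex_embeddings :: ('f => complex) set)"
 have finV: "finite ?V" using card_complex_embeddings(1)[OF nf] by simp
 let ?q = "\<Prod>be\<in>?V. [:-be, 1:]"
 have dq: "Polynomial.degree ?q = card ?V" by (subst degree_prod_eq_sum_degree) auto
 have lq: "poly.coeff ?q (card ?V) = 1" using lead_coeff_prod[of "%be. [:-be, 1:]" ?V] by (simp add: dq)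
 have cardV: "card ?V >= n"
 proof (rule ccontr)
  assume "~ card ?V >= n"
  hence lt: "card ?V < n" by simp
  let ?m = "card ?V"
  \<comment> \<open>The coordinate of \<open>x ^ ?m\<close> in a basis that extends the powers of x.
    With fewer than n conjugates, \<open>?q\<close> would give a relation that every embedding,
    hence every functional, satisfies; but this coordinate takes the value 1 on it.\<close>
  define ph where "ph z = complex_of_rat (QV.representation (QV.extend_basis ?S) z (x ^ ?m))" for z
  have "qlin ph" unfolding ph_def using indS by (intro qlin_representation QV.independent_extend_basis QV.span_extend_basis)
  hence "ph : CV.span complex_embeddings" by (rule qlin_in_span_embeddings[OF nf])
  hence "(\<Sum>i\<le>?m. poly.coeff ?q i * ph (x ^ i)) = 0"
  proof (induction rule: CV.span_induct_alt)
   case (step c ta y)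
   have "(\<Sum>i\<le>?m. poly.coeff ?q i * ta (x ^ i)) = poly ?q (ta x)" using step(1) by (simp add: poly_altdef dq hom_power)
   also have "... = 0" using step(1) finV by (auto simp: poly_prod prod_zero_iff)
   finally have "(\<Sum>i\<le>?m. poly.coeff ?q i * ta (x ^ i)) = 0" .
   hence "c * (\<Sum>i\<le>?m. poly.coeff ?q i * ta (x ^ i)) + (\<Sum>i\<le>?m. poly.coeff ?q i * y (x ^ i)) = 0" using step by simp
   thus ?case by (simp add: algebra_simps sum_distrib_left sum.distrib)
  qed (simp add: zero_fun_def)
  moreover have "ph (x ^ i) = (if i = ?m then 1 else 0)" if "i <= ?m" for i
  proof -
   have "x ^ i : QV.extend_basis ?S" using QV.extend_basis_superset[OF indS] that lt by auto
   hence "QV.representation (QV.extend_basis ?S) (x ^ i) = (%v. if v = x ^ i then 1 else 0)"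
    using QV.representation_basis[OF QV.independent_extend_basis[OF indS]] by simp
   moreover have "x ^ ?m = x ^ i \<longleftrightarrow> i = ?m" using inj that lt by (auto dest: inj_onD)
   ultimately show ?thesis by (simp add: ph_def)
  qed
  hence "(\<Sum>i\<le>?m. poly.coeff ?q i * ph (x ^ i)) = (\<Sum>i\<le>?m. if i = ?m then poly.coeff ?q i else 0)" by (intro sum.cong) auto
  hence "(\<Sum>i\<le>?m. poly.coeff ?q i * ph (x ^ i)) = 1" using lq by simp
  ultimately show False by simp
 qed
 define pc where "pc = map_poly complex_of_int p"
 have dpc: "Polynomial.degree pc = n" by (simp add: pc_def n_def degree_map_poly)
 hence pc0: "pc ~= 0" using \<open>n > 0\<close> by auto
 have Vroots: "?V <= {z. poly pc z = 0}"
 proof (intro image_subsetI CollectI)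
  fix ta :: "'f => complex" assume "ta : complex_embeddings"
  hence "field_hom ta" by simp
  thus "poly pc (ta x) = 0" unfolding pc_def by (simp add: hom_poly_int[symmetric] px hom_0)
 qed
 have "card ?V <= n" using card_mono[OF poly_roots_finite[OF pc0] Vroots] card_poly_roots_bound[OF pc0] dpc by linarith
 hence cV: "card ?V = n" using cardV by simp
 let ?l = "Polynomial.lead_coeff pc"
 \<comment> \<open>The leading terms cancel, and a nonzero difference of degree below n cannot have
   the n conjugates as roots.\<close>
 have "pc - Polynomial.smult ?l ?q = 0"
 proof (rule ccontr)
  let ?d = "pc - Polynomial.smult ?l ?q"
  assume "?d ~= 0"
  have "Polynomial.degree ?d < n"
  proof (rule degree_lessI)
   show "\<forall>k\<ge>n. poly.coeff ?d k = 0"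
   proof (intro allI impI)
    fix k assume "k >= n"
    show "poly.coeff ?d k = 0"
    proof (cases "k = n")
     case True
     thus ?thesis using lq dpc cV by simp
    next
     case False
     thus ?thesis using \<open>k >= n\<close> dpc dq cV by (simp add: coeff_eq_0)
    qed
   qed
  qed (use \<open>n > 0\<close> in simp)
  moreover have "?V <= {z. poly ?d z = 0}"
  proof
   fix z assume z: "z : ?V"
   hence "poly ?q z = 0" unfolding poly_prod using finV by (subst prod_zero_iff) auto
   thus "z : {z. poly ?d z = 0}" using Vroots z by auto
  qed
  hence "card ?V <= card {z. poly ?d z = 0}" by (rule card_mono[OF poly_roots_finite[OF \<open>?d ~= 0\<close>]])
  hence "card ?V <= Polynomial.degree ?d" using card_poly_roots_bound[OF \<open>?d ~= 0\<close>] by linarith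
  ultimately show False using cV by simp
 qed
 hence pcq: "pc = Polynomial.smult ?l ?q" by simp
 have "cmod ?l = 1" using monic by (auto simp: pc_def coeff_map_poly degree_map_poly)
 hence "cmod (poly pc 0) = (\<Prod>be\<in>?V. cmod be)" by (subst pcq) (simp add: norm_mult poly_prod prod_norm[symmetric])
 moreover have "poly pc 0 = of_int (poly.coeff p 0)" by (simp add: pc_def poly_0_coeff_0 coeff_map_poly)
 moreover have "poly.coeff p 0 ~= 0"
 proof
  assume "poly.coeff p 0 = 0"
  then obtain p' where p': "p = pCons 0 p'" by (cases p) auto
  hence "p' ~= 0" using p0 by auto
  moreover have "poly (map_poly of_int p') x = 0" using px x(2) p' by (simp add: map_poly_pCons)
  ultimately have "Polynomial.degree p <= Polynomial.degree p'" using min by (simp add: R_def)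
  thus False using p' \<open>p' ~= 0\<close> by simp
 qed
 ultimately show ?thesis by (metis norm_of_int of_int_1_le_iff of_int_abs abs_ge_zero int_one_le_iff_zero_less zero_less_abs_iff)
qed

context
 assumes nf: "number_field TYPE('f::field_char_0)"
begin

lemma algebraic_int_add: "aint (x::'f) ==> aint y ==> aint (x + y)" unfolding algebraic_int_iff_val_ge[OF nf] by (auto intro: val_ge_add)

lemma algebraic_int_mult: "aint (x::'f) ==> aint y ==> aint (x * y)" unfolding algebraic_int_iff_val_ge[OF nf] using val_ge_mult by fastforce

lemma algebraic_int_diff: "aint (x::'f) ==> aint y ==> aint (x - y)" unfolding algebraic_int_iff_val_ge[OF nf] by (auto intro: val_ge_diff)

lemma algebraic_int_of_int: "aint (of_int m :: 'f)" unfolding algebraic_int_iff_val_ge[OF nf] by (auto intro: val_ge_of_int)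

lemma algebraic_int_power: "aint (x::'f) ==> aint (x ^ n)" using algebraic_int_of_int[of 1] by (induction n) (auto intro: algebraic_int_mult)

lemma algebraic_int_sum: "(!!i. i : A ==> aint (g i :: 'f)) ==> aint (sum g A)"
 by (induction A rule: infinite_finite_induct) (auto intro: algebraic_int_add)

lemma ex_algebraic_int_multiple: "\<exists>c::int. c ~= 0 & aint (of_int c * (x::'f))"
proof (cases "x = 0")
 case False
 obtain m n where n: "n > 0" "m n ~= (0::int)" "(\<Sum>i\<le>n. of_int (m i) * x ^ i) = 0" using ex_lead_relation[OF nf] by blast
 let ?c = "m n" and ?y = "of_int (m n) * x"
 \<comment> \<open>The relation times ?c^(n - 1), rewritten in powers of \<open>?y\<close>; it has
   become monic.\<close>
 define c' where "c' i = (if i = n then 1 else m i * ?c ^ (n - 1 - i))" for i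
 have "of_int (c' i) * ?y ^ i = of_int (?c ^ (n - 1)) * (of_int (m i) * x ^ i)" if "i <= n" for i
 proof (cases "i = n")
  case True
  have "(of_int ?c :: 'f) ^ n = of_int ?c * of_int ?c ^ (n - 1)" using n(1) by (cases n) auto
  with True show ?thesis by (simp add: c'_def power_mult_distrib mult_ac)
 next
  case False
  hence "n - 1 = (n - 1 - i) + i" using that n(1) by simp
  hence "(of_int ?c :: 'f) ^ (n - 1) = of_int ?c ^ (n - 1 - i) * of_int ?c ^ i" by (metis power_add)
  with False show ?thesis by (simp add: c'_def power_mult_distrib mult_ac)
 qed
 hence "(\<Sum>i\<le>n. of_int (c' i) * ?y ^ i) = of_int (?c ^ (n - 1)) * (\<Sum>i\<le>n. of_int (m i) * x ^ i)"
  unfolding sum_distrib_left by (intro sum.cong) auto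
 hence rel: "(\<Sum>i\<le>n. of_int (c' i) * ?y ^ i) = 0" using n(3) by simp
 have "val_ge v 0 ?y" if v: "v : finite_places" for v
 proof (rule ccontr)
  assume "~ val_ge v 0 ?y"
  hence "v (of_int (c' n)) > 0" using False n by (intro val_lead_coeff[OF v _ _ n(1) rel]) (auto simp: val_ge_def c'_def)
  thus False using val_1[OF v] by (simp add: c'_def)
 qed
 thus ?thesis using n(2) algebraic_int_iff_val_ge[OF nf] by blast
qed (auto intro: exI[of _ 1])

text \<open>For the combinations of a Q-basis with coefficients N^i, those that fail to separate a
  given pair of embeddings belong to roots N of a nonzero polynomial. So some natural number N
  separates all pairs.\<close>

lemma ex_separating_algebraic_int:
 "\<exists>w::'f. aint w & inj_on (%ta. ta w) (complex_embeddings :: ('f => complex) set)"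
proof -
 obtain B :: "'f set" where B: "finite B" "QV.span B = UNIV" using number_field_basis[OF nf] by metis
 obtain e :: "nat => 'f" and d where e: "B = e ` {i. i < d}" using finite_imp_nat_seg_image_inj_on[OF B(1)] by blast
 let ?E = "complex_embeddings :: ('f => complex) set"
 define P where "P = (%(ta, ta'). \<Sum>i<d. Polynomial.monom (ta (e i) - ta' (e i)) i :: complex poly)"
 have P0: "P (ta, ta') ~= 0" if t: "ta : ?E" "ta' : ?E" "ta ~= ta'" for ta ta'
 proof
  assume P: "P (ta, ta') = 0"
  have "ta (e i) = ta' (e i)" if "i < d" for i using arg_cong[OF P, of "%p. poly.coeff p i"] that by (simp add: P_def coeff_sum)
  hence eB: "ta b = ta' b" if "b : B" for b using that e by auto
  have "ta z = ta' z" for z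
  proof -
   have "z : QV.span B" using B by simp
   thus ?thesis
   proof (induction rule: QV.span_induct_alt)
    case base
    thus ?case using t by (simp add: hom_0)
   next
    case (step c x y)
    thus ?case using t eB by (simp add: hom_add hom_mult hom_of_rat)
   qed
  qed
  with t show False by auto
 qed
 define Bad where "Bad = (\<Union>p\<in>?E \<times> ?E \<inter> {(ta, ta'). ta ~= ta'}. {z. poly (P p) z = 0})"
 have "finite Bad" unfolding Bad_def using card_complex_embeddings(1)[OF nf] P0 by (intro finite_UN_I finite_Int poly_roots_finite) auto
 hence "finite {n::nat. of_nat n : Bad}" using finite_vimageI[OF _ inj_of_nat] by (simp add: vimage_def)
 then obtain N :: nat where N: "of_nat N ~: Bad" using infinite_UNIV_nat by (metis (mono_tags, lifting) UNIV_eq_I mem_Collect_eq)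
 define w0 where "w0 = (\<Sum>i<d. of_nat N ^ i * e i)"
 have w0: "ta w0 ~= ta' w0" if t: "ta : ?E" "ta' : ?E" "ta ~= ta'" for ta ta'
 proof -
  have "poly (P (ta, ta')) (of_nat N) ~= 0" using N t by (auto simp: Bad_def)
  also have "poly (P (ta, ta')) (of_nat N) = (\<Sum>i<d. (ta (e i) - ta' (e i)) * of_nat N ^ i)" by (simp add: P_def poly_sum poly_monom)
  also have "... = ta w0 - ta' w0" using t by (simp add: w0_def hom_sum hom_mult hom_power hom_of_nat sum_subtractf algebra_simps)
  finally show ?thesis by simp
 qed
 obtain c :: int where c: "c ~= 0" "aint (of_int c * w0)" using ex_algebraic_int_multiple by blast
 have "inj_on (%ta. ta (of_int c * w0)) ?E"
 proof (rule inj_onI, rule ccontr)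
  fix ta ta' assume t: "ta : ?E" "ta' : ?E" "ta (of_int c * w0) = ta' (of_int c * w0)" "ta ~= ta'"
  thus False using w0[of ta ta'] c(1) by (simp add: hom_mult hom_of_int)
 qed
 with c show ?thesis by blast
qed

text \<open>The norm is bounded below by multiplying a high power of \<open>x\<close> by one of finitely many
 algebraic integers such that the product has pairwise different conjugates.\<close>

lemma prod_complex_embeddings_ge_1:
 fixes x :: 'f
 assumes x: "aint x" "x ~= 0"
 shows "1 <= (\<Prod>ta\<in>(complex_embeddings :: ('f => complex) set). cmod (ta x))"
proof (rule ccontr)
 let ?E = "complex_embeddings :: ('f => complex) set"
 define q where "q = (\<Prod>ta\<in>?E. cmod (ta x))"
 assume "~ ?thesis"
 hence q1: "q < 1" by (simp add: q_def)
 have finE: "finite ?E" by (rule card_complex_embeddings(1)[OF nf])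
 obtain w :: 'f where w: "aint w" "inj_on (%ta. ta w) ?E" using ex_separating_algebraic_int by blast
 \<comment> \<open>Each pair of embeddings excludes at most one n, and the equation 1 + n w = 0
   excludes at most one more. The set \<open>{..K}\<close> has one element beyond that.\<close>
 define K where "K = card (?E \<times> ?E) + 1"
 define C where "C = (\<Sum>n\<le>K. \<Prod>ta\<in>?E. 1 + real n * cmod (ta w))"
 have "C > 0" unfolding C_def by (intro sum_pos prod_pos) (auto intro!: add_pos_nonneg)
 \<comment> \<open>C bounds the norm of 1 + n w for all n up to K, so the norm of x^m (1 + n w) will
   be below 1, whichever n is taken.\<close>
 then obtain m where m: "q ^ m < 1 / C" using real_arch_pow_inv[of "1 / C" q] q1 by auto
 define good where "good n \<longleftrightarrow> 1 + of_nat n * w ~= 0 & inj_on (%ta. ta (x ^ m * (1 + of_nat n * w))) ?E" for n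
 have "\<exists>n\<le>K. good n"
 proof (rule ccontr)
  assume "~ ?thesis"
  hence bad: "~ good n" if "n <= K" for n using that by blast
  define S :: "('f => complex) \<times> ('f => complex) => nat set" where "S = (%(ta, ta'). {n::nat. ta ~= ta' & ta (x ^ m * (1 + of_nat n * w)) = ta' (x ^ m * (1 + of_nat n * w))})"
  define S0 where "S0 = {n::nat. 1 + of_nat n * w = 0}"
  have S0: "n = n'" if "n : S0" "n' : S0" for n n'
  proof -
   have e: "1 + of_nat n * w = 0" "1 + of_nat n' * w = 0" using that by (simp_all add: S0_def)
   have "w ~= 0" using e(1) by auto
   have "(1 + of_nat n * w) - (1 + of_nat n' * w) = 0" unfolding e by simp
   hence "(of_nat n - of_nat n') * w = 0" by (simp add: algebra_simps)
   with \<open>w ~= 0\<close> have "(of_nat n :: 'f) = of_nat n'" by simp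
   thus ?thesis by simp
  qed
  have S: "n = n'" if t: "ta : ?E" "ta' : ?E" and n: "n : S (ta, ta')" "n' : S (ta, ta')" for ta ta' n n'
  proof (rule ccontr)
   assume nn: "n ~= n'"
   have e: "ta x ^ m * (1 + of_nat k * ta w) = ta' x ^ m * (1 + of_nat k * ta' w)" if "k : S (ta, ta')" for k
    using that t by (simp add: S_def hom_mult hom_add hom_power hom_1 hom_of_nat)
   have "ta x ^ m * (of_nat n - of_nat n') * ta w = ta' x ^ m * (of_nat n - of_nat n') * ta' w"
   proof -
    have "ta x ^ m * (of_nat n - of_nat n') * ta w
     = ta x ^ m * (1 + of_nat n * ta w) - ta x ^ m * (1 + of_nat n' * ta w)" by (simp add: algebra_simps)
    also have "... = ta' x ^ m * (1 + of_nat n * ta' w) - ta' x ^ m * (1 + of_nat n' * ta' w)" by (simp only: e[OF n(1)] e[OF n(2)])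
    finally show ?thesis by (simp add: algebra_simps)
   qed
   hence *: "ta x ^ m * ta w = ta' x ^ m * ta' w" using nn by (simp add: mult_ac)
   have "ta x ^ m + of_nat n * (ta x ^ m * ta w) = ta' x ^ m + of_nat n * (ta' x ^ m * ta' w)" using e[OF n(1)] by (simp add: algebra_simps)
   hence "ta x ^ m = ta' x ^ m" unfolding * by simp
   hence "ta w = ta' w" using * x(2) t by (simp add: hom_eq_0)
   thus False using w(2) t n by (auto simp: S_def inj_on_def)
  qed
  have card1: "finite B & card B <= 1" if "!!n n'. n : B ==> n' : B ==> n = n'" for B :: "nat set"
  proof -
   have "B = {} | (EX n. B = {n})" using that by blast
   thus ?thesis by auto
  qed
  have "{..K} <= (\<Union>p\<in>?E \<times> ?E. S p) \<union> S0" using bad unfolding good_def S_def S0_def inj_on_def by fastforce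
  hence "card {..K} <= card ((\<Union>p\<in>?E \<times> ?E. S p) \<union> S0)"
   using finE card1[of S0] S0 card1 S by (intro card_mono finite_UnI finite_UN_I) auto
  also have "... <= card (\<Union>p\<in>?E \<times> ?E. S p) + card S0" by (rule card_Un_le)
  also have "card (\<Union>p\<in>?E \<times> ?E. S p) <= (\<Sum>p\<in>?E \<times> ?E. card (S p))" using finE by (intro card_UN_le) auto
  also have "... <= (\<Sum>p\<in>?E \<times> ?E. 1)" using card1 S by (intro sum_mono) auto
  also have "card S0 <= 1" using card1[of S0] S0 by auto
  finally show False by (simp add: K_def)
 qed
 then obtain n where n: "n <= K" "good n" by blast
 let ?u = "x ^ m * (1 + of_nat n * w)"
 have "aint ?u" using x w algebraic_int_of_int[of 1] algebraic_int_of_int[of "int n"]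
  by (intro algebraic_int_mult algebraic_int_power algebraic_int_add) auto
 moreover have "?u ~= 0" using x(2) n by (simp add: good_def)
 ultimately have "1 <= (\<Prod>be\<in>(%ta. ta ?u) ` ?E. cmod be)" by (rule prod_conjugates_ge_1[OF nf])
 also have "... = (\<Prod>ta\<in>?E. cmod (ta ?u))" using n by (subst prod.reindex) (auto simp: good_def)
 also have "... = (\<Prod>ta\<in>?E. cmod (ta x) ^ m * cmod (1 + of_nat n * ta w))"
  by (intro prod.cong) (auto simp: hom_mult hom_add hom_1 hom_power hom_of_nat norm_mult norm_power)
 also have "... = q ^ m * (\<Prod>ta\<in>?E. cmod (1 + of_nat n * ta w))" by (simp add: prod.distrib q_def prod_power_distrib)
 also have "... <= q ^ m * C"
 proof (rule mult_left_mono)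
  have "(\<Prod>ta\<in>?E. cmod (1 + of_nat n * ta w)) <= (\<Prod>ta\<in>?E. 1 + real n * cmod (ta w))"
   by (intro prod_mono) (auto intro!: order.trans[OF norm_triangle_ineq] simp: norm_mult)
  also have "... <= C" unfolding C_def using n(1) by (intro member_le_sum) (auto intro!: prod_nonneg)
  finally show "(\<Prod>ta\<in>?E. cmod (1 + of_nat n * ta w)) <= C" .
  show "0 <= q ^ m" by (auto simp: q_def intro!: zero_le_power prod_nonneg)
 qed
 also have "... < 1" using m \<open>C > 0\<close> by (simp add: field_simps)
 finally show False by simp
qed

lemma norm_ge_1:
 fixes x :: 'f
 assumes tr: "totally_real TYPE('f)" and x: "aint x" "x ~= 0"
 shows "1 <= (\<Prod>si\<in>real_embeddings. \<bar>si x\<bar>)"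
proof -
 have "(\<Prod>si\<in>real_embeddings. \<bar>si x\<bar>) = (\<Prod>ta\<in>(complex_embeddings :: ('f => complex) set). cmod (ta x))"
  using prod.reindex_bij_betw[OF bij_real_complex_embeddings[OF tr], of "%ta. cmod (ta x)"] by simp
 thus ?thesis using prod_complex_embeddings_ge_1[OF x] by simp
qed

end

section \<open>Quaternion algebras and their splittings\<close>

lemma real_embeddings_field_hom: "ta : real_embeddings \<longleftrightarrow> field_hom ta" by (simp add: real_embeddings_def ring_hom_iff_field_hom)

lemma ring_of_type_simps:
 "carrier RT = UNIV" "x \<otimes>\<^bsub>RT\<^esub> y = x * y"
 "x \<oplus>\<^bsub>RT\<^esub> y = x + y" "\<one>\<^bsub>RT\<^esub> = 1" "\<zero>\<^bsub>RT\<^esub> = 0" by (simp_all add: ring_of_type_algebra_def)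

lemma ring_of_type_times: "(\<otimes>\<^bsub>RT\<^esub>) = (*)" by (simp add: ring_of_type_algebra_def fun_eq_iff)

lemma ring_of_type_minus:
 fixes x y :: "'a::comm_ring_1"
 shows "x \<ominus>\<^bsub>RT\<^esub> y = x - y"
proof -
 interpret ring "RT :: 'a ring" by (rule ring_from_type_algebra)
 have "\<ominus>\<^bsub>RT\<^esub> y = - y" by (rule minus_equality) (simp_all add: ring_of_type_simps)
 thus ?thesis by (simp add: a_minus_def ring_of_type_simps)
qed

lemmas quat_simps = ring_of_type_simps ring_of_type_minus

lemma nrd_mult:
 fixes a b :: "'a::comm_ring_1"
 shows "nrd a b (mq a b x y) = nrd a b x * nrd a b y" by (cases x; cases y) (simp add: quat_simps sq_simps)

fun conj_quat :: "'a::comm_ring_1 quad => 'a quad" where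
 "conj_quat (x0, x1, x2, x3) = (x0, - x1, - x2, - x3)"

lemma mult_conj_quat:
 fixes a b :: "'a::comm_ring_1"
 shows "mq a b x (conj_quat x) = (nrd a b x, 0, 0, 0)"
  "mq a b (conj_quat x) x = (nrd a b x, 0, 0, 0)" by (cases x; simp add: quat_simps sq_simps)+

lemma nrd_conj: "nrd a b (conj_quat x) = nrd a b x" by (cases x) simp

lemma nrd_1_in_Units:
 assumes "nrd a b x = 1"
 shows "x : Units (quat_alg RT a b)"
proof -
 have "conj_quat x : carrier (quat_alg RT a b)" "x : carrier (quat_alg RT a b)" by (cases x; simp add: quat_alg_def quat_simps)+
 moreover have "conj_quat x \<otimes>\<^bsub>quat_alg RT a b\<^esub> x = \<one>\<^bsub>quat_alg RT a b\<^esub>"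
  "x \<otimes>\<^bsub>quat_alg RT a b\<^esub> conj_quat x = \<one>\<^bsub>quat_alg RT a b\<^esub>"
  using assms by (simp_all add: quat_alg_def quat_simps mult_conj_quat)
 ultimately show ?thesis unfolding Units_def by blast
qed

lemma nrd_hom:
 assumes "field_hom ta"
 shows "nrd (ta a) (ta b) (map_quad ta x) = ta (nrd a b x)" using assms by (cases x) (simp add: hom_add hom_diff hom_mult hom_power)

fun det2 :: "'a::comm_ring_1 quad => 'a" where
 "det2 (p, q, r, s) = p * s - q * r"

fun tr2 :: "'a::comm_ring_1 quad => 'a" where
 "tr2 (p, q, r, s) = p + s"

context
 fixes a b :: "'g::field_char_0" and tht
 assumes tht: "tht : splittings RT a b"
begin

lemma splitting_mult: "tht (mq a b x y) = mmul (tht x) (tht y)"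
 and splitting_add: "tht (add_quad RT x y) = add_quad RT (tht x) (tht y)"
 and splitting_1: "tht (1, 0, 0, 0) = (1, 0, 0, 1)"
 and splitting_scale: "tht (map_quad (%u. c * u) x) = map_quad (%u. c * u) (tht x)"
 and splitting_bij: "bij tht"
proof -
 have c: "carrier (quat_alg RT a b) = UNIV" "carrier (mat2_ring (RT :: 'g ring)) = UNIV" by (auto simp: quat_alg_def mat2_ring_def quat_simps)
 have h: "tht : ring_hom (quat_alg RT a b) (mat2_ring RT)" using tht by (auto simp: splittings_def ring_iso_def)
 show "tht (mq a b x y) = mmul (tht x) (tht y)" using ring_hom_mult[OF h, of x y] by (simp only: c UNIV_I) (simp add: quat_alg_def mat2_ring_def)
 show "tht (add_quad RT x y) = add_quad RT (tht x) (tht y)"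
  using ring_hom_add[OF h, of x y] by (simp only: c UNIV_I) (simp add: quat_alg_def mat2_ring_def)
 show "tht (1, 0, 0, 0) = (1, 0, 0, 1)" using ring_hom_one[OF h] by (simp add: quat_alg_def mat2_ring_def quat_simps)
 show "tht (map_quad (%u. c * u) x) = map_quad (%u. c * u) (tht x)"
  using tht unfolding splittings_def mem_Collect_eq c ring_of_type_times ring_of_type_simps(1) by blast
 show "bij tht" using tht unfolding splittings_def ring_iso_def mem_Collect_eq c by blast
qed

lemma splitting_scalar: "tht (c, 0, 0, 0) = (c, 0, 0, c)" using splitting_scale[of c "(1, 0, 0, 0)"] splitting_1 by simp

text \<open>The image satisfies the quadratic equation of x, with coefficients 2 x0 and nrd x. A
  nonscalar matrix satisfies only one monic quadratic equation, and a scalar matrix comes from a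
  scalar.\<close>

lemma splitting_tr_det:
 assumes "x = (x0, x1, x2, x3)"
 shows "tr2 (tht x) = 2 * x0" "det2 (tht x) = nrd a b x"
proof -
 obtain p q r s where X: "tht x = (p, q, r, s)" by (cases "tht x")
 let ?n = "nrd a b x"
 have "mq a b x x = add_quad RT (map_quad (%u. 2 * x0 * u) x) (- ?n, 0, 0, 0)"
  unfolding assms by (simp add: quat_simps sq_simps)
 hence "mmul (tht x) (tht x)
  = add_quad RT (map_quad (%u. 2 * x0 * u) (tht x)) (- ?n, 0, 0, - ?n)" by (metis splitting_mult splitting_add splitting_scale splitting_scalar)
 hence e: "p * p + q * r = 2 * x0 * p - ?n" "(p + s - 2 * x0) * q = 0"
   "(p + s - 2 * x0) * r = 0" "r * q + s * s = 2 * x0 * s - ?n" unfolding X by (simp_all add: quat_simps algebra_simps)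
 have goal: "p + s = 2 * x0 & p * s - q * r = ?n"
 proof (cases "p + s = 2 * x0")
  case True
  have "p * p + q * r = (p + s) * p - ?n" using e(1) unfolding True .
  hence "p * s - q * r = ?n" by (simp add: algebra_simps)
  thus ?thesis using True by simp
 next
  case False
  hence qr: "q = 0" "r = 0" using e(2,3) by auto
  have "p * p - 2 * x0 * p = - ?n" "s * s - 2 * x0 * s = - ?n" using e(1,4) qr by simp_all
  moreover have "(p - s) * (p + s - 2 * x0) = (p * p - 2 * x0 * p) - (s * s - 2 * x0 * s)" by (simp add: algebra_simps)
  ultimately have "(p - s) * (p + s - 2 * x0) = 0" by simp
  hence "p = s" using False by simp
  hence "tht x = tht (p, 0, 0, 0)" using X qr splitting_scalar by simp
  hence "x = (p, 0, 0, 0)" using splitting_bij by (metis bij_pointE)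
  thus ?thesis using assms \<open>p = s\<close> qr by (simp add: power2_eq_square)
 qed
 thus "tr2 (tht x) = 2 * x0" "det2 (tht x) = nrd a b x" using X by auto
qed

end

lemma splittingsI:
 fixes a b :: "'g::field_char_0"
 assumes "tht' \<circ> tht = id" "tht \<circ> tht' = id"
  and "!!x y. tht (mq a b x y) = mmul (tht x) (tht y)"
  and "!!x y. tht (add_quad RT x y) = add_quad RT (tht x) (tht y)"
  and "tht (1, 0, 0, 0) = (1, 0, 0, 1)" "!!c x. tht (map_quad (%u. c * u) x) = map_quad (%u. c * u) (tht x)"
 shows "tht : splittings RT a b"
proof -
 have c: "carrier (quat_alg RT a b) = UNIV" "carrier (mat2_ring (RT :: 'g ring)) = UNIV" by (auto simp: quat_alg_def mat2_ring_def quat_simps)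
 have "bij tht" using assms(1,2) by (rule o_bij)
 thus ?thesis unfolding splittings_def ring_iso_def ring_hom_def mem_Collect_eq c ring_of_type_times using assms(3-)
  by (auto simp: quat_alg_def mat2_ring_def ring_of_type_simps(1,4,5) simp del: map_quad.simps split_paired_All)
qed

text \<open>Sends i to diag(h, -h) and j to the matrix with rows (0, be) and (1, 0). The next lemma
  exchanges the roles of i and j.\<close>

lemma splittings_left_square:
 fixes h be :: "'g::field_char_0"
 assumes "h ~= 0" "be ~= 0"
 shows "splittings RT (h * h) be ~= {}"
proof -
 define tht where "tht = (%(x0, x1, x2, x3). (x0 + h * x1, be * (x2 + h * x3), x2 - h * x3, x0 - h * x1))"
 define tht' where "tht' = (%(p, q, r, s). ((p + s) / 2, (p - s) / (2 * h), (q / be + r) / 2, (q / be - r) / (2 * h)))"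
 have "tht : splittings RT (h * h) be"
 proof (rule splittingsI)
  show "tht' \<circ> tht = id" "tht \<circ> tht' = id" using assms by (auto simp: fun_eq_iff tht_def tht'_def field_simps)
  fix x y :: "'g quad"
  obtain x0 x1 x2 x3 y0 y1 y2 y3 where "x = (x0, x1, x2, x3)" "y = (y0, y1, y2, y3)" by (cases x; cases y) blast
  thus "tht (mq (h * h) be x y) = mmul (tht x) (tht y)"
   "tht (add_quad RT x y) = add_quad RT (tht x) (tht y)"
   "tht (map_quad (%u. c * u) x) = map_quad (%u. c * u) (tht x)" for c by (simp_all add: tht_def quat_simps algebra_simps)
 qed (simp add: tht_def)
 thus ?thesis by blast
qed

lemma splittings_right_square:
 fixes h al :: "'g::field_char_0"
 assumes "h ~= 0" "al ~= 0"
 shows "splittings RT al (h * h) ~= {}"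
proof -
 define tht where "tht = (%(x0, x1, x2, x3). (x0 + h * x2, al * (x1 - h * x3), x1 + h * x3, x0 - h * x2))"
 define tht' where "tht' = (%(p, q, r, s). ((p + s) / 2, (q / al + r) / 2, (p - s) / (2 * h), (r - q / al) / (2 * h)))"
 have "tht : splittings RT al (h * h)"
 proof (rule splittingsI)
  show "tht' \<circ> tht = id" "tht \<circ> tht' = id" using assms by (auto simp: fun_eq_iff tht_def tht'_def field_simps)
  fix x y :: "'g quad"
  obtain x0 x1 x2 x3 y0 y1 y2 y3 where "x = (x0, x1, x2, x3)" "y = (y0, y1, y2, y3)" by (cases x; cases y) blast
  thus "tht (mq al (h * h) x y) = mmul (tht x) (tht y)"
   "tht (add_quad RT x y) = add_quad RT (tht x) (tht y)"
   "tht (map_quad (%u. c * u) x) = map_quad (%u. c * u) (tht x)" for c by (simp_all add: tht_def quat_simps algebra_simps)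
 qed (simp add: tht_def)
 thus ?thesis by blast
qed

text \<open>A positive parameter is a square and would split the algebra. So the reduced norm is
  positive definite at ramified places, which bounds the traces of elements of norm 1 there.\<close>

lemma not_split_imp_definite:
 fixes al be :: real
 assumes "splittings RT al be = {}" "al ~= 0" "be ~= 0"
 shows "al < 0" "be < 0"
proof -
 show "al < 0" using splittings_left_square[of "sqrt al" be] assms by (cases "al < 0") auto
 show "be < 0" using splittings_right_square[of "sqrt be" al] assms by (cases "be < 0") auto
qed

lemma definite_nrd:
 fixes al be :: real
 assumes "al < 0" "be < 0"
 shows "x0^2 <= nrd al be (x0, x1, x2, x3)" "x0^2 = nrd al be (x0, x1, x2, x3) ==> x1 = 0 & x2 = 0 & x3 = 0"
proof -
 have e: "nrd al be (x0, x1, x2, x3) = x0^2 + ((- al) * x1^2 + (- be) * x2^2 + (al * be) * x3^2)" by simp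
 have nn: "(- al) * x1^2 >= 0" "(- be) * x2^2 >= 0" "(al * be) * x3^2 >= 0" using assms by (simp_all add: mult_nonpos_nonneg mult_neg_neg less_imp_le)
 show "x0^2 <= nrd al be (x0, x1, x2, x3)" unfolding e using nn by linarith
 assume "x0^2 = nrd al be (x0, x1, x2, x3)"
 hence "(- al) * x1^2 = 0 & (- be) * x2^2 = 0 & (al * be) * x3^2 = 0" unfolding e using nn by linarith
 thus "x1 = 0 & x2 = 0 & x3 = 0" using assms by auto
qed

text \<open>A nilpotent matrix comes from a nonzero quaternion of reduced norm 0, which a positive
  definite norm form at some real place would exclude.\<close>

lemma split_imp_all_real_places_split:
 fixes a b :: "'f::field_char_0"
 assumes ph: "ph : splittings RT a b" and ab: "a ~= 0" "b ~= 0"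
 shows "split_real_places a b = real_embeddings"
proof -
 obtain x where x: "ph x = (0, 1, 0, 0)" using splitting_bij[OF ph] by (metis bij_pointE)
 obtain x0 x1 x2 x3 where xx: "x = (x0, x1, x2, x3)" by (cases x)
 have n0: "nrd a b x = 0" using splitting_tr_det(2)[OF ph xx] x by simp
 have "splittings RT (ta a) (ta b) ~= {}" if "ta : real_embeddings" for ta
 proof
  assume ns: "splittings RT (ta a) (ta b) = {}"
  have t: "field_hom ta" using that by (simp add: real_embeddings_field_hom)
  have neg: "ta a < 0" "ta b < 0" using not_split_imp_definite[OF ns] ab t by (auto simp: hom_eq_0)
  have "nrd (ta a) (ta b) (ta x0, ta x1, ta x2, ta x3) = 0" using nrd_hom[OF t, of a b x] n0 t xx by (simp add: hom_0)
  hence "ta x0 = 0 & ta x1 = 0 & ta x2 = 0 & ta x3 = 0" using definite_nrd[OF neg, of "ta x0" "ta x1" "ta x2" "ta x3"] by (auto simp del: nrd.simps)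
  hence "x = (0, 0, 0, 0)" using xx t by (simp add: hom_eq_0)
  thus False using splitting_scalar[OF ph, of 0] x by simp
 qed
 thus ?thesis by (auto simp: split_real_places_def)
qed

lemma (in cring) quat_alg_monoid:
 assumes [simp]: "a : carrier R" "b : carrier R"
 shows "monoid (quat_alg R a b)"
proof
 fix x y z
 assume "x : carrier (quat_alg R a b)" "y : carrier (quat_alg R a b)" "z : carrier (quat_alg R a b)"
 then obtain x0 x1 x2 x3 y0 y1 y2 y3 z0 z1 z2 z3 where
  xyz: "x = (x0, x1, x2, x3)" "y = (y0, y1, y2, y3)" "z = (z0, z1, z2, z3)"
  and [simp]: "x0 : carrier R" "x1 : carrier R" "x2 : carrier R" "x3 : carrier R"
  "y0 : carrier R" "y1 : carrier R" "y2 : carrier R" "y3 : carrier R"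
  "z0 : carrier R" "z1 : carrier R" "z2 : carrier R" "z3 : carrier R" by (auto simp: quat_alg_def)
 show "x \<otimes>\<^bsub>quat_alg R a b\<^esub> y : carrier (quat_alg R a b)" by (simp add: quat_alg_def xyz)
 show "x \<otimes>\<^bsub>quat_alg R a b\<^esub> y \<otimes>\<^bsub>quat_alg R a b\<^esub> z = x \<otimes>\<^bsub>quat_alg R a b\<^esub> (y \<otimes>\<^bsub>quat_alg R a b\<^esub> z)"
  unfolding quat_alg_def xyz monoid.simps mult_quat.simps prod.inject by (intro conjI)
   (simp_all add: a_minus_def l_distr r_distr l_minus r_minus minus_add m_assoc m_comm m_lcomm a_assoc a_comm a_lcomm)
 show "\<one>\<^bsub>quat_alg R a b\<^esub> \<otimes>\<^bsub>quat_alg R a b\<^esub> x = x" by (simp add: quat_alg_def xyz a_minus_def)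
 show "x \<otimes>\<^bsub>quat_alg R a b\<^esub> \<one>\<^bsub>quat_alg R a b\<^esub> = x" by (simp add: quat_alg_def xyz a_minus_def)
qed (simp add: quat_alg_def)

lemma map_quad_mult_quat:
 assumes "cring R" "cring S" and h: "h : ring_hom R S"
  and ab: "a : carrier R" "b : carrier R"
  and xy: "x : carrier (quat_alg R a b)" "y : carrier (quat_alg R a b)"
 shows "map_quad h (mult_quat R a b x y) = mult_quat S (h a) (h b) (map_quad h x) (map_quad h y)"
proof -
 interpret R: cring R by fact
 interpret S: cring S by fact
 interpret h: ring_hom_cring R S h by unfold_locales (rule h)
 show ?thesis using ab xy by (auto simp: quat_alg_def a_minus_def)
qed

section \<open>The completions\<close>

context
 fixes v :: "'f::field_char_0 => int"
 assumes v: "v : finite_places"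
begin

lemma cauchy_carrier: "s : carrier (CR v) \<longleftrightarrow> (ALL N. EX M. \<forall>m\<ge>M. \<forall>n\<ge>M. val_ge v N (s m - s n))"
 by (simp add: cauchy_ring_def)

lemma cauchy_ops: "s \<otimes>\<^bsub>CR v\<^esub> s' = (%n. s n * s' n)" "s \<oplus>\<^bsub>CR v\<^esub> s' = (%n. s n + s' n)"
 "\<one>\<^bsub>CR v\<^esub> = (%_. 1)" "\<zero>\<^bsub>CR v\<^esub> = (%_. 0)" by (simp_all add: cauchy_ring_def)

lemma val_ge_ex: "EX N. val_ge v N x" by (auto simp: val_ge_def)

lemma cauchy_bounded:
 assumes "s : carrier (CR v)"
 shows "EX B. ALL n. val_ge v B (s n)"
proof -
 obtain M where M: "!!m n. m >= M ==> n >= M ==> val_ge v 0 (s m - s n)" using assms unfolding cauchy_carrier by blast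
 have "ALL n. EX N. val_ge v N (s n)" using val_ge_ex by blast
 then obtain b where b: "!!n. val_ge v (b n) (s n)" by metis
 define B where "B = Min (insert 0 (b ` {..M}))"
 have Bb: "B <= b n" if "n <= M" for n unfolding B_def using that by (intro Min_le) auto
 have B0: "B <= 0" unfolding B_def by (intro Min_le) auto
 have "val_ge v B (s n)" for n
 proof (cases "n <= M")
  case True
  thus ?thesis using b Bb val_ge_mono[OF v] by blast
 next
  case False
  hence "val_ge v B (s n - s M)" using M[of n M] B0 val_ge_mono[OF v] by simp
  moreover have "val_ge v B (s M)" using b Bb[of M] val_ge_mono[OF v] by blast
  ultimately have "val_ge v B ((s n - s M) + s M)" by (rule val_ge_add[OF v])
  thus ?thesis by simp
 qed
 thus ?thesis by blast
qed

lemma cauchy_add: "s : carrier (CR v) ==> s' : carrier (CR v) ==> (%n. s n + s' n) : carrier (CR v)" unfolding cauchy_carrier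
proof
 fix N assume *: "ALL N. EX M. \<forall>m\<ge>M. \<forall>n\<ge>M. val_ge v N (s m - s n)" "ALL N. EX M. \<forall>m\<ge>M. \<forall>n\<ge>M. val_ge v N (s' m - s' n)"
 obtain M where M: "\<forall>m\<ge>M. \<forall>n\<ge>M. val_ge v N (s m - s n)" using * by blast
 obtain M' where M': "\<forall>m\<ge>M'. \<forall>n\<ge>M'. val_ge v N (s' m - s' n)" using * by blast
 have "val_ge v N (s m + s' m - (s n + s' n))" if "m >= max M M'" "n >= max M M'" for m n
  using val_ge_add[OF v, of N "s m - s n" "s' m - s' n"] M M' that by (simp add: algebra_simps)
 thus "EX M. \<forall>m\<ge>M. \<forall>n\<ge>M. val_ge v N (s m + s' m - (s n + s' n))" by blast
qed

lemma cauchy_uminus: "s : carrier (CR v) ==> (%n. - s n) : carrier (CR v)"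
 unfolding cauchy_carrier using val_ge_uminus[OF v] by (metis minus_diff_minus)

lemma cauchy_const: "(%_. x) : carrier (CR v)" unfolding cauchy_carrier using val_ge_0[OF v] by simp

lemma cauchy_mult:
 assumes s: "s : carrier (CR v)" and s': "s' : carrier (CR v)"
 shows "(%n. s n * s' n) : carrier (CR v)" unfolding cauchy_carrier
proof
 fix N
 obtain B where B: "!!n. val_ge v B (s n)" using cauchy_bounded[OF s] by blast
 obtain B' where B': "!!n. val_ge v B' (s' n)" using cauchy_bounded[OF s'] by blast
 obtain M where M: "!!m n. m >= M ==> n >= M ==> val_ge v (N - B') (s m - s n)" using s unfolding cauchy_carrier by blast
 obtain M' where M': "!!m n. m >= M' ==> n >= M' ==> val_ge v (N - B) (s' m - s' n)" using s' unfolding cauchy_carrier by blast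
 have "val_ge v N (s m * s' m - s n * s' n)" if mn: "m >= max M M'" "n >= max M M'" for m n
 proof -
  have "val_ge v (B + (N - B)) (s m * (s' m - s' n))" using B M' mn by (intro val_ge_mult[OF v]) auto
  moreover have "val_ge v ((N - B') + B') ((s m - s n) * s' n)" using B' M mn by (intro val_ge_mult[OF v]) auto
  ultimately have "val_ge v N (s m * (s' m - s' n) + (s m - s n) * s' n)" by (intro val_ge_add[OF v]) simp_all
  thus ?thesis by (simp add: algebra_simps)
 qed
 thus "EX M. \<forall>m\<ge>M. \<forall>n\<ge>M. val_ge v N (s m * s' m - s n * s' n)" by blast
qed

lemma cauchy_cring: "cring (CR v)"
proof (rule cringI)
 show "abelian_group (CR v)"
 proof (rule abelian_groupI)
  fix s assume "s : carrier (CR v)"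
  thus "EX y:carrier (CR v). y \<oplus>\<^bsub>CR v\<^esub> s = \<zero>\<^bsub>CR v\<^esub>"
   by (intro bexI[of _ "%n. - s n"]) (auto simp: cauchy_ops cauchy_uminus)
 qed (auto simp: cauchy_ops cauchy_add cauchy_const add_ac)
 show "comm_monoid (CR v)" by (rule comm_monoidI) (auto simp: cauchy_ops cauchy_mult cauchy_const mult_ac)
qed (auto simp: cauchy_ops algebra_simps)

lemma cauchy_a_inv: "s : carrier (CR v) ==> \<ominus>\<^bsub>CR v\<^esub> s = (%n. - s n)"
proof -
 assume s: "s : carrier (CR v)"
 interpret cring "CR v" by (rule cauchy_cring)
 show ?thesis using s by (intro minus_equality) (auto simp: cauchy_ops cauchy_uminus)
qed

lemma null_carrier: "s : null_seqs v ==> s : carrier (CR v)" unfolding cauchy_carrier null_seqs_def mem_Collect_eq using val_ge_diff[OF v] by metis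

lemma null_ideal: "ideal (null_seqs v) (CR v)"
proof (rule idealI)
 interpret cring "CR v" by (rule cauchy_cring)
 show "ring (CR v)" by (rule ring_axioms)
 have mult: "(%n. x n * s n) : null_seqs v" if sx: "s : null_seqs v" "x : carrier (CR v)" for s x unfolding null_seqs_def mem_Collect_eq
 proof
  fix N
  obtain B where B: "!!n. val_ge v B (x n)" using cauchy_bounded[OF sx(2)] by blast
  obtain M where M: "!!n. n >= M ==> val_ge v (N - B) (s n)" using sx(1) by (auto simp: null_seqs_def)
  have "val_ge v (B + (N - B)) (x n * s n)" if "n >= M" for n using B M[OF that] by (rule val_ge_mult[OF v])
  thus "EX M. \<forall>n\<ge>M. val_ge v N (x n * s n)" by auto
 qed
 show "subgroup (null_seqs v) (add_monoid (CR v))"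
 proof (rule subgroup.intro)
  show "null_seqs v <= carrier (add_monoid (CR v))" using null_carrier by auto
  show "x \<otimes>\<^bsub>add_monoid (CR v)\<^esub> y : null_seqs v" if "x : null_seqs v" "y : null_seqs v" for x y
   using that val_ge_add[OF v] unfolding null_seqs_def mem_Collect_eq monoid.simps cauchy_ops
   by (metis (no_types, lifting) max.boundedE max.cobounded1 max.cobounded2 order.trans)
  show "\<one>\<^bsub>add_monoid (CR v)\<^esub> : null_seqs v" using val_ge_0[OF v] by (simp add: null_seqs_def cauchy_ops)
  fix x assume x: "x : null_seqs v"
  have "inv\<^bsub>add_monoid (CR v)\<^esub> x = (%n. - x n)" using cauchy_a_inv[OF null_carrier[OF x]] by (simp add: a_inv_def)
  moreover have "(%n. - x n) : null_seqs v" using x val_ge_uminus[OF v] unfolding null_seqs_def mem_Collect_eq by metis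
  ultimately show "inv\<^bsub>add_monoid (CR v)\<^esub> x : null_seqs v" by simp
 qed
 show "x \<otimes>\<^bsub>CR v\<^esub> s : null_seqs v" "s \<otimes>\<^bsub>CR v\<^esub> x : null_seqs v"
  if "s : null_seqs v" "x : carrier (CR v)" for s x using mult[OF that] by (simp_all add: cauchy_ops mult.commute)
qed

lemma completion_cring: "cring (Kv v)" unfolding place_completion_def by (rule ideal.quotient_is_cring[OF null_ideal cauchy_cring])

definition cls :: "(nat => 'f) => (nat => 'f) set" where
 "cls s = null_seqs v +>\<^bsub>CR v\<^esub> s"

lemma cls_hom: "cls : ring_hom (CR v) (Kv v)" unfolding place_completion_def cls_def[abs_def] by (rule ideal.rcos_ring_hom[OF null_ideal])

lemma completion_carrier: "carrier (Kv v) = cls ` carrier (CR v)" by (auto simp: place_completion_def FactRing_def cls_def A_RCOSETS_def')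

lemma completion_ball_iff:
 "x : Vball v N \<longleftrightarrow> (EX s. s : carrier (CR v) & (EX M. \<forall>n\<ge>M. val_ge v N (s n)) & x = cls s)"
 unfolding completion_ball_def cls_def by blast

lemma completion_ball_carrier: "Vball v N <= carrier (Kv v)" unfolding completion_carrier by (auto simp: completion_ball_iff)

lemma completion_ball_ex: "x : carrier (Kv v) ==> EX N. x : Vball v N" unfolding completion_carrier completion_ball_iff using cauchy_bounded by blast

lemma completion_ball_mono: "N <= M ==> Vball v M <= Vball v N" unfolding completion_ball_iff[abs_def] subset_iff using val_ge_mono[OF v] by blast

lemma completion_ball_add:
 assumes "x : Vball v N" "y : Vball v N"
 shows "x \<oplus>\<^bsub>Kv v\<^esub> y : Vball v N"
proof -
 obtain s M where s: "s : carrier (CR v)" "!!n. n >= M ==> val_ge v N (s n)" "x = cls s" using assms(1) unfolding completion_ball_iff by blast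
 obtain s' M' where s': "s' : carrier (CR v)" "!!n. n >= M' ==> val_ge v N (s' n)" "y = cls s'" using assms(2) unfolding completion_ball_iff by blast
 have "x \<oplus>\<^bsub>Kv v\<^esub> y = cls (%n. s n + s' n)" using ring_hom_add[OF cls_hom s(1) s'(1)] s s' by (simp add: cauchy_ops)
 moreover have "val_ge v N (s n + s' n)" if "n >= max M M'" for n using s(2) s'(2) that by (intro val_ge_add[OF v]) auto
 ultimately show ?thesis unfolding completion_ball_iff using cauchy_add[OF s(1) s'(1)] by blast
qed

lemma completion_ball_mult:
 assumes "x : Vball v N" "y : Vball v K"
 shows "x \<otimes>\<^bsub>Kv v\<^esub> y : Vball v (N + K)"
proof -
 obtain s M where s: "s : carrier (CR v)" "!!n. n >= M ==> val_ge v N (s n)" "x = cls s" using assms(1) unfolding completion_ball_iff by blast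
 obtain s' M' where s': "s' : carrier (CR v)" "!!n. n >= M' ==> val_ge v K (s' n)" "y = cls s'" using assms(2) unfolding completion_ball_iff by blast
 have "x \<otimes>\<^bsub>Kv v\<^esub> y = cls (%n. s n * s' n)" using ring_hom_mult[OF cls_hom s(1) s'(1)] s s' by (simp add: cauchy_ops)
 moreover have "val_ge v (N + K) (s n * s' n)" if "n >= max M M'" for n using s(2) s'(2) that by (intro val_ge_mult[OF v]) auto
 ultimately show ?thesis unfolding completion_ball_iff using cauchy_mult[OF s(1) s'(1)] by blast
qed

lemma completion_ball_uminus:
 assumes "x : Vball v N"
 shows "\<ominus>\<^bsub>Kv v\<^esub> x : Vball v N"
proof -
 interpret R: cring "CR v" by (rule cauchy_cring)
 interpret S: cring "Kv v" by (rule completion_cring)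
 interpret h: ring_hom_cring "CR v" "Kv v" cls by unfold_locales (rule cls_hom)
 obtain s M where s: "s : carrier (CR v)" "!!n. n >= M ==> val_ge v N (s n)" "x = cls s" using assms(1) unfolding completion_ball_iff by blast
 have "\<ominus>\<^bsub>Kv v\<^esub> x = cls (%n. - s n)" using h.hom_a_inv[OF s(1)] s cauchy_a_inv[OF s(1)] by simp
 thus ?thesis unfolding completion_ball_iff using cauchy_uminus[OF s(1)] s(2) val_ge_uminus[OF v] by blast
qed

lemma completion_ball_minus:
 assumes "x : Vball v N" "y : Vball v N"
 shows "x \<ominus>\<^bsub>Kv v\<^esub> y : Vball v N" unfolding a_minus_def using assms by (intro completion_ball_add completion_ball_uminus)

lemma to_completion_eq: "to_completion v x = cls (%_. x)" by (simp add: to_completion_def cls_def)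

lemma to_completion_hom: "to_completion v : ring_hom RT (Kv v)"
proof (rule ring_hom_memI)
 fix x y :: 'f
 show "to_completion v x : carrier (Kv v)" unfolding to_completion_eq completion_carrier using cauchy_const by blast
 show "to_completion v (x \<otimes>\<^bsub>RT\<^esub> y) = to_completion v x \<otimes>\<^bsub>Kv v\<^esub> to_completion v y"
  using ring_hom_mult[OF cls_hom cauchy_const cauchy_const, of x y] by (simp add: to_completion_eq cauchy_ops ring_of_type_algebra_def)
 show "to_completion v (x \<oplus>\<^bsub>RT\<^esub> y) = to_completion v x \<oplus>\<^bsub>Kv v\<^esub> to_completion v y"
  using ring_hom_add[OF cls_hom cauchy_const cauchy_const, of x y] by (simp add: to_completion_eq cauchy_ops ring_of_type_algebra_def)
 show "to_completion v \<one>\<^bsub>RT\<^esub> = \<one>\<^bsub>Kv v\<^esub>" using ring_hom_one[OF cls_hom]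
  by (simp add: to_completion_eq cauchy_ops ring_of_type_algebra_def)
qed

lemma to_completion_ball: "val_ge v N x ==> to_completion v x : Vball v N" unfolding to_completion_eq completion_ball_iff using cauchy_const by blast

text \<open>A representative inside the ball differs from the constant sequence by a null sequence.
  Through this converse of \<open>to_completion_ball\<close> adelic bounds return to the
  field.\<close>

lemma to_completion_ballD:
 assumes "to_completion v x : Vball v N"
 shows "val_ge v N x"
proof -
 interpret ideal "null_seqs v" "CR v" by (rule null_ideal)
 obtain s M where s: "s : carrier (CR v)" "!!n. n >= M ==> val_ge v N (s n)" "cls (%_. x) = cls s"
  using assms unfolding to_completion_eq completion_ball_iff by blast
 have "(%_. x) : cls s" using a_rcos_self[OF cauchy_const[of x]] s(3) by (simp add: cls_def)
 then obtain h where h: "h : null_seqs v" "(%_. x) = (%n. h n + s n)" unfolding cls_def a_r_coset_def' cauchy_ops by blast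
 obtain M' where M': "!!n. n >= M' ==> val_ge v N (h n)" using h(1) by (auto simp: null_seqs_def)
 have "val_ge v N (h (max M M') + s (max M M'))" using M' s(2) by (intro val_ge_add[OF v]) auto
 thus ?thesis using fun_cong[OF h(2)] by simp
qed

lemma completion_top_istopology:
 "istopology (%W. W <= carrier (Kv v) \<and>
  (ALL x:W. EX N. ALL y:Vball v N. x \<oplus>\<^bsub>Kv v\<^esub> y : W))" unfolding istopology_def
proof (intro conjI allI impI)
 fix S T
 assume S: "S <= carrier (Kv v) & (ALL x:S. EX N. ALL y:Vball v N. x \<oplus>\<^bsub>Kv v\<^esub> y : S)"
  and T: "T <= carrier (Kv v) & (ALL x:T. EX N. ALL y:Vball v N. x \<oplus>\<^bsub>Kv v\<^esub> y : T)"
 show "S \<inter> T <= carrier (Kv v)" using S by blast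
 show "ALL x:S \<inter> T. EX N. ALL y:Vball v N. x \<oplus>\<^bsub>Kv v\<^esub> y : S \<inter> T"
 proof
  fix x assume "x : S \<inter> T"
  then obtain N K where "ALL y:Vball v N. x \<oplus>\<^bsub>Kv v\<^esub> y : S"
   "ALL y:Vball v K. x \<oplus>\<^bsub>Kv v\<^esub> y : T" using S T by blast
  thus "EX N. ALL y:Vball v N. x \<oplus>\<^bsub>Kv v\<^esub> y : S \<inter> T"
   using completion_ball_mono[of N "max N K"] completion_ball_mono[of K "max N K"] by (intro exI[of _ "max N K"]) auto
 qed
next
 fix K
 assume K: "ALL S:K. S <= carrier (Kv v) & (ALL x:S. EX N. ALL y:Vball v N. x \<oplus>\<^bsub>Kv v\<^esub> y : S)"
 thus "\<Union>K <= carrier (Kv v)" by blast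
 show "ALL x:\<Union>K. EX N. ALL y:Vball v N. x \<oplus>\<^bsub>Kv v\<^esub> y : \<Union>K"
 proof
  fix x assume "x : \<Union>K"
  then obtain S where S: "S : K" "x : S" by blast
  then obtain N where "ALL y:Vball v N. x \<oplus>\<^bsub>Kv v\<^esub> y : S" using K by blast
  thus "EX N. ALL y:Vball v N. x \<oplus>\<^bsub>Kv v\<^esub> y : \<Union>K" using S(1) by blast
 qed
qed

lemma openin_completion: "openin (completion_top v) W \<longleftrightarrow> W <= carrier (Kv v) \<and>
  (ALL x:W. EX N. ALL y:Vball v N. x \<oplus>\<^bsub>Kv v\<^esub> y : W)"
 unfolding completion_top_def topology_inverse'[OF completion_top_istopology] ..

lemma openin_completion_ball: "openin (completion_top v) (Vball v N)"
 unfolding openin_completion using completion_ball_carrier completion_ball_add by blast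

lemma openin_completion_carrier: "openin (completion_top v) (carrier (Kv v))" unfolding openin_completion
proof (intro conjI ballI exI subset_refl)
 interpret S: cring "Kv v" by (rule completion_cring)
 show "x \<oplus>\<^bsub>Kv v\<^esub> y : carrier (Kv v)"
  if "x : carrier (Kv v)" "y : Vball v 0" for x y using that completion_ball_carrier by auto
qed

text \<open>The structure constants 1, a, b and a b have valuation at least 2 L, and a product loses
  no more than that.\<close>

lemma mult_quat_ball:
 assumes L: "L <= 0" and ab: "a : Vball v L" "b : Vball v L"
  and x: "x : Vball v N \<times> Vball v N \<times> Vball v N \<times> Vball v N"
  and y: "y : Vball v K \<times> Vball v K \<times> Vball v K \<times> Vball v K"
 shows "mult_quat (Kv v) a b x y : Vball v (N + K + 2 * L) \<times> Vball v (N + K + 2 * L) \<times> Vball v (N + K + 2 * L) \<times> Vball v (N + K + 2 * L)"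
proof -
 have m0: "p \<otimes>\<^bsub>Kv v\<^esub> q : Vball v (N + K + 2 * L)"
  if "p : Vball v N" "q : Vball v K" for p q using completion_ball_mult[OF that] completion_ball_mono[of "N + K + 2 * L" "N + K"] L by auto
 have m1: "c \<otimes>\<^bsub>Kv v\<^esub> (p \<otimes>\<^bsub>Kv v\<^esub> q) : Vball v (N + K + 2 * L)"
  if "c : Vball v L" "p : Vball v N" "q : Vball v K" for c p q using completion_ball_mult[OF that(1) completion_ball_mult[OF that(2,3)]]
   completion_ball_mono[of "N + K + 2 * L" "L + (N + K)"] L by auto
 have m2: "a \<otimes>\<^bsub>Kv v\<^esub> b \<otimes>\<^bsub>Kv v\<^esub> (p \<otimes>\<^bsub>Kv v\<^esub> q) : Vball v (N + K + 2 * L)"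
  if "p : Vball v N" "q : Vball v K" for p q using completion_ball_mult[OF completion_ball_mult[OF ab] completion_ball_mult[OF that]]
  by (simp add: add_ac)
 obtain x0 x1 x2 x3 where x': "x = (x0, x1, x2, x3)" "x0 : Vball v N" "x1 : Vball v N"
  "x2 : Vball v N" "x3 : Vball v N" using x by auto
 obtain y0 y1 y2 y3 where y': "y = (y0, y1, y2, y3)" "y0 : Vball v K" "y1 : Vball v K"
  "y2 : Vball v K" "y3 : Vball v K" using y by auto
 show ?thesis unfolding x'(1) y'(1) mult_quat.simps mem_Times_iff fst_conv snd_conv
  using x'(2-) y'(2-) by (simp add: completion_ball_minus completion_ball_add m0 m1 m2 ab)
qed

end

section \<open>The finite adeles\<close>

lemma finite_adeles_carrier: "x : carrier finite_adeles \<longleftrightarrow>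
 x : (\<Pi>\<^sub>E v\<in>finite_places. carrier (Kv v)) & finite {v : finite_places. x v ~: Vball v 0}" by (simp add: finite_adeles_def)

lemma finite_adeles_carrierI:
 assumes "!!v. v : finite_places ==> g v : carrier (Kv v)"
  and "finite S" "!!v. v : finite_places ==> v ~: S ==> g v : Vball v 0"
 shows "(\<lambda>v\<in>finite_places. g v) : carrier finite_adeles" unfolding finite_adeles_carrier using assms
 by (auto intro!: finite_subset[OF _ assms(2)])

lemma finite_adeles_ops:
 "x \<otimes>\<^bsub>finite_adeles\<^esub> y = (\<lambda>v\<in>finite_places. x v \<otimes>\<^bsub>Kv v\<^esub> y v)"
 "x \<oplus>\<^bsub>finite_adeles\<^esub> y = (\<lambda>v\<in>finite_places. x v \<oplus>\<^bsub>Kv v\<^esub> y v)"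
 "\<one>\<^bsub>finite_adeles\<^esub> = (\<lambda>v\<in>finite_places. \<one>\<^bsub>Kv v\<^esub>)"
 "\<zero>\<^bsub>finite_adeles\<^esub> = (\<lambda>v\<in>finite_places. \<zero>\<^bsub>Kv v\<^esub>)" by (simp_all add: finite_adeles_def)

lemma finite_adeles_eqI:
 assumes "x : carrier finite_adeles" "y : carrier finite_adeles" "!!v. v : finite_places ==> x v = y v"
 shows "x = y" using assms unfolding finite_adeles_carrier by (blast intro: PiE_ext)

lemma finite_adeles_component: "x : carrier finite_adeles ==> v : finite_places ==> x v : carrier (Kv v)" by (auto simp: finite_adeles_carrier)

lemma finite_adeles_exceptions:
 assumes "x : carrier finite_adeles"
 obtains S where "finite S" "!!v. v : finite_places ==> v ~: S ==> x v : Vball v 0"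
proof (rule that[of "{v : finite_places. x v ~: Vball v 0}"])
 show "finite {v : finite_places. x v ~: Vball v 0}" using assms by (simp add: finite_adeles_carrier)
qed blast

lemma to_completion_integral:
 assumes "v : finite_places" shows "\<one>\<^bsub>Kv v\<^esub> : Vball v 0" "\<zero>\<^bsub>Kv v\<^esub> : Vball v 0"
proof -
 interpret S: cring "Kv v" by (rule completion_cring[OF assms])
 interpret R: cring "RT :: 'a ring" by (rule cring_from_type_algebra)
 interpret h: ring_hom_cring "RT :: 'a ring" "Kv v" "to_completion v" by unfold_locales (rule to_completion_hom[OF assms])
 have "to_completion v (1::'a) : Vball v 0" "to_completion v (0::'a) : Vball v 0"
  by (intro to_completion_ball[OF assms]; simp add: val_ge_def val_1[OF assms])+
 thus "\<one>\<^bsub>Kv v\<^esub> : Vball v 0" "\<zero>\<^bsub>Kv v\<^esub> : Vball v 0"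
  using h.hom_one h.hom_zero by (simp_all add: ring_of_type_algebra_def)
qed

lemma finite_adeles_cring: "cring (finite_adeles :: (('f::field_char_0 => int) => (nat => 'f) set) ring)"
 (is "cring ?A")
proof -
 have c: "cring (Kv v)" if "v : finite_places" for v :: "'f => int" using completion_cring[OF that] .
 have r: "ring (Kv v)" if "v : finite_places" for v :: "'f => int" using c[OF that] by (rule cring.axioms)
 have add: "x \<oplus>\<^bsub>?A\<^esub> y : carrier ?A" if x: "x : carrier ?A" and y: "y : carrier ?A" for x y
 proof -
  obtain S where S: "finite S" "!!v. v : finite_places ==> v ~: S ==> x v : Vball v 0" using finite_adeles_exceptions[OF x] by blast
  obtain T where T: "finite T" "!!v. v : finite_places ==> v ~: T ==> y v : Vball v 0" using finite_adeles_exceptions[OF y] by blast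
  show ?thesis unfolding finite_adeles_ops using S T r x y by (intro finite_adeles_carrierI[of _ "S \<union> T"])
    (auto intro!: completion_ball_add ring.ring_simprules(1) finite_adeles_component[OF x] finite_adeles_component[OF y])
 qed
 have mult: "x \<otimes>\<^bsub>?A\<^esub> y : carrier ?A" if x: "x : carrier ?A" and y: "y : carrier ?A" for x y
 proof -
  obtain S where S: "finite S" "!!v. v : finite_places ==> v ~: S ==> x v : Vball v 0" using finite_adeles_exceptions[OF x] by blast
  obtain T where T: "finite T" "!!v. v : finite_places ==> v ~: T ==> y v : Vball v 0" using finite_adeles_exceptions[OF y] by blast
  have bm: "p \<otimes>\<^bsub>Kv v\<^esub> q : Vball v 0"
   if "v : finite_places" "p : Vball v 0" "q : Vball v 0" for v :: "'f => int" and p q using completion_ball_mult[OF that] by simp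
  show ?thesis unfolding finite_adeles_ops using S T r x y by (intro finite_adeles_carrierI[of _ "S \<union> T"])
    (auto intro!: bm ring.ring_simprules(5) finite_adeles_component[OF x] finite_adeles_component[OF y])
 qed
 have one: "\<one>\<^bsub>?A\<^esub> : carrier ?A" unfolding finite_adeles_ops
  by (intro finite_adeles_carrierI[of _ "{}"]) (auto intro!: ring.ring_simprules(6) r to_completion_integral)
 have zero: "\<zero>\<^bsub>?A\<^esub> : carrier ?A" unfolding finite_adeles_ops
  by (intro finite_adeles_carrierI[of _ "{}"]) (auto intro!: ring.ring_simprules(2) r to_completion_integral)
 note comp = finite_adeles_component
 show ?thesis
 proof (rule cringI)
  show "abelian_group ?A"
  proof (rule abelian_groupI)
   fix x y z assume xyz: "x : carrier ?A" "y : carrier ?A" "z : carrier ?A"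
   show "x \<oplus>\<^bsub>?A\<^esub> y : carrier ?A" using xyz by (intro add)
   show "x \<oplus>\<^bsub>?A\<^esub> y \<oplus>\<^bsub>?A\<^esub> z = x \<oplus>\<^bsub>?A\<^esub> (y \<oplus>\<^bsub>?A\<^esub> z)"
    by (rule finite_adeles_eqI; (blast intro: xyz add | use comp[OF xyz(1)] comp[OF xyz(2)] comp[OF xyz(3)] in \<open>simp add: finite_adeles_ops cring.cring_simprules[OF c]\<close>))
   show "x \<oplus>\<^bsub>?A\<^esub> y = y \<oplus>\<^bsub>?A\<^esub> x"
    by (rule finite_adeles_eqI; (blast intro: xyz add | use comp[OF xyz(1)] comp[OF xyz(2)] comp[OF xyz(3)] in \<open>simp add: finite_adeles_ops cring.cring_simprules[OF c]\<close>))
  next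
   fix x assume x: "x : carrier ?A"
   show "\<zero>\<^bsub>?A\<^esub> \<oplus>\<^bsub>?A\<^esub> x = x"
    by (rule finite_adeles_eqI; (blast intro: x add zero | use comp[OF x] in \<open>simp add: finite_adeles_ops cring.cring_simprules[OF c]\<close>))
   obtain S where S: "finite S" "!!v. v : finite_places ==> v ~: S ==> x v : Vball v 0" using finite_adeles_exceptions[OF x] by blast
   let ?y = "\<lambda>v\<in>finite_places. \<ominus>\<^bsub>Kv v\<^esub> x v"
   have "?y : carrier ?A"
    using S x by (intro finite_adeles_carrierI[of _ S]) (auto intro!: completion_ball_uminus ring.ring_simprules(3) r comp[OF x])
   moreover have "?y \<oplus>\<^bsub>?A\<^esub> x = \<zero>\<^bsub>?A\<^esub>"
    by (rule finite_adeles_eqI; (blast intro: add zero x \<open>?y : carrier ?A\<close> | use comp[OF x] in \<open>simp add: finite_adeles_ops cring.cring_simprules[OF c]\<close>))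
   ultimately show "EX y:carrier ?A. y \<oplus>\<^bsub>?A\<^esub> x = \<zero>\<^bsub>?A\<^esub>" by blast
  qed (rule zero)
  show "comm_monoid ?A"
  proof (rule comm_monoidI)
   fix x y z assume xyz: "x : carrier ?A" "y : carrier ?A" "z : carrier ?A"
   show "x \<otimes>\<^bsub>?A\<^esub> y : carrier ?A" using xyz by (intro mult)
   show "x \<otimes>\<^bsub>?A\<^esub> y \<otimes>\<^bsub>?A\<^esub> z = x \<otimes>\<^bsub>?A\<^esub> (y \<otimes>\<^bsub>?A\<^esub> z)"
    by (rule finite_adeles_eqI; (blast intro: xyz mult | use comp[OF xyz(1)] comp[OF xyz(2)] comp[OF xyz(3)] in \<open>simp add: finite_adeles_ops cring.cring_simprules[OF c]\<close>))
   show "x \<otimes>\<^bsub>?A\<^esub> y = y \<otimes>\<^bsub>?A\<^esub> x"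
    by (rule finite_adeles_eqI; (blast intro: xyz mult | use comp[OF xyz(1)] comp[OF xyz(2)] comp[OF xyz(3)] in \<open>simp add: finite_adeles_ops cring.cring_simprules[OF c]\<close>))
  next
   fix x assume x: "x : carrier ?A"
   show "\<one>\<^bsub>?A\<^esub> \<otimes>\<^bsub>?A\<^esub> x = x"
    by (rule finite_adeles_eqI; (blast intro: x mult one | use comp[OF x] in \<open>simp add: finite_adeles_ops monoid.l_one[OF ring.is_monoid[OF r]]\<close>))
  qed (rule one)
  fix x y z assume xyz: "x : carrier ?A" "y : carrier ?A" "z : carrier ?A"
  show "(x \<oplus>\<^bsub>?A\<^esub> y) \<otimes>\<^bsub>?A\<^esub> z = x \<otimes>\<^bsub>?A\<^esub> z \<oplus>\<^bsub>?A\<^esub> y \<otimes>\<^bsub>?A\<^esub> z"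
   by (rule finite_adeles_eqI; (blast intro: xyz add mult | use comp[OF xyz(1)] comp[OF xyz(2)] comp[OF xyz(3)] in \<open>simp add: finite_adeles_ops cring.cring_simprules[OF c]\<close>))
 qed
qed

lemma finite_adeles_eval_hom:
 assumes v: "v : finite_places"
 shows "(%x. x v) : ring_hom finite_adeles (Kv v)" using v by (intro ring_hom_memI) (auto simp: finite_adeles_ops intro: finite_adeles_component)

lemma to_finite_adeles_hom:
 assumes nf: "number_field TYPE('f::field_char_0)"
 shows "to_finite_adeles : ring_hom (RT :: 'f ring) finite_adeles"
proof (rule ring_hom_memI)
 fix x y :: 'f
 note h = to_completion_hom
 show "to_finite_adeles x : carrier finite_adeles" unfolding to_finite_adeles_def
 proof (rule finite_adeles_carrierI[OF _ finite_negative_places[OF nf, of x]])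
  fix v :: "'f => int" assume v: "v : finite_places"
  show "to_completion v x : carrier (Kv v)" using ring_hom_closed[OF h[OF v], of x] by (simp add: ring_of_type_algebra_def)
  show "to_completion v x : Vball v 0" if "v ~: {v : finite_places. v x < 0}" using that v by (intro to_completion_ball[OF v]) (auto simp: val_ge_def)
 qed
 show "to_finite_adeles (x \<otimes>\<^bsub>RT\<^esub> y) = to_finite_adeles x \<otimes>\<^bsub>finite_adeles\<^esub> to_finite_adeles y"
  unfolding to_finite_adeles_def finite_adeles_ops
  by (rule restrict_ext) (use ring_hom_mult[OF h] in \<open>auto simp: ring_of_type_algebra_def\<close>)
 show "to_finite_adeles (x \<oplus>\<^bsub>RT\<^esub> y) = to_finite_adeles x \<oplus>\<^bsub>finite_adeles\<^esub> to_finite_adeles y"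
  unfolding to_finite_adeles_def finite_adeles_ops
  by (rule restrict_ext) (use ring_hom_add[OF h] in \<open>auto simp: ring_of_type_algebra_def\<close>)
 show "to_finite_adeles \<one>\<^bsub>RT\<^esub> = \<one>\<^bsub>finite_adeles\<^esub>" unfolding to_finite_adeles_def finite_adeles_ops
  by (rule restrict_ext) (use ring_hom_one[OF h] in \<open>auto simp: ring_of_type_algebra_def\<close>)
qed

text \<open>A basic neighbourhood of x inside this set takes the ball at v, the full completion at
  the places where x is not integral and the valuation ring elsewhere.\<close>

lemma openin_finite_adeles_component:
 fixes v :: "'f::field_char_0 => int"
 assumes v: "v : finite_places"
 shows "openin finite_adeles_top {x : carrier finite_adeles. x v : Vball v N}"
proof (subst openin_subopen, intro ballI)
 fix x :: "('f => int) => (nat => 'f) set"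
 assume "x : {x : carrier finite_adeles. x v : Vball v N}"
 hence x: "x : carrier finite_adeles" "x v : Vball v N" by auto
 obtain S where S: "finite S" "!!v. v : finite_places ==> v ~: S ==> x v : Vball v 0" using finite_adeles_exceptions[OF x(1)] by blast
 define W where "W w = (if w = v then Vball v N else if w : S then carrier (Kv w) else Vball w 0)" for w
 have W_open: "openin (completion_top w) (W w)" if "w : finite_places" for w
  unfolding W_def using openin_completion_ball[OF that] openin_completion_carrier[OF that] by auto
 have "finite {w : finite_places. W w ~= Vball w 0}" by (rule finite_subset[of _ "insert v S"]) (auto simp: W_def S)
 hence "openin finite_adeles_top (\<Pi>\<^sub>E w\<in>finite_places. W w)"
  unfolding finite_adeles_top_def using W_open by (intro topology_generated_by_Basis) blast
 moreover have "x : (\<Pi>\<^sub>E w\<in>finite_places. W w)"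
  using x S finite_adeles_component[OF x(1)] unfolding finite_adeles_carrier by (auto simp: W_def PiE_iff)
 moreover have "(\<Pi>\<^sub>E w\<in>finite_places. W w) <= {x : carrier finite_adeles. x v : Vball v N}"
 proof
  fix y assume y: "y : (\<Pi>\<^sub>E w\<in>finite_places. W w)"
  have "W w <= carrier (Kv w)" if "w : finite_places" for w using completion_ball_carrier[OF that] by (auto simp: W_def)
  hence "y : (\<Pi>\<^sub>E w\<in>finite_places. carrier (Kv w))" using y by (auto simp: PiE_iff)
  moreover have "finite {w : finite_places. y w ~: Vball w 0}"
   by (rule finite_subset[of _ "insert v S"]) (use y S in \<open>auto simp: W_def PiE_iff split: if_splits\<close>)
  moreover have "y v : Vball v N" using y v by (auto simp: W_def PiE_iff dest: bspec[of _ _ v])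
  ultimately show "y : {x : carrier finite_adeles. x v : Vball v N}" by (simp add: finite_adeles_carrier)
 qed
 ultimately show "EX T. openin finite_adeles_top T & x : T & T <= {x : carrier finite_adeles. x v : Vball v N}" by blast
qed


section \<open>The arithmetic group\<close>

context
 fixes a b :: "'f::field_char_0" and U t
 assumes nf: "number_field TYPE('f)"
  and U: "subgroup U (G_fin a b)" and Uc: "compactin (G_fin_top a b) U"
  and t: "t : carrier (G_fin a b)"
begin

abbreviation (input) QA where "QA \<equiv> quat_alg finite_adeles (to_finite_adeles a) (to_finite_adeles b)"

lemma to_finite_adeles_closed: "to_finite_adeles x : carrier (finite_adeles :: (('f => int) => (nat => 'f) set) ring)"
 using ring_hom_closed[OF to_finite_adeles_hom[OF nf], of x] by (simp add: ring_of_type_algebra_def)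

lemma QA_monoid: "monoid QA" by (intro cring.quat_alg_monoid finite_adeles_cring to_finite_adeles_closed)

lemma G_fin_group: "group (G_fin a b)" unfolding G_fin_def by (rule monoid.units_group[OF QA_monoid])

lemma G_fin_simps: "x \<otimes>\<^bsub>G_fin a b\<^esub> y = mult_quat finite_adeles (to_finite_adeles a) (to_finite_adeles b) x y"
 "carrier (G_fin a b) = Units QA" "\<one>\<^bsub>G_fin a b\<^esub> = \<one>\<^bsub>QA\<^esub>" by (simp_all add: G_fin_def units_of_def quat_alg_def)

abbreviation (input) conj_U where "conj_U \<equiv> (t <#\<^bsub>G_fin a b\<^esub> U) #>\<^bsub>G_fin a b\<^esub> (inv\<^bsub>G_fin a b\<^esub> t)"

lemma conj_U_iff: "x : conj_U \<longleftrightarrow> (EX u:U. x = t \<otimes>\<^bsub>G_fin a b\<^esub> u \<otimes>\<^bsub>G_fin a b\<^esub> inv\<^bsub>G_fin a b\<^esub> t)"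
 by (auto simp: l_coset_def r_coset_def)

lemma conj_U_subgroup: "subgroup conj_U (G_fin a b)"
proof -
 interpret G: group "G_fin a b" by (rule G_fin_group)
 have Uc: "u : carrier (G_fin a b)" if "u : U" for u using subgroup.subset[OF U] that by blast
 show ?thesis
 proof (rule G.subgroupI)
  show "conj_U <= carrier (G_fin a b)" using Uc t by (auto simp: conj_U_iff)
  show "conj_U ~= {}" using subgroup.one_closed[OF U] conj_U_iff by blast
  fix x assume "x : conj_U"
  then obtain u where u: "u : U" "x = t \<otimes>\<^bsub>G_fin a b\<^esub> u \<otimes>\<^bsub>G_fin a b\<^esub> inv\<^bsub>G_fin a b\<^esub> t" unfolding conj_U_iff by blast
  have "inv\<^bsub>G_fin a b\<^esub> x = t \<otimes>\<^bsub>G_fin a b\<^esub> inv\<^bsub>G_fin a b\<^esub> u \<otimes>\<^bsub>G_fin a b\<^esub> inv\<^bsub>G_fin a b\<^esub> t"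
   using u Uc t by (simp add: G.inv_mult_group G.m_assoc)
  thus "inv\<^bsub>G_fin a b\<^esub> x : conj_U" unfolding conj_U_iff using subgroup.m_inv_closed[OF U u(1)] by blast
  fix y assume "y : conj_U"
  then obtain w where w: "w : U" "y = t \<otimes>\<^bsub>G_fin a b\<^esub> w \<otimes>\<^bsub>G_fin a b\<^esub> inv\<^bsub>G_fin a b\<^esub> t" unfolding conj_U_iff by blast
  have "x \<otimes>\<^bsub>G_fin a b\<^esub> y = t \<otimes>\<^bsub>G_fin a b\<^esub> (u \<otimes>\<^bsub>G_fin a b\<^esub> w) \<otimes>\<^bsub>G_fin a b\<^esub> inv\<^bsub>G_fin a b\<^esub> t"
  proof -
   have "inv\<^bsub>G_fin a b\<^esub> t \<otimes>\<^bsub>G_fin a b\<^esub> (t \<otimes>\<^bsub>G_fin a b\<^esub> z) = z" if "z : carrier (G_fin a b)" for z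
    using that t by (simp add: G.m_assoc[symmetric])
   thus ?thesis using u w Uc t by (simp add: G.m_assoc)
  qed
  thus "x \<otimes>\<^bsub>G_fin a b\<^esub> y : conj_U" unfolding conj_U_iff using subgroup.m_closed[OF U u(1) w(1)] by blast
 qed
qed

lemma map_quad_carrier: "map_quad to_finite_adeles x : carrier QA" using to_finite_adeles_closed by (cases x) (simp add: quat_alg_def)

lemma map_quad_finite_adeles_mult:
 "map_quad to_finite_adeles (mq a b x y)
 = map_quad to_finite_adeles x \<otimes>\<^bsub>G_fin a b\<^esub> map_quad to_finite_adeles y" unfolding G_fin_simps
proof (rule map_quad_mult_quat[OF cring_from_type_algebra finite_adeles_cring to_finite_adeles_hom[OF nf]])
 have c: "carrier (quat_alg RT a b) = UNIV" by (auto simp: quat_alg_def quat_simps)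
 show "x : carrier (quat_alg RT a b)" "y : carrier (quat_alg RT a b)" unfolding c by simp_all
qed (simp_all add: quat_simps)

text \<open>An element of reduced norm 1 is a unit with positive norm at every infinite place, so
  only the condition at the finite places remains.\<close>

lemma Gamma1_quat_iff: "x : Gamma1_quat a b U t \<longleftrightarrow> nrd a b x = 1 & map_quad to_finite_adeles x : conj_U"
proof -
 have "to_G_inf x : G_inf_plus a b" "x : carrier (G_rat a b)" if n: "nrd a b x = 1"
 proof -
  show "x : carrier (G_rat a b)" using nrd_1_in_Units[OF n] by (simp add: G_rat_def units_of_def)
  have *: "nrd (ta a) (ta b) (map_quad ta x) = 1" if "ta : real_embeddings" for ta
   using nrd_hom[of ta a b x] that n hom_1[of ta] by (simp add: real_embeddings_field_hom)
  hence "map_quad ta x : Units (quat_alg RT (ta a) (ta b))" if "ta : real_embeddings" for ta using nrd_1_in_Units that by blast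
  thus "to_G_inf x : G_inf_plus a b" using * by (auto simp: G_inf_plus_def to_G_inf_def split_real_places_def)
 qed
 thus ?thesis by (auto simp: Gamma1_quat_def Gamma_quat_def G_rat_plus_def)
qed

lemma Gamma1_quat_mult:
 assumes "x : Gamma1_quat a b U t" "y : Gamma1_quat a b U t"
 shows "mq a b x y : Gamma1_quat a b U t" using assms subgroup.m_closed[OF conj_U_subgroup] unfolding Gamma1_quat_iff
 by (simp add: nrd_mult map_quad_finite_adeles_mult)

lemma map_quad_finite_adeles_1: "map_quad to_finite_adeles (1, 0, 0, 0) = \<one>\<^bsub>G_fin a b\<^esub>"
proof -
 interpret R: cring "RT :: 'f ring" by (rule cring_from_type_algebra)
 interpret S: cring "finite_adeles :: (('f => int) => (nat => 'f) set) ring" by (rule finite_adeles_cring)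
 interpret h: ring_hom_cring "RT :: 'f ring" finite_adeles to_finite_adeles by unfold_locales (rule to_finite_adeles_hom[OF nf])
 show ?thesis using h.hom_one h.hom_zero unfolding G_fin_simps by (simp add: quat_alg_def quat_simps)
qed

lemma Gamma1_quat_1: "(1, 0, 0, 0) : Gamma1_quat a b U t" unfolding Gamma1_quat_iff map_quad_finite_adeles_1
 using subgroup.one_closed[OF conj_U_subgroup] by simp

lemma Gamma1_quat_conj:
 assumes "x : Gamma1_quat a b U t"
 shows "conj_quat x : Gamma1_quat a b U t"
proof -
 interpret G: group "G_fin a b" by (rule G_fin_group)
 let ?f = "map_quad to_finite_adeles"
 have x: "nrd a b x = 1" "?f x : conj_U" using assms by (auto simp: Gamma1_quat_iff)
 have xc: "?f x : carrier (G_fin a b)" using x(2) subgroup.subset[OF conj_U_subgroup] by blast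
 have 1: "?f (conj_quat x) \<otimes>\<^bsub>G_fin a b\<^esub> ?f x = \<one>\<^bsub>G_fin a b\<^esub>" "?f x \<otimes>\<^bsub>G_fin a b\<^esub> ?f (conj_quat x) = \<one>\<^bsub>G_fin a b\<^esub>"
  unfolding map_quad_finite_adeles_mult[symmetric] mult_conj_quat x(1) by (rule map_quad_finite_adeles_1)+
 hence "?f (conj_quat x) \<otimes>\<^bsub>QA\<^esub> ?f x = \<one>\<^bsub>QA\<^esub>" "?f x \<otimes>\<^bsub>QA\<^esub> ?f (conj_quat x) = \<one>\<^bsub>QA\<^esub>"
  unfolding G_fin_simps by (simp_all add: quat_alg_def)
 hence "?f (conj_quat x) : Units QA" unfolding Units_def using map_quad_carrier by blast
 hence "?f (conj_quat x) : carrier (G_fin a b)" by (simp add: G_fin_simps)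
 hence "?f (conj_quat x) = inv\<^bsub>G_fin a b\<^esub> (?f x)" using 1 xc by (intro G.inv_equality[symmetric])
 thus ?thesis unfolding Gamma1_quat_iff using x subgroup.m_inv_closed[OF conj_U_subgroup x(2)] by (simp add: nrd_conj)
qed

definition quad_ball where "quad_ball v N = Vball v N \<times> Vball v N \<times> Vball v N \<times> Vball v N"

text \<open>The sets \<open>W N\<close>, on which the components at v lie in a ball, are open, grow
  as N decreases and cover U. Compactness leaves finitely many, and the largest contains U.\<close>

lemma U_bounded:
 assumes v: "v : finite_places"
 shows "EX N. ALL u:U. map_quad (%x. x v) u : quad_ball v N"
proof -
 let ?T = "prod_topology finite_adeles_top (prod_topology finite_adeles_top
        (prod_topology finite_adeles_top (finite_adeles_top :: (('f => int) => (nat => 'f) set) topology)))"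
 define A where "A N = {x : carrier finite_adeles. x v : Vball v N}" for N
 define W where "W N = (%x. (x, inv\<^bsub>G_fin a b\<^esub> x)) -` ((A N \<times> A N \<times> A N \<times> A N) \<times> topspace ?T) \<inter> carrier (G_fin a b)" for N
 have top: "G_fin_top a b = pullback_topology (carrier (G_fin a b)) (%x. (x, inv\<^bsub>G_fin a b\<^esub> x)) (prod_topology ?T ?T)"
  by (simp add: G_fin_top_def Let_def)
 have "openin (prod_topology ?T ?T) ((A N \<times> A N \<times> A N \<times> A N) \<times> topspace ?T)" for N
 proof -
  have "openin finite_adeles_top (A N)" using openin_finite_adeles_component[OF v, of N] by (simp add: A_def)
  thus ?thesis by (intro openin_prod_Times_iff[THEN iffD2] disjI2 conjI openin_topspace)
 qed
 hence W_open: "openin (G_fin_top a b) (W N)" for N unfolding top openin_pullback_topology W_def by blast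
 have AM: "A N <= A M" if "M <= N" for M N using completion_ball_mono[OF v that] by (auto simp: A_def)
 hence WM: "W N <= W M" if "M <= N" for M N using that unfolding W_def by blast
 have "U <= \<Union>(range W)"
 proof
  fix u assume u: "u : U"
  hence ut: "u : topspace (G_fin_top a b)" using compactin_subset_topspace[OF Uc] by blast
  obtain u0 u1 u2 u3 where u': "u = (u0, u1, u2, u3)" by (cases u)
  have uc: "u : carrier (G_fin a b)" using u subgroup.subset[OF U] by blast
  hence "u : carrier QA" unfolding G_fin_simps by (simp add: Units_def)
  hence ui: "u0 : carrier finite_adeles" "u1 : carrier finite_adeles" "u2 : carrier finite_adeles" "u3 : carrier finite_adeles"
   unfolding u' by (auto simp: quat_alg_def)
  have "EX N. w : A N" if "w : carrier finite_adeles" for w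
   using completion_ball_ex[OF v finite_adeles_component[OF that v]] that by (auto simp: A_def)
  then obtain N0 N1 N2 N3 where N: "u0 : A N0" "u1 : A N1" "u2 : A N2" "u3 : A N3" using ui by meson
  define N where "N = Min {N0, N1, N2, N3}"
  have "N <= N0" "N <= N1" "N <= N2" "N <= N3" by (auto simp: N_def)
  hence "u : A N \<times> A N \<times> A N \<times> A N" unfolding u' using N AM by blast
  moreover have "inv\<^bsub>G_fin a b\<^esub> u : topspace ?T" using ut unfolding top topspace_pullback_topology by auto
  ultimately have "u : W N" using uc by (simp add: W_def)
  thus "u : \<Union>(range W)" by blast
 qed
 then obtain \<F> where F: "finite \<F>" "\<F> <= range W" "U <= \<Union>\<F>"
  using Uc W_open unfolding compactin_def by (metis (no_types, lifting) image_iff)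
 obtain I where I: "finite I" "\<F> = W ` I" using finite_subset_image[OF F(1,2)] by blast
 define N where "N = Min (insert 0 I)"
 have "u : W N" if u: "u : U" for u
 proof -
  obtain i where i: "i : I" "u : W i" using F(3) I u by blast
  have "N <= i" unfolding N_def using I(1) i(1) by (intro Min_le) auto
  thus ?thesis using WM i(2) by blast
 qed
 hence "map_quad (%x. x v) u : quad_ball v N" if "u : U" for u using that by (cases u) (fastforce simp: W_def A_def quad_ball_def)
 thus ?thesis by blast
qed

lemma quad_ball_ex:
 assumes v: "v : finite_places" and x: "x : carrier QA"
 shows "EX N. map_quad (%x. x v) x : quad_ball v N"
proof -
 obtain x0 x1 x2 x3 where x': "x = (x0, x1, x2, x3)" by (cases x)
 hence c: "x0 v : carrier (Kv v)" "x1 v : carrier (Kv v)" "x2 v : carrier (Kv v)" "x3 v : carrier (Kv v)"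
  using x finite_adeles_component[OF _ v] by (auto simp: quat_alg_def)
 obtain N0 N1 N2 N3 where N: "x0 v : Vball v N0" "x1 v : Vball v N1"
  "x2 v : Vball v N2" "x3 v : Vball v N3" using c completion_ball_ex[OF v] by meson
 define N where "N = Min {N0, N1, N2, N3}"
 have "N <= N0" "N <= N1" "N <= N2" "N <= N3" by (auto simp: N_def)
 hence "map_quad (%x. x v) x : quad_ball v N" unfolding x' quad_ball_def using N completion_ball_mono[OF v] by auto
 thus ?thesis by blast
qed

lemma G_fin_mult_ball:
 assumes v: "v : finite_places"
 shows "EX L. ALL x:carrier QA. ALL y:carrier QA. ALL N K.
  map_quad (%x. x v) x : quad_ball v N --> map_quad (%x. x v) y : quad_ball v K -->
  map_quad (%x. x v) (x \<otimes>\<^bsub>G_fin a b\<^esub> y) : quad_ball v (N + K + L)"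
proof -
 obtain La where La: "to_finite_adeles a v : Vball v La" using completion_ball_ex[OF v finite_adeles_component[OF to_finite_adeles_closed v]] by blast
 obtain Lb where Lb: "to_finite_adeles b v : Vball v Lb" using completion_ball_ex[OF v finite_adeles_component[OF to_finite_adeles_closed v]] by blast
 define L where "L = Min {0, La, Lb}"
 have L: "L <= 0" "L <= La" "L <= Lb" by (auto simp: L_def)
 have ab: "to_finite_adeles a v : Vball v L" "to_finite_adeles b v : Vball v L"
  using La Lb completion_ball_mono[OF v L(2)] completion_ball_mono[OF v L(3)] by auto
 have "map_quad (%x. x v) (x \<otimes>\<^bsub>G_fin a b\<^esub> y) : quad_ball v (N + K + 2 * L)"
  if "x : carrier QA" "y : carrier QA" "map_quad (%x. x v) x : quad_ball v N" "map_quad (%x. x v) y : quad_ball v K" for x y N K unfolding G_fin_simps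
  using map_quad_mult_quat[OF finite_adeles_cring completion_cring[OF v] finite_adeles_eval_hom[OF v]
    to_finite_adeles_closed to_finite_adeles_closed that(1,2)]
   mult_quat_ball[OF v L(1) ab that(3,4)[unfolded quad_ball_def]] by (simp add: quad_ball_def)
 thus ?thesis by blast
qed

text \<open>An element is t u inv(t) with u in U; the bounds for t, for its inverse and for all of U
  at v add up, with a fixed loss for each product.\<close>

lemma Gamma1_bounded:
 assumes v: "v : finite_places"
 shows "EX N. ALL x:Gamma1_quat a b U t. ALL x0 x1 x2 x3. x = (x0, x1, x2, x3) --> val_ge v N x0"
proof -
 interpret G: group "G_fin a b" by (rule G_fin_group)
 have GQ: "x : carrier QA" if "x : carrier (G_fin a b)" for x using that unfolding G_fin_simps by (simp add: Units_def)
 obtain L where L: "!!x y N K. x : carrier QA ==> y : carrier QA ==>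
  map_quad (%x. x v) x : quad_ball v N ==> map_quad (%x. x v) y : quad_ball v K ==>
  map_quad (%x. x v) (x \<otimes>\<^bsub>G_fin a b\<^esub> y) : quad_ball v (N + K + L)" using G_fin_mult_ball[OF v] by blast
 obtain N1 where N1: "map_quad (%x. x v) t : quad_ball v N1" using quad_ball_ex[OF v GQ[OF t]] by blast
 obtain N2 where N2: "map_quad (%x. x v) (inv\<^bsub>G_fin a b\<^esub> t) : quad_ball v N2"
  using quad_ball_ex[OF v GQ[OF G.inv_closed[OF t]]] by blast
 obtain N3 where N3: "!!u. u : U ==> map_quad (%x. x v) u : quad_ball v N3" using U_bounded[OF v] by blast
 let ?N = "(N1 + N3 + L) + N2 + L"
 have "val_ge v ?N x0" if x: "x : Gamma1_quat a b U t" "x = (x0, x1, x2, x3)" for x x0 x1 x2 x3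
 proof -
  obtain u where u: "u : U" "map_quad to_finite_adeles x = t \<otimes>\<^bsub>G_fin a b\<^esub> u \<otimes>\<^bsub>G_fin a b\<^esub> inv\<^bsub>G_fin a b\<^esub> t"
   using x(1) unfolding Gamma1_quat_iff conj_U_iff by blast
  have uc: "u : carrier (G_fin a b)" using u subgroup.subset[OF U] by blast
  have "map_quad (%x. x v) (map_quad to_finite_adeles x) : quad_ball v ?N" unfolding u(2) using t uc u(1) by (intro L GQ N1 N2 N3) auto
  hence "to_finite_adeles x0 v : Vball v ?N" unfolding x(2) by (simp add: quad_ball_def)
  thus ?thesis using v by (intro to_completion_ballD[OF v]) (simp add: to_finite_adeles_def)
 qed
 thus ?thesis by blast
qed

text \<open>If the trace \<open>c\<close> had negative valuation at \<open>v\<close>, then so would the traces of all the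
 \<open>2\<^sup>n\<close>-th powers, which are obtained by iterating \<open>c \<mapsto> c\<^sup>2 - 2\<close>, and they would tend to \<open>-\<infinity>\<close>.\<close>

lemma Gamma1_trace_algebraic_int:
 assumes x: "(x0, x1, x2, x3) : Gamma1_quat a b U t"
 shows "aint (2 * x0)" unfolding algebraic_int_iff_val_ge[OF nf]
proof (rule ballI, rule ccontr)
 fix v assume v: "v : finite_places" and neg: "~ val_ge v 0 (2 * x0)"
 obtain N where N: "!!y0 y1 y2 y3. (y0, y1, y2, y3) : Gamma1_quat a b U t ==> val_ge v N y0" using Gamma1_bounded[OF v] by blast
 have two: "val_ge v 0 2" using val_ge_of_int[OF v, of 2] by simp
 have "EX y0 y1 y2 y3. (y0, y1, y2, y3) : Gamma1_quat a b U t & 2 * y0 ~= 0 & v (2 * y0) <= - int n - 1" for n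
 proof (induction n)
  case 0
  thus ?case using x neg by (intro exI[of _ x0] exI) (auto simp: val_ge_def)
 next
  case (Suc n)
  then obtain y0 y1 y2 y3 where y: "(y0, y1, y2, y3) : Gamma1_quat a b U t" "2 * y0 ~= 0" "v (2 * y0) <= - int n - 1" by blast
  obtain z0 z1 z2 z3 where z: "mq a b (y0, y1, y2, y3) (y0, y1, y2, y3) = (z0, z1, z2, z3)" by (cases "mq a b (y0, y1, y2, y3) (y0, y1, y2, y3)")
  have "nrd a b (y0, y1, y2, y3) = 1" using y(1) by (simp add: Gamma1_quat_iff del: nrd.simps)
  moreover have "z0 = 2 * y0^2 - nrd a b (y0, y1, y2, y3)" using z by (auto simp: quat_simps sq_simps)
  ultimately have "2 * z0 = 2 * (2 * y0^2 - 1)" by simp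
  also have "... = (2 * y0)^2 + (- 2)" by (simp add: sq_simps)
  finally have z0: "2 * z0 = (2 * y0)^2 + (- 2)" .
  have vsq: "v ((2 * y0)^2) = 2 * v (2 * y0)" using val_power[OF v y(2), of 2] by simp
  have "v (- 2) >= 0" using two val_uminus[OF v, of 2] by (simp add: val_ge_def)
  hence "(2 * y0)^2 + (- 2) ~= 0 & v ((2 * y0)^2 + (- 2)) = v ((2 * y0)^2)" using vsq y(2,3) by (intro val_add_eq[OF v]) auto
  hence "2 * z0 ~= 0" "v (2 * z0) <= - int (Suc n) - 1" unfolding z0 using vsq y(3) by auto
  moreover have "(z0, z1, z2, z3) : Gamma1_quat a b U t" using Gamma1_quat_mult[OF y(1) y(1)] z by simp
  ultimately show ?case by blast
 qed
 then obtain y0 y1 y2 y3 where y: "(y0, y1, y2, y3) : Gamma1_quat a b U t" "2 * y0 ~= 0" "v (2 * y0) <= - int (nat \<bar>N\<bar>) - 1" by blast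
 have "val_ge v (0 + N) (2 * y0)" using two N[OF y(1)] by (rule val_ge_mult[OF v])
 thus False using y(2,3) by (simp add: val_ge_def)
qed

end

section \<open>Holomorphic change of variables\<close>

lemma nn_integral_absolutely_integrable_eq:
 fixes f g :: "'a::euclidean_space => real" and S T :: "'a set"
 assumes f: "f : borel_measurable borel" "!!x. f x >= 0" "S : sets borel"
  and g: "g : borel_measurable borel" "!!x. g x >= 0" "T : sets borel"
  and eq: "!!b. f absolutely_integrable_on S & integral S f = b \<longleftrightarrow> g absolutely_integrable_on T & integral T g = b"
 shows "(\<integral>\<^sup>+x. ennreal (f x) * indicator S x \<partial>lborel) = (\<integral>\<^sup>+x. ennreal (g x) * indicator T x \<partial>lborel)"
proof -
 \<comment> \<open>For a nonnegative measurable function, failure of absolute integrability means an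
   infinite integral; this lets the substitution theorem speak about both cases.\<close>
 have main: "(\<integral>\<^sup>+x. ennreal (f x) * indicator S x \<partial>lborel) =
  (if f absolutely_integrable_on S then ennreal (integral S f) else \<infinity>)"
  if f: "f : borel_measurable borel" "!!x. f x >= 0" "S : sets borel" for f :: "'a => real" and S :: "'a set"
 proof -
  have e: "(\<integral>\<^sup>+x. ennreal (f x) * indicator S x \<partial>lborel) = (\<integral>\<^sup>+x. ennreal (indicator S x *\<^sub>R f x) \<partial>lebesgue)"
   unfolding nn_integral_completion by (intro nn_integral_cong) (auto simp: indicator_def)
  have m: "(%x. indicator S x *\<^sub>R f x) : borel_measurable lebesgue" using f by (intro measurable_completion) auto
  have i: "f absolutely_integrable_on S \<longleftrightarrow> integrable lebesgue (%x. indicator S x *\<^sub>R f x)" by (simp add: set_integrable_def)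
  show ?thesis
  proof (cases "f absolutely_integrable_on S")
   case True
   hence "integral S f = (LINT x|lebesgue. indicator S x *\<^sub>R f x)"
    using set_lebesgue_integral_eq_integral(2)[OF True] by (simp add: set_lebesgue_integral_def)
   moreover have "(\<integral>\<^sup>+x. ennreal (indicator S x *\<^sub>R f x) \<partial>lebesgue) = ennreal (LINT x|lebesgue. indicator S x *\<^sub>R f x)"
    using True f(2) i by (intro nn_integral_eq_integral) auto
   ultimately show ?thesis using e True by simp
  next
   case False
   hence "~ (\<integral>\<^sup>+x. ennreal (norm_class.norm (indicator S x *\<^sub>R f x)) \<partial>lebesgue) < \<infinity>"
    using i m by (simp add: integrable_iff_bounded)
   moreover have "norm_class.norm (indicator S x *\<^sub>R f x) = indicator S x *\<^sub>R f x" for x using f(2) by (auto simp: indicator_def)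
   ultimately show ?thesis using e False by (simp add: less_top[symmetric])
  qed
 qed
 have "f absolutely_integrable_on S \<longleftrightarrow> g absolutely_integrable_on T" using eq by blast
 moreover have "integral S f = integral T g" if "f absolutely_integrable_on S" using eq that by blast
 ultimately show ?thesis using main[OF f] main[OF g] by simp
qed

text \<open>The substitution theorem is about maps between real vectors, so the complex plane has to
  be identified with \<open>real ^ 2\<close> together with its measure.\<close>

lemma lborel_complex_vec2:
 "distr lborel lborel (%v::real^2. Complex (v $ 1) (v $ 2)) = lborel"
proof (rule lborel_eqI[symmetric])
 have c: "continuous_on UNIV (%v::real^2. Complex (v $ 1) (v $ 2))" unfolding Complex_eq by (intro continuous_intros)
 hence [measurable]: "(%v::real^2. Complex (v $ 1) (v $ 2)) : borel_measurable borel" by (rule borel_measurable_continuous_onI)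
 fix l u :: complex assume le: "!!b. b : Basis ==> l \<bullet> b <= u \<bullet> b"
 let ?l = "vector [Re l, Im l] :: real^2" and ?u = "vector [Re u, Im u] :: real^2"
 have "(%v::real^2. Complex (v $ 1) (v $ 2)) -` box l u = box ?l ?u" by (auto simp: mem_box_cart forall_2 in_box_complex_iff)
 hence "emeasure (distr lborel lborel (%v::real^2. Complex (v $ 1) (v $ 2))) (box l u) = emeasure lborel (box ?l ?u)" by (subst emeasure_distr) auto
 also have "... = (\<Prod>b\<in>Basis. (?u - ?l) \<bullet> b)"
 proof -
  have "ALL i. ?l $ i <= ?u $ i" using le[of 1] le[of \<i>] by (simp add: forall_2 Basis_complex_def)
  thus ?thesis by (intro emeasure_lborel_box) (auto simp: Basis_vec_def inner_axis)
 qed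
 also have "(\<Prod>b\<in>Basis. (?u - ?l) \<bullet> b) = (\<Prod>b\<in>Basis. (u - l) \<bullet> b)"
 proof -
  have B: "(Basis :: (real^2) set) = {axis 1 1, axis 2 1}" by (auto simp: Basis_vec_def exhaust_2 UNIV_2)
  have "axis 1 1 ~= (axis 2 1 :: real^2)" by (simp add: axis_eq_axis)
  thus ?thesis by (simp add: B inner_axis Basis_complex_def)
 qed
 finally show "emeasure (distr lborel lborel (%v::real^2. Complex (v $ 1) (v $ 2))) (box l u) = (\<Prod>b\<in>Basis. (u - l) \<bullet> b)" .
qed simp

text \<open>Lebesgue measure with a density that a holomorphic bijection preserves up to the square
 of its derivative (which is its Jacobian determinant) is invariant.\<close>

lemma nn_integral_holomorphic_substitution:
 fixes w :: "complex => real"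
 assumes S: "S : sets borel"
  and T: "!!z. z : S ==> (T has_field_derivative T' z) (at z)" "inj_on T S" "T ` S = S"
  and m: "T : borel_measurable borel" "T' : borel_measurable borel"
  and w: "w : borel_measurable borel" "!!z. w z >= 0" "!!z. z : S ==> w (T z) * (cmod (T' z))^2 = w z"
  and A: "A : sets borel"
 shows "(\<integral>\<^sup>+z. ennreal (w z) * indicator (S \<inter> T -` A) z \<partial>lborel) = (\<integral>\<^sup>+z. ennreal (w z) * indicator (S \<inter> A) z \<partial>lborel)"
proof -
 define iot where "iot = (%v::real^2. Complex (v $ 1) (v $ 2))"
 define ka where "ka = (%z. vector [Re z, Im z] :: real^2)"
 have iotka: "iot (ka z) = z" "ka (iot v) = v" for z v by (auto simp: iot_def ka_def vec_eq_iff forall_2)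
 have ka_eq: "ka z = (\<chi> i. if i = 1 then Re z else Im z)" for z by (auto simp: ka_def vec_eq_iff forall_2)
 have iot_lin: "bounded_linear iot" unfolding linear_conv_bounded_linear[symmetric] by (auto intro!: linearI simp: iot_def complex_eq_iff)
 have ka_lin: "bounded_linear ka" unfolding linear_conv_bounded_linear[symmetric] by (auto intro!: linearI simp: ka_eq vec_eq_iff)
 have iot_m [measurable]: "iot : borel_measurable borel" using iot_lin by (intro borel_measurable_continuous_onI linear_continuous_on)
 have ka_m [measurable]: "ka : borel_measurable borel" using ka_lin by (intro borel_measurable_continuous_onI linear_continuous_on)
 note [measurable] = S A m w(1)
 have L: "(\<integral>\<^sup>+z. h z \<partial>lborel) = (\<integral>\<^sup>+v. h (iot v) \<partial>lborel)" if "h : borel_measurable borel" for h :: "complex => ennreal"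
 proof -
  have "(\<integral>\<^sup>+z. h z \<partial>distr lborel lborel iot) = (\<integral>\<^sup>+v. h (iot v) \<partial>lborel)"
   using that by (intro nn_integral_distr) auto
  thus ?thesis using lborel_complex_vec2 by (simp add: iot_def)
 qed
 define E where "E = iot -` (S \<inter> T -` A)"
 have E_m: "E : sets borel"
 proof -
  have "S \<inter> T -` A : sets borel" using measurable_sets[OF m(1) A] S by auto
  thus ?thesis unfolding E_def using measurable_sets[OF iot_m] by auto
 qed
 define g where "g v = ka (T (iot v))" for v
 define g' where "g' v h = ka (T' (iot v) * iot h)" for v h
 have gE: "g ` E = iot -` (S \<inter> A)"
 proof
  show "g ` E <= iot -` (S \<inter> A)" using T(3) by (auto simp: g_def E_def iotka)
  show "iot -` (S \<inter> A) <= g ` E"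
  proof
   fix v assume "v : iot -` (S \<inter> A)"
   then obtain z where z: "z : S" "iot v = T z" using T(3) by auto
   hence "v = g (ka z)" unfolding g_def iotka(1) using iotka(2)[of v] by simp
   moreover have "ka z : E" using z \<open>v : _\<close> by (auto simp: E_def iotka)
   ultimately show "v : g ` E" by blast
  qed
 qed
 have gE_m: "g ` E : sets borel" unfolding gE using measurable_sets[OF iot_m, of "S \<inter> A"] S A by auto
 have inj: "inj_on g E"
 proof (rule inj_onI)
  fix x y assume xy: "x : E" "y : E" "g x = g y"
  hence "T (iot x) = T (iot y)" unfolding g_def by (metis iotka(1))
  hence "iot x = iot y" using T(2) xy by (auto simp: E_def inj_on_def)
  thus "x = y" by (metis iotka(2))
 qed
 have der: "(g has_derivative g' v) (at v within E)" if "v : E" for v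
 proof -
  have "(T has_derivative (%h. T' (iot v) * h)) (at (iot v))" using T(1)[of "iot v"] that by (simp add: E_def has_field_derivative_def)
  hence "((%v. T (iot v)) has_derivative (%h. T' (iot v) * iot h)) (at v)"
   using has_derivative_compose[OF bounded_linear_imp_has_derivative[OF iot_lin]] by blast
  hence "((%v. ka (T (iot v))) has_derivative (%h. ka (T' (iot v) * iot h))) (at v)" by (rule bounded_linear.has_derivative[OF ka_lin])
  thus ?thesis unfolding g_def[abs_def] g'_def[abs_def] by (rule has_derivative_at_withinI)
 qed
 \<comment> \<open>Multiplication by a complex number, as a real 2 by 2 matrix, has its squared
   modulus as determinant.\<close>
 have det: "\<bar>det (matrix (g' v))\<bar> = (cmod (T' (iot v)))^2" for v
 proof -
  have "iot (axis 1 1) = 1" "iot (axis 2 1) = \<i>" by (auto simp: iot_def axis_def complex_eq_iff)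
  hence "det (matrix (g' v)) = (Re (T' (iot v)))^2 + (Im (T' (iot v)))^2" by (simp add: det_2 matrix_def g'_def ka_eq power2_eq_square)
  thus ?thesis by (simp add: cmod_power2)
 qed
 \<comment> \<open>The substitution theorem has vector-valued integrands, hence the detour through
   \<open>real ^ 1\<close>.\<close>
 define F where "F v = (vec (w (iot v)) :: real^1)" for v
 have cov: "(%x. \<bar>det (matrix (g' x))\<bar> *\<^sub>R F (g x)) absolutely_integrable_on E \<and>
   integral E (%x. \<bar>det (matrix (g' x))\<bar> *\<^sub>R F (g x)) = b
  \<longleftrightarrow> F absolutely_integrable_on (g ` E) & integral (g ` E) F = b" for b
  using E_m by (intro has_absolute_integral_change_of_variables[OF _ der inj]) auto
 have c1: "F absolutely_integrable_on (g ` E) \<longleftrightarrow> (%v. w (iot v)) absolutely_integrable_on (g ` E)"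
  by (subst absolutely_integrable_on_1_iff) (simp add: F_def)
 have c2: "(%x. \<bar>det (matrix (g' x))\<bar> *\<^sub>R F (g x)) absolutely_integrable_on E \<longleftrightarrow> (%v. (cmod (T' (iot v)))^2 * w (T (iot v))) absolutely_integrable_on E"
  by (subst absolutely_integrable_on_1_iff) (simp add: F_def det g_def iotka)
 have c3: "integral (g ` E) F = vec (integral (g ` E) (%v. w (iot v)))" by (subst integral_on_1_eq) (simp add: F_def)
 have c4: "integral E (%x. \<bar>det (matrix (g' x))\<bar> *\<^sub>R F (g x)) = vec (integral E (%v. (cmod (T' (iot v)))^2 * w (T (iot v))))"
  by (subst integral_on_1_eq) (simp add: F_def det g_def iotka)
 have vec1: "vec x = (vec y :: real^1) \<longleftrightarrow> x = y" for x y :: real by (simp add: vec_eq_iff)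
 have "(\<integral>\<^sup>+v. ennreal ((cmod (T' (iot v)))^2 * w (T (iot v))) * indicator E v \<partial>lborel)
   = (\<integral>\<^sup>+v. ennreal (w (iot v)) * indicator (g ` E) v \<partial>lborel)"
 proof (rule nn_integral_absolutely_integrable_eq)
  show "(%v. (cmod (T' (iot v)))\<^sup>2 * w (T (iot v))) absolutely_integrable_on E & integral E (%v. (cmod (T' (iot v)))\<^sup>2 * w (T (iot v))) = b
   \<longleftrightarrow> (%v. w (iot v)) absolutely_integrable_on g ` E & integral (g ` E) (%v. w (iot v)) = b" for b
   using cov[of "vec b"] unfolding c1 c2 c3 c4 vec1 .
 qed (use w(2) E_m gE_m in \<open>auto intro!: mult_nonneg_nonneg\<close>)
 also have "(\<integral>\<^sup>+v. ennreal ((cmod (T' (iot v)))^2 * w (T (iot v))) * indicator E v \<partial>lborel)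
   = (\<integral>\<^sup>+v. ennreal (w (iot v)) * indicator (S \<inter> T -` A) (iot v) \<partial>lborel)"
  using w(3) by (intro nn_integral_cong) (auto simp: E_def indicator_def mult.commute)
 also have "... = (\<integral>\<^sup>+z. ennreal (w z) * indicator (S \<inter> T -` A) z \<partial>lborel)"
 proof -
  have "S \<inter> T -` A : sets borel" using measurable_sets[OF m(1) A] S by auto
  thus ?thesis by (intro L[symmetric]) auto
 qed
 also have "(\<integral>\<^sup>+v. ennreal (w (iot v)) * indicator (g ` E) v \<partial>lborel)
   = (\<integral>\<^sup>+v. ennreal (w (iot v)) * indicator (S \<inter> A) (iot v) \<partial>lborel)"
  unfolding gE by (intro nn_integral_cong) (auto simp: indicator_def)
 also have "... = (\<integral>\<^sup>+z. ennreal (w z) * indicator (S \<inter> A) z \<partial>lborel)" by (intro L[symmetric]) auto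
 finally show ?thesis .
qed

lemma lborel_complex_rotate:
 fixes c :: complex
 assumes "cmod c = 1"
 shows "distr lborel lborel (%z. c * z) = lborel"
proof (rule measure_eqI)
 have c0: "c ~= 0" using assms by auto
 fix A assume "A : sets (distr lborel lborel (%z. c * z))"
 hence A: "A : sets borel" by simp
 have "(\<integral>\<^sup>+z. ennreal 1 * indicator (UNIV \<inter> (%z. c * z) -` A) z \<partial>lborel) = (\<integral>\<^sup>+z. ennreal 1 * indicator (UNIV \<inter> A) z \<partial>lborel)"
 proof (rule nn_integral_holomorphic_substitution[where T' = "%_. c"])
  show "range (%z. c * z) = UNIV" using c0 by (auto intro!: image_eqI[of _ _ "_ / c"])
  show "((%z. c * z) has_field_derivative c) (at z)" for z by (auto intro!: derivative_eq_intros)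
 qed (use c0 assms A in \<open>auto simp: inj_on_def\<close>)
 moreover have "(%z. c * z) -` A : sets borel" using measurable_sets[of "%z. c * z" borel borel A] A by simp
 ultimately show "emeasure (distr lborel lborel (%z. c * z)) A = emeasure lborel A" using A by (simp add: emeasure_distr)
qed simp

section \<open>Product measures\<close>

lemma distr_PiM_preserving:
 fixes T :: "'i => 'a => 'a"
 assumes I: "finite I" and M: "sigma_finite_measure M"
  and T: "!!i. i : I ==> T i : measurable M M" "!!i. i : I ==> distr M M (T i) = M"
 shows "distr (PiM I (%_. M)) (PiM I (%_. M)) (%x. \<lambda>i\<in>I. T i (x i)) = PiM I (%_. M)"
proof -
 interpret product_sigma_finite "%_. M" using M by (simp add: product_sigma_finite_def)
 interpret finite_product_sigma_finite "%_. M" I by unfold_locales (rule I)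
 have m: "(%x. \<lambda>i\<in>I. T i (x i)) : measurable (PiM I (%_. M)) (PiM I (%_. M))"
 proof (rule measurable_restrict)
  fix i assume i: "i : I"
  have "(%x. x i) : measurable (PiM I (%_. M)) M" using i by (rule measurable_component_singleton)
  thus "(%x. T i (x i)) : measurable (PiM I (%_. M)) M" using T(1)[OF i] by (rule measurable_compose)
 qed
 show ?thesis
 proof (rule PiM_eqI[OF I])
  fix A assume A: "!!i. i : I ==> A i : sets M"
  have TA: "T i -` A i \<inter> space M : sets M" if "i : I" for i using measurable_sets[OF T(1) A] that by blast
  have "(%x. \<lambda>i\<in>I. T i (x i)) -` PiE I A \<inter> space (PiM I (%_. M)) = PiE I (%i. T i -` A i \<inter> space M)"
   by (auto simp: space_PiM PiE_iff)
  hence "emeasure (distr (PiM I (%_. M)) (PiM I (%_. M)) (%x. \<lambda>i\<in>I. T i (x i))) (PiE I A)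
    = emeasure (PiM I (%_. M)) (PiE I (%i. T i -` A i \<inter> space M))" using A I by (subst emeasure_distr[OF m]) (auto intro!: sets_PiM_I_finite)
  also have "... = (\<Prod>i\<in>I. emeasure M (T i -` A i \<inter> space M))" using TA by (intro measure_times) auto
  also have "... = (\<Prod>i\<in>I. emeasure M (A i))"
  proof (intro prod.cong refl)
   fix i assume i: "i : I"
   have "emeasure M (A i) = emeasure (distr M M (T i)) (A i)" using T(2)[OF i] by simp
   also have "... = emeasure M (T i -` A i \<inter> space M)" using T(1)[OF i] A[OF i] by (rule emeasure_distr)
   finally show "emeasure M (T i -` A i \<inter> space M) = emeasure M (A i)" by simp
  qed
  finally show "emeasure (distr (PiM I (%_. M)) (PiM I (%_. M)) (%x. \<lambda>i\<in>I. T i (x i))) (PiE I A) = (\<Prod>i\<in>I. emeasure M (A i))" .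
 qed simp
qed

lemma vec_lambda_measurable:
 "(%f. \<chi> j. f j) : measurable (PiM UNIV (%_::'r::finite. borel :: complex measure)) (borel :: (complex^'r) measure)"
proof (subst borel_measurable_euclidean_space, intro ballI)
 fix i :: "complex^'r" assume "i : Basis"
 then obtain j u where i: "i = axis j u" by (auto simp: Basis_vec_def)
 have "(%f. f j \<bullet> u) : borel_measurable (PiM UNIV (%_::'r. borel :: complex measure))" by measurable
 thus "(%f. (\<chi> j. f j) \<bullet> i) : borel_measurable (PiM UNIV (%_::'r. borel :: complex measure))" by (simp add: i inner_axis)
qed

lemma lborel_complex_vec:
 "(lborel :: (complex^'r::finite) measure) = distr (PiM UNIV (%_. lborel)) borel (%f. \<chi> j. f j)"
proof (rule lborel_eqI)
 interpret product_sigma_finite "%_::'r. lborel :: complex measure" by (simp add: product_sigma_finite_def lborel.sigma_finite_measure_axioms)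
 interpret finite_product_sigma_finite "%_::'r. lborel :: complex measure" UNIV by unfold_locales simp
 have m: "(%f. \<chi> j. f j) : measurable (PiM UNIV (%_::'r. lborel :: complex measure)) borel"
  using vec_lambda_measurable by (simp cong: measurable_cong_sets sets_PiM_cong)
 fix l u :: "complex^'r" assume le: "!!b. b : Basis ==> l \<bullet> b <= u \<bullet> b"
 have le': "(l $ j) \<bullet> b <= (u $ j) \<bullet> b" if "b : Basis" for j b using le[of "axis j b"] that by (auto simp: Basis_vec_def inner_axis)
 have "(%f. \<chi> j. f j) -` box l u = PiE UNIV (%j. box (l $ j) (u $ j))" by (auto simp: mem_box Basis_vec_def inner_axis PiE_iff)
 hence "emeasure (distr (PiM UNIV (%_. lborel)) borel (%f. \<chi> j. f j)) (box l u)
  = emeasure (PiM UNIV (%_::'r. lborel)) (PiE UNIV (%j. box (l $ j) (u $ j)))" by (subst emeasure_distr[OF m]) (auto simp: space_PiM)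
 also have "... = (\<Prod>j\<in>UNIV. emeasure lborel (box (l $ j) (u $ j)))" by (intro measure_times) auto
 also have "... = (\<Prod>j\<in>UNIV. ennreal (\<Prod>b\<in>Basis. (u $ j - l $ j) \<bullet> b))"
  using le' by (intro prod.cong refl emeasure_lborel_box) auto
 also have "... = ennreal (\<Prod>j\<in>UNIV. \<Prod>b\<in>Basis. (u $ j - l $ j) \<bullet> b)"
  using le' by (intro prod_ennreal prod_nonneg) (auto simp: inner_diff_left)
 also have "(\<Prod>j\<in>UNIV. \<Prod>b\<in>Basis. (u $ j - l $ j) \<bullet> b) = (\<Prod>b\<in>Basis. (u - l) \<bullet> b)"
 proof -
  have B: "(Basis :: (complex^'r) set) = (%(j, b). axis j b) ` (UNIV \<times> Basis)" by (auto simp: Basis_vec_def)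
  have "inj_on (%(j, b). axis j b) ((UNIV :: 'r set) \<times> (Basis :: complex set))" by (auto simp: inj_on_def axis_eq_axis)
  thus ?thesis unfolding B by (subst prod.reindex) (auto simp: prod.cartesian_product inner_axis intro!: prod.cong)
 qed
 finally show "emeasure (distr (PiM UNIV (%_. lborel)) borel (%f. \<chi> j. f j)) (box l u) = ennreal (\<Prod>b\<in>Basis. (u - l) \<bullet> b)" .
qed simp

lemma PiM_density:
 fixes w :: "complex => ennreal"
 assumes w: "w : borel_measurable borel" and sf: "sigma_finite_measure (density lborel w)"
 shows "PiM (UNIV :: 'r::finite set) (%_. density lborel w)
  = density (PiM UNIV (%_. lborel)) (%f. \<Prod>j\<in>UNIV. w (f j))"
proof -
 interpret P: product_sigma_finite "%_::'r. lborel :: complex measure" by (simp add: product_sigma_finite_def lborel.sigma_finite_measure_axioms)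
 interpret product_sigma_finite "%_::'r. density lborel w" using sf by (simp add: product_sigma_finite_def)
 have [measurable]: "w : borel_measurable lborel" using w by simp
 have wm: "(%f. \<Prod>j\<in>UNIV. w (f j)) : borel_measurable (PiM UNIV (%_::'r. lborel))" by measurable
 show ?thesis
 proof (rule PiM_eqI[symmetric])
  show "sets (density (PiM UNIV (%_. lborel)) (%f. \<Prod>j\<in>UNIV. w (f j))) = sets (PiM UNIV (%_::'r. density lborel w))"
   by (simp cong: sets_PiM_cong)
  fix A :: "'r => complex set" assume A: "!!j. j : UNIV ==> A j : sets (density lborel w)"
  hence A': "A j : sets borel" for j by simp
  have "PiE UNIV A : sets (PiM UNIV (%_::'r. lborel))" using A' by (intro sets_PiM_I_finite) auto
  hence "emeasure (density (PiM UNIV (%_. lborel)) (%f. \<Prod>j\<in>UNIV. w (f j))) (PiE UNIV A)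
   = (\<integral>\<^sup>+f. (\<Prod>j\<in>UNIV. w (f j)) * indicator (PiE UNIV A) f \<partial>PiM UNIV (%_::'r. lborel))"
   by (rule emeasure_density[OF wm])
  also have "... = (\<integral>\<^sup>+f. (\<Prod>j\<in>UNIV. w (f j) * indicator (A j) (f j)) \<partial>PiM UNIV (%_::'r. lborel))"
  proof (intro nn_integral_cong)
   fix f :: "'r => complex"
   have "indicator (PiE UNIV A) f = (\<Prod>j\<in>UNIV. indicator (A j) (f j) :: ennreal)"
    by (cases "f : PiE UNIV A") (auto simp: indicator_def PiE_iff prod_zero_iff)
   thus "(\<Prod>j\<in>UNIV. w (f j)) * indicator (PiE UNIV A) f = (\<Prod>j\<in>UNIV. w (f j) * indicator (A j) (f j))" by (simp add: prod.distrib)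
  qed
  also have "... = (\<Prod>j\<in>UNIV. \<integral>\<^sup>+z. w z * indicator (A j) z \<partial>lborel)"
   using A' by (intro P.product_nn_integral_prod) auto
  also have "... = (\<Prod>j\<in>UNIV. emeasure (density lborel w) (A j))" using A' by (intro prod.cong refl emeasure_density[symmetric]) auto
  finally show "emeasure (density (PiM UNIV (%_. lborel)) (%f. \<Prod>j\<in>UNIV. w (f j))) (PiE UNIV A)
   = (\<Prod>j\<in>UNIV. emeasure (density lborel w) (A j))" .
 qed simp
qed

lemma density_prod_complex_vec:
 fixes w :: "complex => ennreal"
 assumes w: "w : borel_measurable borel" and sf: "sigma_finite_measure (density lborel w)"
 shows "density (lborel :: (complex^'r::finite) measure) (%z. \<Prod>j\<in>UNIV. w (z $ j))
  = distr (PiM UNIV (%_. density lborel w)) borel (%f. \<chi> j. f j)"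
proof -
 have m: "(%f. \<chi> j. f j) : measurable (PiM UNIV (%_::'r. lborel :: complex measure)) borel"
  using vec_lambda_measurable by (simp cong: measurable_cong_sets sets_PiM_cong)
 have nth: "(%z::complex^'r. z $ j) : borel_measurable borel" for j by (intro borel_measurable_continuous_onI continuous_intros)
 have "(%z::complex^'r. \<Prod>j\<in>UNIV. w (z $ j)) : borel_measurable borel" using measurable_compose[OF nth w] by measurable
 thus ?thesis unfolding lborel_complex_vec PiM_density[OF assms] by (subst density_distr[OF _ m]) simp_all
qed

lemma distr_componentwise:
 fixes w :: "complex => ennreal" and T :: "'r::finite => complex => complex"
 assumes w: "w : borel_measurable borel" and sf: "sigma_finite_measure (density lborel w)"
  and T: "!!j. T j : borel_measurable borel" "!!j. distr (density lborel w) (density lborel w) (T j) = density lborel w"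
 defines "mu \<equiv> density (lborel :: (complex^'r) measure) (%z. \<Prod>j\<in>UNIV. w (z $ j))"
 shows "distr mu mu (%z. \<chi> j. T j (z $ j)) = mu"
proof -
 let ?M = "density lborel w"
 let ?P = "PiM (UNIV :: 'r set) (%_. ?M)"
 let ?v = "%f. (\<chi> j. f j) :: complex^'r"
 have m: "?v : measurable ?P borel" using vec_lambda_measurable by (simp cong: measurable_cong_sets sets_PiM_cong)
 have Tm: "T j : measurable ?M ?M" for j using T(1)[of j] by simp
 have Pm: "(%x. \<lambda>j\<in>UNIV. T j (x j)) : measurable ?P ?P"
 proof (rule measurable_restrict)
  fix j :: 'r
  have "(%x. x j) : measurable ?P ?M" by (rule measurable_component_singleton) simp
  thus "(%x. T j (x j)) : measurable ?P ?M" using Tm[of j] by (rule measurable_compose)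
 qed
 have nth: "(%z::complex^'r. z $ j) : borel_measurable borel" for j by (intro borel_measurable_continuous_onI continuous_intros)
 have vm: "(%z::complex^'r. \<chi> j. T j (z $ j)) : borel_measurable borel"
 proof -
  have "(%z::complex^'r. \<lambda>j\<in>UNIV. T j (z $ j)) : measurable borel (PiM UNIV (%_. borel))"
   using measurable_compose[OF nth T(1)] by (intro measurable_restrict)
  from measurable_compose[OF this vec_lambda_measurable] show ?thesis by simp
 qed
 have mu: "mu = distr ?P borel ?v" unfolding mu_def by (rule density_prod_complex_vec[OF w sf])
 have "distr mu mu (%z. \<chi> j. T j (z $ j)) = distr (distr ?P borel ?v) borel (%z. \<chi> j. T j (z $ j))" unfolding mu by (rule distr_cong) auto
 also have "... = distr ?P borel (%f. \<chi> j. T j (f j))" by (subst distr_distr[OF vm m]) (simp add: o_def)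
 also have "... = distr (distr ?P ?P (%x. \<lambda>j\<in>UNIV. T j (x j))) borel ?v" by (subst distr_distr[OF m Pm]) (simp add: o_def restrict_UNIV)
 also have "... = mu" unfolding distr_PiM_preserving[OF finite sf Tm T(2)] mu ..
 finally show ?thesis .
qed

section \<open>Moebius transformations and displacement\<close>

lemma det2_mult: "det2 (mmul g h) = det2 g * (det2 h :: 'a::comm_ring_1)" by (cases g; cases h) (simp add: quat_simps algebra_simps)

fun inv2 :: "'a::comm_ring_1 quad => 'a quad" where
 "inv2 (p, q, r, s) = (s, - q, - r, p)"

lemma det2_inv2: "det2 (inv2 g) = det2 g" by (cases g) (simp add: mult.commute)

lemma mult_inv2:
 fixes g :: "'a::comm_ring_1 quad"
 assumes "det2 g = 1"
 shows "mmul (inv2 g) g = (1, 0, 0, 1)" "mmul g (inv2 g) = (1, 0, 0, 1)" using assms by (cases g; simp add: quat_simps algebra_simps)+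

lemma autfac_nonzero: "det2 g = 1 ==> 0 < Im z ==> autfac g z ~= 0"
proof (cases g)
 fix p q r s assume g: "g = (p, q, r, s)" and d: "det2 g = 1" and z: "0 < Im z"
 show ?thesis
 proof
  assume "autfac g z = 0"
  hence e: "Re (of_real r * z + of_real s) = 0" "Im (of_real r * z + of_real s) = 0" using g by simp_all
  hence "r = 0" using z by simp
  thus False using e d g by simp
 qed
qed

lemma Im_moebius:
 assumes "det2 g = 1" "0 < Im z"
 shows "Im (moebius g z) = Im z / (cmod (autfac g z))^2"
proof -
 obtain p q r s where g: "g = (p, q, r, s)" by (cases g)
 let ?d = "of_real r * z + of_real s"
 have "Im (moebius g z) = Im ((of_real p * z + of_real q) * cnj ?d) / (cmod ?d)^2"
  unfolding g moebius.simps by (simp add: complex_div_cnj[of _ ?d] Im_divide_of_real)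
 also have "Im ((of_real p * z + of_real q) * cnj ?d) = (p * s - q * r) * Im z" by (simp add: algebra_simps)
 finally show ?thesis using assms g by simp
qed

lemma Im_moebius_pos: "det2 g = 1 ==> 0 < Im z ==> 0 < Im (moebius g z)" using autfac_nonzero by (simp add: Im_moebius)

lemma mult_add_divide_cancel: "d ~= 0 ==> (x * (n / d) + y) * d = x * n + y * (d :: 'a::field)" by (simp add: distrib_right)

lemma add_divide_common: "d ~= 0 ==> x * (n / d) + y = (x * n + y * d) / (d :: 'a::field)" by (simp add: add_divide_distrib)

lemma divide_divide_cancel_right: "d ~= 0 ==> (x / d) / (y / d) = x / (y :: 'a::field)" by simp

lemma autfac_mult:
 assumes "det2 h = 1" "0 < Im z"
 shows "autfac (mmul g h) z = autfac g (moebius h z) * autfac h z"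
proof -
 obtain p q r s where g: "g = (p, q, r, s)" by (cases g)
 obtain p' q' r' s' where h: "h = (p', q', r', s')" by (cases h)
 let ?d = "of_real r' * z + of_real s'"
 let ?n = "of_real p' * z + of_real q'"
 have "?d ~= 0" using autfac_nonzero[OF assms] h by simp
 hence "(of_real r * (?n / ?d) + of_real s) * ?d = of_real r * ?n + of_real s * ?d" by (rule mult_add_divide_cancel)
 thus ?thesis unfolding g h by (simp add: quat_simps) (simp add: algebra_simps)
qed

lemma moebius_mult:
 assumes "det2 h = 1" "0 < Im z"
 shows "moebius (mmul g h) z = moebius g (moebius h z)"
proof -
 obtain p q r s where g: "g = (p, q, r, s)" by (cases g)
 obtain p' q' r' s' where h: "h = (p', q', r', s')" by (cases h)
 let ?d = "of_real r' * z + of_real s'"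
 let ?n = "of_real p' * z + of_real q'"
 have d: "?d ~= 0" using autfac_nonzero[OF assms] h by simp
 have "moebius g (moebius h z) = (of_real p * (?n / ?d) + of_real q) / (of_real r * (?n / ?d) + of_real s)" unfolding g h by simp
 also have "... = ((of_real p * ?n + of_real q * ?d) / ?d) / ((of_real r * ?n + of_real s * ?d) / ?d)" by (simp only: add_divide_common[OF d])
 also have "... = (of_real p * ?n + of_real q * ?d) / (of_real r * ?n + of_real s * ?d)" using d by (intro divide_divide_cancel_right)
 finally show ?thesis unfolding g h by (simp add: quat_simps) (simp add: algebra_simps)
qed

lemma moebius_inv2: "det2 g = 1 ==> 0 < Im z ==> moebius (inv2 g) (moebius g z) = z" by (subst moebius_mult[symmetric]) (auto simp: mult_inv2)

lemma moebius_inv2': "det2 g = 1 ==> 0 < Im z ==> moebius g (moebius (inv2 g) z) = z"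
 using moebius_mult[of "inv2 g" z g] by (simp add: mult_inv2 det2_inv2)

lemma moebius_derivative:
 assumes "det2 g = 1" "0 < Im z"
 shows "(moebius g has_field_derivative 1 / (autfac g z)^2) (at z)"
proof -
 obtain p q r s where g: "g = (p, q, r, s)" by (cases g)
 have d: "of_real r * z + of_real s ~= 0" using autfac_nonzero[OF assms] g by simp
 have "complex_of_real (p * s - q * r) = 1" using assms(1) g by simp
 hence e: "complex_of_real p * of_real s = 1 + of_real q * of_real r" by (simp add: algebra_simps flip: of_real_mult of_real_add)
 have "((%z. (of_real p * z + of_real q) / (of_real r * z + of_real s)) has_field_derivative
  ((of_real p * (of_real r * z + of_real s) - (of_real p * z + of_real q) * of_real r) / (of_real r * z + of_real s)^2)) (at z)"
  using d by (auto intro!: derivative_eq_intros simp: power2_eq_square)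
 moreover have "of_real p * (of_real r * z + of_real s) - (of_real p * z + of_real q) * of_real r = 1" by (simp add: algebra_simps e)
 moreover have "moebius g = (%z. (of_real p * z + of_real q) / (of_real r * z + of_real s))" by (simp add: g fun_eq_iff)
 ultimately show ?thesis by (simp add: g)
qed

lemma moebius_measurable [measurable]: "moebius g : borel_measurable borel"
proof -
 obtain p q r s where g: "g = (p, q, r, s)" by (cases g)
 have "moebius g = (%z. (of_real p * z + of_real q) / (of_real r * z + of_real s))" by (simp add: g fun_eq_iff)
 thus ?thesis by simp
qed

lemma autfac_measurable [measurable]: "autfac g : borel_measurable borel"
proof -
 obtain p q r s where g: "g = (p, q, r, s)" by (cases g)
 have "autfac g = (%z. of_real r * z + of_real s)" by (simp add: g fun_eq_iff)
 thus ?thesis by simp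
qed

text \<open>The displacement of \<open>z\<close> controls the discriminant: with
 \<open>Q(z) = r z\<^sup>2 + (s - p) z - q\<close> one has \<open>\<bar>Q(z)\<bar>\<^sup>2 = (Re part)\<^sup>2 + y\<^sup>2 (tr\<^sup>2 - 4)\<close>.\<close>

lemma displacement:
 assumes "det2 (p, q, r, s) = 1" "0 < Im z"
 shows "(cmod (of_real r * z^2 + of_real (s - p) * z - of_real q))^2
  = (cmod (moebius (p, q, r, s) z - z))^2 * Im z / Im (moebius (p, q, r, s) z)"
  and "((p + s)^2 - 4) * (Im z)^2 <= (cmod (of_real r * z^2 + of_real (s - p) * z - of_real q))^2"
proof -
 let ?d = "of_real r * z + of_real s"
 let ?Q = "of_real r * z^2 + of_real (s - p) * z - of_real q"
 have d: "?d ~= 0" using autfac_nonzero[OF assms] by simp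
 have "moebius (p, q, r, s) z - z = - ?Q / ?d" using d by (simp add: field_simps power2_eq_square)
 hence "(cmod (moebius (p, q, r, s) z - z))^2 = (cmod ?Q)^2 / (cmod ?d)^2" by (simp add: norm_divide power_divide norm_minus_commute)
 thus "(cmod ?Q)^2 = (cmod (moebius (p, q, r, s) z - z))^2 * Im z / Im (moebius (p, q, r, s) z)"
  using assms(2) d Im_moebius[OF assms] unfolding autfac.simps by (simp del: moebius.simps)
 obtain x y where z: "z = Complex x y" by (cases z)
 have ps: "p * s = 1 + q * r" using assms(1) by simp
 have "(cmod ?Q)^2 = (r * (x^2 - y^2) + (s - p) * x - q)^2 + (2 * r * x * y + (s - p) * y)^2"
 proof -
  have "Re ?Q = r * (x^2 - y^2) + (s - p) * x - q" "Im ?Q = 2 * r * x * y + (s - p) * y" by (simp_all add: z sq_simps)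
  thus ?thesis by (simp only: cmod_power2)
 qed
 also have "... = (r * (x^2 + y^2) + (s - p) * x - q)^2 + y^2 * ((s - p)^2 + 4 * r * q)" by (simp add: sq_simps)
 also have "(s - p)^2 + 4 * r * q = (p + s)^2 - 4" using ps by (simp add: sq_simps)
 finally show "((p + s)^2 - 4) * (Im z)^2 <= (cmod ?Q)^2" by (simp add: z mult.commute)
qed

lemma elliptic_fixed_point:
 assumes "det2 (p, q, r, s) = 1" "\<bar>p + s\<bar> < 2"
 shows "EX z. 0 < Im z & moebius (p, q, r, s) z = z"
proof -
 have ps: "p * s = 1 + q * r" using assms(1) by simp
 define D where "D = 4 - (p + s)^2"
 have D: "D > 0" using power_strict_mono[OF assms(2), of 2] by (simp add: D_def)
 have r0: "r ~= 0"
 proof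
  assume "r = 0"
  hence "D = - ((p - s)^2)" using ps by (simp add: D_def sq_simps)
  thus False using D zero_le_power2[of "p - s"] by linarith
 qed
 \<comment> \<open>The root in the upper half-plane of r z^2 + (s - p) z - q, whose discriminant is
   -D.\<close>
 define x y where "x = (p - s) / (2 * r)" and "y = sqrt D / (2 * \<bar>r\<bar>)"
 define z where "z = Complex x y"
 have y: "Im z > 0" using D r0 by (simp add: z_def y_def)
 have y2: "y^2 = D / (4 * r^2)" using D by (simp add: y_def power_divide power_mult_distrib)
 have x2: "2 * r * x = p - s" using r0 by (simp add: x_def)
 have "4 * r * (r * (x^2 - y^2) + (s - p) * x - q) = (2 * r * x)^2 - 4 * r^2 * y^2 + 2 * (s - p) * (2 * r * x) - 4 * r * q"
  by (simp add: sq_simps)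
 also have "4 * r^2 * y^2 = D" unfolding y2 using r0 by simp
 also have "(2 * r * x)^2 - D + 2 * (s - p) * (2 * r * x) - 4 * r * q = 0" unfolding x2 D_def using ps by (simp add: sq_simps)
 finally have "r * (x^2 - y^2) + (s - p) * x - q = 0" using r0 by simp
 moreover have "Re (of_real r * z^2 + of_real (s - p) * z - of_real q) = r * (x^2 - y^2) + (s - p) * x - q"
  by (simp add: z_def sq_simps)
 moreover have "Im (of_real r * z^2 + of_real (s - p) * z - of_real q) = y * (2 * r * x - (p - s))"
  by (simp add: z_def sq_simps)
 hence "Im (of_real r * z^2 + of_real (s - p) * z - of_real q) = 0" using x2 by simp
 ultimately have Q: "of_real r * z^2 + of_real (s - p) * z - of_real q = 0" by (simp only: complex_eq_iff zero_complex.simps)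
 have d: "of_real r * z + of_real s ~= 0" using autfac_nonzero[OF assms(1) y] by simp
 have "of_real p * z + of_real q = z * (of_real r * z + of_real s)" using Q by (simp add: sq_simps)
 hence "moebius (p, q, r, s) z = z" using d by simp
 thus ?thesis using y by blast
qed

section \<open>Hyperbolic measure\<close>

text \<open>Zero outside the upper half-plane, so that the measure lives on the whole type and
  values of \<open>moebius\<close> elsewhere do not matter.\<close>

definition hypw :: "complex => real" where
 "hypw z = (if 0 < Im z then 1 / (Im z)^2 else 0)"

lemma hypw_measurable [measurable]: "hypw : borel_measurable borel" unfolding hypw_def by measurable

lemma moebius_preserves_hypw:
 assumes "det2 g = 1"
 shows "distr (density lborel (%z. ennreal (hypw z))) (density lborel (%z. ennreal (hypw z))) (moebius g)
  = density lborel (%z. ennreal (hypw z))" (is "distr ?M ?M _ = ?M")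
proof (rule measure_eqI)
 let ?H = "{z. 0 < Im z}"
 have H: "?H : sets borel" by measurable
 fix A assume "A : sets (distr ?M ?M (moebius g))"
 hence A: "A : sets borel" by simp
 have TA: "moebius g -` A : sets borel" using measurable_sets[OF moebius_measurable A] by simp
 have "(\<integral>\<^sup>+z. ennreal (hypw z) * indicator (?H \<inter> moebius g -` A) z \<partial>lborel) = (\<integral>\<^sup>+z. ennreal (hypw z) * indicator (?H \<inter> A) z \<partial>lborel)"
 proof (rule nn_integral_holomorphic_substitution[where T' = "%z. 1 / (autfac g z)^2"])
  show "moebius g ` ?H = ?H"
  proof
   show "moebius g ` ?H <= ?H" using Im_moebius_pos[OF assms] by auto
   show "?H <= moebius g ` ?H" using moebius_inv2'[OF assms] Im_moebius_pos[of "inv2 g"] assms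
    by (auto simp: det2_inv2 intro!: image_eqI[of _ _ "moebius (inv2 g) _"])
  qed
  show "inj_on (moebius g) ?H" by (rule inj_on_inverseI[of _ "moebius (inv2 g)"]) (simp add: moebius_inv2 assms)
  show "hypw (moebius g z) * (cmod (1 / (autfac g z)^2))^2 = hypw z" if "z : ?H" for z
  proof -
   have z: "0 < Im z" using that by simp
   hence n: "cmod (autfac g z) ~= 0" using autfac_nonzero[OF assms] by simp
   show ?thesis using z n Im_moebius_pos[OF assms z] by (simp add: hypw_def Im_moebius[OF assms] norm_divide norm_power field_simps)
  qed
  show "0 <= hypw z" for z by (simp add: hypw_def)
  show "(moebius g has_field_derivative 1 / (autfac g z)^2) (at z)" if "z : ?H" for z using moebius_derivative[OF assms] that by simp
  show "(%z. 1 / (autfac g z)\<^sup>2) : borel_measurable borel" by measurable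
 qed (use H A in auto)
 moreover have "(\<integral>\<^sup>+z. ennreal (hypw z) * indicator (?H \<inter> B) z \<partial>lborel) = (\<integral>\<^sup>+z. ennreal (hypw z) * indicator B z \<partial>lborel)" for B
  by (intro nn_integral_cong) (auto simp: hypw_def indicator_def)
 ultimately show "emeasure (distr ?M ?M (moebius g)) A = emeasure ?M A" using A TA by (subst emeasure_distr) (auto simp: emeasure_density)
qed simp

definition hyp :: "(complex^'r::finite) measure" where
 "hyp = density lborel (%z. \<Prod>j\<in>UNIV. ennreal (hypw (z $ j)))"

lemma sets_hyp [simp, measurable_cong]: "sets hyp = sets borel" and space_hyp [simp]: "space hyp = UNIV" by (simp_all add: hyp_def)

lemma nth_measurable [measurable]: "(%z::complex^'r::finite. z $ j) : borel_measurable borel"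
 by (intro borel_measurable_continuous_onI continuous_intros)

lemma hyp_density_measurable: "(%z::complex^'r::finite. \<Prod>j\<in>UNIV. ennreal (hypw (z $ j))) : borel_measurable borel" by measurable

lemma act_measurable [measurable]: "act ga : borel_measurable (borel :: (complex^'r::finite) measure)"
proof -
 have "(%z::complex^'r. \<lambda>j\<in>UNIV. moebius (ga j) (z $ j)) : measurable borel (PiM UNIV (%_. borel))"
  by (intro measurable_restrict) measurable
 from measurable_compose[OF this vec_lambda_measurable] show ?thesis by (simp add: act_def[abs_def] restrict_UNIV)
qed

lemma distr_hyp_act:
 assumes "!!j. det2 (ga j) = 1"
 shows "distr hyp hyp (act ga) = (hyp :: (complex^'r::finite) measure)" unfolding hyp_def act_def[abs_def]
proof (rule distr_componentwise)
 have "AE z in lborel. ennreal (hypw z) ~= \<infinity>" by simp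
 thus "sigma_finite_measure (density lborel (%z. ennreal (hypw z)))"
  using sigma_finite_measure.sigma_finite_iff_density_finite[OF lborel.sigma_finite_measure_axioms, of "%z. ennreal (hypw z)"] by simp
qed (use assms moebius_preserves_hypw in auto)

lemma upper_half_open: "open (upper_half :: (complex^'r::finite) set)"
proof -
 have "open (\<Inter>j. {z::complex^'r. 0 < Im (z $ j)})" by (intro open_INT finite ballI open_Collect_less continuous_intros)
 moreover have "(\<Inter>j. {z::complex^'r. 0 < Im (z $ j)}) = upper_half" by (auto simp: upper_half_def)
 ultimately show ?thesis by simp
qed

lemma upper_half_borel [measurable]: "upper_half : sets (borel :: (complex^'r::finite) measure)" by (rule borel_open[OF upper_half_open])

lemma act_upper_half: "(!!j. det2 (ga j) = 1) ==> z : upper_half ==> act ga z : upper_half" by (auto simp: upper_half_def act_def Im_moebius_pos)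

definition fam_mult :: "('r => real quad) => ('r => real quad) => 'r => real quad" where
 "fam_mult ga de = (%j. mmul (ga j) (de j))"

definition fam_inv :: "('r => real quad) => 'r => real quad" where
 "fam_inv ga = (%j. inv2 (ga j))"

lemma act_mult:
 assumes "!!j. det2 (de j) = 1" "z : upper_half"
 shows "act (fam_mult ga de) z = act ga (act de z)" using assms by (auto simp: act_def fam_mult_def vec_eq_iff upper_half_def moebius_mult)

lemma act_inv:
 assumes "!!j. det2 (ga j) = 1" "z : upper_half"
 shows "act (fam_inv ga) (act ga z) = z" using assms by (auto simp: act_def fam_inv_def vec_eq_iff upper_half_def moebius_inv2)

lemma moebius_plus_minus_one: "g : plus_minus_one ==> moebius g z = z" by auto

lemma act_plus_minus_one: "(!!j. ga j : plus_minus_one) ==> act ga z = z" using moebius_plus_minus_one by (simp add: act_def vec_eq_iff)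

text \<open>\<open>polydisc r z\<close> has radius \<open>r\<^sub>j\<close> relative to the distance of \<open>z\<^sub>j\<close> from the real line.\<close>

definition polydisc :: "('r::finite => real) => complex^'r => (complex^'r) set" where
 "polydisc r z = {w. ALL j. cmod (w $ j - z $ j) < r j * Im (z $ j)}"

lemma polydisc_open: "open (polydisc r (z :: complex^'r::finite))"
proof -
 have "polydisc r z = (\<Inter>j. {w. cmod (w $ j - z $ j) < r j * Im (z $ j)})" by (auto simp: polydisc_def)
 moreover have "open {w::complex^'r. cmod (w $ j - z $ j) < r j * Im (z $ j)}" for j by (intro open_Collect_less continuous_intros)
 ultimately show ?thesis by (auto intro!: open_INT)
qed

lemma polydisc_Im:
 fixes w z :: "complex^'r::finite"
 assumes "w : polydisc r z" "z : upper_half" "r j <= 1/2"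
 shows "Im (z $ j) / 2 < Im (w $ j)" "Im (w $ j) < 3/2 * Im (z $ j)"
proof -
 have z: "0 < Im (z $ j)" using assms(2) by (simp add: upper_half_def)
 have "\<bar>Im (w $ j) - Im (z $ j)\<bar> <= cmod (w $ j - z $ j)" using abs_Im_le_cmod[of "w $ j - z $ j"] by simp
 also have "... < r j * Im (z $ j)" using assms(1) by (simp add: polydisc_def)
 also have "... <= 1/2 * Im (z $ j)" using assms(3) z by (intro mult_right_mono) auto
 finally show "Im (z $ j) / 2 < Im (w $ j)" "Im (w $ j) < 3/2 * Im (z $ j)" by linarith+
qed

lemma polydisc_subset:
 fixes z :: "complex^'r::finite"
 assumes "z : upper_half" "!!j. r j <= 1/2"
 shows "polydisc r z <= upper_half"
proof
 fix w assume w: "w : polydisc r z"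
 have "0 < Im (w $ j)" for j using polydisc_Im(1)[OF w assms(1) assms(2)[of j]] assms(1) by (auto simp: upper_half_def dest: spec[of _ j])
 thus "w : upper_half" by (simp add: upper_half_def)
qed

section \<open>A sub-mean value inequality\<close>

text \<open>Cauchy's formula is applied to p^2 instead of p, so that the triangle inequality for
  integrals gives the squared modulus at once.\<close>

lemma circle_mean_value:
 assumes "p holomorphic_on ball 0 2"
 shows "ennreal ((cmod (p 0))^2) <= (\<integral>\<^sup>+tht. indicator {0..1::real} tht * ennreal ((cmod (p (exp (2 * of_real pi * \<i> * of_real tht))))^2) \<partial>lborel)"
proof -
 define e where "e = (%tht::real. exp (2 * of_real pi * \<i> * of_real tht) :: complex)"
 have ce: "continuous_on S e" for S unfolding e_def by (intro continuous_intros)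
 have ne: "cmod (e x) = 1" for x by (simp add: e_def)
 have hp: "(%z. (p z)^2) holomorphic_on cball 0 1" using assms by (intro holomorphic_intros) (auto elim!: holomorphic_on_subset)
 have cpe: "circlepath 0 1 x = e x" for x by (simp add: circlepath e_def)
 have "((%u. (p u)^2 / (u - 0)) has_contour_integral (2 * of_real pi * \<i> * (p 0)^2)) (circlepath 0 1)"
  by (rule Cauchy_integral_circlepath_simple[OF hp]) simp
 hence "((%x. (p (e x))^2 / e x * (2 * of_real pi * \<i> * e x)) has_integral (2 * of_real pi * \<i> * (p 0)^2)) {0..1}"
  unfolding has_contour_integral_def
  by (rule has_integral_eq[rotated]) (simp add: vector_derivative_circlepath01 cpe del: times_divide_eq_left, simp add: e_def)
 hence "((%x. (2 * of_real pi * \<i>) * (p (e x))^2) has_integral ((2 * of_real pi * \<i>) * (p 0)^2)) {0..1}"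
  by (rule has_integral_eq[rotated]) (simp add: e_def)
 from has_integral_mult_right[OF this, of "1 / (2 * of_real pi * \<i>)"]
 have hi: "((%x. (p (e x))^2) has_integral (p 0)^2) {0..1}" by simp
 have cp: "continuous_on UNIV (%x. p (e x))" by (rule continuous_on_compose2[OF holomorphic_on_imp_continuous_on[OF assms] ce]) (auto simp: ne)
 have io: "(%x. (cmod (p (e x)))^2) integrable_on {0..1}" by (intro integrable_continuous_interval continuous_intros continuous_on_subset[OF cp]) auto
 have "cmod ((p 0)^2) = cmod (integral {0..1} (%x. (p (e x))^2))" using hi by (simp add: integral_unique)
 also have "... <= integral {0..1} (%x. (cmod (p (e x)))^2)"
  using hi io by (intro Henstock_Kurzweil_Integration.integral_norm_bound_integral) (auto simp: norm_power)
 finally have "ennreal ((cmod (p 0))^2) <= ennreal (integral {0..1} (%x. (cmod (p (e x)))^2))" by (intro ennreal_leI) (simp add: norm_power)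
 also have "... = (\<integral>\<^sup>+tht. ennreal (indicator {0..1} tht * (cmod (p (e tht)))^2) \<partial>lborel)"
  by (rule nn_integral_has_integral_lebesgue[symmetric]) (use io in \<open>auto simp: has_integral_integral\<close>)
 also have "... = (\<integral>\<^sup>+tht. indicator {0..1::real} tht * ennreal ((cmod (p (e tht)))^2) \<partial>lborel)"
  by (intro nn_integral_cong) (auto simp: indicator_def)
 finally show ?thesis unfolding e_def .
qed

lemma lborel_complex_affine:
 assumes "cmod c = 1"
 shows "distr lborel lborel (%z. t + c * z) = lborel"
proof -
 have "distr lborel lborel (%z. t + c * z) = distr (distr lborel lborel (%z. c * z)) borel ((+) t)"
  by (subst distr_distr) (auto simp: comp_def intro!: distr_cong)
 also have "... = lborel" by (simp add: lborel_complex_rotate[OF assms] lborel_distr_plus)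
 finally show ?thesis .
qed

lemma lborel_vec_rotate:
 fixes z0 :: "complex^'r::finite"
 assumes "cmod c = 1"
 shows "distr lborel lborel (%w. z0 + c *s (w - z0)) = lborel"
proof -
 have 1: "density lborel (%_. 1) = (lborel :: complex measure)" by (rule density_1)
 have e: "(%w. \<chi> j. (z0 $ j - c * z0 $ j) + c * w $ j) = (%w. z0 + c *s (w - z0))" by (auto simp: fun_eq_iff vec_eq_iff algebra_simps)
 have "distr (density lborel (%z::complex^'r. \<Prod>j\<in>(UNIV::'r set). 1)) (density lborel (%z. \<Prod>j\<in>(UNIV::'r set). 1))
  (%w. \<chi> j. (z0 $ j - c * z0 $ j) + c * w $ j) = density lborel (%z. \<Prod>j\<in>(UNIV::'r set). 1)"
  by (rule distr_componentwise[where w = "%_. 1" and T = "%j x. (z0 $ j - c * z0 $ j) + c * x"])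
   (auto simp: 1 lborel_complex_affine assms intro: lborel.sigma_finite_measure_axioms)
 thus ?thesis by (simp add: density_1 e)
qed

lemma holomorphic_vec_continuous: "holomorphic_vec f S ==> continuous_on S f"
 unfolding holomorphic_vec_def by (meson continuous_at_imp_continuous_on has_derivative_continuous)

lemma holomorphic_vec_line:
 assumes "holomorphic_vec f S" "!!ze. ze : A ==> z + ze *s u : S" "open A"
 shows "(%ze. f (z + ze *s u)) holomorphic_on A"
proof (rule holomorphic_onI)
 fix ze assume ze: "ze : A"
 obtain D where D: "(f has_derivative D) (at (z + ze *s u))" "!!c v. D (c *s v) = c * D v" using assms(1,2) ze unfolding holomorphic_vec_def by blast
 have bl: "bounded_linear (%ze::complex. ze *s u)"
  by (rule linear_conv_bounded_linear[THEN iffD1]) (auto intro!: linearI simp: vec_eq_iff algebra_simps)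
 have "((%ze. z + ze *s u) has_derivative (%h. h *s u)) (at ze)"
  by (rule derivative_eq_intros bounded_linear_imp_has_derivative[OF bl] refl)+ (simp add: fun_eq_iff)
 from has_derivative_compose[OF this D(1)]
 have "((%ze. f (z + ze *s u)) has_derivative (%h. D u * h)) (at ze)" by (simp add: D(2) mult.commute)
 hence "((%ze. f (z + ze *s u)) has_field_derivative D u) (at ze)" unfolding has_field_derivative_def by simp
 thus "(%ze. f (z + ze *s u)) field_differentiable at ze within A" using field_differentiable_at_within field_differentiable_def by blast
qed

lemma emeasure_polydisc:
 fixes z :: "complex^'r::finite"
 assumes "z : upper_half" "!!j. 0 <= r j"
 shows "emeasure lborel (polydisc r z) = ennreal (\<Prod>j\<in>UNIV. pi * (r j * Im (z $ j))^2)"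
proof -
 have nn: "0 <= r j * Im (z $ j)" for j using assms by (simp add: upper_half_def less_imp_le)
 interpret product_sigma_finite "%_::'r. lborel :: complex measure" by standard
 have "emeasure lborel (polydisc r z)
  = emeasure (PiM UNIV (%_::'r. lborel)) ((%f. \<chi> j. f j) -` polydisc r z \<inter> space (PiM UNIV (%_::'r. lborel :: complex measure)))"
  unfolding lborel_complex_vec
 proof (rule emeasure_distr)
  have "sets (PiM UNIV (%_::'r. lborel :: complex measure)) = sets (PiM UNIV (%_. borel))" by (rule sets_PiM_cong) auto
  thus "(%f. \<chi> j. f j) : measurable (PiM UNIV (%_::'r. lborel :: complex measure)) borel"
   using vec_lambda_measurable measurable_cong_sets by blast
 qed (intro borel_open polydisc_open)
 also have "(%f. \<chi> j. f j) -` polydisc r z \<inter> space (PiM UNIV (%_::'r. lborel :: complex measure))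
  = PiE UNIV (%j. ball (z $ j) (r j * Im (z $ j)))" by (auto simp: polydisc_def space_PiM PiE_def Pi_def dist_norm norm_minus_commute)
 also have "emeasure (PiM UNIV (%_::'r. lborel)) ... = (\<Prod>j\<in>UNIV. emeasure lborel (ball (z $ j) (r j * Im (z $ j))))"
  by (rule emeasure_PiM) auto
 also have "... = (\<Prod>j\<in>UNIV. ennreal (pi * (r j * Im (z $ j))^2))"
  using nn by (intro prod.cong refl) (simp add: emeasure_ball unit_ball_vol_2)
 also have "... = ennreal (\<Prod>j\<in>UNIV. pi * (r j * Im (z $ j))^2)" by (intro prod_ennreal) auto
 finally show ?thesis .
qed

text \<open>The common rotation of all coordinates about z preserves the polydisc and Lebesgue
  measure. Each orbit is a circle in a complex line through z, where the one-variable inequality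
  applies; integrating over the polydisc and exchanging the integrals finishes the argument.\<close>

lemma polydisc_mean_value:
 fixes G :: "complex^'r::finite => complex"
 assumes G: "holomorphic_vec G upper_half" and z: "z : upper_half" and r: "!!j. 0 <= r j" "!!j. r j <= 1/2"
 shows "ennreal ((cmod (G z))^2) * emeasure lborel (polydisc r z)
  <= (\<integral>\<^sup>+w. ennreal ((cmod (G w))^2) * indicator (polydisc r z) w \<partial>lborel)"
proof -
 define e where "e = (%tht::real. exp (2 * of_real pi * \<i> * of_real tht) :: complex)"
 define T where "T = (%tht w. z + e tht *s (w - z))"
 define G' where "G' = (%w. indicator upper_half w *\<^sub>R G w)"
 let ?D = "polydisc r z"
 have ne: "cmod (e x) = 1" for x by (simp add: e_def)
 have D: "?D : sets borel" by (intro borel_open polydisc_open)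
 have DH: "?D <= upper_half" by (rule polydisc_subset[OF z r(2)])
 have [measurable]: "G' : borel_measurable borel"
  unfolding G'_def by (intro borel_measurable_continuous_on_indicator upper_half_borel holomorphic_vec_continuous G)
 have TD: "T tht w : ?D \<longleftrightarrow> w : ?D" for tht w
 proof -
  have "T tht w $ j - z $ j = e tht * (w $ j - z $ j)" for j by (simp add: T_def right_diff_distrib)
  thus ?thesis unfolding polydisc_def by (simp only: mem_Collect_eq norm_mult ne mult_1)
 qed
 have "continuous_on UNIV (%(tht, w::complex^'r). T tht w)" unfolding T_def e_def vector_scalar_mult_def case_prod_beta by (intro continuous_intros)
 hence T2: "(%(tht, w). T tht w) : borel_measurable (borel \<Otimes>\<^sub>M borel)" unfolding borel_prod by (rule borel_measurable_continuous_onI)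
 have T1: "T tht : borel_measurable borel" for tht unfolding T_def vector_scalar_mult_def by (intro borel_measurable_continuous_onI continuous_intros)
 define F where "F = (%w. ennreal ((cmod (G' w))^2) * indicator ?D w)"
 have F [measurable]: "F : borel_measurable borel" unfolding F_def using D by measurable
 have FT: "(%(tht, w). F (T tht w)) : borel_measurable (lborel \<Otimes>\<^sub>M lborel)"
  using measurable_compose[OF T2 F] by (simp add: case_prod_beta cong: measurable_cong_sets)
 have inv: "(\<integral>\<^sup>+w. F (T tht w) \<partial>lborel) = (\<integral>\<^sup>+w. F w \<partial>lborel)" for tht
 proof -
  have "(\<integral>\<^sup>+w. F w \<partial>lborel) = (\<integral>\<^sup>+w. F w \<partial>distr lborel lborel (T tht))"
   unfolding T_def by (simp only: lborel_vec_rotate[OF ne])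
  also have "... = (\<integral>\<^sup>+w. F (T tht w) \<partial>lborel)" by (rule nn_integral_distr) (use T1 in auto)
  finally show ?thesis by simp
 qed
 have pw: "ennreal ((cmod (G z))^2) * indicator ?D w <= (\<integral>\<^sup>+tht. indicator {0..1::real} tht * F (T tht w) \<partial>lborel)" for w
 proof (cases "w : ?D")
  case True
  \<comment> \<open>Radius 2 leaves a margin around the unit circle; with r j \<le> 1/2 the line
    stays in the domain up to there.\<close>
  have h: "(%ze. G (z + ze *s (w - z))) holomorphic_on ball 0 2"
  proof (rule holomorphic_vec_line[OF G])
   fix ze :: complex assume "ze : ball 0 2"
   hence ze: "cmod ze <= 2" by simp
   have "0 < Im ((z + ze *s (w - z)) $ j)" for j
   proof -
    have zj: "0 < Im (z $ j)" using z by (simp add: upper_half_def)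
    have "cmod (ze * (w $ j - z $ j)) <= 2 * cmod (w $ j - z $ j)" unfolding norm_mult using ze by (intro mult_right_mono) auto
    also have "... < 2 * (r j * Im (z $ j))" using True by (simp add: polydisc_def)
    also have "... <= 2 * (1/2 * Im (z $ j))" using r(2)[of j] zj by (intro mult_left_mono mult_right_mono) auto
    finally have "cmod (ze * (w $ j - z $ j)) < Im (z $ j)" by simp
    with abs_Im_le_cmod[of "ze * (w $ j - z $ j)"] have "0 < Im (z $ j) + Im (ze * (w $ j - z $ j))" by linarith
    thus ?thesis by (simp only: vector_add_component vector_smult_component vector_minus_component plus_complex.sel)
   qed
   thus "z + ze *s (w - z) : upper_half" by (simp add: upper_half_def)
  qed simp
  have "ennreal ((cmod (G z))^2) <= (\<integral>\<^sup>+tht. indicator {0..1::real} tht * ennreal ((cmod (G (T tht w)))^2) \<partial>lborel)"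
   using circle_mean_value[OF h] by (simp add: T_def e_def)
  also have "... = (\<integral>\<^sup>+tht. indicator {0..1::real} tht * F (T tht w) \<partial>lborel)"
   using True DH TD by (intro nn_integral_cong) (auto simp: F_def G'_def indicator_def)
  finally show ?thesis using True by simp
 qed simp
 have "ennreal ((cmod (G z))^2) * emeasure lborel ?D = (\<integral>\<^sup>+w. ennreal ((cmod (G z))^2) * indicator ?D w \<partial>lborel)"
  using D by (simp add: nn_integral_cmult_indicator)
 also have "... <= (\<integral>\<^sup>+w. (\<integral>\<^sup>+tht. indicator {0..1::real} tht * F (T tht w) \<partial>lborel) \<partial>lborel)"
  by (intro nn_integral_mono pw)
 also have "... = (\<integral>\<^sup>+tht. (\<integral>\<^sup>+w. indicator {0..1} tht * F (T tht w) \<partial>lborel) \<partial>lborel)"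
 proof (rule lborel_pair.Fubini')
  show "case_prod (%tht w. indicator {0..1} tht * F (T tht w)) : borel_measurable (lborel \<Otimes>\<^sub>M lborel)"
   using FT by (simp add: case_prod_beta) 
 qed
 also have "... = (\<integral>\<^sup>+tht. indicator {0..1::real} tht * (\<integral>\<^sup>+w. F w \<partial>lborel) \<partial>lborel)"
 proof (rule nn_integral_cong)
  fix tht
  have "(%w. F (T tht w)) : borel_measurable lborel" using measurable_compose[OF T1 F] by simp
  thus "(\<integral>\<^sup>+w. indicator {0..1} tht * F (T tht w) \<partial>lborel) = indicator {0..1} tht * (\<integral>\<^sup>+w. F w \<partial>lborel)"
   by (simp add: nn_integral_cmult inv)
 qed
 also have "... = (\<integral>\<^sup>+w. F w \<partial>lborel)" by (subst nn_integral_multc) auto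
 also have "... = (\<integral>\<^sup>+w. ennreal ((cmod (G w))^2) * indicator ?D w \<partial>lborel)"
  using DH by (intro nn_integral_cong) (auto simp: F_def G'_def indicator_def)
 finally show ?thesis .
qed

definition pet :: "('r::finite => nat) => (complex^'r => complex) => complex^'r => real" where
 "pet k f z = (\<Prod>j\<in>UNIV. Im (z $ j) ^ k j) * (cmod (f z))^2"

lemma pet_nonneg: "z : upper_half ==> 0 <= pet k f z"
 unfolding pet_def upper_half_def by (intro mult_nonneg_nonneg prod_nonneg) (auto simp: less_imp_le)

text \<open>From |w - cnj z|^2 - |w - z|^2 = 4 Im w Im z it follows that Im w is at least (1 - rh^2
  / k) |w - cnj z|^2 / (4 Im z), and by Bernoulli the k-th power of the factor stays above 1/2. This
  fixes the order k^(-1/2) of the radii.\<close>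

lemma power_comparison:
 assumes "0 < k" "0 <= rh" "rh <= 1/2" "0 < Im z" "cmod (w - z) <= rh / sqrt (real k) * Im z" "0 < Im w"
 shows "Im z ^ k * (cmod ((w - cnj z) / (2 * \<i> * of_real (Im z))))^(2 * k) <= 2 * Im w ^ k"
proof -
 define y where "y = Im z"
 define a where "a = (cmod (w - cnj z))^2 / (4 * y)"
 have y: "y > 0" using assms by (simp add: y_def)
 have id: "(cmod (w - cnj z))^2 - (cmod (w - z))^2 = 4 * Im w * y" unfolding cmod_power2 by (simp add: y_def sq_simps)
 have "y <= \<bar>Im (w - cnj z)\<bar>" using assms by (simp add: y_def)
 also have "... <= cmod (w - cnj z)" by (rule abs_Im_le_cmod)
 finally have ge: "y^2 <= (cmod (w - cnj z))^2" using y by (intro power_mono) auto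
 have "(cmod (w - z))^2 <= (rh / sqrt (real k) * y)^2" using assms(5) by (intro power_mono) (auto simp: y_def)
 also have "... = rh^2 / k * y^2" by (simp add: power_mult_distrib power_divide)
 also have "... <= rh^2 / k * (cmod (w - cnj z))^2" using ge by (intro mult_left_mono) auto
 finally have "(cmod (w - z))^2 <= rh^2 / k * (cmod (w - cnj z))^2" .
 moreover have "(1 - rh^2 / k) * (cmod (w - cnj z))^2 = (cmod (w - cnj z))^2 - rh^2 / k * (cmod (w - cnj z))^2" by (simp add: left_diff_distrib)
 ultimately have "(1 - rh^2 / k) * (cmod (w - cnj z))^2 <= 4 * Im w * y" using id by linarith
 hence le: "(1 - rh^2 / k) * a <= Im w" using y by (simp add: a_def field_simps)
 have r2: "rh^2 <= 1/2" using power_mono[OF assms(3) assms(2), of 2] by (simp add: power2_eq_square)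
 have k1: "rh^2 / k <= 1/2" using r2 assms(1) by (simp add: field_simps)
 have "1 + real k * (- (rh^2 / k)) <= (1 + - (rh^2 / k)) ^ k" by (rule Bernoulli_inequality) (use k1 in linarith)
 hence b: "1/2 <= (1 - rh^2 / k) ^ k" using r2 assms(1) by simp
 have a0: "0 <= a" using y by (simp add: a_def)
 have "a ^ k <= 2 * (1 - rh^2 / k) ^ k * a ^ k" using mult_right_mono[of 1 "2 * (1 - rh^2 / k) ^ k" "a ^ k"] b a0 by simp
 also have "... = 2 * ((1 - rh^2 / k) * a) ^ k" by (simp add: power_mult_distrib)
 also have "... <= 2 * Im w ^ k" using power_mono[OF le, of k] mult_nonneg_nonneg[of "1 - rh^2 / k" a] a0 k1 by simp
 finally have fin: "a ^ k <= 2 * Im w ^ k" .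
 have "(cmod ((w - cnj z) / (2 * \<i> * of_real y)))^2 = a / y"
  using y by (simp add: norm_divide norm_mult power_divide power_mult_distrib a_def power2_eq_square)
 hence "y ^ k * (cmod ((w - cnj z) / (2 * \<i> * of_real y)))^(2 * k) = a ^ k" using y by (simp add: power_mult power_divide)
 with fin show ?thesis by (simp add: y_def)
qed

lemma holomorphic_vec_mult:
 assumes "holomorphic_vec f S" "holomorphic_vec g S"
 shows "holomorphic_vec (%z. f z * g z) S" unfolding holomorphic_vec_def
proof
 fix z assume z: "z : S"
 obtain D where D: "(f has_derivative D) (at z)" "!!c v. D (c *s v) = c * D v" using assms(1) z unfolding holomorphic_vec_def by blast
 obtain E where E: "(g has_derivative E) (at z)" "!!c v. E (c *s v) = c * E v" using assms(2) z unfolding holomorphic_vec_def by blast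
 have "((%z. f z * g z) has_derivative (%h. f z * E h + D h * g z)) (at z)" by (rule has_derivative_mult[OF D(1) E(1)])
 thus "EX D. ((%z. f z * g z) has_derivative D) (at z) & (ALL c v. D (c *s v) = c * D v)"
  by (intro exI[of _ "%h. f z * E h + D h * g z"]) (auto simp: D(2) E(2) algebra_simps)
qed

lemma holomorphic_vec_affine: "holomorphic_vec (%w::complex^'r::finite. (w $ j - c) / d) S" unfolding holomorphic_vec_def
proof
 fix z :: "complex^'r"
 have "((%w::complex^'r. (w $ j - c) / d) has_derivative (%h. h $ j / d)) (at z)" unfolding divide_inverse
  by (rule derivative_eq_intros bounded_linear_imp_has_derivative[OF bounded_linear_vec_nth] refl | simp)+
 thus "EX D. ((%w. (w $ j - c) / d) has_derivative D) (at z) & (ALL c v. D (c *s v) = c * D v)" by (intro exI[of _ "%h. h $ j / d"]) auto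
qed

lemma holomorphic_vec_const: "holomorphic_vec (%w. c) S" unfolding holomorphic_vec_def by (auto intro!: exI[of _ "%h. 0"])

lemma holomorphic_vec_power: "holomorphic_vec f S ==> holomorphic_vec (%z. f z ^ n) S"
 by (induction n) (auto intro: holomorphic_vec_const holomorphic_vec_mult)

lemma holomorphic_vec_prod:
 "finite I ==> (!!i. i : I ==> holomorphic_vec (f i) S) ==> holomorphic_vec (%z. \<Prod>i\<in>I. f i z) S"
 by (induction I rule: finite_induct) (auto intro: holomorphic_vec_const holomorphic_vec_mult)

lemma pet_submean:
 fixes f :: "complex^'r::finite => complex"
 assumes f: "holomorphic_vec f upper_half" "f : borel_measurable borel" and z: "z : upper_half"
  and k: "!!j. 0 < k j" and rh: "0 < rh" "rh <= 1/2"
 shows "ennreal (pet k f z) <= ennreal ((8 / rh^2) ^ CARD('r) * kprod k)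
  * (\<integral>\<^sup>+w. ennreal (pet k f w) * indicator (polydisc (%j. rh / sqrt (real (k j))) z) w \<partial>hyp)"
proof -
 define r where "r = (%j. rh / sqrt (real (k j)))"
 define y where "y = (%j. Im (z $ j))"
 define h where "h = (%w j. (w $ j - cnj (z $ j)) / (2 * \<i> * of_real (y j)))"
 \<comment> \<open>The functions \<open>h w j\<close> are holomorphic in w and equal 1 at z; their
   powers stand in for the weight.\<close>
 define G where "G = (%w. f w * (\<Prod>j\<in>UNIV. h w j ^ k j))"
 define P where "P = (\<Prod>j\<in>UNIV. y j ^ k j)"
 \<comment> \<open>The 8 is 2 from \<open>power_comparison\<close> times 4 from Im w \<le> 2 Im z in
   the hyperbolic density.\<close>
 define Q where "Q = (\<Prod>j\<in>(UNIV::'r set). 1 / (8 * y j ^ 2))"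
 let ?D = "polydisc r z"
 have y: "y j > 0" for j using z by (simp add: y_def upper_half_def)
 have r: "0 <= r j" "r j <= 1/2" for j
 proof -
  have "1 <= sqrt (real (k j))" using k[of j] by simp
  hence "rh / sqrt (real (k j)) <= rh / 1" using rh by (intro divide_left_mono) auto
  hence "rh / sqrt (real (k j)) <= 1/2" using rh by linarith
  thus "0 <= r j" "r j <= 1/2" using rh unfolding r_def by simp_all
 qed
 have DH: "?D <= upper_half" by (rule polydisc_subset[OF z r(2)])
 have D: "?D : sets borel" by (intro borel_open polydisc_open)
 have P0: "0 < P" unfolding P_def using y by (intro prod_pos) auto
 have Q0: "0 < Q" unfolding Q_def using y by (intro prod_pos ballI divide_pos_pos mult_pos_pos zero_less_power) auto
 have hG: "holomorphic_vec G upper_half"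
  unfolding G_def h_def by (intro holomorphic_vec_mult f holomorphic_vec_prod holomorphic_vec_power holomorphic_vec_affine) auto
 have "h z j = 1" for j
 proof -
  have "z $ j - cnj (z $ j) = 2 * \<i> * of_real (y j)" by (simp add: complex_diff_cnj y_def)
  thus ?thesis using y[of j] by (simp add: h_def)
 qed
 hence Gz: "pet k f z = P * (cmod (G z))^2" by (simp add: pet_def G_def P_def y_def)
 have pt: "P * (cmod (G w))^2 * Q <= pet k f w * (\<Prod>j\<in>UNIV. hypw (w $ j))" if w: "w : ?D" for w
 proof -
  have Imw: "0 < Im (w $ j)" for j using DH w by (auto simp: upper_half_def)
  have "P * (cmod (G w))^2 * Q = (cmod (f w))^2 * (\<Prod>j\<in>UNIV. (y j ^ k j * cmod (h w j) ^ (2 * k j)) * (1 / (8 * y j ^ 2)))"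
   unfolding P_def G_def Q_def norm_mult prod_norm[symmetric] power_mult_distrib prod.distrib
   by (simp add: norm_power prod_power_distrib power_mult[symmetric] mult_ac)
  also have "... <= (cmod (f w))^2 * (\<Prod>j\<in>UNIV. Im (w $ j) ^ k j * hypw (w $ j))"
  proof (intro mult_left_mono prod_mono conjI)
   fix j :: 'r
   have "y j ^ k j * cmod (h w j) ^ (2 * k j) <= 2 * Im (w $ j) ^ k j" unfolding h_def y_def
    by (rule power_comparison[OF k[of j], of rh]) (use rh y[of j] Imw[of j] w in \<open>auto simp: polydisc_def r_def y_def less_imp_le\<close>)
   moreover have "1 / (4 * y j ^ 2) <= hypw (w $ j)"
   proof -
    have "Im (w $ j) ^ 2 <= (2 * y j)^2" using polydisc_Im(2)[OF w z r(2)[of j]] Imw[of j] y[of j] by (intro power_mono) (auto simp: y_def)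
    hence "1 / (2 * y j)^2 <= 1 / Im (w $ j) ^ 2" using Imw[of j] y[of j] by (intro divide_left_mono) auto
    thus ?thesis using Imw[of j] by (simp add: hypw_def)
   qed
   ultimately have "(y j ^ k j * cmod (h w j) ^ (2 * k j)) * (1 / (4 * y j ^ 2)) <= (2 * Im (w $ j) ^ k j) * hypw (w $ j)"
    by (rule mult_mono) (use y[of j] Imw[of j] in \<open>auto simp: less_imp_le\<close>)
   thus "(y j ^ k j * cmod (h w j) ^ (2 * k j)) * (1 / (8 * y j ^ 2)) <= Im (w $ j) ^ k j * hypw (w $ j)" by simp
   show "0 <= (y j ^ k j * cmod (h w j) ^ (2 * k j)) * (1 / (8 * y j ^ 2))" using y[of j] by simp
  qed simp
  also have "... = pet k f w * (\<Prod>j\<in>UNIV. hypw (w $ j))" by (simp add: pet_def prod.distrib)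
  finally show ?thesis .
 qed
 have m: "(%w. ennreal (pet k f w)) : borel_measurable borel" using f(2) unfolding pet_def by measurable
 define V where "V = (\<Prod>j\<in>(UNIV::'r set). pi * (r j * y j)^2)"
 have V0: "0 < V" unfolding V_def r_def
 proof (intro prod_pos ballI)
  fix j
  have "0 < rh / sqrt (real (k j)) * y j" using y[of j] rh k[of j] by simp
  thus "0 < pi * (rh / sqrt (real (k j)) * y j)^2" by (metis mult_pos_pos pi_gt_zero zero_less_power)
 qed
 have "ennreal (pet k f z) * ennreal (Q * V) = ennreal (P * Q) * (ennreal ((cmod (G z))^2) * emeasure lborel ?D)"
  unfolding emeasure_polydisc[OF z r(1)] Gz using P0 Q0 V0 by (simp add: V_def y_def ennreal_mult'[symmetric] mult_ac)
 also have "... <= ennreal (P * Q) * (\<integral>\<^sup>+w. ennreal ((cmod (G w))^2) * indicator ?D w \<partial>lborel)"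
  by (intro mult_left_mono polydisc_mean_value hG z r) auto
 also have "... = (\<integral>\<^sup>+w. ennreal (P * Q) * (ennreal ((cmod (G w))^2) * indicator ?D w) \<partial>lborel)"
 proof (rule nn_integral_cmult[symmetric])
  have "h' : borel_measurable borel" if "h' = (%w. h w j)" for j h' unfolding that h_def by measurable
  hence [measurable]: "(%w. h w j) : borel_measurable borel" for j by blast
  show "(%w. ennreal ((cmod (G w))^2) * indicator ?D w) : borel_measurable lborel" unfolding G_def using f(2) D by measurable
 qed
 also have "... <= (\<integral>\<^sup>+w. (\<Prod>j\<in>UNIV. ennreal (hypw (w $ j))) * (ennreal (pet k f w) * indicator ?D w) \<partial>lborel)"
 proof (intro nn_integral_mono)
  fix w
  show "ennreal (P * Q) * (ennreal ((cmod (G w))^2) * indicator ?D w) <= (\<Prod>j\<in>UNIV. ennreal (hypw (w $ j))) * (ennreal (pet k f w) * indicator ?D w)"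
  proof (cases "w : ?D")
   case True
   have "ennreal (P * Q) * ennreal ((cmod (G w))^2) = ennreal (P * (cmod (G w))^2 * Q)" using P0 Q0 by (simp add: ennreal_mult'[symmetric] mult_ac)
   also have "... <= ennreal (pet k f w * (\<Prod>j\<in>UNIV. hypw (w $ j)))" by (intro ennreal_leI pt True)
   also have "... = (\<Prod>j\<in>UNIV. ennreal (hypw (w $ j))) * ennreal (pet k f w)"
    by (subst prod_ennreal) (auto simp: hypw_def mult.commute ennreal_mult'' prod_nonneg)
   finally show ?thesis using True by simp
  qed simp
 qed
 also have "... = (\<integral>\<^sup>+w. ennreal (pet k f w) * indicator ?D w \<partial>hyp)"
  unfolding hyp_def by (subst nn_integral_density) (use m D in auto)
 finally have main: "ennreal (pet k f z) * ennreal (Q * V) <= (\<integral>\<^sup>+w. ennreal (pet k f w) * indicator ?D w \<partial>hyp)" .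
 \<comment> \<open>With V the volume of the polydisc, K Q V = pi^r, which is at least 1.\<close>
 define K where "K = (8 / rh^2) ^ CARD('r) * kprod k"
 have "1 <= K * (Q * V)"
 proof -
  have "K * (Q * V) = (\<Prod>j\<in>UNIV. (8 / rh^2) * real (k j) * ((1 / (8 * y j ^ 2)) * (pi * (r j * y j)^2)))"
   by (simp only: K_def Q_def V_def prod.distrib prod_constant)
  also have "... = (\<Prod>j\<in>(UNIV::'r set). pi)"
  proof (intro prod.cong refl)
   fix j :: 'r
   have "(r j)^2 = rh^2 / k j" by (simp add: r_def power_divide)
   thus "(8 / rh^2) * real (k j) * ((1 / (8 * y j ^ 2)) * (pi * (r j * y j)^2)) = pi" using y[of j] rh k[of j] by (simp add: power_mult_distrib)
  qed
  also have "... >= 1" using pi_ge_two by (intro prod_ge_1) linarith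
  finally show ?thesis .
 qed
 hence "ennreal (pet k f z) * 1 <= ennreal (pet k f z) * ennreal (K * (Q * V))" by (intro mult_left_mono) auto
 also have "... = ennreal K * (ennreal (pet k f z) * ennreal (Q * V))"
 proof -
  have "0 <= K" by (simp add: K_def prod_nonneg)
  hence "ennreal (K * (Q * V)) = ennreal K * ennreal (Q * V)" using Q0 V0 by (intro ennreal_mult) auto
  thus ?thesis by (simp add: mult_ac)
 qed
 also have "... <= ennreal K * (\<integral>\<^sup>+w. ennreal (pet k f w) * indicator ?D w \<partial>hyp)" by (intro mult_left_mono main) auto
 finally show ?thesis by (simp add: K_def r_def)
qed

section \<open>Fundamental domains and unfolding\<close>

text \<open>The last assumption joins proper discontinuity to the absence of fixed points. Elements
  of PSL_2(R)^r are represented up to signs, so being trivial means having every component in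
  \<open>plus_minus_one\<close>.\<close>

locale disc_group =
 fixes Ga :: "('r::finite => real quad) set"
 assumes det: "!!ga j. ga : Ga ==> det2 (ga j) = 1"
  and mult_closed: "!!ga de. ga : Ga ==> de : Ga ==> fam_mult ga de : Ga"
  and inv_closed: "!!ga. ga : Ga ==> fam_inv ga : Ga"
  and one_closed: "(%_. (1, 0, 0, 1)) : Ga"
  and countable: "countable Ga"
  and discontinuous: "!!z. z : upper_half ==> \<exists>ep>0. ep <= 1/2 \<and>
   (ALL ga:Ga. ALL w:polydisc (%_. ep) z. act ga w : polydisc (%_. ep) z --> (ALL j. ga j : plus_minus_one))"
begin

lemma act_H: "ga : Ga ==> z : upper_half ==> act ga z : upper_half" by (rule act_upper_half[OF det])

lemma act_fam_mult: "de : Ga ==> z : upper_half ==> act (fam_mult ga de) z = act ga (act de z)" by (rule act_mult[OF det])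

lemma act_fam_inv: "ga : Ga ==> z : upper_half ==> act (fam_inv ga) (act ga z) = z" by (rule act_inv[OF det])

lemma fam_inv_fam_inv: "fam_inv (fam_inv ga) = ga"
proof
 fix j show "fam_inv (fam_inv ga) j = ga j" by (cases "ga j") (simp add: fam_inv_def)
qed

lemma act_fam_inv': "ga : Ga ==> z : upper_half ==> act ga (act (fam_inv ga) z) = z"
 using act_fam_inv[OF inv_closed, of ga z] by (simp add: fam_inv_fam_inv)

text \<open>Cut a countable cover by small polydiscs into pieces disjoint modulo the group.\<close>

lemma ex_fundamental_domain: "EX D. fundamental_domain Ga D"
proof -
 obtain ep where ep: "!!z. z : upper_half ==> 0 < ep z & ep z <= 1/2 \<and>
   (ALL ga:Ga. ALL w:polydisc (%_. ep z) z. act ga w : polydisc (%_. ep z) z --> (ALL j. ga j : plus_minus_one))" using discontinuous by metis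
 define P where "P = (%z. polydisc (%_. ep z) (z :: complex^'r))"
 have "!!S. S : P ` upper_half ==> open S" by (auto simp: P_def polydisc_open)
 then obtain F' where F': "F' <= P ` upper_half" "countable F'" "\<Union>F' = \<Union>(P ` upper_half)" using Lindelof by metis
 have in_P: "z : P z" if "z : upper_half" for z using ep[OF that] that by (auto simp: P_def polydisc_def upper_half_def)
 have P_H: "P z <= upper_half" if "z : upper_half" for z unfolding P_def using that ep[OF that] by (intro polydisc_subset) auto
 have cov: "upper_half <= \<Union>F'" using F'(3) in_P by blast
 have "(\<chi> j. \<i>) : (upper_half :: (complex^'r) set)" by (simp add: upper_half_def)
 hence ne: "F' ~= {}" using cov by blast
 define D where "D = from_nat_into F'"
 have D: "range D = F'" unfolding D_def by (rule range_from_nat_into[OF ne F'(2)])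
 have D_open: "open (D i)" and D_H: "D i <= upper_half" for i
 proof -
  have "D i : P ` upper_half" using D F'(1) by blast
  thus "open (D i)" "D i <= upper_half" using P_H by (auto simp: P_def polydisc_open)
 qed
 have same: "act ga w = w" if "w : D i" "act ga w : D i" "ga : Ga" for i ga w
 proof -
  obtain z where z: "z : upper_half" "D i = P z" using D F'(1) by blast
  have "ga j : plus_minus_one" for j using ep[OF z(1)] that unfolding z(2) P_def by blast
  thus ?thesis by (rule act_plus_minus_one)
 qed
 \<comment> \<open>The points of \<open>D i\<close> whose orbits avoid all earlier
   \<open>D j\<close>. Inside one \<open>D i\<close> equivalent points are equal, by
   \<open>same\<close>.\<close>
 define E where "E = (%i. D i - (\<Union>j<i. \<Union>ga\<in>Ga. act ga -` D j))"
 have E: "E i : sets borel" for i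
 proof -
  have "act ga -` D j : sets borel" for ga j using measurable_sets[OF act_measurable, of "D j" ga] D_open by simp
  thus ?thesis unfolding E_def using D_open countable by (intro sets.Diff sets.countable_UN'') (auto intro: borel_open)
 qed
 have eq: "w = w'" if z: "z : upper_half" and w: "w : E i" "ga : Ga" "w = act ga z" and w': "w' : E i'" "ga' : Ga" "w' = act ga' z" and le: "i <= i'"
  for z w i ga w' i' ga'
 proof -
  let ?de = "fam_mult ga (fam_inv ga')"
  have de: "?de : Ga" using w w' mult_closed inv_closed by blast
  have "act ?de w' = w" using act_fam_mult[OF inv_closed[OF w'(2)] act_H[OF w'(2) z]] act_fam_inv[OF w'(2) z] w w' by simp
  moreover from this have "~ i < i'" using w'(1) w(1) de unfolding E_def by auto
  ultimately show ?thesis using le same[of w' i ?de] w w' de unfolding E_def by auto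
 qed
 have "fundamental_domain Ga (\<Union>i. E i)" unfolding fundamental_domain_def
 proof (intro conjI ballI)
  show "(\<Union>i. E i) : sets borel" using E by auto
  show "(\<Union>i. E i) <= upper_half" using D_H by (auto simp: E_def)
  fix z :: "complex^'r" assume z: "z : upper_half"
  have "EX i. EX ga:Ga. act ga z : D i"
  proof -
   have "z : (\<Union>i. D i)" using z cov D by auto
   then obtain i where "z : D i" by blast
   hence "act (%_. (1, 0, 0, 1)) z : D i" by (subst act_plus_minus_one) auto
   thus ?thesis using one_closed by blast
  qed
  then obtain i where i: "EX ga:Ga. act ga z : D i" "!!j. j < i ==> ~ (EX ga:Ga. act ga z : D j)"
   using exists_least_iff[of "%i. EX ga:Ga. act ga z : D i"] by blast
  then obtain ga where ga: "ga : Ga" "act ga z : D i" by blast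
  have "act ga z : E i"
  proof -
   have "act de (act ga z) ~: D j" if "j < i" "de : Ga" for j de
    using i(2)[OF that(1)] act_fam_mult[OF ga(1) z, of de] mult_closed[OF that(2) ga(1)] by metis
   thus ?thesis unfolding E_def using ga by blast
  qed
  thus "\<exists>!w. w : (\<Union>i. E i) & (EX ga:Ga. w = act ga z)"
  proof (intro ex1I[of _ "act ga z"])
   fix w assume w: "w : (\<Union>i. E i) & (EX ga:Ga. w = act ga z)"
   then obtain i' ga' where "w : E i'" "ga' : Ga" "w = act ga' z" by blast
   thus "w = act ga z"
    using eq[OF z, of "act ga z" i ga w i' ga'] eq[OF z, of w i' ga' "act ga z" i ga] ga \<open>act ga z : E i\<close> by (cases "i <= i'") auto
  qed (use ga in blast)
 qed
 thus ?thesis by blast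
qed

text \<open>The very set that \<open>quotient_integral\<close> chooses, so that Petersson products
  are integrals over it.\<close>

definition Fd :: "(complex^'r) set" where
 "Fd = (SOME D. fundamental_domain Ga D)"

abbreviation (input) "pnorm k f \<equiv> \<integral>\<^sup>+w. ennreal (pet k f w) * indicator Fd w \<partial>hyp"

lemma Fd: "fundamental_domain Ga Fd" unfolding Fd_def using ex_fundamental_domain by (rule someI_ex)

lemma Fd_borel [measurable]: "Fd : sets borel" and Fd_H: "Fd <= upper_half" using Fd by (auto simp: fundamental_domain_def)

lemma AE_hyp_upper_half: "AE z in (hyp :: (complex^'r) measure). z : upper_half"
proof -
 have "(\<Prod>j\<in>UNIV. ennreal (hypw (z $ j))) = 0" if "z ~: upper_half" for z :: "complex^'r" using that by (auto simp: upper_half_def hypw_def)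
 thus ?thesis unfolding hyp_def by (subst AE_density) (use hyp_density_measurable in \<open>auto intro!: AE_I2 simp: zero_less_iff_neq_zero\<close>)
qed

text \<open>Every point of D has a translate in the fundamental domain. After a change of variables
  by each group element, a point u of the fundamental domain is counted once for every element that
  takes it into D.\<close>

lemma unfolding_le:
 assumes h [measurable]: "h : borel_measurable borel" and inv: "!!ga w. ga : Ga ==> w : upper_half ==> h (act ga w) = h w"
  and D [measurable]: "D : sets borel" and DH: "D <= upper_half"
  and N: "!!w. w : upper_half ==> finite {ga\<in>Ga. act ga w : D} & real (card {ga\<in>Ga. act ga w : D}) <= N"
 shows "(\<integral>\<^sup>+w. h w * indicator D w \<partial>hyp) <= ennreal N * (\<integral>\<^sup>+w. h w * indicator Fd w \<partial>hyp)"
proof -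
 have "(\<integral>\<^sup>+w. h w * indicator D w \<partial>hyp)
  <= (\<integral>\<^sup>+w. (\<integral>\<^sup>+ga. h w * indicator D w * indicator Fd (act ga w) \<partial>count_space Ga) \<partial>hyp)"
 proof (intro nn_integral_mono)
  fix w
  show "h w * indicator D w <= (\<integral>\<^sup>+ga. h w * indicator D w * indicator Fd (act ga w) \<partial>count_space Ga)"
  proof (cases "w : D")
   case True
   then obtain ga where ga: "ga : Ga" "act ga w : Fd" using Fd DH unfolding fundamental_domain_def by blast
   thus ?thesis using nn_integral_ge_point[OF ga(1), of "%ga. h w * indicator D w * indicator Fd (act ga w)"] by simp
  qed simp
 qed
 also have "... = (\<integral>\<^sup>+ga. (\<integral>\<^sup>+w. h w * indicator D w * indicator Fd (act ga w) \<partial>hyp) \<partial>count_space Ga)"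
  by (rule nn_integral_count_space_nn_integral[OF countable]) measurable
 also have "... = (\<integral>\<^sup>+ga. (\<integral>\<^sup>+u. h u * indicator Fd u * indicator D (act (fam_inv ga) u) \<partial>hyp) \<partial>count_space Ga)"
 proof (rule nn_integral_cong)
  fix ga assume "ga : space (count_space Ga)"
  hence ga: "ga : Ga" by simp
  let ?F = "%w. h w * indicator D w * indicator Fd (act ga w)"
  have "(\<integral>\<^sup>+w. ?F w \<partial>hyp) = (\<integral>\<^sup>+w. ?F w \<partial>distr hyp hyp (act (fam_inv ga)))"
   using distr_hyp_act[of "fam_inv ga", OF det[OF inv_closed[OF ga]]] by simp
  also have "... = (\<integral>\<^sup>+u. ?F (act (fam_inv ga) u) \<partial>hyp)" by (rule nn_integral_distr) measurable
  also have "... = (\<integral>\<^sup>+u. h u * indicator Fd u * indicator D (act (fam_inv ga) u) \<partial>hyp)"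
  proof (rule nn_integral_cong_AE, rule AE_mp[OF AE_hyp_upper_half], intro AE_I2 impI)
   fix u :: "complex^'r" assume "u : upper_half"
   thus "?F (act (fam_inv ga) u) = h u * indicator Fd u * indicator D (act (fam_inv ga) u)"
    using inv[OF inv_closed[OF ga]] act_fam_inv'[OF ga] by (simp add: mult_ac)
  qed
  finally show "(\<integral>\<^sup>+w. ?F w \<partial>hyp) = (\<integral>\<^sup>+u. h u * indicator Fd u * indicator D (act (fam_inv ga) u) \<partial>hyp)" .
 qed
 also have "... = (\<integral>\<^sup>+u. (\<integral>\<^sup>+ga. h u * indicator Fd u * indicator D (act (fam_inv ga) u) \<partial>count_space Ga) \<partial>hyp)"
  by (rule nn_integral_count_space_nn_integral[OF countable, symmetric]) measurable
 also have "... <= (\<integral>\<^sup>+u. ennreal N * (h u * indicator Fd u) \<partial>hyp)"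
 proof (intro nn_integral_mono)
  fix u
  show "(\<integral>\<^sup>+ga. h u * indicator Fd u * indicator D (act (fam_inv ga) u) \<partial>count_space Ga) <= ennreal N * (h u * indicator Fd u)"
  proof (cases "u : Fd")
   case True
   hence u: "u : upper_half" using Fd_H by blast
   have bij: "bij_betw fam_inv Ga Ga" by (rule bij_betwI[where g = fam_inv]) (auto simp: inv_closed fam_inv_fam_inv)
   have "(\<integral>\<^sup>+ga. h u * indicator Fd u * indicator D (act (fam_inv ga) u) \<partial>count_space Ga)
    = (\<integral>\<^sup>+ga. h u * indicator D (act ga u) \<partial>count_space Ga)"
    using True nn_integral_bij_count_space[OF bij, of "%ga. h u * indicator D (act ga u)"] by simp
   also have "... = (\<integral>\<^sup>+ga. h u * indicator {ga\<in>Ga. act ga u : D} ga \<partial>count_space Ga)"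
    by (intro nn_integral_cong) (auto simp: indicator_def)
   also have "... = h u * of_nat (card {ga\<in>Ga. act ga u : D})" using N[OF u] by (simp add: nn_integral_cmult_indicator)
   also have "... <= h u * ennreal N" using N[OF u] by (intro mult_left_mono) (auto simp: ennreal_of_nat_eq_real_of_nat intro: ennreal_leI)
   finally show ?thesis using True by (simp add: mult.commute)
  qed simp
 qed
 also have "... = ennreal N * (\<integral>\<^sup>+w. h w * indicator Fd w \<partial>hyp)" by (intro nn_integral_cmult) measurable
 finally show ?thesis .
qed

lemma petersson_eq:
 "petersson Ga k f g = (\<integral>z. complex_of_real (indicator Fd z * ((\<Prod>j\<in>UNIV. Im (z $ j) ^ k j) / (\<Prod>j\<in>UNIV. (Im (z $ j))^2))) * (f z * cnj (g z)) \<partial>lborel)"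
 unfolding petersson_def quotient_integral_def set_lebesgue_integral_def Fd_def[symmetric]
 by (intro Bochner_Integration.integral_cong refl) (auto simp: indicator_def scaleR_conv_of_real)

lemma nn_integral_pet:
 assumes "f : borel_measurable borel"
 shows "pnorm k f
  = (\<integral>\<^sup>+z. ennreal (indicator Fd z * ((\<Prod>j\<in>UNIV. Im (z $ j) ^ k j) / (\<Prod>j\<in>UNIV. (Im (z $ j))^2)) * (cmod (f z))^2) \<partial>lborel)"
proof -
 have m: "(%w. ennreal (pet k f w)) : borel_measurable borel" using assms unfolding pet_def by measurable
 have "pnorm k f
  = (\<integral>\<^sup>+w. (\<Prod>j\<in>UNIV. ennreal (hypw (w $ j))) * (ennreal (pet k f w) * indicator Fd w) \<partial>lborel)"
  unfolding hyp_def by (subst nn_integral_density) (use m in auto)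
 also have "... = (\<integral>\<^sup>+z. ennreal (indicator Fd z * ((\<Prod>j\<in>UNIV. Im (z $ j) ^ k j) / (\<Prod>j\<in>UNIV. (Im (z $ j))^2)) * (cmod (f z))^2) \<partial>lborel)"
 proof (intro nn_integral_cong)
  fix z
  show "(\<Prod>j\<in>UNIV. ennreal (hypw (z $ j))) * (ennreal (pet k f z) * indicator Fd z)
   = ennreal (indicator Fd z * ((\<Prod>j\<in>UNIV. Im (z $ j) ^ k j) / (\<Prod>j\<in>UNIV. (Im (z $ j))^2)) * (cmod (f z))^2)"
  proof (cases "z : Fd")
   case True
   hence z: "z : upper_half" using Fd_H by blast
   have "(\<Prod>j\<in>UNIV. ennreal (hypw (z $ j))) = ennreal (\<Prod>j\<in>UNIV. 1 / (Im (z $ j))^2)"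
    using z by (subst prod_ennreal[symmetric]) (auto simp: hypw_def upper_half_def)
   thus ?thesis using True pet_nonneg[OF z, of k f] by (simp add: ennreal_mult''[symmetric] pet_def prod_dividef mult_ac)
  qed simp
 qed
 finally show ?thesis .
qed

lemma bergman_kernel_le:
 assumes onb: "orthonormal_basis Ga k S bs" and M: "0 <= M"
  and meas: "!!f. f : S ==> f : borel_measurable borel"
  and lin: "!!c. (%z. \<Sum>g\<in>bs. c g * g z) : S"
  and bound: "!!f z. f : S ==> z : upper_half ==>
    ennreal (pet k f z) <= ennreal M * pnorm k f"
  and z: "z : upper_half"
 shows "bergman_kernel k bs z <= M"
proof -
 define W where "W = (%z::complex^'r. indicator Fd z * ((\<Prod>j\<in>UNIV. Im (z $ j) ^ k j) / (\<Prod>j\<in>UNIV. (Im (z $ j))^2)) :: real)"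
 have Wm [measurable]: "W : borel_measurable borel" unfolding W_def by measurable
 have W0: "0 <= W z" for z using Fd_H by (cases "z : Fd") (auto simp: W_def upper_half_def less_imp_le intro!: divide_nonneg_nonneg prod_nonneg)
 have bs: "finite bs" "bs <= S" and on: "!!f g. f : bs ==> g : bs ==> petersson Ga k f g = (if f = g then 1 else 0)"
  using onb by (auto simp: orthonormal_basis_def)
 have p: "petersson Ga k f g = (\<integral>z. of_real (W z) * (f z * cnj (g z)) \<partial>lborel)" for f g unfolding petersson_eq W_def ..
 have bm [measurable]: "f : borel_measurable borel" if "f : bs" for f using meas bs(2) that by blast
 \<comment> \<open>An integral that does not exist has the value 0, whereas the norm of f is
   1.\<close>
 have i1: "integrable lborel (%z. W z * (cmod (f z))^2)" if f: "f : bs" for f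
 proof -
  have "integrable lborel (%z. of_real (W z) * (f z * cnj (f z)))" using on[OF f f] not_integrable_integral_eq unfolding p by fastforce
  hence "integrable lborel (%z. complex_of_real (W z * (cmod (f z))^2))" by (simp add: complex_norm_square[symmetric] del: of_real_power)
  thus ?thesis by (simp only: complex_of_real_integrable_eq)
 qed
 have i2: "integrable lborel (%z. of_real (W z) * (f z * cnj (g z)))" if f: "f : bs" and g: "g : bs" for f g
 proof (rule Bochner_Integration.integrable_bound[OF Bochner_Integration.integrable_add[OF i1[OF f] i1[OF g]]])
  show "(%z. of_real (W z) * (f z * cnj (g z))) : borel_measurable lborel"
  proof -
   have "cnj : borel_measurable borel" by (intro borel_measurable_continuous_onI continuous_intros)
   from measurable_compose[OF bm[OF g] this] bm[OF f] show ?thesis by simp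
  qed
  have "cmod (of_real (W z) * (f z * cnj (g z))) <= W z * (cmod (f z))^2 + W z * (cmod (g z))^2" for z
  proof -
   have "0 <= (cmod (f z) - cmod (g z))^2" "0 <= cmod (f z) * cmod (g z)" by simp_all
   hence "cmod (f z) * cmod (g z) <= (cmod (f z))^2 + (cmod (g z))^2" using power2_diff[of "cmod (f z)" "cmod (g z)"] by linarith
   from mult_left_mono[OF this W0[of z]] show ?thesis using W0[of z] by (simp add: norm_mult algebra_simps)
  qed
  thus "AE z in lborel. cmod (of_real (W z) * (f z * cnj (g z))) <= norm_class.norm (W z * (cmod (f z))^2 + W z * (cmod (g z))^2)"
   by (intro AE_I2) (metis abs_ge_self order_trans real_norm_def)
 qed
 \<comment> \<open>At the given z, this number is both f z and the squared Petersson norm of f,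
   while \<open>pet k f z\<close> is the kernel times s. The bound for f is then divided by
   s.\<close>
 define s where "s = (\<Sum>g\<in>bs. (cmod (g z))^2)"
 define f where "f = (%w. \<Sum>g\<in>bs. cnj (g z) * g w)"
 have fS: "f : S" unfolding f_def by (rule lin)
 have s0: "0 <= s" unfolding s_def by (intro sum_nonneg) simp
 have fz: "f z = of_real s" unfolding f_def s_def by (simp add: complex_norm_square mult.commute del: of_real_power)
 have ff: "of_real (W w) * (f w * cnj (f w)) = (\<Sum>g\<in>bs. \<Sum>h\<in>bs. cnj (g z) * h z * (of_real (W w) * (g w * cnj (h w))))" for w
 proof -
  have "f w * cnj (f w) = (\<Sum>g\<in>bs. \<Sum>h\<in>bs. (cnj (g z) * g w) * (h z * cnj (h w)))"
   unfolding f_def cnj_sum by (simp only: sum_product complex_cnj_mult complex_cnj_cnj)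
  thus ?thesis by (simp only: sum_distrib_left) (intro sum.cong refl, simp)
 qed
 have if1: "integrable lborel (%w. of_real (W w) * (f w * cnj (f w)))"
  unfolding ff by (intro Bochner_Integration.integrable_sum integrable_mult_right i2)
 have "(\<integral>w. of_real (W w) * (f w * cnj (f w)) \<partial>lborel)
  = (\<Sum>g\<in>bs. \<Sum>h\<in>bs. cnj (g z) * h z * (\<integral>w. of_real (W w) * (g w * cnj (h w)) \<partial>lborel))"
  unfolding ff by (simp add: Bochner_Integration.integral_sum Bochner_Integration.integrable_sum i2 integrable_mult_right)
 also have "... = (\<Sum>g\<in>bs. \<Sum>h\<in>bs. if g = h then cnj (g z) * h z else 0)" by (intro sum.cong refl) (simp add: p[symmetric] on)
 also have "... = of_real s" using bs(1) by (simp add: s_def complex_norm_square mult.commute del: of_real_power)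
 finally have int: "(\<integral>w. of_real (W w) * (f w * cnj (f w)) \<partial>lborel) = of_real s" .
 have e: "of_real (W w) * (f w * cnj (f w)) = complex_of_real (W w * (cmod (f w))^2)" for w by (simp add: complex_norm_square del: of_real_power)
 have "integrable lborel (%w. W w * (cmod (f w))^2)" using if1 unfolding e by (simp only: complex_of_real_integrable_eq)
 moreover have "(\<integral>w. W w * (cmod (f w))^2 \<partial>lborel) = s"
  using int unfolding e by (simp only: integral_complex_of_real of_real_eq_iff)
 ultimately have "(\<integral>\<^sup>+w. ennreal (W w * (cmod (f w))^2) \<partial>lborel) = ennreal s"
  using nn_integral_eq_integral[of lborel "%w. W w * (cmod (f w))^2"] W0 by simp
 hence "ennreal (pet k f z) <= ennreal (M * s)"
  using bound[OF fS z] nn_integral_pet[OF meas[OF fS], of k] M s0 unfolding W_def by (simp add: ennreal_mult)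
 hence "pet k f z <= M * s" using M s0 by (simp add: ennreal_le_iff)
 moreover have "pet k f z = bergman_kernel k bs z * s"
 proof -
  have "cmod (f z) = s" using fz s0 by simp
  moreover have "bergman_kernel k bs z = (\<Prod>j\<in>UNIV. Im (z $ j) ^ k j) * s" by (simp add: bergman_kernel_def s_def sum_distrib_left)
  ultimately show ?thesis by (simp add: pet_def power2_eq_square)
 qed
 ultimately have le: "bergman_kernel k bs z * s <= M * s" by simp
 show ?thesis
 proof (cases "s = 0")
  case True
  hence "bergman_kernel k bs z = 0" by (simp add: bergman_kernel_def s_def sum_distrib_left[symmetric])
  thus ?thesis using M by simp
 next
  case False
  thus ?thesis using le s0 by (simp add: mult_le_cancel_right)
 qed
qed

end

section \<open>Bounds for cusp forms from counting\<close>

lemma cusp_forms_measurable: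
 fixes f :: "complex^'r::finite => complex"
 assumes "f : cusp_forms Ga C k"
 shows "f : borel_measurable borel"
proof -
 have "f = (%z. indicator upper_half z *\<^sub>R f z)" using assms by (auto simp: cusp_forms_def indicator_def fun_eq_iff)
 moreover have "(%z. indicator upper_half z *\<^sub>R f z) : borel_measurable borel"
  using assms by (intro borel_measurable_continuous_on_indicator upper_half_borel holomorphic_vec_continuous)
   (auto simp: cusp_forms_def)
 ultimately show ?thesis by simp
qed

lemma holomorphic_vec_add:
 assumes "holomorphic_vec f S" "holomorphic_vec g S"
 shows "holomorphic_vec (%z. f z + g z) S" unfolding holomorphic_vec_def
proof
 fix z assume z: "z : S"
 obtain D where D: "(f has_derivative D) (at z)" "!!c v. D (c *s v) = c * D v" using assms(1) z unfolding holomorphic_vec_def by blast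
 obtain E where E: "(g has_derivative E) (at z)" "!!c v. E (c *s v) = c * E v" using assms(2) z unfolding holomorphic_vec_def by blast
 have "((%z. f z + g z) has_derivative (%h. D h + E h)) (at z)" by (rule has_derivative_add[OF D(1) E(1)])
 thus "EX D. ((%z. f z + g z) has_derivative D) (at z) & (ALL c v. D (c *s v) = c * D v)"
  by (intro exI[of _ "%h. D h + E h"]) (auto simp: D(2) E(2) algebra_simps)
qed

lemma cusp_forms_add:
 assumes "f : cusp_forms Ga C k" "g : cusp_forms Ga C k"
 shows "(%z. f z + g z) : cusp_forms Ga C k"
proof -
 have "vanishes_at_infinity (slash k (%z. f z + g z) de)" if "de : C" for de unfolding vanishes_at_infinity_def
 proof (intro allI impI)
  fix e :: real assume e: "e > 0"
  have "EX Y. ALL z:upper_half. (ALL j. Y < Im (z $ j)) --> cmod (slash k h de z) < e / 2" if "h : cusp_forms Ga C k" for h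
   using that \<open>de : C\<close> e half_gt_zero[OF e] unfolding cusp_forms_def vanishes_at_infinity_def by blast
  from this[OF assms(1)] this[OF assms(2)] obtain Y Z where
   YZ: "ALL z:upper_half. (ALL j. Y < Im (z $ j)) --> cmod (slash k f de z) < e / 2"
    "ALL z:upper_half. (ALL j. Z < Im (z $ j)) --> cmod (slash k g de z) < e / 2" by blast
  show "EX Y. ALL z:upper_half. (ALL j. Y < Im (z $ j)) --> cmod (slash k (%z. f z + g z) de z) < e"
  proof (intro exI[of _ "max Y Z"] ballI impI)
   fix z :: "complex^'a" assume z: "z : upper_half" "ALL j. max Y Z < Im (z $ j)"
   have "cmod (slash k f de z + slash k g de z) <= cmod (slash k f de z) + cmod (slash k g de z)" by (rule norm_triangle_ineq)
   also have "... < e / 2 + e / 2" using YZ z by (intro add_strict_mono) auto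
   finally show "cmod (slash k (%z. f z + g z) de z) < e" by (simp add: slash_def add_divide_distrib)
  qed
 qed
 thus ?thesis using assms unfolding cusp_forms_def by (auto intro: holomorphic_vec_add simp: algebra_simps)
qed

lemma cusp_forms_scale:
 assumes "f : cusp_forms Ga C k"
 shows "(%z. c * f z) : cusp_forms Ga C k"
proof -
 have "vanishes_at_infinity (slash k (%z. c * f z) de)" if "de : C" for de unfolding vanishes_at_infinity_def
 proof (intro allI impI)
  fix e :: real assume e: "e > 0"
  have "e / (cmod c + 1) > 0" using e by (simp add: add_nonneg_pos)
  moreover have "vanishes_at_infinity (slash k f de)" using assms that by (simp add: cusp_forms_def)
  ultimately obtain Y where Y: "ALL z:upper_half. (ALL j. Y < Im (z $ j)) --> cmod (slash k f de z) < e / (cmod c + 1)"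
   unfolding vanishes_at_infinity_def by meson
  show "EX Y. ALL z:upper_half. (ALL j. Y < Im (z $ j)) --> cmod (slash k (%z. c * f z) de z) < e"
  proof (intro exI[of _ Y] ballI impI)
   fix z :: "complex^'a" assume z: "z : upper_half" "ALL j. Y < Im (z $ j)"
   have "cmod (c * slash k f de z) <= (cmod c + 1) * cmod (slash k f de z)" unfolding norm_mult by (intro mult_right_mono) auto
   also have "... < e" using Y z by (simp add: pos_less_divide_eq[symmetric] add_nonneg_pos pos_less_divide_eq mult.commute)
   finally show "cmod (slash k (%z. c * f z) de z) < e" by (simp add: slash_def)
  qed
 qed
 thus ?thesis using assms unfolding cusp_forms_def by (auto intro!: holomorphic_vec_mult holomorphic_vec_const)
qed

lemma cusp_forms_lincomb:
 assumes "finite bs" "bs <= cusp_forms Ga C k"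
 shows "(%z. \<Sum>g\<in>bs. c g * g z) : cusp_forms Ga C k" using assms
proof (induction bs rule: finite_induct)
 case empty
 thus ?case by (auto simp: cusp_forms_def slash_def vanishes_at_infinity_def intro: holomorphic_vec_const)
next
 case (insert g bs)
 thus ?case by (auto intro: cusp_forms_add cusp_forms_scale)
qed

text \<open>The image of z has imaginary part at least Im z / 2, so \<open>displacement\<close>
  loses only a factor 2.\<close>

lemma near_fixed_bound:
 assumes "det2 (p, q, r, s) = 1" "0 < Im z" "0 <= ep" "ep <= 1/2" "cmod (moebius (p, q, r, s) z - z) <= ep * Im z"
 shows "(cmod (of_real r * z^2 + of_real (s - p) * z - of_real q))^2 <= 2 * ep^2 * (Im z)^2"
  and "(p + s)^2 - 4 <= 2 * ep^2"
proof -
 let ?w = "moebius (p, q, r, s) z" and ?Q = "of_real r * z^2 + of_real (s - p) * z - of_real q"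
 have "\<bar>Im ?w - Im z\<bar> <= cmod (?w - z)" using abs_Im_le_cmod[of "?w - z"] by (simp del: moebius.simps)
 also note assms(5)
 also have "ep * Im z <= 1/2 * Im z" using assms by (intro mult_right_mono) auto
 finally have w: "Im z / 2 <= Im ?w" by linarith
 have "(cmod ?Q)^2 = (cmod (?w - z))^2 * Im z / Im ?w" by (rule displacement(1)[OF assms(1,2)])
 also have "... <= (cmod (?w - z))^2 * Im z / (Im z / 2)" using w assms(2) by (intro divide_left_mono) auto
 also have "... = 2 * (cmod (?w - z))^2" using assms(2) by (simp del: moebius.simps)
 also have "... <= 2 * (ep * Im z)^2" using assms(5) by (intro mult_left_mono power_mono) auto
 finally show Q: "(cmod ?Q)^2 <= 2 * ep^2 * (Im z)^2" by (simp add: power_mult_distrib)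
 have "((p + s)^2 - 4) * (Im z)^2 <= (2 * ep^2) * (Im z)^2" using displacement(2)[OF assms(1,2)] Q by linarith
 thus "(p + s)^2 - 4 <= 2 * ep^2" using assms(2) by (simp add: mult_le_cancel_right)
qed

lemma mult_mat2_assoc:
 "mmul (mmul x y) z
  = mmul x (mmul y (z :: 'a::comm_ring_1 quad))" by (cases x; cases y; cases z) (simp add: quat_simps algebra_simps)

lemma mult_mat2_1: "mmul x (1, 0, 0, 1) = (x :: 'a::comm_ring_1 quad)"
 "mmul (1, 0, 0, 1) x = x" by (cases x; simp add: quat_simps)+

lemma pet_slash:
 assumes ga: "!!j. det2 (ga j) = 1" and w: "w : upper_half"
 shows "pet k (slash k f ga) w = pet k f (act ga w)"
proof -
 have "pet k (slash k f ga) w = (\<Prod>j\<in>UNIV. Im (w $ j) ^ k j / (cmod (autfac (ga j) (w $ j)) ^ k j)^2) * (cmod (f (act ga w)))^2"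
  by (simp add: pet_def slash_def norm_divide power_divide prod_norm[symmetric] norm_power prod_dividef prod_power_distrib)
 also have "(\<Prod>j\<in>UNIV. Im (w $ j) ^ k j / (cmod (autfac (ga j) (w $ j)) ^ k j)^2) = (\<Prod>j\<in>UNIV. Im (act ga w $ j) ^ k j)"
 proof (intro prod.cong refl)
  fix j
  have "0 < Im (w $ j)" using w by (simp add: upper_half_def)
  hence "Im (act ga w $ j) = Im (w $ j) / (cmod (autfac (ga j) (w $ j)))^2" by (simp add: act_def Im_moebius[OF ga])
  thus "Im (w $ j) ^ k j / (cmod (autfac (ga j) (w $ j)) ^ k j)^2 = Im (act ga w $ j) ^ k j"
   by (simp add: power_divide power_mult[symmetric] mult.commute)
 qed
 finally show ?thesis by (simp add: pet_def)
qed

context disc_group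
begin

definition near_stabilizer :: "('r => real) => complex^'r => ('r => real quad) set" where
 "near_stabilizer ep w = {ga\<in>Ga. ALL j. cmod (act ga w $ j - w $ j) <= ep j * Im (w $ j)}"

lemma pet_invariant:
 assumes f: "f : cusp_forms Ga C k" and ga: "ga : Ga" and w: "w : upper_half"
 shows "pet k f (act ga w) = pet k f w"
proof -
 have "slash k f ga w = f w" using f ga w autfac_nonzero[OF det[OF ga]] by (simp add: slash_def cusp_forms_def upper_half_def)
 thus ?thesis using pet_slash[of ga w k f, OF det[OF ga] w] by (simp add: pet_def)
qed

text \<open>Joins \<open>pet_submean\<close> to \<open>unfolding_le\<close> and reduces the
  multiplicity in the latter to a count of elements of small displacement.\<close>

lemma pet_le:
 assumes f: "f : cusp_forms Ga C k" and k: "!!j. 0 < k j" and z: "z : upper_half" and rh: "0 < rh" "rh <= 1/2" and N: "0 <= N"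
  and count: "!!w. w : polydisc (%j. rh / sqrt (real (k j))) z ==>
   finite (near_stabilizer (%j. 4 * rh / sqrt (real (k j))) w) & real (card (near_stabilizer (%j. 4 * rh / sqrt (real (k j))) w)) <= N"
 shows "ennreal (pet k f z) <= ennreal ((8 / rh^2) ^ CARD('r) * kprod k * N)
  * pnorm k f"
proof -
 define r where "r = (%j. rh / sqrt (real (k j)))"
 let ?D = "polydisc r z"
 have fm [measurable]: "f : borel_measurable borel" by (rule cusp_forms_measurable[OF f])
 have r: "0 < r j" "r j <= 1/2" for j
 proof -
  have "1 <= sqrt (real (k j))" using k[of j] by simp
  hence "rh / sqrt (real (k j)) <= rh / 1" using rh by (intro divide_left_mono) auto
  hence "rh / sqrt (real (k j)) <= 1/2" using rh by linarith
  thus "0 < r j" "r j <= 1/2" using rh k[of j] unfolding r_def by simp_all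
 qed
 have DH: "?D <= upper_half" by (rule polydisc_subset[OF z r(2)])
 have "(\<integral>\<^sup>+w. ennreal (pet k f w) * indicator ?D w \<partial>hyp) <= ennreal N * pnorm k f"
 proof (rule unfolding_le)
  show "(%w. ennreal (pet k f w)) : borel_measurable borel" unfolding pet_def by measurable
  show "ennreal (pet k f (act ga w)) = ennreal (pet k f w)" if "ga : Ga" "w : upper_half" for ga w using pet_invariant[OF f that] by simp
  show "?D : sets borel" by (intro borel_open polydisc_open)
  show "?D <= upper_half" by (rule DH)
  fix w :: "complex^'r" assume w: "w : upper_half"
  let ?A = "{ga\<in>Ga. act ga w : ?D}"
  show "finite ?A & real (card ?A) <= N"
  proof (cases "?A = {}")
   case True
   show ?thesis unfolding True using N by simp
  next
   case False
   then obtain ga0 where ga0: "ga0 : Ga" "act ga0 w : ?D" by blast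
   \<comment> \<open>All elements taking w into the polydisc are compared with one of them,
     \<open>ga0\<close>: the quotients move \<open>?w\<close> by at most two radii. In units of Im
     \<open>?w\<close>, which exceeds Im z / 2, this becomes four radii.\<close>
   let ?w = "act ga0 w" and ?T = "%ga. fam_mult ga (fam_inv ga0)"
   let ?B = "near_stabilizer (%j. 4 * rh / sqrt (real (k j))) ?w"
   have B: "finite ?B" "real (card ?B) <= N" using count ga0(2) by (auto simp: r_def)
   have inj: "inj_on ?T ?A"
   proof (rule inj_on_inverseI[of _ "%de. fam_mult de ga0"])
    fix ga show "fam_mult (?T ga) ga0 = ga" by (simp add: fam_mult_def fam_inv_def mult_mat2_assoc mult_inv2[OF det[OF ga0(1)]] mult_mat2_1)
   qed
   have "?T ` ?A <= ?B"
   proof (intro image_subsetI)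
    fix ga assume "ga : ?A"
    hence ga: "ga : Ga" "act ga w : ?D" by auto
    have e: "act (?T ga) ?w = act ga w" using act_fam_mult[OF inv_closed[OF ga0(1)] act_H[OF ga0(1) w], of ga] act_fam_inv[OF ga0(1) w] by simp
    have "cmod (act ga w $ j - ?w $ j) <= 4 * rh / sqrt (real (k j)) * Im (?w $ j)" for j
    proof -
     have "cmod (act ga w $ j - ?w $ j) <= cmod (act ga w $ j - z $ j) + cmod (?w $ j - z $ j)"
      using norm_triangle_ineq4[of "act ga w $ j - z $ j" "?w $ j - z $ j"] by simp
     also have "... <= r j * Im (z $ j) + r j * Im (z $ j)" using ga(2) ga0(2) by (intro add_mono) (auto simp: polydisc_def less_imp_le)
     also have "... = 4 * r j * (Im (z $ j) / 2)" by simp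
     also have "... <= 4 * r j * Im (?w $ j)" using polydisc_Im(1)[OF ga0(2) z r(2)[of j]] r(1)[of j] by (intro mult_left_mono) auto
     finally show ?thesis by (simp add: r_def)
    qed
    thus "?T ga : ?B" unfolding near_stabilizer_def using e mult_closed[OF ga(1) inv_closed[OF ga0(1)]] by simp
   qed
   hence "finite (?T ` ?A)" "card (?T ` ?A) <= card ?B" using B(1) by (auto intro: finite_subset card_mono)
   thus ?thesis using inj B(2) by (auto simp: card_image finite_image_iff)
  qed
 qed
 moreover have "ennreal (pet k f z) <= ennreal ((8 / rh^2) ^ CARD('r) * kprod k) * (\<integral>\<^sup>+w. ennreal (pet k f w) * indicator ?D w \<partial>hyp)"
  unfolding r_def by (rule pet_submean) (use f fm z k rh in \<open>auto simp: cusp_forms_def\<close>)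
 ultimately have le: "ennreal (pet k f z) <= ennreal ((8 / rh^2) ^ CARD('r) * kprod k) * (ennreal N * pnorm k f)"
  by (meson mult_left_mono order_trans zero_le)
 have "0 <= (8 / rh^2) ^ CARD('r) * kprod k" by (simp add: prod_nonneg)
 hence e: "ennreal ((8 / rh^2) ^ CARD('r) * kprod k * N)
   = ennreal ((8 / rh^2) ^ CARD('r) * kprod k) * ennreal N" using N by (rule ennreal_mult)
 show ?thesis unfolding e using le by (simp only: mult.assoc)
qed

lemma SUP_bergman_kernel_le:
 assumes onb: "orthonormal_basis Ga k (cusp_forms Ga C k) bs" and M: "0 <= M"
  and bound: "!!f z. f : cusp_forms Ga C k ==> z : upper_half ==>
    ennreal (pet k f z) <= ennreal M * pnorm k f"
 shows "(SUP z\<in>upper_half. ereal (bergman_kernel k bs z)) <= ereal M"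
proof (rule SUP_least)
 fix z :: "complex^'r" assume z: "z : upper_half"
 have "(%z. \<Sum>g\<in>bs. c g * g z) : cusp_forms Ga C k" for c using onb by (intro cusp_forms_lincomb) (auto simp: orthonormal_basis_def)
 thus "ereal (bergman_kernel k bs z) <= ereal M" using bergman_kernel_le[OF onb M cusp_forms_measurable _ bound z] by simp
qed

end

section \<open>The arithmetic groups as discontinuous groups\<close>

lemma countable_number_field:
 assumes "number_field TYPE('f::field_char_0)"
 shows "countable (UNIV :: 'f set)"
proof -
 obtain B :: "'f set" where B: "finite B" "QV.span B = UNIV" using number_field_basis[OF assms] by metis
 have "UNIV = (%u. \<Sum>v\<in>B. of_rat (u v) * v) ` (PiE B (%_. UNIV :: rat set))"
 proof (intro equalityI subsetI)
  fix x assume "x : (UNIV :: 'f set)"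
  hence "x : QV.span B" using B by simp
  then obtain u where "x = (\<Sum>v\<in>B. of_rat (u v) * v)" unfolding QV.span_finite[OF B(1)] by auto
  thus "x : (%u. \<Sum>v\<in>B. of_rat (u v) * v) ` (PiE B (%_. UNIV))" by (intro image_eqI[of _ _ "restrict u B"]) (auto intro!: sum.cong)
 qed simp
 also have "countable ..." by (intro countable_image countable_PiE B) auto
 finally show ?thesis .
qed

lemma map_quad_mult_via_embedding:
 assumes "field_hom ta"
 shows "map_quad ta (mq a b x y)
  = mq (ta a) (ta b) (map_quad ta x) (map_quad ta y)" using assms by (cases x; cases y) (simp add: quat_simps hom_add hom_mult hom_diff)

locale arithmetic_group =
 fixes a b :: "'f::field_char_0"
  and si :: "'r::finite => 'f => real"
  and tht :: "'r => real quad => real quad"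
  and U :: "(('f => int) => (nat => 'f) set) quad set"
  and t :: "(('f => int) => (nat => 'f) set) quad"
  and Ga :: "('r => real quad) set"
 assumes nf: "number_field TYPE('f)" and tr: "totally_real TYPE('f)"
  and ab: "a ~= 0" "b ~= 0"
  and si: "bij_betw si UNIV (split_real_places a b)"
  and tht: "!!j. tht j : splittings RT (si j a) (si j b)"
  and U: "subgroup U (G_fin a b)" and Uc: "compactin (G_fin_top a b) U"
  and t: "t : carrier (G_fin a b)"
  and Ga: "Ga = Gamma1 a b si tht U t"
  and ell: "no_elliptic_fixed_points Ga"
  and mixed: "ALL ga:Ga. ~ hyperbolic_elliptic ga"
begin

definition emb :: "'f quad => 'r => real quad" where
 "emb x = (%j. tht j (map_quad (si j) x))"

lemma Ga_emb: "Ga = emb ` Gamma1_quat a b U t" by (auto simp: Ga Gamma1_def emb_def)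

lemma si_hom: "field_hom (si j)"
proof -
 have "si j : split_real_places a b" using bij_betwE[OF si] by blast
 thus ?thesis by (simp add: split_real_places_def real_embeddings_field_hom)
qed

lemmas sh_0 = hom_0[OF si_hom]
 and sh_1 = hom_1[OF si_hom]
 and sh_add = hom_add[OF si_hom]
 and sh_diff = hom_diff[OF si_hom]
 and sh_eq_0 = hom_eq_0[OF si_hom]
 and sh_inj = hom_inj[OF si_hom]
 and sh_minus = hom_minus[OF si_hom]
 and sh_mult = hom_mult[OF si_hom]
 and sh_of_int = hom_of_int[OF si_hom]
 and sh_of_nat = hom_of_nat[OF si_hom]
 and sh_of_rat = hom_of_rat[OF si_hom]
 and sh_power = hom_power[OF si_hom]
 and sh_sum = hom_sum[OF si_hom]

lemma emb_mult: "emb (mq a b x y) = fam_mult (emb x) (emb y)"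
 by (simp add: emb_def fam_mult_def map_quad_mult_via_embedding[OF si_hom] splitting_mult[OF tht])

lemma emb_1: "emb (1, 0, 0, 0) = (%_. (1, 0, 0, 1))" by (simp add: emb_def sh_1 sh_0 splitting_1[OF tht])

lemma Gamma1_nrd: "x : Gamma1_quat a b U t ==> nrd a b x = 1" by (simp add: Gamma1_quat_def)

lemma emb_det: "nrd a b x = 1 ==> det2 (emb x j) = 1"
proof (cases x)
 fix x0 x1 x2 x3 assume n: "nrd a b x = 1" and x: "x = (x0, x1, x2, x3)"
 have "det2 (emb x j) = nrd (si j a) (si j b) (map_quad (si j) x)" unfolding emb_def x map_quad.simps by (rule splitting_tr_det(2)[OF tht refl])
 thus ?thesis by (simp only: nrd_hom[OF si_hom] n sh_1)
qed

lemma emb_tr: "tr2 (emb (x0, x1, x2, x3) j) = si j (2 * x0)"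
proof -
 have "tr2 (emb (x0, x1, x2, x3) j) = 2 * si j x0" unfolding emb_def map_quad.simps by (rule splitting_tr_det(1)[OF tht refl])
 thus ?thesis by (simp only: mult_2 sh_add)
qed

lemma emb_conj:
 assumes "nrd a b x = 1"
 shows "emb (conj_quat x) = fam_inv (emb x)"
proof
 fix j
 have "mmul (emb (conj_quat x) j) (emb x j) = (1, 0, 0, 1)"
  using emb_mult[of "conj_quat x" x] assms emb_1 by (simp add: mult_conj_quat fam_mult_def fun_eq_iff)
 hence "mmul (mmul (emb (conj_quat x) j) (emb x j)) (inv2 (emb x j)) = inv2 (emb x j)" by (simp add: mult_mat2_1)
 thus "emb (conj_quat x) j = fam_inv (emb x) j" unfolding mult_mat2_assoc mult_inv2(2)[OF emb_det[OF assms]] by (simp add: mult_mat2_1 fam_inv_def)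
qed

lemma emb_scalar: "emb (c, 0, 0, 0) j = (si j c, 0, 0, si j c)" by (simp add: emb_def sh_0 splitting_scalar[OF tht])

lemma Ga_group:
 shows Ga_det: "ga : Ga ==> det2 (ga j) = 1"
  and Ga_mult: "ga : Ga ==> de : Ga ==> fam_mult ga de : Ga"
  and Ga_inv: "ga : Ga ==> fam_inv ga : Ga"
  and Ga_1: "(%_. (1, 0, 0, 1)) : Ga"
  and Ga_countable: "countable Ga"
proof -
 show "ga : Ga ==> det2 (ga j) = 1" unfolding Ga_emb by (erule imageE) (simp add: emb_det Gamma1_nrd)
 show "fam_mult ga de : Ga" if g: "ga : Ga" "de : Ga"
 proof -
  obtain x y where xy: "x : Gamma1_quat a b U t" "ga = emb x" "y : Gamma1_quat a b U t" "de = emb y" using g unfolding Ga_emb by blast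
  show ?thesis unfolding xy emb_mult[symmetric] Ga_emb by (intro imageI Gamma1_quat_mult[OF nf U Uc t] xy)
 qed
 show "fam_inv ga : Ga" if g: "ga : Ga"
 proof -
  obtain x where x: "x : Gamma1_quat a b U t" "ga = emb x" using g unfolding Ga_emb by blast
  show ?thesis unfolding x emb_conj[OF Gamma1_nrd[OF x(1)], symmetric] Ga_emb by (intro imageI Gamma1_quat_conj[OF nf U Uc t] x)
 qed
 show "(%_. (1, 0, 0, 1)) : Ga" unfolding emb_1[symmetric] Ga_emb by (intro imageI Gamma1_quat_1[OF nf U Uc t])
 have "countable ((UNIV :: 'f set) \<times> (UNIV :: 'f set) \<times> (UNIV :: 'f set) \<times> (UNIV :: 'f set))"
  by (intro countable_SIGMA countable_number_field[OF nf])
 hence "countable (UNIV :: 'f quad set)" by (simp only: UNIV_Times_UNIV)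
 thus "countable Ga" unfolding Ga_emb by (meson countable_image countable_subset subset_UNIV)
qed

text \<open>Displacements are measured by Im w and polydiscs by Im z. Shrinking the radius to ep / 4
  pays for the triangle inequality and for Im w > Im z / 2.\<close>

lemma disc_groupI:
 assumes "!!z. z : upper_half ==> \<exists>ep>0. ep <= 1/2 & (ALL ga:Ga. ALL w:polydisc (%_. 1/2) z.
   (ALL j. cmod (act ga w $ j - w $ j) <= ep * Im (w $ j)) --> (ALL j. ga j : plus_minus_one))"
 shows "disc_group Ga"
proof
 fix z :: "complex^'r" assume z: "z : upper_half"
 then obtain ep where ep: "0 < ep" "ep <= 1/2" "ALL ga:Ga. ALL w:polydisc (%_. 1/2) z.
   (ALL j. cmod (act ga w $ j - w $ j) <= ep * Im (w $ j)) --> (ALL j. ga j : plus_minus_one)" using assms by blast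
 show "\<exists>ep>0. ep <= 1/2 \<and>
   (ALL ga:Ga. ALL w:polydisc (%_. ep) z. act ga w : polydisc (%_. ep) z --> (ALL j. ga j : plus_minus_one))"
 proof (intro exI[of _ "ep / 4"] conjI ballI impI)
  fix ga w assume ga: "ga : Ga" and w: "w : polydisc (%_. ep / 4) z" "act ga w : polydisc (%_. ep / 4) z"
  have "ep / 4 * Im (z $ j) <= 1/2 * Im (z $ j)" for j using z ep by (intro mult_right_mono) (auto simp: upper_half_def less_imp_le)
  hence w2: "w : polydisc (%_. 1/2) z" using w(1) unfolding polydisc_def by (blast intro: less_le_trans)
  have "cmod (act ga w $ j - w $ j) <= ep * Im (w $ j)" for j
  proof -
   have "cmod (act ga w $ j - w $ j) <= cmod (act ga w $ j - z $ j) + cmod (w $ j - z $ j)"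
    using norm_triangle_ineq4[of "act ga w $ j - z $ j" "w $ j - z $ j"] by simp
   also have "... <= ep / 4 * Im (z $ j) + ep / 4 * Im (z $ j)" using w by (intro add_mono) (auto simp: polydisc_def less_imp_le)
   also have "... = ep * (Im (z $ j) / 2)" by simp
   also have "... <= ep * Im (w $ j)" using polydisc_Im(1)[OF w(1) z, of j] ep by (intro mult_left_mono) auto
   finally show ?thesis .
  qed
  thus "ALL j. ga j : plus_minus_one" using ep(3) ga w2 by blast
 qed (use ep in auto)
qed (auto intro: Ga_det Ga_mult Ga_inv Ga_1 Ga_countable)

lemma trace_algebraic_int: "(x0, x1, x2, x3) : Gamma1_quat a b U t ==> aint (2 * x0)" by (rule Gamma1_trace_algebraic_int[OF nf U Uc t])

text \<open>By the hypothesis on mixed elements, a nonparabolic trace is hyperbolic at every split place.\<close>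

lemma trace_hyperbolic:
 assumes x: "(x0, x1, x2, x3) : Gamma1_quat a b U t" and ne: "(2 * x0)^2 ~= 4"
 shows "2 < \<bar>si j (2 * x0)\<bar>"
proof -
 let ?ga = "emb (x0, x1, x2, x3)"
 have ga: "?ga : Ga" using x by (simp add: Ga_emb)
 have tr2: "trace2 (?ga i) = si i (2 * x0)" for i using emb_tr[of x0 x1 x2 x3 i] by (cases "?ga i") simp
 have ne2: "\<bar>si i (2 * x0)\<bar> ~= 2" for i
 proof
  assume "\<bar>si i (2 * x0)\<bar> = 2"
  hence "(si i (2 * x0))^2 = 4" using power2_abs[of "si i (2 * x0)"] by simp
  hence "si i ((2 * x0)^2) = si i (of_int 4)" by (simp only: sh_power sh_of_int)
  thus False using ne by (simp add: sh_inj)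
 qed
 show ?thesis
 proof (rule ccontr)
  assume "~ ?thesis"
  hence "\<bar>si j (2 * x0)\<bar> < 2" using ne2[of j] by simp
  moreover have "~ hyperbolic_elliptic ?ga" using mixed ga by blast
  ultimately have "~ (EX i. 2 < \<bar>si i (2 * x0)\<bar>)" using ne2 unfolding hyperbolic_elliptic_def tr2 by (metis linorder_neqE_linordered_idom)
  hence lt: "\<bar>si i (2 * x0)\<bar> < 2" for i using ne2[of i] by (metis linorder_neqE_linordered_idom)
  \<comment> \<open>With all components elliptic there is a common fixed point in the product, which
    the absence of elliptic fixed points forbids.\<close>
  have "EX z. 0 < Im z & moebius (?ga i) z = z" for i
  proof -
   obtain p q r s where e: "?ga i = (p, q, r, s)" by (cases "?ga i")
   show ?thesis unfolding e using elliptic_fixed_point[of p q r s] Ga_det[OF ga, of i] lt[of i] tr2[of i] e by simp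
  qed
  then obtain zz where zz: "!!i. 0 < Im (zz i) & moebius (?ga i) (zz i) = zz i" by metis
  let ?z = "\<chi> i. zz i"
  have "?z : upper_half" "act ?ga ?z = ?z" using zz by (simp_all add: upper_half_def act_def)
  hence pm: "?ga j : plus_minus_one" using ell ga unfolding no_elliptic_fixed_points_def by blast
  hence "\<bar>trace2 (?ga j)\<bar> = 2" by auto
  thus False using ne2[of j] by (simp add: tr2)
 qed
qed

lemma near_stabilizer_trace:
 assumes x: "(x0, x1, x2, x3) : Gamma1_quat a b U t" and w: "w : upper_half" and ep: "0 <= ep" "ep <= 1/2"
  and close: "cmod (act (emb (x0, x1, x2, x3)) w $ j - w $ j) <= ep * Im (w $ j)"
 shows "(si j (2 * x0))^2 - 4 <= 2 * ep^2"
proof -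
 obtain p q r s where e: "emb (x0, x1, x2, x3) j = (p, q, r, s)" by (cases "emb (x0, x1, x2, x3) j")
 have "det2 (p, q, r, s) = 1" using emb_det[OF Gamma1_nrd[OF x], of j] e by simp
 from near_fixed_bound(2)[OF this, of "w $ j" ep] have "(p + s)^2 - 4 <= 2 * ep^2" using w ep close e by (simp add: upper_half_def act_def)
 moreover have "p + s = si j (2 * x0)" using emb_tr[of x0 x1 x2 x3 j] e by simp
 ultimately show ?thesis by simp
qed


lemma card_split: "card (split_real_places a b) = CARD('r)" using bij_betw_same_card[OF si] by simp

lemma split_subset: "split_real_places a b <= real_embeddings" by (auto simp: split_real_places_def)

lemma near_identity_compact:
 assumes r: "CARD('r) < field_degree TYPE('f)" and ep: "ep = 1 / (2 * 4 ^ field_degree TYPE('f))"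
  and ga: "ga : Ga" and w: "w : upper_half" and close: "!!j. cmod (act ga w $ j - w $ j) <= ep * Im (w $ j)"
 shows "ALL j. ga j : plus_minus_one"
proof -
 let ?d = "field_degree TYPE('f)" and ?S = "split_real_places a b"
 have fin: "finite (real_embeddings :: ('f => real) set)" and cd: "card (real_embeddings :: ('f => real) set) = ?d"
  using card_real_embeddings[OF nf tr] by auto
 obtain x0 x1 x2 x3 where x: "(x0, x1, x2, x3) : Gamma1_quat a b U t" and gax: "ga = emb (x0, x1, x2, x3)" using ga unfolding Ga_emb by auto
 have "(1::real) <= 4 ^ ?d" by simp
 hence ep0: "0 < ep" "ep <= 1/2" unfolding ep by (auto simp: field_simps)
 have n: "nrd a b (x0, x1, x2, x3) = 1" by (rule Gamma1_nrd[OF x])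
 have definite: "ta a < 0" "ta b < 0" and tn: "nrd (ta a) (ta b) (ta x0, ta x1, ta x2, ta x3) = 1"
  if ta: "ta : real_embeddings - ?S" for ta
 proof -
  have h: "field_hom ta" using ta real_embeddings_field_hom by auto
  have "splittings RT (ta a) (ta b) = {}" using ta by (auto simp: split_real_places_def)
  from not_split_imp_definite[OF this] show "ta a < 0" "ta b < 0" using ab by (simp_all add: hom_eq_0[OF h])
  show "nrd (ta a) (ta b) (ta x0, ta x1, ta x2, ta x3) = 1" using nrd_hom[OF h, of a b "(x0, x1, x2, x3)"] n hom_1[OF h] by simp
 qed
 have "(2 * x0)^2 = 4"
 proof (rule ccontr)
  assume ne: "(2 * x0)^2 ~= 4"
  let ?y = "(2 * x0)^2 - of_int 4"
  have "aint ?y" by (intro algebraic_int_diff[OF nf] algebraic_int_power[OF nf] algebraic_int_of_int[OF nf] trace_algebraic_int[OF x])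
  hence "1 <= (\<Prod>ta\<in>real_embeddings. \<bar>ta ?y\<bar>)" using norm_ge_1[OF nf tr] ne by simp
  also have "... = (\<Prod>ta\<in>real_embeddings - ?S. \<bar>ta ?y\<bar>) * (\<Prod>ta\<in>?S. \<bar>ta ?y\<bar>)"
   by (rule prod.subset_diff[OF split_subset fin])
  \<comment> \<open>At a ramified place x0^2 \<le> 1, at a split one t^2 - 4 lies between 0 and 2
    ep^2. The choice of \<open>ep\<close> makes 4^d times 2 ep^2 equal to \<open>ep\<close>, which
    is less than 1.\<close>
  also have "... <= (\<Prod>ta\<in>real_embeddings - ?S. 4) * (\<Prod>ta\<in>?S. 2 * ep^2)"
  proof (intro mult_mono prod_mono conjI prod_nonneg)
   fix ta assume ta: "ta : real_embeddings - ?S"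
   hence h: "field_hom ta" using real_embeddings_field_hom by auto
   have "(ta x0)^2 <= 1" using definite_nrd(1)[OF definite[OF ta], of "ta x0"] tn[OF ta] by metis
   moreover have "ta ?y = 4 * (ta x0)^2 - 4"
   proof -
    have "?y = of_int 4 * x0^2 - of_int 4" by (simp add: power_mult_distrib)
    hence "ta ?y = ta (of_int 4) * (ta x0)^2 - ta (of_int 4)" by (simp only: hom_diff[OF h] hom_mult[OF h] hom_power[OF h])
    moreover have "ta (of_int 4) = 4" using hom_of_int[OF h, of 4] by simp
    ultimately show ?thesis by (simp only:)
   qed
   ultimately show "\<bar>ta ?y\<bar> <= 4" by (simp add: abs_le_iff)
  next
   fix ta assume "ta : ?S"
   then obtain j where j: "ta = si j" using si by (auto simp: bij_betw_def)
   have e: "ta ?y = (si j (2 * x0))^2 - 4" using hom_of_int[OF si_hom, of j 4] unfolding j by (simp only: sh_diff sh_power of_int_numeral)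
   have "(si j (2 * x0))^2 - 4 <= 2 * ep^2" by (rule near_stabilizer_trace[OF x w]) (use ep0 close gax in auto)
   moreover have "2\<^sup>2 < \<bar>si j (2 * x0)\<bar>\<^sup>2" using trace_hyperbolic[OF x ne, of j] by (intro power_strict_mono) auto
   ultimately show "\<bar>ta ?y\<bar> <= 2 * ep^2" unfolding e by simp
  qed auto
  also have "... = 4 ^ card (real_embeddings - ?S) * (2 * ep^2) ^ CARD('r)" by (simp add: card_split)
  also have "... <= 4 ^ ?d * (2 * ep^2) ^ 1"
  proof (rule mult_mono)
   have "card (real_embeddings - ?S) <= ?d" unfolding cd[symmetric] by (intro card_mono fin) auto
   thus "(4::real) ^ card (real_embeddings - ?S) <= 4 ^ ?d" by (intro power_increasing) auto
   have "2 * ep^2 <= 1" using power_mono[of ep "1/2" 2] ep0 by (simp add: power2_eq_square)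
   thus "(2 * ep^2) ^ CARD('r) <= (2 * ep^2) ^ 1" by (intro power_decreasing) (auto simp: Suc_le_eq)
  qed auto
  also have "... = ep" unfolding ep by (simp add: power2_eq_square)
  finally show False using ep0 by simp
 qed
 hence x0: "x0 = 1 | x0 = - 1" by (simp add: power_mult_distrib power2_eq_1_iff)
 \<comment> \<open>At a ramified place x0^2 = 1 is already the whole reduced norm, so definiteness
   kills the other coordinates.\<close>
 have "?S ~= real_embeddings" using card_split cd r by auto
 then obtain ta where ta: "ta : real_embeddings - ?S" using split_subset by blast
 hence h: "field_hom ta" using real_embeddings_field_hom by auto
 have "(ta x0)^2 = 1" using x0 hom_1[OF h] hom_minus[OF h, of 1] by auto
 hence "ta x1 = 0 & ta x2 = 0 & ta x3 = 0" using definite_nrd(2)[OF definite[OF ta], of "ta x0" "ta x1" "ta x2" "ta x3"] tn[OF ta] by metis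
 hence "x1 = 0" "x2 = 0" "x3 = 0" by (simp_all add: hom_eq_0[OF h])
 thus ?thesis using x0 emb_scalar[of x0] gax by (auto simp: sh_1 sh_minus)
qed

text \<open>Matrices are not taken modulo signs, so the trivial element may occur 2^r times in a
  count.\<close>

lemma card_plus_minus_one:
 shows "finite {ga :: 'r => real quad. ALL j. ga j : plus_minus_one}"
  and "card {ga :: 'r => real quad. ALL j. ga j : plus_minus_one} = 2 ^ CARD('r)"
proof -
 have e: "{ga :: 'r => real quad. ALL j. ga j : plus_minus_one} = PiE UNIV (%_. plus_minus_one)" by (auto simp: PiE_def Pi_def)
 show "finite {ga :: 'r => real quad. ALL j. ga j : plus_minus_one}" unfolding e by (intro finite_PiE) auto
 show "card {ga :: 'r => real quad. ALL j. ga j : plus_minus_one} = 2 ^ CARD('r)" unfolding e by (subst card_PiE) (auto simp: numeral_2_eq_2)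
qed

theorem bergman_kernel_type1:
 assumes "type1 si"
 shows "EX C. ALL k. (ALL j. even (k j) & 0 < k j) -->
     (ALL bs. orthonormal_basis Ga k (cusp_forms Ga {} k) bs -->
       (SUP z\<in>upper_half. ereal (bergman_kernel k bs z)) <= ereal (C * kprod k))"
proof -
 define ep :: real where "ep = 1 / (2 * 4 ^ field_degree TYPE('f))"
 have r: "CARD('r) < field_degree TYPE('f)" using assms by (simp add: type1_def)
 have "(1::real) <= 4 ^ field_degree TYPE('f)" by simp
 hence ep0: "0 < ep" "ep <= 1/2" unfolding ep_def by (auto simp: field_simps)
 interpret disc_group Ga using near_identity_compact[OF r ep_def] ep0 polydisc_subset[of _ "%_. 1/2"]
  by (intro disc_groupI exI[of _ ep] conjI ballI impI) blast+
 \<comment> \<open>The displacement 4 rh / sqrt k tested by \<open>pet_le\<close> is then at most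
   \<open>ep\<close> for all weights, so one count serves all of them.\<close>
 define rh where "rh = ep / 4"
 define C where "C = (8 / rh^2) ^ CARD('r) * 2 ^ CARD('r)"
 show ?thesis
 proof (intro exI[of _ C] allI impI)
  fix k :: "'r => nat" and bs :: "(complex^'r => complex) set"
  assume k: "ALL j. even (k j) & 0 < k j" and onb: "orthonormal_basis Ga k (cusp_forms Ga {} k) bs"
  show "(SUP z\<in>upper_half. ereal (bergman_kernel k bs z)) <= ereal (C * kprod k)"
  proof (rule SUP_bergman_kernel_le[OF onb])
   show "0 <= C * kprod k" by (simp add: C_def prod_nonneg)
   fix f z assume f: "f : cusp_forms Ga {} k" and z: "z : (upper_half :: (complex^'r) set)"
   have "ennreal (pet k f z) <= ennreal ((8 / rh^2) ^ CARD('r) * kprod k * 2 ^ CARD('r))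
     * pnorm k f"
   proof (rule pet_le[OF f _ z])
    show "0 < rh" "rh <= 1/2" using ep0 by (simp_all add: rh_def)
    fix w assume w: "w : polydisc (%j. rh / sqrt (real (k j))) z"
    have le: "rh / sqrt (real (k j)) <= rh" for j using k ep0 by (simp add: rh_def divide_le_eq Suc_le_eq)
    have "rh / sqrt (real (k j)) <= 1/2" for j using le[of j] ep0 unfolding rh_def by linarith
    hence wH: "w : upper_half" using w polydisc_subset[OF z, of "%j. rh / sqrt (real (k j))"] by blast
    let ?N = "near_stabilizer (%j. 4 * rh / sqrt (real (k j))) w"
    have "?N <= {ga. ALL j. ga j : plus_minus_one}"
    proof
     fix ga assume ga: "ga : ?N"
     have "cmod (act ga w $ j - w $ j) <= ep * Im (w $ j)" for j
     proof -
      have "cmod (act ga w $ j - w $ j) <= 4 * rh / sqrt (real (k j)) * Im (w $ j)" using ga by (simp add: near_stabilizer_def)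
      also have "... <= ep * Im (w $ j)" using le[of j] wH by (intro mult_right_mono) (auto simp: rh_def upper_half_def less_imp_le)
      finally show ?thesis .
     qed
     thus "ga : {ga. ALL j. ga j : plus_minus_one}" using near_identity_compact[OF r ep_def, of ga w] wH ga unfolding near_stabilizer_def by blast
    qed
    hence "finite ?N" "card ?N <= 2 ^ CARD('r)"
     using card_plus_minus_one by (auto intro: finite_subset simp flip: card_plus_minus_one(2) intro!: card_mono)
    thus "finite ?N & real (card ?N) <= 2 ^ CARD('r)" by (metis of_nat_le_iff of_nat_numeral of_nat_power)
   qed (use k in auto)
   thus "ennreal (pet k f z) <= ennreal (C * kprod k) * pnorm k f"
    by (simp add: C_def mult_ac)
  qed
 qed
qed

end

section \<open>Integers in boxes\<close>

text \<open>Pigeonhole: in a grid with sides l j each cell contains at most one point.\<close>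

lemma cell_count:
 fixes g :: "'a => 'r::finite => real"
 assumes bd: "!!x j. x : S ==> \<bar>g x j\<bar> <= A j" and A: "!!j. 0 <= A j" and l: "!!j. 0 < l j"
  and sep: "!!x y. x : S ==> y : S ==> (!!j. \<bar>g x j - g y j\<bar> < l j) ==> x = y"
 shows "finite S & real (card S) <= (\<Prod>j\<in>UNIV. 2 * A j / l j + 2)"
proof -
 define F where "F = (%x j. \<lfloor>g x j / l j\<rfloor>)"
 define T where "T = PiE UNIV (%j. {\<lfloor>- A j / l j\<rfloor>..\<lfloor>A j / l j\<rfloor>})"
 have inj: "inj_on F S"
 proof (rule inj_onI)
  fix x y assume xy: "x : S" "y : S" "F x = F y"
  have "\<bar>g x j - g y j\<bar> < l j" for j
  proof -
   have "\<lfloor>g x j / l j\<rfloor> = \<lfloor>g y j / l j\<rfloor>" using xy(3) by (simp add: F_def fun_eq_iff)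
   hence "\<bar>g x j / l j - g y j / l j\<bar> < 1" by linarith
   hence "\<bar>(g x j - g y j) / l j\<bar> < 1" by (simp add: diff_divide_distrib)
   thus ?thesis using l[of j] by (simp add: abs_divide)
  qed
  thus "x = y" using sep xy by blast
 qed
 have "- A j / l j <= g x j / l j" "g x j / l j <= A j / l j" if "x : S" for x j
  using bd[OF that, of j] l[of j] by (intro divide_right_mono; linarith)+
 hence sub: "F ` S <= T" unfolding F_def T_def by (auto intro!: floor_mono)
 have "finite T" unfolding T_def by (intro finite_PiE) auto
 hence fin: "finite (F ` S)" "card (F ` S) <= card T" using sub by (auto intro: finite_subset card_mono)
 have "real (card T) = (\<Prod>j\<in>UNIV. real (card {\<lfloor>- A j / l j\<rfloor>..\<lfloor>A j / l j\<rfloor>}))"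
  unfolding T_def by (simp add: card_PiE)
 also have "... <= (\<Prod>j\<in>UNIV. 2 * A j / l j + 2)"
 proof (intro prod_mono conjI)
  fix j
  have "0 <= A j / l j" using A[of j] l[of j] by simp
  hence "real_of_int (\<lfloor>A j / l j\<rfloor> + 1 - \<lfloor>- A j / l j\<rfloor>) <= 2 * A j / l j + 2" "0 <= \<lfloor>A j / l j\<rfloor> + 1 - \<lfloor>- A j / l j\<rfloor>"
   by (auto; linarith)+
  thus "real (card {\<lfloor>- A j / l j\<rfloor>..\<lfloor>A j / l j\<rfloor>}) <= 2 * A j / l j + 2" by simp
 qed simp
 finally show ?thesis using fin inj by (auto simp: card_image finite_image_iff)
qed

locale real_places =
 fixes si :: "'r::finite => 'f::field_char_0 => real"
 assumes nf: "number_field TYPE('f)" and tr: "totally_real TYPE('f)"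
  and si: "bij_betw si UNIV real_embeddings"
begin

lemma si_hom: "field_hom (si j)" using bij_betwE[OF si] by (simp add: real_embeddings_field_hom)

lemmas sh_0 = hom_0[OF si_hom]
 and sh_1 = hom_1[OF si_hom]
 and sh_add = hom_add[OF si_hom]
 and sh_diff = hom_diff[OF si_hom]
 and sh_eq_0 = hom_eq_0[OF si_hom]
 and sh_inj = hom_inj[OF si_hom]
 and sh_minus = hom_minus[OF si_hom]
 and sh_mult = hom_mult[OF si_hom]
 and sh_of_int = hom_of_int[OF si_hom]
 and sh_of_nat = hom_of_nat[OF si_hom]
 and sh_of_rat = hom_of_rat[OF si_hom]
 and sh_power = hom_power[OF si_hom]
 and sh_sum = hom_sum[OF si_hom]

lemma card_places: "CARD('r) = field_degree TYPE('f)" using bij_betw_same_card[OF si] card_real_embeddings(2)[OF nf tr] by simp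

definition anorm :: "'f => real" where
 "anorm x = (\<Prod>j\<in>UNIV. \<bar>si j x\<bar>)"

lemma anorm_mult: "anorm (x * y) = anorm x * anorm y" by (simp add: anorm_def sh_mult abs_mult prod.distrib)

lemma anorm_ge_1: "aint x ==> x ~= 0 ==> 1 <= anorm x"
 using norm_ge_1[OF nf tr, of x] prod.reindex_bij_betw[OF si, of "%ta. \<bar>ta x\<bar>"] by (simp add: anorm_def)

lemma anorm_pos: "x ~= 0 ==> 0 < anorm x" unfolding anorm_def by (intro prod_pos) (simp add: sh_eq_0)

lemma anorm_nonneg: "0 <= anorm x" unfolding anorm_def by (intro prod_nonneg) simp

lemma anorm_of_nat: "anorm (of_nat n) = real n ^ CARD('r)" by (simp add: anorm_def sh_of_nat)

lemma anorm_less_prod: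
 assumes "!!j. \<bar>si j x\<bar> < h j"
 shows "anorm x < (\<Prod>j\<in>UNIV. h j)" unfolding anorm_def using assms
 by (rule prod_mono_strict[OF UNIV_I]) (auto intro: less_imp_le le_less_trans[OF abs_ge_zero assms] assms)

lemma algebraic_int_of_nat: "aint (of_nat n :: 'f)" using algebraic_int_of_int[OF nf, of "int n"] by simp

text \<open>A Q-basis with denominators cleared. It spans a full lattice inside the integers, which
  serves both pigeonhole arguments below.\<close>

lemma ex_integral_basis:
 obtains B :: "'f set" and e :: "'f => 'f" and A :: real
 where "finite B" "card B = CARD('r)" "!!b. b : B ==> aint (e b)"
  "\<forall>n :: 'f => int. (\<Sum>b\<in>B. of_int (n b) * e b) = 0 --> (ALL b:B. n b = 0)"
  "!!xi. \<exists>q :: 'f => rat. xi = (\<Sum>b\<in>B. of_rat (q b) * e b)"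
  "0 < A" "ALL q T j. (ALL b:B. \<bar>of_rat (q b)\<bar> <= T) --> 0 <= T --> \<bar>si j (\<Sum>b\<in>B. of_rat (q b) * e b)\<bar> <= A * T"
proof -
 obtain B :: "'f set" where B: "finite B" "QV.independent B" "QV.span B = UNIV" "card B = field_degree TYPE('f)"
  using number_field_basis[OF nf] by blast
 obtain c :: "'f => int" where c: "!!x. c x ~= 0 & aint (of_int (c x) * x)" using ex_algebraic_int_multiple[OF nf] by metis
 define e where "e = (%b. of_int (c b) * b :: 'f)"
 define A where "A = 1 + (\<Sum>b\<in>B. \<Sum>j\<in>UNIV. \<bar>si j (e b)\<bar>)"
 show thesis
 proof
  show "card B = CARD('r)" using B(4) card_places by simp
  show "aint (e b)" for b using c by (simp add: e_def)
  show "\<forall>n :: 'f => int. (\<Sum>b\<in>B. of_int (n b) * e b) = 0 --> (ALL b:B. n b = 0)"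
  proof (intro allI impI)
   fix n :: "'f => int" assume that: "(\<Sum>b\<in>B. of_int (n b) * e b) = 0"
   have "(\<Sum>b\<in>B. of_rat (of_int (n b * c b)) * b) = 0" using that by (simp add: e_def mult.assoc of_rat_mult)
   hence "ALL b:B. (of_int (n b * c b) :: rat) = 0" using QV.independentD[OF B(2) B(1) subset_refl] by (intro ballI)
   thus "ALL b:B. n b = 0" using c by simp
  qed
  show "\<exists>q :: 'f => rat. xi = (\<Sum>b\<in>B. of_rat (q b) * e b)" for xi
  proof -
   have "xi : QV.span B" using B(3) by simp
   then obtain u where u: "xi = (\<Sum>b\<in>B. of_rat (u b) * b)" unfolding QV.span_finite[OF B(1)] by auto
   have "of_rat (u b) * b = of_rat (u b / of_int (c b)) * e b" for b using c[of b] by (simp add: e_def of_rat_divide)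
   thus ?thesis using u by (intro exI[of _ "%b. u b / of_int (c b)"]) simp
  qed
  show "0 < A" unfolding A_def by (intro add_pos_nonneg sum_nonneg) auto
  show "ALL q T j. (ALL b:B. \<bar>of_rat (q b)\<bar> <= T) --> 0 <= T --> \<bar>si j (\<Sum>b\<in>B. of_rat (q b) * e b)\<bar> <= A * T"
  proof (intro allI impI)
   fix q :: "'f => rat" and T :: real and j assume q: "ALL b:B. \<bar>of_rat (q b)\<bar> <= T" and T: "0 <= T"
   have "\<bar>si j (\<Sum>b\<in>B. of_rat (q b) * e b)\<bar> <= (\<Sum>b\<in>B. \<bar>of_rat (q b) * si j (e b)\<bar>)"
    unfolding sh_sum sh_mult sh_of_rat by (rule sum_abs)
   also have "... <= (\<Sum>b\<in>B. T * (\<Sum>j\<in>UNIV. \<bar>si j (e b)\<bar>))"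
    unfolding abs_mult using q T by (intro sum_mono mult_mono member_le_sum) auto
   also have "... <= A * T" using T by (simp add: A_def sum_distrib_left[symmetric] algebra_simps)
   finally show "\<bar>si j (\<Sum>b\<in>B. of_rat (q b) * e b)\<bar> <= A * T" .
  qed
 qed (rule B)
qed

text \<open>Pigeonhole in place of Minkowski's theorem: two combinations of the integral basis fall
  into the same cell with sides h j, and u is their difference.\<close>

lemma ex_small_integer:
 obtains C0 where "0 < C0"
  "!!h. (!!j. 0 < h j) ==> C0 <= (\<Prod>j\<in>UNIV. h j) ==> EX u. aint u & u ~= 0 & (ALL j. \<bar>si j u\<bar> <= h j)"
proof -
 obtain B :: "'f set" and e :: "'f => 'f" and A :: real
  where B: "finite B" "card B = CARD('r)" "!!b. b : B ==> aint (e b)"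
   "\<forall>n :: 'f => int. (\<Sum>b\<in>B. of_int (n b) * e b) = 0 --> (ALL b:B. n b = 0)"
   "!!xi. \<exists>q :: 'f => rat. xi = (\<Sum>b\<in>B. of_rat (q b) * e b)"
  and A: "0 < A" and bound: "ALL q T j. (ALL b:B. \<bar>of_rat (q b)\<bar> <= T) --> 0 <= T --> \<bar>si j (\<Sum>b\<in>B. of_rat (q b) * e b)\<bar> <= A * T"
  by (rule ex_integral_basis) (rule that)
 define C0 where "C0 = (2 * A) ^ CARD('r) * 2"
 show thesis
 proof
  show "0 < C0" using A by (simp add: C0_def)
  fix h :: "'r => real" assume h: "!!j. 0 < h j" and C0: "C0 <= (\<Prod>j\<in>UNIV. h j)"
  \<comment> \<open>Coefficients below n give n^r combinations, against at most the product of 2 A n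
    / h j + 2 cells. The quotient of cells by combinations tends to the product of 2 A / h j, which
    is below 1 because \<open>C0\<close> is twice (2 A)^r.\<close>
  have "(%n. \<Prod>j\<in>UNIV. 2 * A / h j + 2 / real n) \<longlonglongrightarrow> (\<Prod>j\<in>UNIV. 2 * A / h j + 0)"
   by (intro tendsto_prod tendsto_add tendsto_const lim_const_over_n)
  moreover have "(\<Prod>j\<in>UNIV. 2 * A / h j + 0) < 1"
  proof -
   have "(2 * A) ^ CARD('r) > 0" using A by simp
   hence "(2 * A) ^ CARD('r) < (\<Prod>j\<in>UNIV. h j)" using C0 unfolding C0_def by linarith
   moreover have "(\<Prod>j\<in>UNIV. h j) > 0" using h by (intro prod_pos) auto
   ultimately show ?thesis by (simp add: prod_dividef)
  qed
  ultimately have "\<forall>\<^sub>F n in sequentially. (\<Prod>j\<in>UNIV. 2 * A / h j + 2 / real n) < 1" by (rule order_tendstoD(2))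
  hence "\<forall>\<^sub>F n in sequentially. 0 < n & (\<Prod>j\<in>UNIV. 2 * A / h j + 2 / real n) < 1"
   using eventually_gt_at_top[of 0] by eventually_elim auto
  then obtain n where n: "0 < n" "(\<Prod>j\<in>UNIV. 2 * A / h j + 2 / real n) < 1" using eventually_happens'[OF sequentially_bot] by blast
  define E where "E = PiE B (%_. {0..<int n})"
  define L where "L = (%m. \<Sum>b\<in>B. of_int (m b) * e b :: 'f)"
  have injL: "inj_on L E"
  proof (rule inj_onI)
   fix m m' assume mm: "m : E" "m' : E" "L m = L m'"
   hence "(\<Sum>b\<in>B. of_int (m b - m' b) * e b) = 0" by (simp add: L_def left_diff_distrib sum_subtractf)
   hence "ALL b:B. m b - m' b = 0" using B(4)[rule_format, of "%b. m b - m' b"] by blast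
   hence "ALL b:B. m b = m' b" by simp
   thus "m = m'" using mm(1,2) unfolding E_def by (metis PiE_ext)
  qed
  have cardE: "real (card (L ` E)) = real n ^ CARD('r)" using injL B(1,2) by (simp add: card_image E_def card_PiE)
  have Lbd: "\<bar>si j x\<bar> <= A * real n" if xE: "x : L ` E" for x j
  proof -
   obtain m where m: "m : E" "x = L m" using xE by blast
   have "ALL b:B. \<bar>of_rat (of_int (m b))\<bar> <= real n" using m(1) by (fastforce simp: E_def PiE_def Pi_def)
   thus ?thesis using bound[rule_format, of "%b. of_int (m b)" "real n" j] by (simp add: m L_def)
  qed
  have "~ (ALL x:L ` E. ALL y:L ` E. (ALL j. \<bar>si j x - si j y\<bar> < h j) --> x = y)"
  proof
   assume "ALL x:L ` E. ALL y:L ` E. (ALL j. \<bar>si j x - si j y\<bar> < h j) --> x = y"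
   hence "real (card (L ` E)) <= (\<Prod>j\<in>UNIV. 2 * (A * real n) / h j + 2)"
    using cell_count[of "L ` E" "%x j. si j x" "%_. A * real n" h] Lbd A h by auto
   also have "... = (\<Prod>j\<in>UNIV. real n * (2 * A / h j + 2 / real n))" using n by (intro prod.cong refl) (simp add: field_simps)
   also have "... = real n ^ CARD('r) * (\<Prod>j\<in>UNIV. 2 * A / h j + 2 / real n)" by (simp add: prod.distrib)
   also have "... < real n ^ CARD('r) * 1" using n by (intro mult_strict_left_mono) auto
   finally show False using cardE by simp
  qed
  then obtain m m' where m: "m : E" "m' : E" "L m ~= L m'" "!!j. \<bar>si j (L m) - si j (L m')\<bar> < h j" by blast
  have "aint (L i)" for i unfolding L_def by (intro algebraic_int_sum[OF nf] algebraic_int_mult[OF nf] algebraic_int_of_int[OF nf] B)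
  thus "EX u. aint u & u ~= 0 & (ALL j. \<bar>si j u\<bar> <= h j)"
   using m by (intro exI[of _ "L m - L m'"]) (auto simp: algebraic_int_diff[OF nf] sh_diff less_imp_le)
 qed
qed

text \<open>Hurwitz's lemma from the proof of the finiteness of the class number.\<close>

lemma Hurwitz:
 obtains M0 :: nat where "0 < M0"
  "!!xi. EX n:{1..M0}. EX om. aint om & anorm (of_nat n * xi - om) <= 1/2"
proof -
 obtain B :: "'f set" and e :: "'f => 'f" and A :: real
  where B: "finite B" "card B = CARD('r)" "!!b. b : B ==> aint (e b)"
   "\<forall>n :: 'f => int. (\<Sum>b\<in>B. of_int (n b) * e b) = 0 --> (ALL b:B. n b = 0)"
   "!!xi. \<exists>q :: 'f => rat. xi = (\<Sum>b\<in>B. of_rat (q b) * e b)"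
  and A: "0 < A" and bound: "ALL q T j. (ALL b:B. \<bar>of_rat (q b)\<bar> <= T) --> 0 <= T --> \<bar>si j (\<Sum>b\<in>B. of_rat (q b) * e b)\<bar> <= A * T"
  by (rule ex_integral_basis) (rule that)
 have near: "EX om. aint om & (ALL j. \<bar>si j (xi - om)\<bar> <= A)" for xi
 proof -
  obtain q :: "'f => rat" where q: "xi = (\<Sum>b\<in>B. of_rat (q b) * e b)" using B(5) by blast
  let ?om = "\<Sum>b\<in>B. of_int \<lfloor>q b\<rfloor> * e b"
  have "xi - ?om = (\<Sum>b\<in>B. of_rat (q b - of_int \<lfloor>q b\<rfloor>) * e b)" by (simp add: q of_rat_diff left_diff_distrib sum_subtractf)
  moreover have "\<bar>of_rat (q b - of_int \<lfloor>q b\<rfloor>)\<bar> <= (1::real)" for b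
  proof -
   have "0 <= q b - of_int \<lfloor>q b\<rfloor>" "q b - of_int \<lfloor>q b\<rfloor> <= 1" by linarith+
   hence "0 <= (of_rat (q b - of_int \<lfloor>q b\<rfloor>) :: real)" "of_rat (q b - of_int \<lfloor>q b\<rfloor>) <= (1::real)"
    by (simp_all add: zero_le_of_rat_iff of_rat_le_1_iff)
   thus ?thesis by simp
  qed
  ultimately have "\<bar>si j (xi - ?om)\<bar> <= A" for j using bound[rule_format, of "%b. q b - of_int \<lfloor>q b\<rfloor>" 1 j] by simp
  moreover have "aint ?om" by (intro algebraic_int_sum[OF nf] algebraic_int_mult[OF nf] algebraic_int_of_int[OF nf] B)
  ultimately show ?thesis by blast
 qed
 \<comment> \<open>Bounds the number of cells of side 1/2 that meet the box of size A. Among more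
   than K multiples of xi, reduced by integers, two share a cell, and their difference has norm at
   most 1/2.\<close>
 define K where "K = (\<Prod>j\<in>(UNIV :: 'r set). 2 * A / (1/2) + 2)"
 obtain M0 :: nat where M0: "K < real M0" using reals_Archimedean2 by blast
 have "0 <= K" unfolding K_def using A by (intro prod_nonneg) auto
 hence "0 < M0" using M0 by (cases M0) auto
 moreover have "EX n:{1..M0}. EX om. aint om & anorm (of_nat n * xi - om) <= 1/2" for xi
 proof -
  obtain om where om: "!!n. aint (om n)" "!!n j. \<bar>si j (of_nat n * xi - om n)\<bar> <= A"
  proof -
   obtain w where "ALL xi. aint (w xi) & (ALL j. \<bar>si j (xi - w xi)\<bar> <= A)"
    using choice[of "%xi om. aint om & (ALL j. \<bar>si j (xi - om)\<bar> <= A)"] near by blast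
   thus thesis by (intro that[of "%n. w (of_nat n * xi)"]) auto
  qed
  have "~ (ALL x:{0..M0}. ALL y:{0..M0}. (ALL j. \<bar>si j (of_nat x * xi - om x) - si j (of_nat y * xi - om y)\<bar> < 1/2) --> x = y)"
  proof
   assume "ALL x:{0..M0}. ALL y:{0..M0}. (ALL j. \<bar>si j (of_nat x * xi - om x) - si j (of_nat y * xi - om y)\<bar> < 1/2) --> x = y"
   hence "real (card {0..M0}) <= K" using cell_count[of "{0..M0}" "%n j. si j (of_nat n * xi - om n)" "%_. A" "%_. 1/2"] om(2) A
    unfolding K_def by auto
   thus False using M0 by simp
  qed
  then obtain x y where xy: "x : {0..M0}" "y : {0..M0}" "x ~= y"
    "!!j. \<bar>si j (of_nat x * xi - om x) - si j (of_nat y * xi - om y)\<bar> < 1/2" by blast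
  have main: "EX n:{1..M0}. EX om. aint om & anorm (of_nat n * xi - om) <= 1/2"
   if xy: "x : {0..M0}" "y < x" "!!j. \<bar>si j (of_nat x * xi - om x) - si j (of_nat y * xi - om y)\<bar> < 1/2" for x y
  proof (intro bexI[of _ "x - y"] exI[of _ "om x - om y"] conjI)
   show "aint (om x - om y)" by (intro algebraic_int_diff[OF nf] om)
   have "of_nat (x - y) * xi - (om x - om y) = (of_nat x * xi - om x) - (of_nat y * xi - om y)" using xy(2) by (simp add: of_nat_diff algebra_simps)
   hence "anorm (of_nat (x - y) * xi - (om x - om y)) < (\<Prod>j\<in>(UNIV :: 'r set). 1/2)" by (intro anorm_less_prod)
     (simp only: hom_diff[OF si_hom, of _ "of_nat x * xi - om x" "of_nat y * xi - om y"] xy(3))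
   also have "... <= (1/2) ^ 1" unfolding prod_constant by (intro power_decreasing) (auto simp: Suc_le_eq)
   finally show "anorm (of_nat (x - y) * xi - (om x - om y)) <= 1/2" by simp
  qed (use xy in auto)
  show ?thesis
  proof (cases "y < x")
   case True
   thus ?thesis using main[of x y] xy by blast
  next
   case False
   thus ?thesis using main[of y x] xy by (metis abs_minus_commute nat_neq_iff)
  qed
 qed
 ultimately show thesis using that by blast
qed

text \<open>A substitute for coprimality: the inverse square of the ideal generated by c and s lies
  in 1 / M times the integers. The three products are those whose integrality follows from that of
  the entries of \<open>unip l c s\<close>.\<close>

definition good_pair :: "nat => 'f => 'f => bool" where
 "good_pair M c s \<longleftrightarrow> aint c & aint s & (c ~= 0 | s ~= 0) \<and>
  (ALL l. aint (l * c^2) --> aint (l * (c * s)) --> aint (l * s^2) --> aint (of_nat M * l))"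

text \<open>Let mu have nearly least norm in the ideal generated by c and s. By Hurwitz
  \<open>fact M0\<close> times the ideal consists of integral multiples of mu. So \<open>ka\<close>
  makes the pair integral, and \<open>fact M0\<close> becomes a combination of the new pair, with an
  M that is the same for all pairs.\<close>

lemma ex_good_pair:
 obtains M :: nat where "0 < M" "!!c s. c ~= 0 | s ~= 0 ==> EX ka. ka ~= 0 & good_pair M (ka * c) (ka * s)"
proof -
 obtain M0 :: nat where M0: "0 < M0" "!!xi. EX n:{1..M0}. EX om. aint om & anorm (of_nat n * xi - om) <= 1/2" using Hurwitz by blast
 have "EX ka. ka ~= 0 & good_pair ((fact M0)^2) (ka * c) (ka * s)" if cs: "c ~= 0 | s ~= 0" for c s
 proof -
  define I where "I = {al * c + be * s | al be. aint al & aint be}"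
  have I_c: "c : I" unfolding I_def by (intro CollectI exI[of _ 1] exI[of _ 0]) (use algebraic_int_of_nat[of 0] algebraic_int_of_nat[of 1] in simp)
  have I_s: "s : I" unfolding I_def by (intro CollectI exI[of _ 0] exI[of _ 1]) (use algebraic_int_of_nat[of 0] algebraic_int_of_nat[of 1] in simp)
  have I_comb: "of_nat n * x - om * y : I" if xy: "x : I" "y : I" "aint om" for x y om n
  proof -
   obtain al be al' be' where e: "x = al * c + be * s" "y = al' * c + be' * s" "aint al" "aint be" "aint al'" "aint be'"
    using xy(1,2) unfolding I_def by blast
   have "of_nat n * x - om * y = (of_nat n * al - om * al') * c + (of_nat n * be - om * be') * s" by (simp add: e algebra_simps)
   thus ?thesis unfolding I_def using e xy(3) by (blast intro: algebraic_int_diff[OF nf] algebraic_int_mult[OF nf] algebraic_int_of_nat)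
  qed
  obtain m n :: int where mn: "m ~= 0" "aint (of_int m * c)" "n ~= 0" "aint (of_int n * s)" using ex_algebraic_int_multiple[OF nf] by metis
  have low: "1 / anorm (of_int (m * n)) <= anorm x" if xI: "x : I" "x ~= 0" for x
  proof -
   obtain al be where x: "x = al * c + be * s" "aint al" "aint be" using xI(1) unfolding I_def by blast
   have "of_int (m * n) * x = of_int n * al * (of_int m * c) + of_int m * be * (of_int n * s)" by (simp add: x algebra_simps)
   hence "aint (of_int (m * n) * x)"
    using x mn by (auto intro!: algebraic_int_add[OF nf] algebraic_int_mult[OF nf] algebraic_int_of_int[OF nf] simp del: of_int_mult)
   hence "1 <= anorm (of_int (m * n)) * anorm x" using anorm_ge_1[of "of_int (m * n) * x"] xI mn by (simp add: anorm_mult)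
   thus ?thesis using anorm_pos[of "of_int (m * n)"] mn by (simp add: pos_divide_le_eq mult.commute)
  qed
  let ?V = "anorm ` (I - {0})"
  have ne: "?V ~= {}" using cs I_c I_s by blast
  have bb: "bdd_below ?V" using low by (intro bdd_belowI[of _ "1 / anorm (of_int (m * n))"]) auto
  have "0 < Inf ?V"
  proof -
   have "1 / anorm (of_int (m * n)) <= Inf ?V" using low ne by (intro cInf_greatest) auto
   moreover have "0 < 1 / anorm (of_int (m * n))" using anorm_pos[of "of_int (m * n)"] mn by simp
   ultimately show ?thesis by linarith
  qed
  \<comment> \<open>Being within a factor 2 of the infimum matches the 1/2 in Hurwitz's lemma: a
    remainder of norm at most half that of mu must vanish.\<close>
  hence "Inf ?V < 2 * Inf ?V" by simp
  then obtain mu where mu: "mu : I" "mu ~= 0" "anorm mu < 2 * Inf ?V" using cInf_lessD[OF ne] by blast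
  have small: "x = 0" if "x : I" "anorm x <= 1/2 * anorm mu" for x
  proof (rule ccontr)
   assume "x ~= 0"
   hence "Inf ?V <= anorm x" using that(1) bb by (intro cInf_lower) auto
   thus False using that(2) mu(3) by linarith
  qed
  define ka where "ka = of_nat (fact M0) / mu"
  have kaI: "aint (ka * x)" if x: "x : I" for x
  proof -
   obtain n om where n: "n : {1..M0}" "aint om" "anorm (of_nat n * (x / mu) - om) <= 1/2" using M0(2) by blast
   have "anorm (of_nat n * x - om * mu) = anorm (of_nat n * (x / mu) - om) * anorm mu"
    using mu(2) by (simp add: anorm_mult[symmetric] left_diff_distrib)
   also have "... <= 1/2 * anorm mu" using n(3) anorm_nonneg by (intro mult_right_mono)
   finally have "of_nat n * x - om * mu = 0" using small I_comb[OF x mu(1) n(2)] by blast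
   hence w: "of_nat n * (x / mu) = om" using mu(2) by (simp add: field_simps)
   obtain l where l: "fact M0 = n * l" using n(1) dvd_fact[of n M0] by (auto elim: dvdE)
   have "ka * x = of_nat l * om" unfolding ka_def l w[symmetric] by simp
   thus ?thesis using n(2) by (simp add: algebraic_int_mult[OF nf] algebraic_int_of_nat)
  qed
  have "good_pair ((fact M0)^2) (ka * c) (ka * s)" unfolding good_pair_def
  proof (intro conjI allI impI)
   show "aint (ka * c)" "aint (ka * s)" using kaI I_c I_s by auto
   show "ka * c ~= 0 | ka * s ~= 0" using cs mu(2) by (simp add: ka_def)
   fix l assume l: "aint (l * (ka * c)^2)" "aint (l * (ka * c * (ka * s)))" "aint (l * (ka * s)^2)"
   obtain al be where ab: "mu = al * c + be * s" "aint al" "aint be" using mu(1) unfolding I_def by blast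
   \<comment> \<open>Squaring this combination expresses M l through the three products.\<close>
   have "ka * mu = of_nat (fact M0)" using mu(2) by (simp add: ka_def)
   hence "of_nat ((fact M0)^2) * l = l * (ka * mu)^2" by (simp add: mult.commute)
   also have "... = al^2 * (l * (ka * c)^2) + of_nat 2 * (al * be * (l * (ka * c * (ka * s)))) + be^2 * (l * (ka * s)^2)"
    unfolding ab(1) by (simp add: sq_simps)
   finally show "aint (of_nat ((fact M0)^2) * l)"
    using ab l by (auto intro!: algebraic_int_add[OF nf] algebraic_int_mult[OF nf] algebraic_int_power[OF nf] algebraic_int_of_nat simp del: of_nat_numeral)
  qed
  thus ?thesis using mu(2) by (intro exI[of _ ka]) (simp add: ka_def)
 qed
 moreover have "0 < ((fact M0)^2 :: nat)" by simp
 ultimately show thesis using that by blast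
qed

lemma box_count:
 assumes a: "!!j. 0 < a j" and M: "0 < M"
 shows "finite {l. aint (of_nat M * l) & (ALL j. \<bar>si j l\<bar> <= a j)}"
  and "real (card {l. aint (of_nat M * l) & (ALL j. \<bar>si j l\<bar> <= a j)}) <= 4 ^ CARD('r) * (1 + real M ^ CARD('r) * (\<Prod>j\<in>UNIV. a j))"
proof -
 let ?d = "CARD('r)" and ?S = "{l. aint (of_nat M * l) & (ALL j. \<bar>si j l\<bar> <= a j)}"
 define P where "P = (\<Prod>j\<in>UNIV. a j)"
 \<comment> \<open>Makes the volume of a cell with sides a j / u equal to M^(-r). Then two points in
   one cell have a difference whose M-fold is an integer of norm below 1, hence 0.\<close>
 define u where "u = real M * root ?d P"
 have P: "0 < P" unfolding P_def using a by (intro prod_pos) auto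
 have u: "0 < u" "u ^ ?d = real M ^ ?d * P" using P M by (auto simp: u_def power_mult_distrib real_root_pow_pos)
 have fc: "finite ?S & real (card ?S) <= (\<Prod>j\<in>UNIV. 2 * a j / (a j / u) + 2)"
 proof (rule cell_count[of ?S "%l j. si j l" a "%j. a j / u"])
  fix x y assume xy: "x : ?S" "y : ?S" and lt: "!!j. \<bar>si j x - si j y\<bar> < a j / u"
  have "anorm (x - y) < (\<Prod>j\<in>UNIV. a j / u)" using lt by (intro anorm_less_prod) (simp add: sh_diff)
  also have "... = P / u ^ ?d" by (simp add: prod_dividef P_def)
  also have "... = P / (real M ^ ?d * P)" by (simp only: u(2))
  also have "... = 1 / real M ^ ?d" using P by simp
  finally have "anorm (of_nat M * (x - y)) < 1" using M by (simp add: anorm_mult anorm_of_nat pos_less_divide_eq mult.commute)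
  moreover have "aint (of_nat M * (x - y))" using xy by (simp add: right_diff_distrib algebraic_int_diff[OF nf])
  ultimately have "of_nat M * (x - y) = 0" using anorm_ge_1[of "of_nat M * (x - y)"] by linarith
  thus "x = y" using M by simp
 qed (use a u in \<open>auto simp: less_imp_le\<close>)
 thus "finite ?S" by blast
 have "(\<Prod>j\<in>UNIV. 2 * a j / (a j / u) + 2) = (\<Prod>j\<in>(UNIV :: 'r set). 2 * u + 2)"
  using a u by (intro prod.cong refl) (simp add: less_imp_neq[THEN not_sym])
 also have "... = (2 * u + 2) ^ ?d" by simp
 also have "... <= 4 ^ ?d * (1 + u ^ ?d)"
 proof (cases "u <= 1")
  case True
  hence "(2 * u + 2) ^ ?d <= 4 ^ ?d * 1" using u by (simp add: power_mono)
  also have "... <= 4 ^ ?d * (1 + u ^ ?d)" using zero_less_power[OF u(1), of ?d] by (intro mult_left_mono) auto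
  finally show ?thesis .
 next
  case False
  hence "(2 * u + 2) ^ ?d <= (4 * u) ^ ?d" using u by (intro power_mono) auto
  also have "... <= 4 ^ ?d * (1 + u ^ ?d)" by (simp add: power_mult_distrib)
  finally show ?thesis .
 qed
 finally show "real (card ?S) <= 4 ^ ?d * (1 + real M ^ ?d * (\<Prod>j\<in>UNIV. a j))" using fc u(2) unfolding P_def by simp
qed

end

section \<open>Moving down from a cusp\<close>

text \<open>In the coordinate e = exp(2 pi i ze) the function extends by 0 to a disc, where Q(e) / e
  is holomorphic. The maximum principle on the disc of radius exp(2 pi m) compares |e| = 1 with |e|
  = exp(2 pi m), that is, height 0 with height - m.\<close>

lemma periodic_schwarz:
 fixes q :: "complex => complex"
 assumes hol: "q holomorphic_on {ze. - b < Im ze}" and per: "!!ze. - b < Im ze ==> q (ze + 1) = q ze"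
  and van: "!!ep. 0 < ep ==> EX Y. ALL ze. Y < Im ze --> cmod (q ze) < ep" and m: "0 < m" "m < b"
 shows "EX ze. Im ze = - m & cmod (q 0) <= exp (- (2 * pi * m)) * cmod (q ze)"
proof -
 define E where "E = (%ze. exp (2 * of_real pi * \<i> * ze) :: complex)"
 define L where "L = (%e. Ln e / (2 * of_real pi * \<i>))"
 define Q where "Q = (%e. if e = 0 then 0 else q (L e))"
 define R R' where "R = exp (2 * pi * m)" and "R' = exp (2 * pi * b)"
 have RR: "0 < R" "R < R'" using m by (simp_all add: R_def R'_def)
 have nE: "cmod (E ze) = exp (- (2 * pi * Im ze))" for ze by (simp add: E_def)
 have ImL: "Im (L e) = - ln (cmod e) / (2 * pi)" if "e ~= 0" for e
 proof -
  have "L e = - \<i> * Ln e / of_real (2 * pi)" by (simp add: L_def field_simps)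
  hence "Im (L e) = - Re (Ln e) / (2 * pi)" by (simp only: Im_divide_of_real) simp
  thus ?thesis using that by simp
 qed
 have EL: "E (L e) = e" if "e ~= 0" for e using that by (simp add: E_def L_def)
 have per_nat: "q (ze + of_nat n) = q ze" if "- b < Im ze" for ze n
 proof (induction n)
  case (Suc n)
  have "q (ze + of_nat n + 1) = q (ze + of_nat n)" using per[of "ze + of_nat n"] that by simp
  thus ?case using Suc by (simp add: add_ac)
 qed simp
 have per_int: "q (ze + of_int n) = q ze" if "- b < Im ze" for ze n
 proof (cases n rule: int_cases2)
  case (nonneg k)
  thus ?thesis using per_nat[OF that, of k] by simp
 next
  case (nonpos k)
  thus ?thesis using per_nat[of "ze + of_int n" k] that by simp
 qed
 have QE: "Q (E ze) = q ze" if "- b < Im ze" for ze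
 proof -
  have ne: "E ze ~= 0" by (simp add: E_def)
  have "exp (Ln (E ze)) = exp (2 * of_real pi * \<i> * ze)" using ne by (simp add: E_def)
  then obtain n :: int where "Ln (E ze) = 2 * of_real pi * \<i> * ze + of_int (2 * n) * of_real pi * \<i>" unfolding exp_eq by auto
  hence "L (E ze) = ze + of_int n" by (simp add: L_def field_simps)
  thus ?thesis using ne per_int[OF that] by (simp add: Q_def)
 qed
 have hd: "Q field_differentiable at e0" if e0: "e0 : ball 0 R' - {0}" for e0
 proof -
  \<comment> \<open>A branch of the logarithm near e0; the principal one may be cut there.\<close>
  define ph where "ph = (%e. (Ln (e / e0) + Ln e0) / (2 * of_real pi * \<i>))"
  define S where "S = ball 0 R' \<inter> - {0} \<inter> (%e. e / e0) -` ball 1 1"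
  have ne0: "e0 ~= 0" "cmod e0 < R'" using e0 by auto
  have "continuous_on UNIV (%e. e / e0)" using ne0 by (intro continuous_intros) auto
  hence "open ((%e. e / e0) -` ball 1 1)" by (intro open_vimage) auto
  hence opS: "open S" unfolding S_def by (intro open_Int) auto
  have e0S: "e0 : S" using ne0 by (simp add: S_def)
  have ph: "E (ph e) = e" "- b < Im (ph e)" if "e : S" for e
  proof -
   have ne: "e ~= 0" using that by (simp add: S_def)
   have "E (ph e) = exp (Ln (e / e0) + Ln e0)" by (simp add: E_def ph_def)
   thus "E (ph e) = e" using ne ne0 by (simp add: exp_add)
   hence "exp (- (2 * pi * Im (ph e))) < exp (2 * pi * b)" using that nE[of "ph e"] by (simp add: S_def R'_def)
   hence "2 * pi * (- Im (ph e)) < 2 * pi * b" by simp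
   hence "- Im (ph e) < b" by (subst (asm) mult_less_cancel_left_pos) auto
   thus "- b < Im (ph e)" by simp
  qed
  have "(ph has_field_derivative (1 / e0) / (2 * of_real pi * \<i>)) (at e0)"
   unfolding ph_def using ne0 by (auto intro!: derivative_eq_intros simp: divide_simps)
  hence "ph field_differentiable at e0" unfolding field_differentiable_def by blast
  moreover have "q field_differentiable at (ph e0)"
  proof -
   have "open {ze. - b < Im ze}" by (intro open_Collect_less continuous_intros)
   thus ?thesis using hol ph(2)[OF e0S] holomorphic_on_imp_differentiable_at by blast
  qed
  ultimately have "(q \<circ> ph) field_differentiable at e0" by (intro field_differentiable_compose)
  then obtain D where "((q \<circ> ph) has_field_derivative D) (at e0)" unfolding field_differentiable_def by blast
  hence "(Q has_field_derivative D) (at e0)"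
  proof (rule has_field_derivative_transform_within_open[OF _ opS e0S])
   fix e assume e: "e : S"
   show "(q \<circ> ph) e = Q e" using QE[OF ph(2)[OF e]] by (simp add: ph(1)[OF e])
  qed
  thus ?thesis unfolding field_differentiable_def by blast
 qed
 have h1: "Q holomorphic_on ball 0 R' - {0}" by (rule holomorphic_onI) (rule field_differentiable_at_within[OF hd])
 have c0: "isCont Q 0" unfolding continuous_at_eps_delta
 proof (intro allI impI)
  fix ep :: real assume "0 < ep"
  then obtain Y where Y: "ALL ze. Y < Im ze --> cmod (q ze) < ep" using van by blast
  have "cmod (Q e) < ep" if "cmod e < exp (- (2 * pi * Y))" for e
  proof (cases "e = 0")
   case False
   hence "exp (ln (cmod e)) < exp (- (2 * pi * Y))" using that by simp
   hence "ln (cmod e) < - (2 * pi * Y)" by (simp only: exp_less_cancel_iff)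
   hence "Y < Im (L e)" by (simp add: ImL[OF False] field_simps)
   thus ?thesis using Y False by (simp add: Q_def)
  qed (use \<open>0 < ep\<close> in \<open>simp add: Q_def\<close>)
  thus "\<exists>d>0. ALL x'. dist x' 0 < d --> dist (Q x') (Q 0) < ep" by (intro exI[of _ "exp (- (2 * pi * Y))"]) (simp add: Q_def)
 qed
 have "continuous_on (ball 0 R') Q"
 proof (rule continuous_at_imp_continuous_on, rule ballI)
  fix e :: complex assume e: "e : ball 0 R'"
  show "isCont Q e"
  proof (cases "e = 0")
   case False
   hence "Q field_differentiable at e" using h1 e holomorphic_on_imp_differentiable_at[OF h1] by auto
   thus ?thesis by (rule field_differentiable_imp_continuous_at)
  qed (use c0 in simp)
 qed
 hence hQ: "Q holomorphic_on ball 0 R'" using h1 by (rule no_isolated_singularity) auto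
 obtain h where h: "h holomorphic_on ball 0 R'" "!!z. cmod z < R' ==> Q z = z * h z" using Schwarz3[OF hQ] by (auto simp: Q_def)
 have ch: "continuous_on (cball 0 R) h" "continuous_on (sphere 0 R) h"
  using RR by (auto intro!: continuous_on_subset[OF holomorphic_on_imp_continuous_on[OF h(1)]])
 obtain e1 where e1: "e1 : sphere 0 R" "!!e. e : sphere 0 R ==> cmod (h e) <= cmod (h e1)"
 proof -
  have ne: "sphere (0::complex) R ~= {}" using RR by simp
  have "continuous_on (sphere 0 R) (%e. cmod (h e))" using ch(2) by (intro continuous_intros)
  from continuous_attains_sup[OF compact_sphere ne this] show thesis by (elim bexE) (rule that, auto)
 qed
 have "cmod (h 1) <= cmod (h e1)"
 proof (rule maximum_modulus_frontier[of h "cball 0 R"])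
  show "h holomorphic_on interior (cball 0 R)" using h(1) RR by (auto intro: holomorphic_on_subset)
  show "continuous_on (closure (cball 0 R)) h" using ch by simp
  show "cmod (h z) <= cmod (h e1)" if "z : frontier (cball 0 R)" for z using e1 that RR by simp
  show "1 : cball (0::complex) R" using m by (simp add: R_def)
 qed simp
 hence "cmod (Q 1) <= cmod (Q e1) / R" using h(2)[of 1] h(2)[of e1] e1(1) RR m by (simp add: norm_mult R'_def)
 moreover have "Q 1 = q 0" using QE[of 0] m by (simp add: E_def)
 moreover have "e1 ~= 0" using e1(1) RR by auto
 hence "Im (L e1) = - m" "Q e1 = q (L e1)" using ImL[of e1] e1(1) by (auto simp: R_def Q_def)
 ultimately show ?thesis by (intro exI[of _ "L e1"]) (simp add: R_def exp_minus divide_inverse mult.commute)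
qed

lemma holomorphic_vec_nth:
 assumes "!!z. z : S ==> EX D. (p has_field_derivative D) (at (z $ j))"
 shows "holomorphic_vec (%z::complex^'r::finite. p (z $ j)) S" unfolding holomorphic_vec_def
proof
 fix z :: "complex^'r" assume "z : S"
 then obtain D where D: "(p has_field_derivative D) (at (z $ j))" using assms by blast
 have "((%z::complex^'r. z $ j) has_derivative (%h. h $ j)) (at z)" by (rule bounded_linear_imp_has_derivative[OF bounded_linear_vec_nth])
 from has_derivative_compose[OF this D[unfolded has_field_derivative_def]]
 show "EX D. ((%z. p (z $ j)) has_derivative D) (at z) & (ALL c v. D (c *s v) = c * D v)" by (intro exI[of _ "%h. D * h $ j"]) auto
qed

lemma act_has_derivative:
 assumes ga: "!!j. det2 (ga j) = 1" and z: "z : (upper_half :: (complex^'r::finite) set)"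
 shows "(act ga has_derivative (%h. \<chi> j. 1 / (autfac (ga j) (z $ j))^2 * h $ j)) (at z)"
proof -
 have e: "(\<chi> j. c j) = (\<Sum>j\<in>UNIV. axis j (c j) :: complex^'r)" for c :: "'r => complex" by (simp add: vec_eq_iff axis_def)
 have ax: "bounded_linear (axis j :: complex => complex^'r)" for j
  by (rule linear_conv_bounded_linear[THEN iffD1]) (auto intro!: linearI simp: axis_def vec_eq_iff)
 have "((%z. axis j (moebius (ga j) (z $ j)) :: complex^'r) has_derivative (%h. axis j (1 / (autfac (ga j) (z $ j))^2 * h $ j))) (at z)" for j
 proof -
  have "0 < Im (z $ j)" using z by (simp add: upper_half_def)
  from moebius_derivative[OF ga this] have D: "(moebius (ga j) has_derivative (*) (1 / (autfac (ga j) (z $ j))^2)) (at (z $ j))"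
   by (simp add: has_field_derivative_def)
  have "((%z::complex^'r. z $ j) has_derivative (%h. h $ j)) (at z)" by (rule bounded_linear_imp_has_derivative[OF bounded_linear_vec_nth])
  from has_derivative_compose[OF this D]
  have "((%z. moebius (ga j) (z $ j)) has_derivative (%h. 1 / (autfac (ga j) (z $ j))^2 * h $ j)) (at z)" .
  from bounded_linear.has_derivative[OF ax this] show ?thesis .
 qed
 thus ?thesis unfolding act_def[abs_def] e by (intro has_derivative_sum)
qed

lemma holomorphic_vec_slash:
 assumes f: "holomorphic_vec f upper_half" and ga: "!!j. det2 (ga j) = 1"
 shows "holomorphic_vec (slash k f ga) (upper_half :: (complex^'r::finite) set)"
proof -
 have "holomorphic_vec (%z. f (act ga z)) upper_half" unfolding holomorphic_vec_def
 proof
  fix z :: "complex^'r" assume z: "z : upper_half"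
  obtain D where D: "(f has_derivative D) (at (act ga z))" "!!c v. D (c *s v) = c * D v"
   using f act_upper_half[of ga z, OF ga z] unfolding holomorphic_vec_def by blast
  let ?A = "%h. \<chi> j. 1 / (autfac (ga j) (z $ j))^2 * h $ j :: complex^'r"
  have "?A (c *s v) = c *s ?A v" for c v by (simp add: vec_eq_iff)
  thus "EX D. ((%z. f (act ga z)) has_derivative D) (at z) & (ALL c v. D (c *s v) = c * D v)"
   using has_derivative_compose[OF act_has_derivative[of ga z, OF ga z] D(1)] D(2) by (intro exI[of _ "%h. D (?A h)"]) simp
 qed
 moreover have "holomorphic_vec (%z. 1 / autfac (ga j) (z $ j)) upper_half" for j
 proof (rule holomorphic_vec_nth)
  fix z :: "complex^'r" assume "z : upper_half"
  hence "0 < Im (z $ j)" by (simp add: upper_half_def)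
  from autfac_nonzero[OF ga this] have ne: "autfac (ga j) (z $ j) ~= 0" .
  obtain p q r s where g: "ga j = (p, q, r, s)" by (cases "ga j")
  have "autfac (ga j) = (%z. of_real r * z + of_real s)" by (simp add: g fun_eq_iff)
  thus "EX D. ((%z. 1 / autfac (ga j) z) has_field_derivative D) (at (z $ j))" using ne by (auto intro!: exI derivative_eq_intros)
 qed
 ultimately have "holomorphic_vec (%z. f (act ga z) * (\<Prod>j\<in>UNIV. (1 / autfac (ga j) (z $ j)) ^ k j)) upper_half"
  by (intro holomorphic_vec_mult holomorphic_vec_prod holomorphic_vec_power) auto
 thus ?thesis by (simp add: slash_def[abs_def] power_divide prod_dividef)
qed

section \<open>Hilbert modular groups\<close>

text \<open>The identity plus l times the column (s, -c) times the row (c, s). It fixes the vector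
  (s, -c), hence the cusp -s/c.\<close>

definition unip :: "'a::comm_ring_1 => 'a => 'a => 'a quad" where
 "unip l c s = (1 + l * (c * s), l * s^2, - (l * c^2), 1 - l * (c * s))"

lemma unipotent_parametrization:
 fixes p q r s :: "'a::field"
 assumes "p * s - q * r = 1" "p + s = 2"
 obtains l c s' where "c ~= 0 | s' ~= 0" "(p, q, r, s) = unip l c s'"
proof (cases "r = 0")
 case True
 have s: "s = 2 - p" using assms(2) by (simp add: algebra_simps)
 have "(p - 1)^2 = 0" using assms(1) True unfolding s by (simp add: sq_simps)
 hence "p = 1" by simp
 thus ?thesis using that[of 0 1 q] True s by (simp add: unip_def)
next
 case False
 have s: "s = 2 - p" using assms(2) by (simp add: algebra_simps)
 define x where "x = (p - 1) / r"
 have x: "r * x = p - 1" using False by (simp add: x_def)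
 have "q * r = - ((r * x)^2)" using assms(1) unfolding s x by (simp add: sq_simps)
 hence "q * r = - (r * x^2) * r" by (simp add: power2_eq_square)
 hence "q = - (r * x^2)" using mult_right_cancel[OF False] by blast
 thus ?thesis using that[of 1 "- x" "- r"] x s by (simp add: unip_def)
qed

lemma map_quad_unip: "field_hom ta ==> map_quad ta (unip l c s) = unip (ta l) (ta c) (ta s)"
 by (simp add: unip_def hom_add hom_diff hom_mult hom_minus hom_power hom_1)

locale hilbert_group = arithmetic_group a b si tht U t Ga
 for a b :: "'f::field_char_0" and si :: "'r::finite => 'f => real" and tht U t Ga +
 fixes ph :: "'f quad => 'f quad"
 assumes ph: "ph : splittings RT a b"
  and ph_si: "!!x j. tht j (map_quad (si j) x) = map_quad (si j) (ph x)"
  and H_subgroup: "subgroup ((%x. plus_minus_one #>\<^bsub>SL2 ring_of_integers\<^esub> ph x) ` Gamma1_quat a b U t) PSL2_int"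
  and H_index: "finite (rcosets\<^bsub>PSL2_int\<^esub> ((%x. plus_minus_one #>\<^bsub>SL2 ring_of_integers\<^esub> ph x) ` Gamma1_quat a b U t))"
begin

sublocale places: real_places si using nf tr si split_imp_all_real_places_split[OF ph ab] by unfold_locales auto

lemma emb_ph: "emb x = (%j. map_quad (si j) (ph x))" by (simp add: emb_def ph_si)

lemma pm1_coset:
 "plus_minus_one #>\<^bsub>SL2 S\<^esub> y = {y, map_quad uminus y}" by (cases y) (auto simp: r_coset_def SL2_def quat_simps)

lemma ph_SL2:
 assumes "x : Gamma1_quat a b U t"
 shows "ph x : carrier (SL2 ring_of_integers)"
proof -
 have "plus_minus_one #>\<^bsub>SL2 ring_of_integers\<^esub> ph x : carrier PSL2_int" using subgroup.subset[OF H_subgroup] assms by blast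
 then obtain y where y: "y : carrier (SL2 (ring_of_integers :: 'f set))"
  "plus_minus_one #>\<^bsub>SL2 ring_of_integers\<^esub> ph x = plus_minus_one #>\<^bsub>SL2 ring_of_integers\<^esub> y"
  by (auto simp: PSL2_int_def FactGroup_def RCOSETS_def)
 hence "ph x = y | ph x = map_quad uminus y" unfolding pm1_coset by blast
 thus ?thesis using y(1) by (cases y) (auto simp: SL2_def)
qed

definition dfac :: "'f => 'f => complex^'r => 'r => real" where
 "dfac c s w j = cmod (of_real (si j c) * w $ j + of_real (si j s))"

text \<open>The product of the imaginary parts after a matrix of determinant 1 with lower row (c,
  s), so the height of w at the cusp -s/c; it depends on the scaling of the pair.\<close>

definition height :: "'f => 'f => complex^'r => real" where
 "height c s w = (\<Prod>j\<in>UNIV. Im (w $ j) / (dfac c s w j)^2)"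

lemma dfac_pos: "w : upper_half ==> c ~= 0 | s ~= 0 ==> 0 < dfac c s w j"
proof -
 assume w: "w : upper_half" and cs: "c ~= 0 | s ~= 0"
 have "of_real (si j c) * w $ j + of_real (si j s) ~= 0"
 proof
  assume e: "of_real (si j c) * w $ j + of_real (si j s) = 0"
  have "si j c * Im (w $ j) = Im (of_real (si j c) * w $ j + of_real (si j s))" by simp
  also have "... = 0" by (simp only: e zero_complex.simps)
  finally have "si j c = 0" using w by (auto simp: upper_half_def less_le)
  hence "c = 0" "si j s = 0" using e by (simp_all add: sh_eq_0 sh_0)
  thus False using cs by (simp add: sh_eq_0)
 qed
 thus ?thesis by (simp add: dfac_def)
qed

lemma height_pos: "w : upper_half ==> c ~= 0 | s ~= 0 ==> 0 < height c s w"
 unfolding height_def by (intro prod_pos ballI divide_pos_pos zero_less_power dfac_pos) (auto simp: upper_half_def)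

text \<open>Im (A cnj B) is the determinant of the two rows times Im w. It keeps a point from being
  high at two different cusps.\<close>

lemma dfac_cross:
 assumes w: "w : upper_half"
 shows "\<bar>si j (c * s' - s * c')\<bar> * Im (w $ j) <= dfac c s w j * dfac c' s' w j"
proof -
 let ?A = "of_real (si j c) * w $ j + of_real (si j s)" and ?B = "of_real (si j c') * w $ j + of_real (si j s')"
 have "\<bar>si j (c * s' - s * c')\<bar> * Im (w $ j) = \<bar>Im (?A * cnj ?B)\<bar>"
 proof -
  have "Im (?A * cnj ?B) = si j (c * s' - s * c') * Im (w $ j)" by (simp add: sh_diff sh_mult algebra_simps)
  thus ?thesis using w by (simp add: abs_mult upper_half_def less_imp_le abs_of_pos)
 qed
 also have "... <= cmod (?A * cnj ?B)" by (rule abs_Im_le_cmod)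
 also have "... = dfac c s w j * dfac c' s' w j" by (simp only: dfac_def norm_mult complex_mod_cnj)
 finally show ?thesis .
qed

definition close :: "('r => real) => complex^'r => 'f quad => bool" where
 "close ep w x \<longleftrightarrow> x : Gamma1_quat a b U t & (ALL j. cmod (act (emb x) w $ j - w $ j) <= ep j * Im (w $ j))"

text \<open>All infinite places are split here, so t^2 - 4 is an integer with every conjugate below
  1 and vanishes. What is left is a unipotent up to the sign \<open>et\<close>, and the displacement
  bounds its parameter l.\<close>

lemma close_unipotent:
 assumes w: "w : upper_half" and ep: "!!j. 0 < ep j" "!!j. ep j <= 1/4" and x: "close ep w x"
 obtains et l c s where "et = 1 | et = - 1" "c ~= 0 | s ~= 0" "ph x = map_quad (%u. et * u) (unip l c s)"
  "!!j. \<bar>si j l\<bar> * (dfac c s w j)^2 <= 2 * ep j * Im (w $ j)"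
  "aint (l * c^2)" "aint (l * (c * s))" "aint (l * s^2)"
proof -
 obtain x0 x1 x2 x3 where xx: "x = (x0, x1, x2, x3)" by (cases x)
 have xG: "x : Gamma1_quat a b U t" and xw: "!!j. cmod (act (emb x) w $ j - w $ j) <= ep j * Im (w $ j)" using x by (auto simp: close_def)
 obtain p q r s where P: "ph x = (p, q, r, s)" by (cases "ph x")
 have int: "aint p" "aint q" "aint r" "aint s" and det: "p * s - q * r = 1" using ph_SL2[OF xG] unfolding P by (auto simp: SL2_def)
 have tr: "p + s = 2 * x0" using splitting_tr_det(1)[OF ph xx] P by simp
 have "(2 * x0)^2 = 4"
 proof (rule ccontr)
  assume ne: "(2 * x0)^2 ~= 4"
  let ?y = "(2 * x0)^2 - of_int 4"
  have "aint ?y" unfolding tr[symmetric]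
   by (intro algebraic_int_diff[OF nf] algebraic_int_power[OF nf] algebraic_int_of_int[OF nf] algebraic_int_add[OF nf] int)
  hence "1 <= places.anorm ?y" using ne by (intro places.anorm_ge_1) auto
  moreover have "places.anorm ?y < (\<Prod>j\<in>(UNIV :: 'r set). 1)"
  proof (rule places.anorm_less_prod)
   fix j
   have e: "si j ?y = (si j (2 * x0))^2 - 4" using hom_of_int[OF si_hom, of j 4] by (simp only: sh_diff sh_power of_int_numeral)
   have "(si j (2 * x0))^2 - 4 <= 2 * (ep j)^2"
    by (rule near_stabilizer_trace[OF xG[unfolded xx] w]) (use ep(1)[of j] ep(2)[of j] xw xx in \<open>auto simp: less_imp_le\<close>)
   moreover have "2\<^sup>2 < \<bar>si j (2 * x0)\<bar>\<^sup>2" using trace_hyperbolic[OF xG[unfolded xx] ne, of j] by (intro power_strict_mono) auto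
   moreover have "(ep j)^2 <= (1/4)^2" using ep(1)[of j] ep(2)[of j] by (intro power_mono) auto
   hence "(ep j)^2 <= 1/16" by (simp add: power2_eq_square)
   ultimately show "\<bar>si j ?y\<bar> < 1" unfolding e by simp
  qed
  ultimately show False by simp
 qed
 hence "(p + s)^2 = 2^2" unfolding tr by simp
 hence "p + s = 2 | p + s = - 2" unfolding power2_eq_iff .
 then obtain et :: 'f where et: "et = 1 | et = - 1" "et * p + et * s = 2"
 proof
  assume "p + s = - 2"
  hence "- (p + s) = 2" by simp
  hence "(- 1) * p + (- 1) * s = 2" by simp
  thus thesis using that[of "- 1"] by simp
 qed (use that[of 1] in simp)
 have et2: "et * et = 1" using et(1) by auto
 have "(et * p) * (et * s) - (et * q) * (et * r) = (et * et) * (p * s - q * r)" by (simp add: algebra_simps)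
 hence "(et * p) * (et * s) - (et * q) * (et * r) = 1" using et2 det by simp
 then obtain l c s' where u: "c ~= 0 | s' ~= 0" "(et * p, et * q, et * r, et * s) = unip l c s'" using et(2) by (rule unipotent_parametrization)
 have ui: "et * p = 1 + l * (c * s')" "et * q = l * s'^2" "et * r = - (l * c^2)" "et * s = 1 - l * (c * s')" using u(2) by (auto simp: unip_def)
 have Pet: "p = et * (et * p)" "q = et * (et * q)" "r = et * (et * r)" "s = et * (et * s)" using et2 by (simp_all flip: mult.assoc)
 show thesis
 proof
  show "et = 1 | et = - 1" by (rule et)
  show "c ~= 0 | s' ~= 0" by (rule u)
  show "ph x = map_quad (%u. et * u) (unip l c s')" unfolding P u(2)[symmetric] using Pet by simp
  have eti: "aint et" using et(1) algebraic_int_of_int[OF nf, of 1] algebraic_int_of_int[OF nf, of "-1"] by auto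
  have i: "aint (et * p)" "aint (et * q)" "aint (et * r)" by (intro algebraic_int_mult[OF nf] eti int)+
  show "aint (l * s'^2)" using i(2) unfolding ui .
  show "aint (l * c^2)" using algebraic_int_mult[OF nf algebraic_int_of_int[OF nf, of "-1"] i(3)] unfolding ui by simp
  show "aint (l * (c * s'))" using algebraic_int_diff[OF nf i(1) algebraic_int_of_int[OF nf, of 1]] unfolding ui by simp
  fix j
  have h: "field_hom (si j)" by (rule si_hom)
  have y: "0 < Im (w $ j)" using w by (simp add: upper_half_def)
  have e: "emb x j = (si j p, si j q, si j r, si j s)" by (simp add: emb_ph P)
  let ?Q = "of_real (si j r) * (w $ j)^2 + of_real (si j s - si j p) * (w $ j) - of_real (si j q)"
  have "(cmod ?Q)^2 <= 2 * (ep j)^2 * (Im (w $ j))^2" by (rule near_fixed_bound(1)[OF _ y])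
    (use emb_det[OF Gamma1_nrd[OF xG], of j] xw[of j] ep(1)[of j] ep(2)[of j] e in \<open>auto simp: act_def\<close>)
  also have "... <= (2 * ep j * Im (w $ j))^2" by (simp add: power_mult_distrib)
  finally have "cmod ?Q <= 2 * ep j * Im (w $ j)" by (rule power2_le_imp_le) (use ep(1)[of j] y in simp)
  \<comment> \<open>The quadratic form of a unipotent is a perfect square: up to sign it is l (c w +
    s)^2.\<close>
  moreover have "cmod ?Q = \<bar>si j l\<bar> * (dfac c s' w j)^2"
  proof -
   let ?n = "complex_of_real (si j et)"
   have n: "\<bar>si j et\<bar> = 1" using et(1) hom_1[OF h] hom_minus[OF h, of 1] by auto
   have "?n * ?Q = of_real (si j (et * r)) * (w $ j)^2 + of_real (si j (et * s) - si j (et * p)) * (w $ j) - of_real (si j (et * q))"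
    by (simp add: hom_mult[OF h] algebra_simps)
   also have "... = - of_real (si j l) * (of_real (si j c) * w $ j + of_real (si j s'))^2"
    unfolding ui hom_add[OF h] hom_diff[OF h] hom_minus[OF h] hom_mult[OF h] hom_power[OF h] by (simp add: sq_simps)
   finally have "cmod (?n * ?Q) = cmod (of_real (si j l) * (of_real (si j c) * w $ j + of_real (si j s'))^2)" by (simp add: norm_mult)
   thus ?thesis by (simp add: norm_mult n norm_power dfac_def)
  qed
  ultimately show "\<bar>si j l\<bar> * (dfac c s' w j)^2 <= 2 * ep j * Im (w $ j)" by simp
 qed
qed

text \<open>Two nontrivial unipotents moving \<open>w\<close> little fix the same cusp:
 \<open>l l' (c s' - s c')\<^sup>2 = - tr ((u - 1) (u' - 1))\<close> is an integer with all conjugates small.\<close>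

lemma close_common_cusp:
 assumes w: "w : upper_half" and ep: "!!j. 0 < ep j" "!!j. ep j <= 1/4"
  and b: "!!j. \<bar>si j l\<bar> * (dfac c s w j)^2 <= 2 * ep j * Im (w $ j)" "!!j. \<bar>si j l'\<bar> * (dfac c' s' w j)^2 <= 2 * ep j * Im (w $ j)"
  and i: "aint (l * c^2)" "aint (l * (c * s))" "aint (l * s^2)"
   "aint (l' * c'^2)" "aint (l' * (c' * s'))" "aint (l' * s'^2)"
  and l: "l ~= 0" "l' ~= 0"
 shows "c * s' = s * c'"
proof (rule ccontr)
 assume ne: "c * s' ~= s * c'"
 let ?mu = "l * l' * (c * s' - s * c')^2"
 have "?mu = (l * c^2) * (l' * s'^2) + (l * s^2) * (l' * c'^2) - of_int 2 * ((l * (c * s)) * (l' * (c' * s')))"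
  by (simp add: sq_simps)
 moreover have "aint ..." by (intro algebraic_int_diff[OF nf] algebraic_int_add[OF nf] algebraic_int_mult[OF nf] algebraic_int_of_int[OF nf] i)
 ultimately have "aint ?mu" by simp
 hence "1 <= places.anorm ?mu" using l ne by (intro places.anorm_ge_1) auto
 moreover have "places.anorm ?mu < (\<Prod>j\<in>(UNIV :: 'r set). 1)"
 proof (rule places.anorm_less_prod)
  fix j
  let ?y = "Im (w $ j)" and ?D = "dfac c s w j" and ?D' = "dfac c' s' w j" and ?x = "si j (c * s' - s * c')"
  have y: "0 < ?y" using w by (simp add: upper_half_def)
  have "(\<bar>?x\<bar> * ?y)^2 <= (?D * ?D')^2" using dfac_cross[OF w, of j c s' s c'] y by (intro power_mono) auto
  hence "(\<bar>si j l\<bar> * \<bar>si j l'\<bar>) * (\<bar>?x\<bar> * ?y)^2 <= (\<bar>si j l\<bar> * \<bar>si j l'\<bar>) * (?D * ?D')^2" by (intro mult_left_mono) auto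
  also have "... = (\<bar>si j l\<bar> * ?D^2) * (\<bar>si j l'\<bar> * ?D'^2)" by (simp add: power_mult_distrib)
  also have "... <= (2 * ep j * ?y) * (2 * ep j * ?y)" using y ep(1)[of j] by (intro mult_mono[OF b(1)[of j] b(2)[of j]]) auto
  also have "... <= (1/2 * ?y) * (1/2 * ?y)" using y ep(1)[of j] ep(2)[of j] by (intro mult_mono mult_right_mono) auto
  finally have "(\<bar>si j l\<bar> * \<bar>si j l'\<bar> * ?x^2) * ?y^2 <= 1/4 * ?y^2" by (simp add: power_mult_distrib power2_eq_square mult_ac)
  hence "\<bar>si j l\<bar> * \<bar>si j l'\<bar> * ?x^2 <= 1/4" using y by (simp add: mult_le_cancel_right)
  thus "\<bar>si j ?mu\<bar> < 1" by (simp add: sh_mult sh_power abs_mult)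
 qed
 ultimately show False by simp
qed

lemma unip_scale: "ka ~= 0 ==> unip l c s = unip (l / ka^2) (ka * c) (ka * (s :: 'f))" by (simp add: unip_def power_mult_distrib power2_eq_square)

text \<open>If some nearby element is nontrivial, its cusp is taken, scaled to a good pair;
  otherwise any good pair does. By \<open>close_common_cusp\<close> all other elements fix the same
  cusp, so they are described by one parameter l with M l integral.\<close>

lemma close_cusp:
 assumes M: "!!c s. c ~= 0 | s ~= 0 ==> EX ka. ka ~= 0 & places.good_pair M (ka * c) (ka * s)"
  and w: "w : upper_half" and ep: "!!j. 0 < ep j" "!!j. ep j <= 1/4"
 obtains c s where "places.good_pair M c s"
  "ALL x. close ep w x --> (EX et l. (et = 1 | et = - 1) & ph x = map_quad (%u. et * u) (unip l c s)
   & aint (of_nat M * l) & (ALL j. \<bar>si j l\<bar> <= 2 * ep j * (Im (w $ j) / (dfac c s w j)^2)))"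
proof -
 have nz: "aint (of_nat M * (0::'f))" using algebraic_int_of_int[OF nf, of 0] by simp
 have y: "0 < Im (w $ j)" for j using w by (simp add: upper_half_def)
 show thesis
 proof (cases "EX x1 et l c s. close ep w x1 & (c ~= 0 | s ~= 0) & l ~= 0 & ph x1 = map_quad (%u. et * u) (unip l c s)
   & (ALL j. \<bar>si j l\<bar> * (dfac c s w j)^2 <= 2 * ep j * Im (w $ j)) & aint (l * c^2) & aint (l * (c * s)) & aint (l * s^2)")
  case False
  obtain ka where g: "places.good_pair M (ka * 1) (ka * 0)" using M[of 1 0] by auto
  show thesis
  proof (rule that[OF g], intro allI impI)
   fix x assume x: "close ep w x"
   obtain et l c s where *: "et = 1 | et = - 1" "c ~= 0 | s ~= 0" "ph x = map_quad (%u. et * u) (unip l c s)"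
    "!!j. \<bar>si j l\<bar> * (dfac c s w j)^2 <= 2 * ep j * Im (w $ j)"
    "aint (l * c^2)" "aint (l * (c * s))" "aint (l * s^2)" using close_unipotent[OF w ep x] by metis
   hence "l = 0" using False x by blast
   hence "ph x = map_quad (%u. et * u) (unip 0 (ka * 1) (ka * 0))" using *(3) by (simp add: unip_def)
   moreover have "\<bar>si j 0\<bar> <= 2 * ep j * (Im (w $ j) / (dfac (ka * 1) (ka * 0) w j)^2)" for j using ep(1)[of j] y[of j] by (simp add: sh_0)
   ultimately show "EX et l. (et = 1 | et = - 1) & ph x = map_quad (%u. et * u) (unip l (ka * 1) (ka * 0))
    & aint (of_nat M * l) & (ALL j. \<bar>si j l\<bar> <= 2 * ep j * (Im (w $ j) / (dfac (ka * 1) (ka * 0) w j)^2))"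
    using *(1) nz by (intro exI[of _ et] exI[of _ 0]) blast
  qed
 next
  case True
  then obtain l1 c1 s1 where 1: "c1 ~= 0 | s1 ~= 0" "l1 ~= 0"
   "!!j. \<bar>si j l1\<bar> * (dfac c1 s1 w j)^2 <= 2 * ep j * Im (w $ j)"
   "aint (l1 * c1^2)" "aint (l1 * (c1 * s1))" "aint (l1 * s1^2)" by blast
  obtain ka where ka: "ka ~= 0" and g: "places.good_pair M (ka * c1) (ka * s1)" using M[OF 1(1)] by blast
  let ?c = "ka * c1" and ?s = "ka * s1"
  have cs: "?c ~= 0 | ?s ~= 0" using ka 1(1) by simp
  show thesis
  proof (rule that[OF g], intro allI impI)
   fix x assume x: "close ep w x"
   obtain et l c s where *: "et = 1 | et = - 1" "c ~= 0 | s ~= 0" "ph x = map_quad (%u. et * u) (unip l c s)"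
    "!!j. \<bar>si j l\<bar> * (dfac c s w j)^2 <= 2 * ep j * Im (w $ j)"
    "aint (l * c^2)" "aint (l * (c * s))" "aint (l * s^2)" using close_unipotent[OF w ep x] by metis
   show "EX et l. (et = 1 | et = - 1) & ph x = map_quad (%u. et * u) (unip l ?c ?s)
    & aint (of_nat M * l) & (ALL j. \<bar>si j l\<bar> <= 2 * ep j * (Im (w $ j) / (dfac ?c ?s w j)^2))"
   proof (cases "l = 0")
    case True
    hence "ph x = map_quad (%u. et * u) (unip 0 ?c ?s)" using *(3) by (simp add: unip_def)
    moreover have "\<bar>si j 0\<bar> <= 2 * ep j * (Im (w $ j) / (dfac ?c ?s w j)^2)" for j using ep(1)[of j] y[of j] by (simp add: sh_0)
    ultimately show ?thesis using *(1) nz by (intro exI[of _ et] exI[of _ 0]) blast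
   next
    case False
    have "c1 * s = s1 * c" by (rule close_common_cusp[OF w ep 1(3) *(4) 1(4-6) *(5-7) 1(2) False])
    then obtain nu where nu: "nu ~= 0" "?c = nu * c" "?s = nu * s"
    proof (cases "c = 0")
     case True
     hence "s ~= 0" "c1 = 0" using *(2) \<open>c1 * s = s1 * c\<close> by auto
     thus ?thesis using that[of "?s / s"] cs True by simp
    next
     case False
     hence "c1 ~= 0" using \<open>c1 * s = s1 * c\<close> 1(1) by auto
     thus ?thesis using that[of "?c / c"] ka False \<open>c1 * s = s1 * c\<close> by (simp add: field_simps)
    qed
    let ?l = "l / nu^2"
    have e: "?l * ?c^2 = l * c^2" "?l * (?c * ?s) = l * (c * s)" "?l * ?s^2 = l * s^2"
     unfolding nu(2,3) using nu(1) by (simp_all add: power2_eq_square)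
    have "aint (of_nat M * ?l)" using g *(5-7) unfolding places.good_pair_def by (metis e)
    moreover have "ph x = map_quad (%u. et * u) (unip ?l ?c ?s)" using *(3) unip_scale[OF nu(1), of l c s] nu by simp
    moreover have "\<bar>si j ?l\<bar> <= 2 * ep j * (Im (w $ j) / (dfac ?c ?s w j)^2)" for j
    proof -
     have "of_real (si j ?c) * w $ j + of_real (si j ?s) = of_real (si j nu) * (of_real (si j c) * w $ j + of_real (si j s))"
      unfolding nu(2,3) by (simp add: sh_mult algebra_simps)
     hence "dfac ?c ?s w j = \<bar>si j nu\<bar> * dfac c s w j" by (simp add: dfac_def norm_mult)
     moreover have "si j l = si j ?l * (si j nu)^2" using nu(1) by (simp flip: sh_mult sh_power)
     ultimately have "\<bar>si j ?l\<bar> * (dfac ?c ?s w j)^2 = \<bar>si j l\<bar> * (dfac c s w j)^2" by (simp add: abs_mult power_mult_distrib)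
     hence "\<bar>si j ?l\<bar> * (dfac ?c ?s w j)^2 <= 2 * ep j * Im (w $ j)" using *(4)[of j] by simp
     thus ?thesis using dfac_pos[OF w cs, of j] by (simp add: field_simps)
    qed
    ultimately show ?thesis using *(1) by blast
   qed
  qed
 qed
qed

text \<open>The product of the factors \<open>dfac\<close> is at least the norm of s if c = 0, and
  otherwise at least the product of the imaginary parts times the norm of c. The bound is the same
  for all good pairs, and discontinuity of the group rests on it.\<close>

lemma height_le:
 assumes "places.good_pair M c s" and w: "w : upper_half"
 shows "height c s w <= (\<Prod>j\<in>UNIV. Im (w $ j)) + 1 / (\<Prod>j\<in>UNIV. Im (w $ j))"
proof -
 have cs: "aint c" "aint s" "c ~= 0 | s ~= 0" using assms(1) by (auto simp: places.good_pair_def)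
 have y: "0 < Im (w $ j)" for j using w by (simp add: upper_half_def)
 define P where "P = (\<Prod>j\<in>UNIV. Im (w $ j))"
 have P: "0 < P" unfolding P_def using y by (intro prod_pos) auto
 have h: "height c s w = P / (\<Prod>j\<in>UNIV. dfac c s w j)^2" by (simp add: height_def prod_dividef P_def prod_power_distrib)
 show ?thesis unfolding P_def[symmetric]
 proof (cases "c = 0")
  case True
  have "(\<Prod>j\<in>UNIV. dfac c s w j) = places.anorm s" by (simp add: True dfac_def places.anorm_def sh_0)
  hence "1 <= (\<Prod>j\<in>UNIV. dfac c s w j)" using places.anorm_ge_1 cs True by simp
  hence "1 <= (\<Prod>j\<in>UNIV. dfac c s w j)^2" by (rule one_le_power)
  hence "P / (\<Prod>j\<in>UNIV. dfac c s w j)^2 <= P / 1" using P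
   by (intro divide_left_mono mult_pos_pos) (auto dest: less_le_trans[OF zero_less_one])
  moreover have "0 < 1 / P" using P by simp
  ultimately show "height c s w <= P + 1 / P" unfolding h div_by_1 by linarith
 next
  case False
  have "P * 1 <= P * places.anorm c" using P places.anorm_ge_1[OF cs(1) False] by (intro mult_left_mono) auto
  also have "... = (\<Prod>j\<in>UNIV. Im (w $ j) * \<bar>si j c\<bar>)" by (simp add: P_def places.anorm_def prod.distrib)
  also have "... <= (\<Prod>j\<in>UNIV. dfac c s w j)"
  proof (intro prod_mono conjI)
   fix j
   have "\<bar>Im (of_real (si j c) * w $ j + of_real (si j s))\<bar> <= dfac c s w j" unfolding dfac_def by (rule abs_Im_le_cmod)
   thus "Im (w $ j) * \<bar>si j c\<bar> <= dfac c s w j" using y[of j] by (simp add: abs_mult mult.commute)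
   show "0 <= Im (w $ j) * \<bar>si j c\<bar>" using y[of j] by simp
  qed
  finally have "P^2 <= (\<Prod>j\<in>UNIV. dfac c s w j)^2" using P by (intro power_mono) auto
  moreover from this P have "0 < (\<Prod>j\<in>UNIV. dfac c s w j)^2 * P^2" by (meson less_le_trans mult_pos_pos zero_less_power)
  ultimately have "P / (\<Prod>j\<in>UNIV. dfac c s w j)^2 <= P / P^2" using P by (intro divide_left_mono) auto
  also have "... = 1 / P" using P by (simp add: power2_eq_square)
  finally show "height c s w <= P + 1 / P" unfolding h using P by simp
 qed
qed

lemma discontinuous_hilbert: "disc_group Ga"
proof (rule disc_groupI)
 fix z :: "complex^'r" assume z: "z : upper_half"
 obtain M :: nat where M: "0 < M" "!!c s. c ~= 0 | s ~= 0 ==> EX ka. ka ~= 0 & places.good_pair M (ka * c) (ka * s)"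
  by (rule places.ex_good_pair) blast
 define P where "P = (\<Prod>j\<in>UNIV. Im (z $ j))"
 \<comment> \<open>Bounds the heights at all good pairs for all w in the polydisc. With the
   following \<open>ep\<close> the norm of M l is at most (2 M ep)^r B < 1, which forces l =
   0.\<close>
 define B where "B = 2 ^ CARD('r) * (P + 1 / P)"
 define ep where "ep = 1 / (4 * real M * (1 + B))"
 have P: "0 < P" unfolding P_def using z by (intro prod_pos) (auto simp: upper_half_def)
 have B: "0 < B" using P by (simp add: B_def add_pos_pos)
 have "1 <= real M * (1 + B)" using mult_mono[of 1 "real M" 1 "1 + B"] M(1) B by (simp add: Suc_le_eq)
 hence ep: "0 < ep" "ep <= 1/4" unfolding ep_def by (simp_all add: field_simps)
 have e: "2 * real M * ep = 1 / (2 * (1 + B))"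
 proof -
  define q where "q = 1 + B"
  have "0 < q" using B by (simp add: q_def)
  thus ?thesis unfolding ep_def q_def[symmetric] using M(1) by (simp add: field_simps)
 qed
 have triv: "ALL j. emb x j : plus_minus_one" if x: "x : Gamma1_quat a b U t" and w: "w : polydisc (%_. 1/2) z"
   and cl: "ALL j. cmod (act (emb x) w $ j - w $ j) <= ep * Im (w $ j)" for x w
 proof -
  have wH: "w : upper_half" using polydisc_subset[OF z, of "%_. 1/2"] w by auto
  have clo: "close (%_. ep) w x" using x cl by (simp add: close_def)
  obtain c s where g: "places.good_pair M c s" and *: "ALL x. close (%_. ep) w x --> (EX et l. (et = 1 | et = - 1) & ph x = map_quad (%u. et * u) (unip l c s)
   & aint (of_nat M * l) & (ALL j. \<bar>si j l\<bar> <= 2 * ep * (Im (w $ j) / (dfac c s w j)^2)))"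
   by (rule close_cusp[OF M(2) wH, of "%_. ep"]) (use ep in blast)+
  obtain et l where l: "et = 1 | et = - 1" "ph x = map_quad (%u. et * u) (unip l c s)"
   "aint (of_nat M * l)" "ALL j. \<bar>si j l\<bar> <= 2 * ep * (Im (w $ j) / (dfac c s w j)^2)" using *[rule_format, OF clo] by blast
  have "l = 0"
  proof (rule ccontr)
   assume "l ~= 0"
   hence "1 <= places.anorm (of_nat M * l)" using places.anorm_ge_1[OF l(3)] M(1) by simp
   also have "... = real M ^ CARD('r) * places.anorm l" by (simp add: places.anorm_mult places.anorm_of_nat)
   also have "... <= real M ^ CARD('r) * (\<Prod>j\<in>UNIV. 2 * ep * (Im (w $ j) / (dfac c s w j)^2))"
    unfolding places.anorm_def using l(4) by (intro mult_left_mono prod_mono) auto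
   also have "... = real M ^ CARD('r) * ((2 * ep) ^ CARD('r) * height c s w)" by (simp only: height_def prod.distrib prod_constant power_mult_distrib)
   also have "... = (2 * real M * ep) ^ CARD('r) * height c s w" by (simp add: power_mult_distrib)
   also have "... <= (2 * real M * ep) ^ CARD('r) * B"
   proof (intro mult_left_mono)
    let ?W = "\<Prod>j\<in>UNIV. Im (w $ j)"
    have W1: "(1/2) ^ CARD('r) * P <= ?W"  unfolding P_def prod_constant[symmetric] prod.distrib[symmetric]
     using polydisc_Im(1)[OF w z] z by (intro prod_mono) (auto simp: upper_half_def less_imp_le)
    have W2: "?W <= 2 ^ CARD('r) * P"  unfolding P_def prod_constant[symmetric] prod.distrib[symmetric]
    proof (intro prod_mono conjI)
     fix j show "Im (w $ j) <= 2 * Im (z $ j)" using polydisc_Im(2)[OF w z, of j] z by (simp add: upper_half_def) (smt (verit))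
     show "0 <= Im (w $ j)" using wH by (simp add: upper_half_def less_imp_le)
    qed
    have "0 < ?W" using wH by (intro prod_pos) (simp add: upper_half_def)
    hence "1 / ?W <= 1 / ((1/2) ^ CARD('r) * P)" using W1 P by (intro divide_left_mono mult_pos_pos) auto
    hence "1 / ?W <= 2 ^ CARD('r) * (1 / P)" by (simp add: power_divide)
    hence "?W + 1 / ?W <= B" using W2 unfolding B_def by (simp add: distrib_left)
    thus "height c s w <= B" using height_le[OF g wH] by linarith
    show "0 <= (2 * real M * ep) ^ CARD('r)" using ep by simp
   qed
   also have "... <= (2 * real M * ep) ^ 1 * B"
   proof (intro mult_right_mono power_decreasing)
    show "2 * real M * ep <= 1" unfolding e using B by (simp add: divide_le_eq_1)
   qed (use ep B in \<open>auto simp: Suc_le_eq\<close>)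
   also have "... = B / (2 * (1 + B))" unfolding e by simp
   also have "... < 1" using B by (simp add: field_simps)
   finally show False by simp
  qed
  hence "ph x = map_quad (%u. et * u) (1, 0, 0, 1)" using l(2) by (simp add: unip_def)
  thus ?thesis using l(1) by (auto simp: emb_ph sh_0 sh_1 sh_minus)
 qed
 show "\<exists>ep>0. ep <= 1/2 & (ALL ga:Ga. ALL w:polydisc (%_. 1/2) z.
   (ALL j. cmod (act ga w $ j - w $ j) <= ep * Im (w $ j)) --> (ALL j. ga j : plus_minus_one))"
 proof (intro exI[of _ ep] conjI ballI impI)
  fix ga w assume ga: "ga : Ga" and w: "w : polydisc (%_. 1/2) z" "ALL j. cmod (act ga w $ j - w $ j) <= ep * Im (w $ j)"
  obtain x where x: "x : Gamma1_quat a b U t" "ga = emb x" using ga unfolding Ga_emb by blast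
  show "ALL j. ga j : plus_minus_one" unfolding x(2) using triv[OF x(1) w(1)] w(2) unfolding x(2) by blast
 qed (use ep in auto)
qed

sublocale disc_group Ga by (rule discontinuous_hilbert)

text \<open>By \<open>close_cusp\<close> an element is given by a sign and a parameter l in a box
  whose volume is 2^r times the product of the ep j times the height; \<open>box_count\<close>
  counts these.\<close>

lemma near_stabilizer_count:
 assumes M: "0 < M" "!!c s. c ~= 0 | s ~= 0 ==> EX ka. ka ~= 0 & places.good_pair M (ka * c) (ka * s)"
  and w: "w : upper_half" and ep: "!!j. 0 < ep j" "!!j. ep j <= 1/4"
 shows "EX c s. places.good_pair M c s & finite (near_stabilizer ep w) \<and>
  real (card (near_stabilizer ep w)) <= 2 * 4 ^ CARD('r) * (1 + (2 * real M) ^ CARD('r) * (\<Prod>j\<in>UNIV. ep j) * height c s w)"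
proof -
 obtain c s where g: "places.good_pair M c s" and *: "ALL x. close ep w x --> (EX et l. (et = 1 | et = - 1) & ph x = map_quad (%u. et * u) (unip l c s)
   & aint (of_nat M * l) & (ALL j. \<bar>si j l\<bar> <= 2 * ep j * (Im (w $ j) / (dfac c s w j)^2)))" by (rule close_cusp[OF M(2) w ep]) blast
 have cs: "c ~= 0 | s ~= 0" using g by (simp add: places.good_pair_def)
 let ?a = "%j. 2 * ep j * (Im (w $ j) / (dfac c s w j)^2)"
 let ?S = "{l. aint (of_nat M * l) & (ALL j. \<bar>si j l\<bar> <= ?a j)}"
 let ?F = "%(et, l) j. map_quad (si j) (map_quad (%u. et * u) (unip l c s))"
 have a: "0 < ?a j" for j using ep(1)[of j] dfac_pos[OF w cs, of j] w by (simp add: upper_half_def)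
 have bc: "finite ?S" "real (card ?S) <= 4 ^ CARD('r) * (1 + real M ^ CARD('r) * (\<Prod>j\<in>UNIV. ?a j))"
  using places.box_count[of ?a M, OF a M(1)] by auto
 have sub: "near_stabilizer ep w <= ?F ` ({1, - 1} \<times> ?S)"
 proof
  fix ga assume ga: "ga : near_stabilizer ep w"
  hence "ga : emb ` Gamma1_quat a b U t" by (simp add: near_stabilizer_def flip: Ga_emb)
  then obtain x where x: "x : Gamma1_quat a b U t" "ga = emb x" by blast
  hence "close ep w x" using ga by (simp add: close_def near_stabilizer_def)
  from *[rule_format, OF this] obtain et l where l: "et = 1 | et = - 1" "ph x = map_quad (%u. et * u) (unip l c s)" "l : ?S" by blast
  thus "ga : ?F ` ({1, - 1} \<times> ?S)" by (intro image_eqI[of _ _ "(et, l)"]) (auto simp: x(2) emb_ph)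
 qed
 have fin: "finite ({1, - 1 :: 'f} \<times> ?S)" using bc(1) by simp
 have "card (near_stabilizer ep w) <= card ({1, - 1 :: 'f} \<times> ?S)" using surj_card_le[OF fin sub] .
 also have "... <= 2 * card ?S" by (simp add: card_cartesian_product card_insert_if)
 finally have "real (card (near_stabilizer ep w)) <= 2 * real (card ?S)" by linarith
 also have "... <= 2 * (4 ^ CARD('r) * (1 + real M ^ CARD('r) * (\<Prod>j\<in>UNIV. ?a j)))" using bc(2) by simp
 also have "(\<Prod>j\<in>UNIV. ?a j) = 2 ^ CARD('r) * (\<Prod>j\<in>UNIV. ep j) * height c s w" by (simp only: prod.distrib height_def prod_constant)
 finally have "real (card (near_stabilizer ep w)) <= 2 * 4 ^ CARD('r) * (1 + (2 * real M) ^ CARD('r) * (\<Prod>j\<in>UNIV. ep j) * height c s w)"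
  by (simp add: power_mult_distrib mult_ac)
 moreover have "finite (near_stabilizer ep w)" using sub fin by (meson finite_imageI finite_subset)
 ultimately show ?thesis using g by blast
qed

end

section \<open>Unipotent elements of finite-index subgroups\<close>

text \<open>Two of the powers of x with exponents up to the index share a coset. The difference of
  their exponents puts a power into H and divides the factorial.\<close>

lemma (in group) finite_index_pow:
 assumes H: "subgroup H G" and fin: "finite (rcosets H)" and x: "x : carrier G"
 shows "x [^] (fact (card (rcosets H)) :: nat) : H"
proof -
 let ?N = "card (rcosets H)"
 have sub: "H <= carrier G" by (rule subgroup.subset[OF H])
 have "(%n::nat. H #> x [^] n) ` {0..?N} <= rcosets H" using x by (auto simp: RCOSETS_def)
 hence "card ((%n::nat. H #> x [^] n) ` {0..?N}) <= ?N" using fin by (intro card_mono)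
 hence "~ inj_on (%n::nat. H #> x [^] n) {0..?N}" using card_image by fastforce
 then obtain i j where ij0: "i : {0..?N}" "j : {0..?N}" "i ~= j" "H #> x [^] i = H #> x [^] j" unfolding inj_on_def by blast
 have "EX i j. i < j & j <= ?N & H #> x [^] i = H #> x [^] j"
 proof (cases "i < j")
  case True
  thus ?thesis using ij0 by (intro exI[of _ i] exI[of _ j]) auto
 next
  case False
  thus ?thesis using ij0 by (intro exI[of _ j] exI[of _ i]) auto
 qed
 then obtain i j where ij: "i < j" "j <= ?N" "H #> x [^] i = H #> x [^] j" by blast
 have "x [^] j : H #> x [^] i" unfolding ij(3) by (rule rcos_self[OF nat_pow_closed[OF x] H])
 then obtain h where h: "h : H" "x [^] j = h \<otimes> x [^] i" by (auto simp: r_coset_def)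
 have "x [^] j = x [^] (j - i) \<otimes> x [^] i" using ij(1) x by (simp add: nat_pow_mult)
 hence "h \<otimes> x [^] i = x [^] (j - i) \<otimes> x [^] i" using h(2) by simp
 moreover have "h : carrier G" using h(1) sub by blast
 ultimately have "h = x [^] (j - i)" using x by (simp add: r_cancel)
 hence p: "x [^] (j - i) : H" using h by simp
 have "(j - i) dvd fact ?N" using ij by (intro dvd_fact) auto
 then obtain l where l: "fact ?N = (j - i) * l" by (auto elim: dvdE)
 have "(x [^] (j - i)) [^] n : H" for n :: nat using p subgroup.one_closed[OF H] subgroup.m_closed[OF H] by (induction n) auto
 thus ?thesis unfolding l using x by (simp add: nat_pow_pow[symmetric])
qed

lemma one_minus_ge_exp: "0 <= (t::real) ==> t <= 1/2 ==> exp (- (2 * t)) <= 1 - t"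
proof -
 assume t: "0 <= t" "t <= 1/2"
 have "1 <= (1 - t) * (1 + 2 * t)" using mult_nonneg_nonneg[of t "1 - 2 * t"] t by (simp add: algebra_simps)
 also have "... <= (1 - t) * exp (2 * t)" using t exp_ge_add_one_self[of "2 * t"] by (intro mult_left_mono) auto
 finally have "exp (- (2 * t)) * 1 <= exp (- (2 * t)) * ((1 - t) * exp (2 * t))" by (intro mult_left_mono) auto
 also have "... = 1 - t" by (simp add: exp_minus)
 finally show ?thesis by simp
qed

context hilbert_group
begin

abbreviation SLO :: "'f quad monoid" where
 "SLO \<equiv> SL2 ring_of_integers"

lemma SLO_simps:
 "x \<otimes>\<^bsub>SLO\<^esub> y = mmul x y" "\<one>\<^bsub>SLO\<^esub> = (1, 0, 0, 1)"
 "(p, q, r, s) : carrier SLO \<longleftrightarrow> aint p & aint q & aint r & aint s & p * s - q * r = 1" by (auto simp: SL2_def)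

lemma int_0_1: "aint (0::'f)" "aint (1::'f)" "aint (- 1::'f)"
 using algebraic_int_of_int[OF nf, of 0] algebraic_int_of_int[OF nf, of 1] algebraic_int_of_int[OF nf, of "-1"] by simp_all

lemma int_minus: "aint (x::'f) ==> aint (- x)" using algebraic_int_diff[OF nf int_0_1(1)] by simp

lemma SLO_group: "group SLO"
proof (rule groupI)
 fix x y assume "x : carrier SLO" "y : carrier SLO"
 thus "x \<otimes>\<^bsub>SLO\<^esub> y : carrier SLO" using det2_mult[of x y] by (cases x; cases y)
   (simp add: SLO_simps quat_simps algebraic_int_add[OF nf] algebraic_int_mult[OF nf])
next
 show "\<one>\<^bsub>SLO\<^esub> : carrier SLO" by (simp add: SLO_simps int_0_1)
next
 fix x y z show "x \<otimes>\<^bsub>SLO\<^esub> y \<otimes>\<^bsub>SLO\<^esub> z = x \<otimes>\<^bsub>SLO\<^esub> (y \<otimes>\<^bsub>SLO\<^esub> z)"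
  by (simp only: SLO_simps mult_mat2_assoc)
next
 fix x show "\<one>\<^bsub>SLO\<^esub> \<otimes>\<^bsub>SLO\<^esub> x = x" by (simp only: SLO_simps mult_mat2_1)
next
 fix x assume x: "x : carrier SLO"
 have "inv2 x : carrier SLO" using x by (cases x) (simp add: SLO_simps int_minus mult.commute)
 moreover have "det2 x = 1" using x by (cases x) (simp add: SLO_simps)
 hence "inv2 x \<otimes>\<^bsub>SLO\<^esub> x = \<one>\<^bsub>SLO\<^esub>" by (simp only: SLO_simps mult_inv2)
 ultimately show "EX y:carrier SLO. y \<otimes>\<^bsub>SLO\<^esub> x = \<one>\<^bsub>SLO\<^esub>" by blast
qed

lemma pm1_normal: "plus_minus_one \<lhd> SLO"
proof -
 interpret group SLO by (rule SLO_group)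
 have c: "plus_minus_one <= carrier SLO" by (auto simp: SLO_simps int_0_1)
 have 1: "mmul (-1, 0, 0, -1) x = map_quad uminus x"
  "mmul x (-1, 0, 0, -1) = map_quad uminus x" for x :: "'f quad" by (cases x; simp add: quat_simps)+
 have inv1: "inv\<^bsub>SLO\<^esub> (- 1, 0, 0, - 1) = (- 1, 0, 0, - 1)" by (rule inv_equality) (simp_all add: SLO_simps quat_simps int_0_1)
 have "subgroup plus_minus_one SLO"
 proof (rule subgroupI)
  fix x y :: "'f quad" assume "x : plus_minus_one" "y : plus_minus_one"
  thus "x \<otimes>\<^bsub>SLO\<^esub> y : plus_minus_one" by (auto simp: SLO_simps quat_simps)
 next
  fix x :: "'f quad" assume "x : plus_minus_one"
  moreover have "inv\<^bsub>SLO\<^esub> (1, 0, 0, 1) = (1, 0, 0, 1)" using inv_one by (simp only: SLO_simps)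
  ultimately show "inv\<^bsub>SLO\<^esub> x : plus_minus_one" using inv1 by auto
 qed (use c in auto)
 moreover have "plus_minus_one #>\<^bsub>SLO\<^esub> x = x <#\<^bsub>SLO\<^esub> plus_minus_one" for x
  unfolding r_coset_def l_coset_def SLO_simps by (simp add: 1 mult_mat2_1)
 ultimately show ?thesis by (intro normalI ballI)
qed

lemma unip_SLO: "aint l ==> aint c ==> aint s ==> unip l c s : carrier SLO" unfolding unip_def SLO_simps
 by (auto intro!: algebraic_int_add[OF nf] algebraic_int_diff[OF nf] algebraic_int_mult[OF nf] algebraic_int_power[OF nf] int_0_1 int_minus
   simp: sq_simps)

lemma unip_mult: "mmul (unip l c s) (unip l' c s) = unip (l + l') c (s :: 'f)" by (simp add: unip_def quat_simps sq_simps)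

lemma unip_pow_coset:
 assumes "aint l" "aint c" "aint s"
 shows "(plus_minus_one #>\<^bsub>SLO\<^esub> unip l c s) [^]\<^bsub>PSL2_int\<^esub> n = plus_minus_one #>\<^bsub>SLO\<^esub> unip (of_nat n * l) c s"
proof (induction n)
 case 0
 have "plus_minus_one #>\<^bsub>SLO\<^esub> unip 0 c s = plus_minus_one" by (simp add: pm1_coset unip_def)
 thus ?case by (simp add: PSL2_int_def FactGroup_def)
next
 case (Suc n)
 have "aint (of_nat n * l)" by (intro algebraic_int_mult[OF nf] places.algebraic_int_of_nat assms)
 hence "(plus_minus_one #>\<^bsub>SLO\<^esub> unip (of_nat n * l) c s) <#>\<^bsub>SLO\<^esub> (plus_minus_one #>\<^bsub>SLO\<^esub> unip l c s)
  = plus_minus_one #>\<^bsub>SLO\<^esub> (unip (of_nat n * l) c s \<otimes>\<^bsub>SLO\<^esub> unip l c s)"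
  by (intro normal.rcos_sum[OF pm1_normal] unip_SLO assms)
 thus ?case using Suc by (simp add: PSL2_int_def FactGroup_def SLO_simps unip_mult distrib_right add.commute)
qed

text \<open>With N the index, N! serves all cusps at once: that power of \<open>unip v c s\<close>
  is again unipotent, with v multiplied by N!, and lies in the group up to sign.\<close>

lemma ex_unipotent:
 obtains n0 :: nat where "0 < n0"
  "!!v c s. aint v ==> aint c ==> aint s ==>
   EX x:Gamma1_quat a b U t. EX et. (et = 1 | et = - 1) & ph x = map_quad (%u. et * u) (unip (of_nat n0 * v) c s)"
proof -
 let ?H = "(%x. plus_minus_one #>\<^bsub>SLO\<^esub> ph x) ` Gamma1_quat a b U t"
 define n0 :: nat where "n0 = fact (card (rcosets\<^bsub>PSL2_int\<^esub> ?H))"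
 interpret P: group "PSL2_int :: 'f quad set monoid" unfolding PSL2_int_def by (rule normal.factorgroup_is_group[OF pm1_normal])
 have "EX x:Gamma1_quat a b U t. EX et. (et = 1 | et = - 1) & ph x = map_quad (%u. et * u) (unip (of_nat n0 * v) c s)"
  if i: "aint v" "aint c" "aint s" for v c s
 proof -
  have "plus_minus_one #>\<^bsub>SLO\<^esub> unip v c s : carrier PSL2_int"
   using unip_SLO[OF i] by (auto simp: PSL2_int_def FactGroup_def RCOSETS_def)
  from P.finite_index_pow[OF H_subgroup H_index this]
  have "plus_minus_one #>\<^bsub>SLO\<^esub> unip (of_nat n0 * v) c s : ?H" unfolding n0_def unip_pow_coset[OF i] .
  then obtain x where x: "x : Gamma1_quat a b U t"
    "plus_minus_one #>\<^bsub>SLO\<^esub> unip (of_nat n0 * v) c s = plus_minus_one #>\<^bsub>SLO\<^esub> ph x" by blast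
  hence "ph x : {unip (of_nat n0 * v) c s, map_quad uminus (unip (of_nat n0 * v) c s)}" unfolding pm1_coset by blast
  moreover have "map_quad (%u. 1 * u) y = y" "map_quad (%u. - 1 * u) y = map_quad uminus y" for y :: "'f quad" by (cases y; simp)+
  ultimately show ?thesis using x(1) by (metis (no_types, lifting) insertE singletonD)
 qed
 moreover have "0 < n0" by (simp add: n0_def)
 ultimately show thesis using that by blast
qed

section \<open>Periodicity and decay towards a cusp\<close>

definition cusp_mat :: "'f => 'f => 'f quad" where
 "cusp_mat c s = (if c = 0 then (1 / s, 0, c, s) else (0, - 1 / c, c, s))"

text \<open>The lower row (c, s) means that the cusp -s/c is sent to infinity.\<close>

lemma cusp_mat:
 assumes "c ~= 0 | s ~= 0"
 obtains al be where "cusp_mat c s = (al, be, c, s)" "al * s - be * c = 1" using assms that unfolding cusp_mat_def by (cases "c = 0") auto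

lemma conjugate_translation:
 fixes v :: "'b::comm_ring_1"
 assumes "al * s - be * c = 1"
 shows "mmul (inv2 (al, be, c, s)) (1, v, 0, 1)
  = mmul (unip v c s) (inv2 (al, be, c, s))"
proof -
 have "al * s = 1 + be * c" using assms by (simp add: algebra_simps)
 hence "v * s * (al * s) = v * s * (1 + be * c)" "v * c * (al * s) = v * c * (1 + be * c)" by simp_all
 thus ?thesis by (simp add: unip_def quat_simps sq_simps)
qed

text \<open>The inverse of \<open>cusp_mat\<close> carries infinity to the cusp and conjugates the
  translation by v into the unipotent. The sign \<open>et\<close> disappears because the weights are
  even.\<close>

lemma slash_translation:
 fixes de :: "'r => real quad"
 assumes f: "f : cusp_forms Ga C k" and even: "!!j. even (k j)" and cs: "c ~= 0 | s ~= 0"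
  and x: "x : Gamma1_quat a b U t" "et = 1 | et = - 1" "ph x = map_quad (%u. et * u) (unip v c s)"
  and w: "w : upper_half" and de: "de = (%j. map_quad (si j) (inv2 (cusp_mat c s)))"
 shows "slash k f de (\<chi> j. w $ j + of_real (si j v)) = slash k f de w"
proof -
 obtain al be where ab: "cusp_mat c s = (al, be, c, s)" "al * s - be * c = 1" using cusp_mat[OF cs] by blast
 define g where "g = (%j. (si j al, si j be, si j c, si j s))"
 define T where "T = (%j. (1::real, si j v, 0::real, 1::real))"
 define u where "u = (%j. unip (si j v) (si j c) (si j s))"
 let ?w = "\<chi> j. w $ j + of_real (si j v)"
 have y: "0 < Im (w $ j)" for j using w by (simp add: upper_half_def)
 have deg: "de j = inv2 (g j)" for j by (simp add: de ab g_def sh_minus)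
 have gd: "si j al * si j s - si j be * si j c = 1" for j
 proof -
  have "si j (al * s - be * c) = 1" by (simp add: ab(2) sh_1)
  thus ?thesis by (simp only: sh_diff sh_mult)
 qed
 have ded: "det2 (de j) = 1" for j by (simp add: deg det2_inv2) (simp add: g_def gd)
 have Td: "det2 (T j) = 1" for j by (simp add: T_def)
 have conj: "mmul (de j) (T j) = mmul (u j) (de j)" for j unfolding deg g_def T_def u_def by (rule conjugate_translation[OF gd])
 have ga: "emb x : Ga" using x(1) by (simp add: Ga_emb)
 have et: "si j et = 1 | si j et = - 1" for j using x(2) hom_1[OF si_hom, of j] hom_minus[OF si_hom, of j 1] by auto
 have emb: "emb x j = map_quad (%t. si j et * t) (u j)" for j unfolding emb_ph x(3) u_def map_quad_unip[OF si_hom, symmetric]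
  by (cases "unip v c s") (simp add: sh_mult)
 have ud: "det2 (u j) = 1" for j by (simp add: u_def unip_def sq_simps)
 have af: "autfac (emb x j) z ^ k j = autfac (u j) z ^ k j" for j z
 proof -
  have "autfac (emb x j) z = of_real (si j et) * autfac (u j) z" unfolding emb by (cases "u j") (simp add: algebra_simps)
  thus ?thesis using et[of j] even[of j] by (auto simp: power_mult_distrib power_minus_even)
 qed
 have mo: "moebius (emb x j) z = moebius (u j) z" for j z
 proof (cases "si j et = 1")
  case True
  thus ?thesis unfolding emb by (cases "u j") simp
 next
  case False
  hence m: "si j et = - 1" using et by blast
  obtain p q r s' where u': "u j = (p, q, r, s')" by (cases "u j")
  have "moebius (emb x j) z = (- (of_real p * z + of_real q)) / (- (of_real r * z + of_real s'))" unfolding emb m u' by (simp add: algebra_simps)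
  thus ?thesis by (simp only: u' moebius.simps divide_minus_left divide_minus_right minus_minus)
 qed
 let ?u = "act de w"
 have uH: "?u : upper_half" by (rule act_upper_half[OF ded w])
 have Tw: "moebius (T j) (w $ j) = w $ j + of_real (si j v)" for j by (simp add: T_def)
 have m1: "moebius (de j) (w $ j + of_real (si j v)) = moebius (u j) (moebius (de j) (w $ j))" for j
  unfolding Tw[symmetric] moebius_mult[OF Td y, symmetric] moebius_mult[OF ded y, symmetric] conj ..
 have a1: "autfac (de j) (w $ j + of_real (si j v)) = autfac (u j) (moebius (de j) (w $ j)) * autfac (de j) (w $ j)" for j
 proof -
  have "autfac (de j) (moebius (T j) (w $ j)) * autfac (T j) (w $ j) = autfac (u j) (moebius (de j) (w $ j)) * autfac (de j) (w $ j)"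
   unfolding autfac_mult[OF Td y, symmetric] autfac_mult[OF ded y, symmetric] conj ..
  moreover have "autfac (T j) (w $ j) = 1" by (simp add: T_def)
  ultimately show ?thesis by (simp add: Tw)
 qed
 have "act de ?w = act (emb x) ?u" by (simp add: act_def vec_eq_iff m1 mo)
 hence e1: "f (act de ?w) = (\<Prod>j\<in>UNIV. autfac (u j) (?u $ j) ^ k j) * f ?u" using f ga uH by (simp add: cusp_forms_def af)
 have e2: "(\<Prod>j\<in>UNIV. autfac (de j) (?w $ j) ^ k j)
   = (\<Prod>j\<in>UNIV. autfac (u j) (?u $ j) ^ k j) * (\<Prod>j\<in>UNIV. autfac (de j) (w $ j) ^ k j)"
  by (simp add: a1 act_def power_mult_distrib prod.distrib)
 have "(\<Prod>j\<in>UNIV. autfac (u j) (?u $ j) ^ k j) ~= 0" using autfac_nonzero[OF ud] uH by (simp add: upper_half_def)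
 thus ?thesis unfolding slash_def e1 e2 by (rule mult_divide_mult_cancel_left)
qed

text \<open>With the cusp moved to infinity, f has period 1 along the line in direction v and
  vanishes high up, as v is totally positive. Going down by m gains the square of exp(- 2 pi m),
  while the smallness of v keeps the loss in the weight below e and each local height within a
  factor 2.\<close>

lemma descent:
 assumes f: "f : cusp_forms Ga (hilbert_cusps si) k" and even: "!!j. even (k j)" and k: "!!j. 0 < k j"
  and cs: "c ~= 0 | s ~= 0" and z: "z : upper_half" and m: "1 <= m"
  and x: "x : Gamma1_quat a b U t" "et = 1 | et = - 1" "ph x = map_quad (%u. et * u) (unip v c s)"
  and v: "!!j. 0 < si j v" "!!j. 2 * real CARD('r) * m * real (k j) * si j v <= Im (z $ j) / (dfac c s z j)^2"
 shows "\<exists>z'\<in>upper_half. pet k f z <= exp (- m) * pet k f z' & height c s z' <= height c s z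
  & height c s z <= 2 ^ CARD('r) * height c s z'"
proof -
 obtain al be where ab: "cusp_mat c s = (al, be, c, s)" "al * s - be * c = 1" using cusp_mat[OF cs] by blast
 define g where "g = (%j. (si j al, si j be, si j c, si j s))"
 define de where "de = (%j. map_quad (si j) (inv2 (cusp_mat c s)))"
 have gd: "det2 (g j) = 1" for j
 proof -
  have "si j (al * s - be * c) = 1" by (simp add: ab(2) sh_1)
  thus ?thesis by (simp add: g_def sh_diff sh_mult)
 qed
 have deg: "de = fam_inv g" by (simp add: de_def fam_inv_def ab g_def sh_minus fun_eq_iff)
 have ded: "det2 (de j) = 1" for j by (simp add: deg fam_inv_def det2_inv2 gd)
 have deC: "de : hilbert_cusps si"
  using ab by (auto simp: hilbert_cusps_def de_def SL2_def mult.commute intro!: image_eqI[of _ _ "inv2 (cusp_mat c s)"])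
 define h where "h = slash k f de"
 define w0 where "w0 = act g z"
 define vv where "vv = ((\<chi> j. of_real (si j v)) :: complex^'r)"
 define Y where "Y = (%j. Im (w0 $ j))"
 define q where "q = (%ze. h (w0 + ze *s vv))"
 have w0: "w0 : upper_half" unfolding w0_def by (rule act_upper_half[OF gd z])
 have Y: "0 < Y j" for j using w0 by (simp add: Y_def upper_half_def)
 have afg: "cmod (autfac (g j) (w $ j)) = dfac c s w j" for w j by (simp add: g_def dfac_def)
 have hgt: "height c s w = (\<Prod>j\<in>UNIV. Im (act g w $ j))" if "w : upper_half" for w
  using that by (simp add: height_def act_def Im_moebius[OF gd] afg upper_half_def)
 have Yz: "Y j = Im (z $ j) / (dfac c s z j)^2" for j using z by (simp add: Y_def w0_def act_def Im_moebius[OF gd] afg upper_half_def)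
 have mv: "m * si j v * (2 * real (k j) * real CARD('r)) <= Y j" for j using v(2)[of j] unfolding Yz by (simp add: mult_ac)
 have mv2: "m * si j v * 2 <= Y j" for j
 proof -
  have "m * si j v * 2 * 1 <= m * si j v * 2 * (real (k j) * real CARD('r))"
   using k[of j] m v(1)[of j] mult_mono[of 1 "real (k j)" 1 "real CARD('r)"] by (intro mult_left_mono) (auto simp: Suc_le_eq)
  thus ?thesis using mv[of j] by (simp add: mult_ac)
 qed
 have Imw: "Im ((w0 + ze *s vv) $ j) = Y j + Im ze * si j v" for ze j by (simp add: Y_def vv_def)
 have inH: "w0 + ze *s vv : upper_half" if "- (2 * m) < Im ze" for ze
 proof -
  have "0 < Y j + Im ze * si j v" for j
  proof -
   have "- (2 * m) * si j v < Im ze * si j v" using that v(1)[of j] by (rule mult_strict_right_mono)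
   thus ?thesis using mv2[of j] by (simp add: mult_ac)
  qed
  thus ?thesis unfolding upper_half_def mem_Collect_eq Imw by blast
 qed
 have hh: "holomorphic_vec h upper_half" unfolding h_def using f by (intro holomorphic_vec_slash ded) (simp add: cusp_forms_def)
 \<comment> \<open>The strip reaches down to - 2 m, which leaves room below - m; by
   \<open>mv2\<close> the line is still in the domain there.\<close>
 have "EX ze. Im ze = - m & cmod (q 0) <= exp (- (2 * pi * m)) * cmod (q ze)"
 proof (rule periodic_schwarz[of q "2 * m"])
  have "open {ze. - (2 * m) < Im ze}" by (intro open_Collect_less continuous_intros)
  thus "q holomorphic_on {ze. - (2 * m) < Im ze}" unfolding q_def by (intro holomorphic_vec_line[OF hh]) (auto intro: inH)
  show "q (ze + 1) = q ze" if "- (2 * m) < Im ze" for ze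
  proof -
   have "w0 + (ze + 1) *s vv = (\<chi> j. (w0 + ze *s vv) $ j + of_real (si j v))" by (simp add: vec_eq_iff vv_def algebra_simps)
   thus ?thesis unfolding q_def h_def using slash_translation[OF f even cs x inH[OF that] de_def] by simp
  qed
  show "EX Z. ALL ze. Z < Im ze --> cmod (q ze) < ep" if ep: "0 < ep" for ep
  proof -
   have "vanishes_at_infinity h" using f deC by (simp add: cusp_forms_def h_def)
   then obtain Z where Z: "ALL w:upper_half. (ALL j. Z < Im (w $ j)) --> cmod (h w) < ep" unfolding vanishes_at_infinity_def using ep by meson
   show ?thesis
   proof (intro exI[of _ "\<Sum>j\<in>UNIV. \<bar>Z\<bar> / si j v"] allI impI)
    fix ze assume ze: "(\<Sum>j\<in>UNIV. \<bar>Z\<bar> / si j v) < Im ze"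
    have nn: "0 <= \<bar>Z\<bar> / si j v" for j using v(1)[of j] by simp
    have "0 <= (\<Sum>j\<in>UNIV. \<bar>Z\<bar> / si j v)" by (intro sum_nonneg nn)
    hence "w0 + ze *s vv : upper_half" using ze m by (intro inH) linarith
    moreover have "Z < Im ((w0 + ze *s vv) $ j)" for j
    proof -
     have "\<bar>Z\<bar> / si j v <= (\<Sum>j\<in>UNIV. \<bar>Z\<bar> / si j v)" using nn by (intro member_le_sum) auto
     hence "\<bar>Z\<bar> / si j v < Im ze" using ze by linarith
     hence "\<bar>Z\<bar> < Im ze * si j v" using v(1)[of j] by (simp add: pos_divide_less_eq)
     thus ?thesis unfolding Imw using Y[of j] by linarith
    qed
    ultimately show "cmod (q ze) < ep" using Z by (simp add: q_def)
   qed
  qed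
 qed (use m in auto)
 then obtain ze where ze: "Im ze = - m" "cmod (q 0) <= exp (- (2 * pi * m)) * cmod (q ze)" by blast
 define w where "w = w0 + ze *s vv"
 define z' where "z' = act de w"
 have wH: "w : upper_half" unfolding w_def using ze(1) m by (intro inH) simp
 have z'H: "z' : upper_half" unfolding z'_def by (rule act_upper_half[OF ded wH])
 have dew0: "act de w0 = z" unfolding deg w0_def by (rule act_inv[OF gd z])
 have gz': "act g z' = w" using act_inv[of de w, OF ded wH] unfolding z'_def deg fam_inv_fam_inv .
 have Yw: "Im (w $ j) = Y j - m * si j v" for j unfolding w_def Imw ze(1) by simp
 have w1: "Im (w $ j) <= Y j" "Y j <= 2 * Im (w $ j)" for j unfolding Yw using mv2[of j] m v(1)[of j] by simp_all
 have "Y j ^ k j <= exp (1 / real CARD('r)) * Im (w $ j) ^ k j" for j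
 proof -
  \<comment> \<open>The relative loss of height at j. Its k j-th power costs at most exp(1 / r), so
    the r places together cost at most e.\<close>
  define ta where "ta = m * si j v / Y j"
  have t0: "0 <= ta" "ta <= 1/2" using mv2[of j] Y[of j] m v(1)[of j] by (simp_all add: ta_def field_simps)
  have tk: "2 * ta * real (k j) <= 1 / real CARD('r)" using mv[of j] Y[of j] by (simp add: ta_def field_simps)
  have "Im (w $ j) = Y j * (1 - ta)" using Y[of j] by (simp add: Yw ta_def field_simps)
  moreover have "Y j * exp (- (2 * ta)) <= Y j * (1 - ta)" using one_minus_ge_exp[OF t0] Y[of j] by (intro mult_left_mono) auto
  ultimately have "(Y j * exp (- (2 * ta))) ^ k j <= Im (w $ j) ^ k j" using Y[of j] by (intro power_mono) auto
  moreover have "(Y j * exp (- (2 * ta))) ^ k j * exp (2 * ta * real (k j)) = Y j ^ k j"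
  proof -
   have "exp (- (2 * ta)) ^ k j * exp (2 * ta * real (k j)) = exp (real (k j) * (- (2 * ta)) + 2 * ta * real (k j))"
    by (simp only: exp_add exp_of_nat_mult)
   also have "... = 1" by simp
   finally show ?thesis by (simp add: power_mult_distrib)
  qed
  ultimately have "Y j ^ k j <= Im (w $ j) ^ k j * exp (2 * ta * real (k j))" by (metis exp_ge_zero mult_right_mono)
  also have "... <= Im (w $ j) ^ k j * exp (1 / real CARD('r))" using tk wH by (intro mult_left_mono) (auto simp: upper_half_def less_imp_le)
  finally show ?thesis by (simp add: mult.commute)
 qed
 hence "(\<Prod>j\<in>UNIV. Y j ^ k j) <= (\<Prod>j\<in>UNIV. exp (1 / real CARD('r)) * Im (w $ j) ^ k j)"
  using Y by (intro prod_mono) (auto simp: less_imp_le)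
 also have "... = exp 1 * (\<Prod>j\<in>UNIV. Im (w $ j) ^ k j)" by (simp add: prod.distrib exp_of_nat_mult[symmetric])
 finally have Yk: "(\<Prod>j\<in>UNIV. Y j ^ k j) <= exp 1 * (\<Prod>j\<in>UNIV. Im (w $ j) ^ k j)" .
 have "pet k f z = pet k h w0" unfolding h_def using pet_slash[of de w0 k f, OF ded w0] dew0 by simp
 also have "... = (\<Prod>j\<in>UNIV. Y j ^ k j) * (cmod (q 0))^2" by (simp add: pet_def Y_def q_def)
 also have "... <= (exp 1 * (\<Prod>j\<in>UNIV. Im (w $ j) ^ k j)) * (exp (- (2 * pi * m)) * cmod (q ze))^2"
  using Yk ze(2) wH by (intro mult_mono power_mono) (auto simp: upper_half_def less_imp_le intro!: mult_nonneg_nonneg prod_nonneg)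
 also have "... = exp (1 - 4 * pi * m) * ((\<Prod>j\<in>UNIV. Im (w $ j) ^ k j) * (cmod (q ze))^2)"
  by (simp add: power_mult_distrib exp_double[symmetric] exp_diff exp_minus field_simps)
 also have "(\<Prod>j\<in>UNIV. Im (w $ j) ^ k j) * (cmod (q ze))^2 = pet k h w" by (simp add: pet_def q_def w_def)
 also have "... = pet k f z'" unfolding h_def z'_def by (rule pet_slash[OF ded wH])
 also have "exp (1 - 4 * pi * m) * pet k f z' <= exp (- m) * pet k f z'"
 proof (rule mult_right_mono)
  have "8 * m <= 4 * pi * m" using pi_ge_two m by (intro mult_right_mono) auto
  hence "1 - 4 * pi * m <= - m" using m by linarith
  thus "exp (1 - 4 * pi * m) <= exp (- m)" by (simp only: exp_le_cancel_iff)
 qed (rule pet_nonneg[OF z'H])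
 finally have "pet k f z <= exp (- m) * pet k f z'" .
 moreover have "height c s z' <= height c s z" unfolding hgt[OF z] hgt[OF z'H] gz' w0_def[symmetric]
  using w1 wH by (intro prod_mono) (auto simp: Y_def upper_half_def less_imp_le)
 moreover have "height c s z <= 2 ^ CARD('r) * height c s z'"
  unfolding hgt[OF z] hgt[OF z'H] gz' w0_def[symmetric] prod_constant[symmetric] prod.distrib[symmetric]
  using w1 Y by (intro prod_mono) (auto simp: Y_def less_imp_le)
 ultimately show ?thesis using z'H by blast
qed

end

section \<open>Bounds near the cusps and the exponent 3/2\<close>

lemma power_le_fact_exp: "0 <= (x::real) ==> x ^ n <= fact n * exp x"
proof -
 assume x: "0 <= x"
 have "sum (%i. x ^ i /\<^sub>R fact i) {n} <= (\<Sum>i. x ^ i /\<^sub>R fact i)" using x by (intro sum_le_suminf summable_exp_generic) auto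
 hence "inverse (fact n) * x ^ n <= exp x" by (simp add: exp_def)
 hence "fact n * (inverse (fact n) * x ^ n) <= fact n * exp x" by (intro mult_left_mono) auto
 moreover have "fact n * (inverse (fact n) * x ^ n) = x ^ n" by (simp add: mult.assoc[symmetric])
 ultimately show ?thesis by (simp only:)
qed

context hilbert_group
begin

text \<open>A good pair for the same cusp is a multiple by \<open>ka\<close>, and goodness of (c, s)
  bounds the norm of \<open>ka\<close> from below. For different cusps \<open>dfac_cross\<close>
  bounds the product of the two heights by 1. The sum covers both cases.\<close>

lemma height_other:
 assumes M: "0 < M" and g: "places.good_pair M c s" "places.good_pair M c' s'" and w: "w : upper_half"
 shows "height c' s' w <= real M ^ CARD('r) * height c s w + 1 / height c s w"
proof -
 have cs: "c ~= 0 | s ~= 0" "c' ~= 0 | s' ~= 0" and int: "aint c" "aint s" "aint c'" "aint s'" using g by (auto simp: places.good_pair_def)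
 have H: "0 < height c s w" "0 < height c' s' w" using height_pos[OF w] cs by auto
 show ?thesis
 proof (cases "c * s' = s * c'")
  case True
  obtain ka where ka: "c' = ka * c" "s' = ka * s"
  proof (cases "c = 0")
   case c: True
   hence "s ~= 0" "c' = 0" using cs True by auto
   thus ?thesis using that[of "s' / s"] c by simp
  next
   case False
   thus ?thesis using that[of "c' / c"] True by (simp add: field_simps)
  qed
  hence ka0: "ka ~= 0" using cs by auto
  have "aint (ka^2 * c^2)" "aint (ka^2 * (c * s))" "aint (ka^2 * s^2)"
  proof -
   have "ka^2 * c^2 = c'^2" "ka^2 * (c * s) = c' * s'" "ka^2 * s^2 = s'^2" by (simp_all add: ka power2_eq_square)
   thus "aint (ka^2 * c^2)" "aint (ka^2 * (c * s))" "aint (ka^2 * s^2)"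
    using int by (simp_all add: algebraic_int_power[OF nf] algebraic_int_mult[OF nf])
  qed
  hence "aint (of_nat M * ka^2)" using g(1) unfolding places.good_pair_def by blast
  hence "1 <= places.anorm (of_nat M * ka^2)" using M ka0 by (intro places.anorm_ge_1) auto
  hence A: "1 <= real M ^ CARD('r) * (places.anorm ka)^2" by (simp add: places.anorm_mult places.anorm_of_nat power2_eq_square)
  have "dfac c' s' w j = \<bar>si j ka\<bar> * dfac c s w j" for j
  proof -
   have "of_real (si j c') * w $ j + of_real (si j s') = of_real (si j ka) * (of_real (si j c) * w $ j + of_real (si j s))"
    unfolding ka by (simp add: sh_mult algebra_simps)
   thus ?thesis by (simp add: dfac_def norm_mult)
  qed
  hence "height c' s' w = (\<Prod>j\<in>UNIV. (Im (w $ j) / (dfac c s w j)^2) / (\<bar>si j ka\<bar>^2))"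
   unfolding height_def by (simp add: power_mult_distrib mult.commute)
  also have "... = height c s w / (places.anorm ka)^2" unfolding height_def places.anorm_def prod_power_distrib by (rule prod_dividef)
  finally have e: "height c' s' w * (places.anorm ka)^2 = height c s w" using places.anorm_pos[OF ka0] by simp
  have "height c' s' w * 1 <= height c' s' w * (real M ^ CARD('r) * (places.anorm ka)^2)" using A H by (intro mult_left_mono) auto
  also have "... = real M ^ CARD('r) * height c s w" by (simp add: e[symmetric])
  finally have "height c' s' w <= real M ^ CARD('r) * height c s w" by simp
  moreover have "0 <= 1 / height c s w" using H by simp
  ultimately show ?thesis by linarith
 next
  case False
  define P where "P = (\<Prod>j\<in>UNIV. Im (w $ j))"
  define D where "D = (\<Prod>j\<in>UNIV. dfac c s w j * dfac c' s' w j)"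
  have y: "0 < Im (w $ j)" for j using w by (simp add: upper_half_def)
  have P: "0 < P" unfolding P_def using y by (intro prod_pos) auto
  have "aint (c * s' - s * c')" by (intro algebraic_int_diff[OF nf] algebraic_int_mult[OF nf] int)
  hence "1 <= places.anorm (c * s' - s * c')" using False by (intro places.anorm_ge_1) auto
  hence "1 * P <= places.anorm (c * s' - s * c') * P" using P by (intro mult_right_mono) auto
  also have "... = (\<Prod>j\<in>UNIV. \<bar>si j (c * s' - s * c')\<bar> * Im (w $ j))" by (simp add: places.anorm_def P_def prod.distrib)
  also have "... <= D" unfolding D_def using dfac_cross[OF w] y by (intro prod_mono) (auto simp: less_imp_le)
  finally have "P^2 <= D^2" using P by (intro power_mono) auto
  moreover have "height c s w * height c' s' w = P^2 / D^2" unfolding height_def P_def D_def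
   by (simp add: prod.distrib[symmetric] prod_dividef[symmetric] prod_power_distrib power_mult_distrib power2_eq_square mult_ac)
  moreover have "0 < D" unfolding D_def using dfac_pos[OF w] cs by (intro prod_pos) auto
  ultimately have "height c s w * height c' s' w <= 1" by (simp add: divide_le_eq_1)
  hence "height c' s' w <= 1 / height c s w" using H by (simp add: pos_le_divide_eq mult.commute)
  moreover have "0 <= real M ^ CARD('r) * height c s w" using H by simp
  ultimately show ?thesis by linarith
 qed
qed

text \<open>The 6 is 3/2 times 4: Im w is below 3/2 Im z, and \<open>dfac\<close> at z is at most
  twice its value at w.\<close>

lemma height_near:
 assumes w: "w : polydisc r z" and z: "z : upper_half" and r: "!!j. r j <= 1/2" and cs: "c ~= 0 | s ~= 0"
 shows "height c s w <= 6 ^ CARD('r) * height c s z" unfolding height_def prod_constant[symmetric] prod.distrib[symmetric]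
proof (intro prod_mono conjI)
 fix j
 have wH: "w : upper_half" using polydisc_subset[of z r, OF z r] w by blast
 have y: "0 < Im (w $ j)" "0 < Im (z $ j)" using z wH by (simp_all add: upper_half_def)
 let ?A = "of_real (si j c) * w $ j + of_real (si j s)" and ?B = "of_real (si j c) * z $ j + of_real (si j s)"
 have "cmod (w $ j - z $ j) < r j * Im (z $ j)" using w by (simp add: polydisc_def)
 also have "... <= 1/2 * Im (z $ j)" using r[of j] y by (intro mult_right_mono) auto
 also have "... <= Im (w $ j)" using polydisc_Im(1)[OF w z r[of j]] by simp
 finally have d: "cmod (w $ j - z $ j) <= Im (w $ j)" by simp
 have "?B = ?A - of_real (si j c) * (w $ j - z $ j)" by (simp add: algebra_simps)
 hence "cmod ?B <= cmod ?A + \<bar>si j c\<bar> * cmod (w $ j - z $ j)" by (metis norm_mult norm_of_real norm_triangle_ineq4)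
 also have "... <= cmod ?A + \<bar>si j c\<bar> * Im (w $ j)" using d by (intro add_left_mono mult_left_mono) auto
 also have "\<bar>si j c\<bar> * Im (w $ j) = \<bar>Im ?A\<bar>" using y by (simp add: abs_mult)
 also have "cmod ?A + \<bar>Im ?A\<bar> <= 2 * cmod ?A" using abs_Im_le_cmod[of ?A] by linarith
 finally have D: "dfac c s z j <= 2 * dfac c s w j" by (simp add: dfac_def)
 have Dp: "0 < dfac c s z j" "0 < dfac c s w j" using dfac_pos[OF z cs] dfac_pos[OF wH cs] by auto
 have "(dfac c s z j)^2 <= 4 * (dfac c s w j)^2" using power_mono[OF D, of 2] Dp by (simp add: power_mult_distrib)
 hence "Im (w $ j) * (dfac c s z j)^2 <= (3/2 * Im (z $ j)) * (4 * (dfac c s w j)^2)" using polydisc_Im(2)[OF w z r[of j]] y by (intro mult_mono) auto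
 thus "Im (w $ j) / (dfac c s w j)^2 <= 6 * (Im (z $ j) / (dfac c s z j)^2)" using Dp by (simp add: divide_le_eq le_divide_eq mult_ac)
 show "0 <= Im (w $ j) / (dfac c s w j)^2" using y by simp
qed

lemma pet_le_height:
 assumes f: "f : cusp_forms Ga C k" and k: "!!j. 0 < k j" and z: "z : upper_half" and Hm: "0 <= Hm"
  and M: "0 < M" "!!c s. c ~= 0 | s ~= 0 ==> EX ka. ka ~= 0 & places.good_pair M (ka * c) (ka * s)"
  and h: "!!c s. places.good_pair M c s ==> height c s z <= Hm"
 shows "ennreal (pet k f z) <= ennreal (2 * 8192 ^ CARD('r) * kprod k * (1 + (3 * real M) ^ CARD('r) * Hm / (\<Prod>j\<in>UNIV. sqrt (real (k j)))))
  * pnorm k f"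
proof -
 \<comment> \<open>Makes \<open>ep j\<close>, the displacement tested in \<open>pet_le\<close>, at
   most 1/4, as the common cusp argument requires.\<close>
 let ?rh = "1/16 :: real"
 define ep where "ep = (%j. 4 * ?rh / sqrt (real (k j)))"
 define S where "S = (\<Prod>j\<in>UNIV. sqrt (real (k j)))"
 define N where "N = 2 * 4 ^ CARD('r) * (1 + (3 * real M) ^ CARD('r) * Hm / S)"
 have k1: "1 <= sqrt (real (k j))" for j using k[of j] by (simp add: Suc_le_eq)
 have S: "0 < S" unfolding S_def using k by (intro prod_pos) auto
 have N0: "0 <= N" unfolding N_def using Hm S by (intro mult_nonneg_nonneg add_nonneg_nonneg divide_nonneg_nonneg) auto
 have ep: "0 < ep j" "ep j <= 1/4" for j
 proof -
  show "0 < ep j" using k[of j] by (simp add: ep_def)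
  have "4 * ?rh / sqrt (real (k j)) <= 4 * ?rh / 1" using k1[of j] by (intro divide_left_mono) auto
  thus "ep j <= 1/4" by (simp add: ep_def)
 qed
 have Pep: "(\<Prod>j\<in>UNIV. ep j) = (1/4) ^ CARD('r) / S" 
 proof -
  have "ep j = (1/4) / sqrt (real (k j))" for j by (simp add: ep_def)
  thus ?thesis by (simp only: S_def prod_dividef prod_constant power_divide)
 qed
 have "ennreal (pet k f z) <= ennreal ((8 / ?rh^2) ^ CARD('r) * kprod k * N) * pnorm k f"
 proof (rule pet_le[OF f k z])
  fix w assume w: "w : polydisc (%j. ?rh / sqrt (real (k j))) z"
  have r: "?rh / sqrt (real (k j)) <= 1/2" for j using ep(2)[of j] by (simp add: ep_def)
  have wH: "w : upper_half" using polydisc_subset[of z "%j. ?rh / sqrt (real (k j))", OF z r] w by blast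
  obtain c s where c: "places.good_pair M c s" "finite (near_stabilizer ep w)"
   "real (card (near_stabilizer ep w)) <= 2 * 4 ^ CARD('r) * (1 + (2 * real M) ^ CARD('r) * (\<Prod>j\<in>UNIV. ep j) * height c s w)"
   using near_stabilizer_count[of M w ep, OF M wH ep] by blast
  have cs: "c ~= 0 | s ~= 0" using c(1) by (simp add: places.good_pair_def)
  have "height c s w <= 6 ^ CARD('r) * height c s z" by (rule height_near[OF w z r cs])
  also have "... <= 6 ^ CARD('r) * Hm" using h[OF c(1)] by (intro mult_left_mono) auto
  finally have "(2 * real M) ^ CARD('r) * (\<Prod>j\<in>UNIV. ep j) * height c s w <= (2 * real M) ^ CARD('r) * (\<Prod>j\<in>UNIV. ep j) * (6 ^ CARD('r) * Hm)"
   unfolding Pep using S by (intro mult_left_mono) auto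
  also have "... = ((2 * real M) * (1/4) * 6) ^ CARD('r) * Hm / S" unfolding Pep by (simp only: power_mult_distrib) simp
  also have "(2 * real M) * (1/4) * 6 = 3 * real M" by simp
  finally have "2 * 4 ^ CARD('r) * (1 + (2 * real M) ^ CARD('r) * (\<Prod>j\<in>UNIV. ep j) * height c s w) <= N"
   unfolding N_def by (intro mult_left_mono add_left_mono) auto
  thus "finite (near_stabilizer (%j. 4 * ?rh / sqrt (real (k j))) w) & real (card (near_stabilizer (%j. 4 * ?rh / sqrt (real (k j))) w)) <= N"
   using c(2,3) unfolding ep_def by linarith
 qed (use N0 in auto)
 moreover have "(8 / ?rh^2) ^ CARD('r) * kprod k * N = 2 * 8192 ^ CARD('r) * kprod k * (1 + (3 * real M) ^ CARD('r) * Hm / S)"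
 proof -
  \<comment> \<open>8 / (1/16)^2 = 2048, and the other 4 comes from
    \<open>near_stabilizer_count\<close>.\<close>
  have e: "(8 / ?rh^2) ^ CARD('r) * 4 ^ CARD('r) = (8192 :: real) ^ CARD('r)" unfolding power_mult_distrib[symmetric] by (simp add: power2_eq_square)
  show ?thesis unfolding N_def e[symmetric] by (simp only: mult_ac)
 qed
 ultimately show ?thesis unfolding S_def by simp
qed

theorem pet_bound:
 shows "\<exists>C\<ge>0. ALL k. (ALL j. even (k j) & 0 < k j) --> (ALL f:cusp_forms Ga (hilbert_cusps si) k. ALL z:upper_half.
  ennreal (pet k f z) <= ennreal (C * (\<Prod>j\<in>UNIV. real (k j) * sqrt (real (k j)))) * pnorm k f)"
proof -
 let ?d = "CARD('r)"
 obtain M :: nat where M: "0 < M" "!!c s. c ~= 0 | s ~= 0 ==> EX ka. ka ~= 0 & places.good_pair M (ka * c) (ka * s)"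
  by (rule places.ex_good_pair) blast
 obtain C0 where C0: "0 < C0" "!!h. (!!j. 0 < h j) ==> C0 <= (\<Prod>j\<in>UNIV. h j) ==> EX u. aint u & u ~= 0 & (ALL j. \<bar>si j u\<bar> <= h j)"
  by (rule places.ex_small_integer) blast
 obtain n0 :: nat where n0: "0 < n0" "!!v c s. aint v ==> aint c ==> aint s ==>
   EX x:Gamma1_quat a b U t. EX et. (et = 1 | et = - 1) & ph x = map_quad (%u. et * u) (unip (of_nat n0 * v) c s)" by (rule ex_unipotent) blast
 define q where "q = 2 * real ?d * real n0"
 \<comment> \<open>The quotient of height by P above which a translation short enough for
   \<open>descent\<close> exists: \<open>C0\<close> is what \<open>ex_small_integer\<close> demands,
   and q collects the constants of \<open>descent\<close> together with \<open>n0\<close>.\<close>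
 define C1 where "C1 = q ^ ?d * C0^2"
 define B where "B = exp 1 * (fact ?d :: real)"
 define L where "L = (2::real) * 8192 ^ ?d"
 define W where "W = (3 * real M) ^ ?d"
 define CA where "CA = L * (1 + W * C1)"
 define CB where "CB = L * (1 + W * (2 ^ ?d / C1 + real M ^ ?d * (C1 * B)))"
 have q: "0 < q" using n0(1) by (simp add: q_def)
 have C1: "0 < C1" using C0(1) q by (simp add: C1_def)
 have B: "0 < B" and L: "0 < L" and W: "0 < W" using M(1) by (simp_all add: B_def L_def W_def)
 have CAB: "0 <= CA" "0 <= CB" unfolding CA_def CB_def using C1 B L W M(1) by (auto intro!: mult_nonneg_nonneg add_nonneg_nonneg divide_nonneg_nonneg)
 show ?thesis
 proof (intro exI[of _ "CA + CB"] conjI allI impI ballI)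
  show "0 <= CA + CB" using CAB by simp
  fix k :: "'r => nat" and f z
  assume kk: "ALL j. even (k j) & 0 < k j" and f: "f : cusp_forms Ga (hilbert_cusps si) k" and z: "z : (upper_half :: (complex^'r) set)"
  have even: "even (k j)" and k: "0 < k j" for j using kk by auto
  define P where "P = kprod k"
  define S where "S = (\<Prod>j\<in>UNIV. sqrt (real (k j)))"
  define I where "I = pnorm k f"
  have S1: "1 <= S" unfolding S_def using k by (intro prod_ge_1) (simp add: Suc_le_eq)
  have PS: "P = S * S" by (simp add: P_def S_def prod.distrib[symmetric])
  have P1: "1 <= P" unfolding PS using mult_mono[OF S1 S1] S1 by simp
  have target: "(\<Prod>j\<in>UNIV. real (k j) * sqrt (real (k j))) = P * S" by (simp add: P_def S_def prod.distrib)
  have finish: "ennreal (pet k f z) <= ennreal ((CA + CB) * (P * S)) * I"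
   if "ennreal (pet k f z) <= ennreal E * I" "E <= CA * (P * S) | E <= CB * (P * S)" for E
  proof -
   have "0 <= CA * (P * S)" "0 <= CB * (P * S)" using CAB P1 S1 by simp_all
   hence "E <= (CA + CB) * (P * S)" using that(2) by (auto simp: distrib_right)
   thus ?thesis using that(1) by (meson ennreal_leI mult_right_mono order_trans zero_le)
  qed
  have bound: "ennreal (pet k f z) <= ennreal (L * P * (1 + W * Hm / S)) * I"
   if "z : upper_half" "0 <= Hm" "!!c s. places.good_pair M c s ==> height c s z <= Hm" for z Hm
   using pet_le_height[OF f k that(1,2) M that(3)] unfolding L_def P_def W_def S_def I_def by simp
  show "ennreal (pet k f z) <= ennreal ((CA + CB) * (\<Prod>j\<in>UNIV. real (k j) * sqrt (real (k j)))) * pnorm k f"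
   unfolding target I_def[symmetric]
  proof (cases "ALL c s. places.good_pair M c s --> height c s z <= C1 * P")
   \<comment> \<open>Below the threshold the count is enough: since P = S^2, the factor P Hm / S
     with \<open>Hm = C1 * P\<close> is C1 P S.\<close>
   case True
   have "ennreal (pet k f z) <= ennreal (L * P * (1 + W * (C1 * P) / S)) * I" using True C1 P1 by (intro bound z) auto
   moreover have "L * P * (1 + W * (C1 * P) / S) <= CA * (P * S)"
   proof -
    have "1 + W * (C1 * P) / S = 1 + W * C1 * S" unfolding PS using S1 by simp
    also have "... <= (1 + W * C1) * S" using S1 by (simp add: distrib_right)
    finally have "L * P * (1 + W * (C1 * P) / S) <= L * P * ((1 + W * C1) * S)" using L P1 by (intro mult_left_mono) auto
    thus ?thesis by (simp add: CA_def mult_ac)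
   qed
   ultimately show "ennreal (pet k f z) <= ennreal ((CA + CB) * (P * S)) * I" using finish by blast
  next
   case False
   then obtain c s where g: "places.good_pair M c s" and gt: "C1 * P < height c s z" by auto
   have cs: "c ~= 0 | s ~= 0" and cint: "aint c" "aint s" using g by (auto simp: places.good_pair_def)
   define xi where "xi = height c s z / P"
   have xi: "C1 < xi" "height c s z = xi * P" using gt P1 by (simp_all add: xi_def pos_less_divide_eq)
   have ex: "EX n. xi < C1 * (real n + 1) ^ ?d"
   proof -
    obtain n :: nat where n: "xi / C1 < real n" using reals_Archimedean2 by blast
    have "real n <= (real n + 1) ^ 1" by simp
    also have "... <= (real n + 1) ^ ?d" by (intro power_increasing) (auto simp: Suc_le_eq)
    finally have "xi / C1 < (real n + 1) ^ ?d" using n by linarith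
    thus ?thesis using C1 by (intro exI[of _ n]) (simp add: pos_divide_less_eq mult.commute)
   qed
   \<comment> \<open>The greatest depth with C1 n^d \<le> xi; it is positive because xi >
     C1.\<close>
   define n where "n = (LEAST n. xi < C1 * (real n + 1) ^ ?d)"
   have n1: "xi < C1 * (real n + 1) ^ ?d" unfolding n_def using ex by (rule LeastI_ex)
   have n0': "n ~= 0" using n1 xi(1) by (intro notI) simp
   hence "~ xi < C1 * (real (n - 1) + 1) ^ ?d" unfolding n_def by (intro not_less_Least) simp
   hence n2: "C1 * real n ^ ?d <= xi" using n0' by (simp add: of_nat_diff Suc_le_eq)
   define m where "m = real n"
   have m: "1 <= m" using n0' by (simp add: m_def Suc_le_eq)
   define Y where "Y = (%j. Im (z $ j) / (dfac c s z j)^2)"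
   have Y: "0 < Y j" for j unfolding Y_def
    by (intro divide_pos_pos zero_less_power dfac_pos[OF z cs]) (use z in \<open>simp add: upper_half_def\<close>)
   \<comment> \<open>The bound for the conjugates of u under which n0 u^2 is short enough for
     \<open>descent\<close> with m. The square of the product is xi / (q m)^d, at least C0^2 by the
     choice of m.\<close>
   define h where "h = (%j. sqrt (Y j / (q * m * real (k j))))"
   have hpos: "0 < h j" for j using Y[of j] q m k[of j] by (simp add: h_def)
   have "(\<Prod>j\<in>UNIV. h j)^2 = (\<Prod>j\<in>UNIV. Y j / (q * m * real (k j)))" using Y q m by (simp add: prod_power_distrib h_def less_imp_le)
   also have "... = height c s z / ((q * m) ^ ?d * P)" by (simp add: prod_dividef prod.distrib height_def Y_def P_def)
   also have "... = xi / (q * m) ^ ?d" unfolding xi(2) using P1 by simp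
   also have "... >= C1 * m ^ ?d / (q * m) ^ ?d" using n2 q m by (intro divide_right_mono) (auto simp: m_def)
   also have "C1 * m ^ ?d / (q * m) ^ ?d = C0^2" using q m by (simp add: C1_def power_mult_distrib)
   finally have "C0^2 <= (\<Prod>j\<in>UNIV. h j)^2" .
   hence "C0 <= (\<Prod>j\<in>UNIV. h j)" by (rule power2_le_imp_le) (use hpos in \<open>auto intro!: prod_nonneg simp: less_imp_le\<close>)
   then obtain u where u: "aint u" "u ~= 0" "!!j. \<bar>si j u\<bar> <= h j" using C0(2)[of h, OF hpos] by blast
   \<comment> \<open>The signs of the conjugates of u are unknown; the square makes the translation
     totally positive.\<close>
   obtain x et where x: "x : Gamma1_quat a b U t" "et = 1 | et = - 1" "ph x = map_quad (%u. et * u) (unip (of_nat n0 * u^2) c s)"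
    using n0(2)[OF algebraic_int_power[OF nf u(1)] cint] by blast
   have siv: "si j (of_nat n0 * u^2) = real n0 * (si j u)^2" for j by (simp add: sh_mult sh_of_nat sh_power)
   have "\<exists>z'\<in>upper_half. pet k f z <= exp (- m) * pet k f z' & height c s z' <= height c s z
    & height c s z <= 2 ^ ?d * height c s z'"
   proof (rule descent[OF f even k cs z m x])
    fix j
    show "0 < si j (of_nat n0 * u^2)" unfolding siv using n0(1) u(2) by (simp add: sh_eq_0)
    have "(si j u)^2 <= (h j)^2" using power_mono[OF u(3)[of j], of 2] by simp
    also have "... = Y j / (q * m * real (k j))" using Y[of j] q m by (simp add: h_def less_imp_le)
    finally have "(si j u)^2 * (q * m * real (k j)) <= Y j" using q m k[of j] by (simp add: pos_le_divide_eq)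
    thus "2 * real ?d * m * real (k j) * si j (of_nat n0 * u^2) <= Im (z $ j) / (dfac c s z j)^2" unfolding siv q_def by (simp add: Y_def mult_ac)
   qed
   then obtain z' where z': "z' : upper_half" "pet k f z <= exp (- m) * pet k f z'" "height c s z' <= height c s z"
    "height c s z <= 2 ^ ?d * height c s z'" by blast
   \<comment> \<open>Bounds the heights of \<open>z'\<close> at all good pairs through
     \<open>height_other\<close>, because its height at (c, s) lies between C1 / 2^d and xi
     P.\<close>
   define Hm where "Hm = real M ^ ?d * (xi * P) + 2 ^ ?d / C1"
   have hp: "0 < height c s z'" by (rule height_pos[OF z'(1) cs])
   have le: "height c' s' z' <= Hm" if "places.good_pair M c' s'" for c' s'
   proof -
    have "C1 * 1 <= C1 * P" using C1 P1 by (intro mult_left_mono) auto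
    hence "C1 <= 2 ^ ?d * height c s z'" using gt z'(4) by linarith
    hence "1 / height c s z' <= 2 ^ ?d / C1" using hp C1 by (simp add: divide_le_eq le_divide_eq mult_ac)
    moreover have "real M ^ ?d * height c s z' <= real M ^ ?d * (xi * P)" using z'(3) xi(2) by (intro mult_left_mono) auto
    ultimately show ?thesis using height_other[OF M(1) g that z'(1)] unfolding Hm_def by linarith
   qed
   have xi0: "0 < xi" using xi(1) C1 by linarith
   have Hm0: "0 <= Hm" unfolding Hm_def using xi0 P1 C1 by (intro add_nonneg_nonneg mult_nonneg_nonneg divide_nonneg_nonneg) auto
   have b': "ennreal (pet k f z') <= ennreal (L * P * (1 + W * Hm / S)) * I" by (rule bound[OF z'(1) Hm0 le])
   define E where "E = exp (- m)"
   have E: "0 < E" "E <= 1" using m by (simp_all add: E_def)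
   have "ennreal (pet k f z) <= ennreal (E * pet k f z')" using z'(2) by (intro ennreal_leI) (simp add: E_def)
   also have "... = ennreal E * ennreal (pet k f z')" using E pet_nonneg[OF z'(1)] by (intro ennreal_mult) auto
   also have "... <= ennreal E * (ennreal (L * P * (1 + W * Hm / S)) * I)" by (intro mult_left_mono b') auto
   also have "... = ennreal (E * (L * P * (1 + W * Hm / S))) * I"
    using E L P1 W S1 Hm0 by (subst ennreal_mult) (auto simp: mult.assoc intro!: mult_nonneg_nonneg add_nonneg_nonneg divide_nonneg_nonneg)
   finally have fin: "ennreal (pet k f z) <= ennreal (E * (L * P * (1 + W * Hm / S))) * I" .
   \<comment> \<open>The exponential gain absorbs xi, which may be arbitrarily large but is below C1
     (m + 1)^d and hence below a constant times exp(m).\<close>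
   have EX: "E * xi <= C1 * B"
   proof -
    have "C1 * (m + 1) ^ ?d <= C1 * (fact ?d * exp (m + 1))" using C1 m by (intro mult_left_mono power_le_fact_exp) auto
    hence "xi <= C1 * (fact ?d * exp (m + 1))" using n1 by (simp add: m_def)
    hence "E * xi <= E * (C1 * (fact ?d * exp (m + 1)))" using E by (intro mult_left_mono) auto
    also have "... = C1 * (fact ?d * (exp (- m) * exp (m + 1)))" by (simp add: E_def mult_ac)
    also have "exp (- m) * exp (m + 1) = exp 1" by (simp flip: exp_add)
    finally show ?thesis by (simp add: B_def mult_ac)
   qed
   have "E * (1 + W * Hm / S) <= (1 + W * (2 ^ ?d / C1 + real M ^ ?d * (C1 * B))) * S"
   proof -
    have "E * (1 + W * Hm / S) = E + W * (real M ^ ?d * (E * xi) * S + E * (2 ^ ?d / C1) / S)" unfolding Hm_def PS using S1 by (simp add: field_simps)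
    also have "... <= 1 * S + W * (real M ^ ?d * (C1 * B) * S + (2 ^ ?d / C1) * S)"
    proof (intro add_mono mult_left_mono)
     show "E <= 1 * S" using E S1 by linarith
     show "real M ^ ?d * (E * xi) * S <= real M ^ ?d * (C1 * B) * S" using EX S1 by (intro mult_right_mono mult_left_mono) auto
     have T: "0 <= 2 ^ ?d / C1" using C1 by simp
     have "E * (2 ^ ?d / C1) / S <= 1 * (2 ^ ?d / C1) / 1" using E S1 T by (intro frac_le mult_right_mono) auto
     also have "... <= (2 ^ ?d / C1) * S" using mult_left_mono[OF S1 T] by simp
     finally show "E * (2 ^ ?d / C1) / S <= (2 ^ ?d / C1) * S" .
    qed (use W in auto)
    also have "... = (1 + W * (2 ^ ?d / C1 + real M ^ ?d * (C1 * B))) * S" by (simp add: algebra_simps)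
    finally show ?thesis .
   qed
   hence "L * P * (E * (1 + W * Hm / S)) <= L * P * ((1 + W * (2 ^ ?d / C1 + real M ^ ?d * (C1 * B))) * S)" using L P1 by (intro mult_left_mono) auto
   hence "E * (L * P * (1 + W * Hm / S)) <= CB * (P * S)" unfolding CB_def by (simp only: mult_ac)
   thus "ennreal (pet k f z) <= ennreal ((CA + CB) * (P * S)) * I" using finish[OF fin] by blast
  qed
 qed
qed

lemma bergman_kernel_type2:
 "EX C. ALL k. (ALL j. even (k j) & 0 < k j) -->
     (ALL bs. orthonormal_basis Ga k (cusp_forms Ga (hilbert_cusps si) k) bs -->
       (SUP z\<in>upper_half. ereal (bergman_kernel k bs z))
        <= ereal (C * (\<Prod>j\<in>UNIV. real (k j) powr (3/2))))"
proof -
 obtain C where C: "0 <= C" "!!k f z. (ALL j. even (k j) & 0 < k j) ==> f : cusp_forms Ga (hilbert_cusps si) k ==> z : upper_half ==>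
  ennreal (pet k f z) <= ennreal (C * (\<Prod>j\<in>UNIV. real (k j) * sqrt (real (k j)))) * pnorm k f"
  using pet_bound by blast
 have e: "real n powr (3/2) = real n * sqrt (real n)" for n :: nat
 proof (cases "n = 0")
  case False
  have "real n powr (1 + 1/2) = real n powr 1 * real n powr (1/2)" by (rule powr_add)
  thus ?thesis using False by (simp add: powr_half_sqrt)
 qed simp
 show ?thesis
 proof (intro exI[of _ C] allI impI)
  fix k :: "'r => nat" and bs
  assume k: "ALL j. even (k j) & 0 < k j" and onb: "orthonormal_basis Ga k (cusp_forms Ga (hilbert_cusps si) k) bs"
  show "(SUP z\<in>upper_half. ereal (bergman_kernel k bs z)) <= ereal (C * (\<Prod>j\<in>UNIV. real (k j) powr (3/2)))" unfolding e
  proof (rule SUP_bergman_kernel_le[OF onb])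
   show "0 <= C * (\<Prod>j\<in>UNIV. real (k j) * sqrt (real (k j)))" using C(1) by (intro mult_nonneg_nonneg prod_nonneg) auto
  qed (rule C(2)[OF k])
 qed
qed

end

theorem theorem2:
  fixes a b :: "'f::field_char_0"
    and \<sigma> :: "'r::finite \<Rightarrow> 'f \<Rightarrow> real"
    and \<theta> :: "'r \<Rightarrow> real quad \<Rightarrow> real quad"
    and U :: "(('f \<Rightarrow> int) \<Rightarrow> (nat \<Rightarrow> 'f) set) quad set"
    and t :: "(('f \<Rightarrow> int) \<Rightarrow> (nat \<Rightarrow> 'f) set) quad"
    and \<Gamma> :: "('r \<Rightarrow> real quad) set"
  assumes "number_field TYPE('f)" and "totally_real TYPE('f)"
    and "a \<noteq> 0" and "b \<noteq> 0" and "split_at_finite_places a b"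
    and "bij_betw \<sigma> UNIV (split_real_places a b)"
    and "\<And>j. \<theta> j \<in> splittings ring_of_type_algebra (\<sigma> j a) (\<sigma> j b)"
    and "subgroup U (G_fin a b)" and "openin (G_fin_top a b) U" and "compactin (G_fin_top a b) U"
    and "t \<in> carrier (G_fin a b)"
    and "\<Gamma> = Gamma1 a b \<sigma> \<theta> U t"
    and "no_elliptic_fixed_points \<Gamma>"
    and "\<forall>\<gamma>\<in>\<Gamma>. \<not> hyperbolic_elliptic \<gamma>"
  shows
    "(type1 \<sigma> \<longrightarrow>
        (\<exists>C. \<forall>k. (\<forall>j. even (k j) \<and> 0 < k j) \<longrightarrow>
           (\<forall>bs. orthonormal_basis \<Gamma> k (cusp_forms \<Gamma> {} k) bs \<longrightarrow>
              (SUP z\<in>upper_half. ereal (bergman_kernel k bs z)) \<le> ereal (C * (\<Prod>j\<in>UNIV. real (k j))))))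
     \<and>
     (type2 a b \<sigma> \<theta> U t \<longrightarrow>
        (\<exists>C. \<forall>k. (\<forall>j. even (k j) \<and> 0 < k j) \<longrightarrow>
           (\<forall>bs. orthonormal_basis \<Gamma> k (cusp_forms \<Gamma> (hilbert_cusps \<sigma>) k) bs \<longrightarrow>
              (SUP z\<in>upper_half. ereal (bergman_kernel k bs z))
                \<le> ereal (C * (\<Prod>j\<in>UNIV. real (k j) powr (3/2))))))"
proof (intro conjI impI)
  interpret arithmetic_group a b \<sigma> \<theta> U t \<Gamma>
    by (rule arithmetic_group.intro) (rule assms)+
  show "\<exists>C. \<forall>k. (\<forall>j. even (k j) \<and> 0 < k j) \<longrightarrow>
           (\<forall>bs. orthonormal_basis \<Gamma> k (cusp_forms \<Gamma> {} k) bs \<longrightarrow>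
              (SUP z\<in>upper_half. ereal (bergman_kernel k bs z)) \<le> ereal (C * (\<Prod>j\<in>UNIV. real (k j))))"
    if "type1 \<sigma>"
    by (rule bergman_kernel_type1[OF that])
  show "\<exists>C. \<forall>k. (\<forall>j. even (k j) \<and> 0 < k j) \<longrightarrow>
           (\<forall>bs. orthonormal_basis \<Gamma> k (cusp_forms \<Gamma> (hilbert_cusps \<sigma>) k) bs \<longrightarrow>
              (SUP z\<in>upper_half. ereal (bergman_kernel k bs z))
                \<le> ereal (C * (\<Prod>j\<in>UNIV. real (k j) powr (3/2))))"
    if type2: "type2 a b \<sigma> \<theta> U t"
  proof -
    obtain \<phi> where \<phi>: "\<phi> \<in> splittings ring_of_type_algebra a b"
      "\<forall>x j. \<theta> j (map_quad (\<sigma> j) x) = map_quad (\<sigma> j) (\<phi> x)"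
      "subgroup ((\<lambda>x. plus_minus_one #>\<^bsub>SL2 ring_of_integers\<^esub> \<phi> x) ` Gamma1_quat a b U t) PSL2_int"
      "finite (rcosets\<^bsub>PSL2_int\<^esub> ((\<lambda>x. plus_minus_one #>\<^bsub>SL2 ring_of_integers\<^esub> \<phi> x) ` Gamma1_quat a b U t))"
      using type2 unfolding type2_def Let_def by blast
    interpret hilbert_group a b \<sigma> \<theta> U t \<Gamma> \<phi>
      by (rule hilbert_group.intro[OF arithmetic_group_axioms], rule hilbert_group_axioms.intro)
        (rule \<phi>(1) \<phi>(2)[rule_format] \<phi>(3) \<phi>(4))+
    show ?thesis by (rule bergman_kernel_type2)
  qed
qed

end
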